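(* Let $m_1,m_2\in\mathbb R$, $\tau>0$, $0\le\delta<\rho\le1$, $\delta<1$, and let $p_1(x,\xi)\in C^\tau S^{m_1}_{\rho,\delta}(\mathbb R^n,\mathbb R^n)$, $p_2(x,\xi)\in S^{m_2}_{\rho,\delta}(\mathbb R^n\times\mathbb R^n)$. Then $p_1(X,D_x)p_2(X,D_x)\in\mathrm{OP}\,C^\tau S^{m_1+m_2}_{\rho,\delta}(\mathbb R^n,\mathbb R^n)$. The composed symbol $$p_1\#p_2(x,\xi):=\mathrm{O_s}\text{-}\iint e^{-iy\cdot\eta}p_1(x,\xi+\eta)\,p_2(x+y,\xi)\,dy\,\frac{d\eta}{(2\pi)^n}$$ belongs to $C^\tau S^{m_1+m_2}_{\rho,\delta}(\mathbb R^n,\mathbb R^n)$ and induces the operator $p_1\#p_2(X,D_x)=p_1(X,D_x)p_2(X,D_x)$. Moreover $$p_1\#p_2(x,\xi)\sim\sum_{\alpha\in\mathbb N_0^n}\frac1{\alpha!}\partial_\xi^\alpha p_1(x,\xi)\,D_x^\alpha p_2(x,\xi)$$ in the sense that for each $N\in\mathbb N_0$ the symbol $$p_1\#p_2(x,\xi)-\sum_{|\alpha|\le N}\frac1{\alpha!}\partial_\xi^\alpha p_1(x,\xi)\,D_x^\alpha p_2(x,\xi)$$ belongs to $C^\tau S^{m_1+m_2-(\rho-\delta)(N+1)}_{\rho,\delta}(\mathbb R^n,\mathbb R^n)$.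
   Context: $\langle\xi\rangle=(1+|\xi|^2)^{1/2}$, $D_x=\frac1i\partial_x$. $C^t(\mathbb R^n)=C^{\lfloor t\rfloor,t-\lfloor t\rfloor}(\mathbb R^n)$ is the Hölder space. $C^\tau S^m_{\rho,\delta}(\mathbb R^n,\mathbb R^n)$: functions $p(x,\xi)$, smooth in $\xi$ and $C^\tau$ in $x$, such that for each $\alpha\in\mathbb N_0^n$ there is $C_\alpha$ with $|\partial_\xi^\alpha p(x,\xi)|\le C_\alpha\langle\xi\rangle^{m-\rho|\alpha|}$ and $\|\partial_\xi^\alpha p(\cdot,\xi)\|_{C^t(\mathbb R^n)}\le C_\alpha\langle\xi\rangle^{m-\rho|\alpha|+\delta t}$ for all $0\le t\le\tau$. $S^m_{\rho,\delta}(\mathbb R^n\times\mathbb R^n)=\bigcap_{\tau>0}C^\tau S^m_{\rho,\delta}(\mathbb R^n,\mathbb R^n)$ (smooth symbols). $p(X,D_x)u(x)=(2\pi)^{-n}\int e^{ix\cdot\xi}p(x,\xi)\hat u(\xi)\,d\xi$ with $\hat u(\xi)=\int e^{-ix\cdot\xi}u(x)\,dx$; $\mathrm{OP}$ of a class is the set of its operators. Oscillatory integral: $\mathrm{O_s}\text{-}\iint e^{-iy\cdot\eta}a(\eta,y)\,dy\,\frac{d\eta}{(2\pi)^n}:=\lim_{\epsilon\to0}\iint e^{-iy\cdot\eta}\chi(\epsilon\eta,\epsilon y)a(\eta,y)\,dy\,\frac{d\eta}{(2\pi)^n}$ for any $\chi\in\mathscr S(\mathbb R^n\times\mathbb R^n)$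 with $\chi(0,0)=1$ (independent of $\chi$), for smooth $a$ with $|\partial_\eta^\alpha\partial_y^\beta a|\le C_{\alpha\beta}\langle\eta\rangle^{m+\delta|\beta|}\langle y\rangle^\kappa$, some $m\in\mathbb R$, $0\le\delta<1$, $\kappa\ge0$. *)

theory Defs
  imports "HOL-Analysis.Analysis"
begin

section \<open>Derivatives and differentiability classes\<close>

text \<open>Iterated directional derivatives; the head of the list is applied last.\<close>

primrec iter_deriv :: "'a::real_normed_vector list \<Rightarrow> ('a \<Rightarrow> 'b::real_normed_vector) \<Rightarrow> 'a \<Rightarrow> 'b" where
  "iter_deriv [] f = f"
| "iter_deriv (v # vs) f = (\<lambda>x. frechet_derivative (iter_deriv vs f) (at x) v)"

text \<open>All partial derivatives of order at most \<open>k\<close> exist and are continuous. For order less than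
  \<open>k\<close>, Frechet differentiability is then automatic; asking for it makes
  \<^const>\<open>frechet_derivative\<close> meaningful.\<close>

definition Ck :: "nat \<Rightarrow> ('a::euclidean_space \<Rightarrow> 'b::real_normed_vector) \<Rightarrow> bool" where
  "Ck k f \<longleftrightarrow>
     (\<forall>vs. set vs \<subseteq> Basis \<and> length vs < k \<longrightarrow> iter_deriv vs f differentiable_on UNIV) \<and>
     (\<forall>vs. set vs \<subseteq> Basis \<and> length vs \<le> k \<longrightarrow> continuous_on UNIV (iter_deriv vs f))"

definition smooth :: "('a::euclidean_space \<Rightarrow> 'b::real_normed_vector) \<Rightarrow> bool" where
  "smooth f \<longleftrightarrow> (\<forall>k. Ck k f)"

text \<open>Multi-indices in \<open>\<nat>\<^sub>0\<^sup>n\<close> are functions \<open>'n \<Rightarrow> nat\<close>.\<close>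

definition mi_abs :: "('n::finite \<Rightarrow> nat) \<Rightarrow> nat" where
  "mi_abs \<alpha> = (\<Sum>i\<in>UNIV. \<alpha> i)"

definition mi_fact :: "('n::finite \<Rightarrow> nat) \<Rightarrow> nat" where
  "mi_fact \<alpha> = (\<Prod>i\<in>UNIV. fact (\<alpha> i))"

text \<open>The index type carries no order, so an enumeration of the coordinates is fixed once and for
  all. For functions of class \<open>C\<^sup>k\<close> and \<open>|\<alpha>| \<le> k\<close> the derivative \<open>\<partial>\<^sup>\<alpha> f\<close> does not depend on it.\<close>

definition coords :: "'n::finite list" where
  "coords = (SOME is. distinct is \<and> set is = UNIV)"

definition mderiv :: "('n::finite \<Rightarrow> nat) \<Rightarrow> (real ^ 'n \<Rightarrow> 'b::real_normed_vector) \<Rightarrow> real ^ 'n \<Rightarrow> 'b" where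
  "mderiv \<alpha> f = iter_deriv (concat (map (\<lambda>i. replicate (\<alpha> i) (axis i 1)) coords)) f"

text \<open>\<open>D\<^sup>\<alpha> = (1/i)\<^bsup>|\<alpha>|\<^esup> \<partial>\<^sup>\<alpha>\<close>\<close>

definition Dderiv :: "('n::finite \<Rightarrow> nat) \<Rightarrow> (real ^ 'n \<Rightarrow> complex) \<Rightarrow> real ^ 'n \<Rightarrow> complex" where
  "Dderiv \<alpha> f x = (1 / \<i>) ^ mi_abs \<alpha> * mderiv \<alpha> f x"

definition japanese :: "'a::real_normed_vector \<Rightarrow> real" where
  "japanese \<xi> = sqrt (1 + (norm \<xi>)\<^sup>2)"


section \<open>Function spaces\<close>

definition schwartz :: "('a::euclidean_space \<Rightarrow> complex) set" where
  "schwartz = {f. smooth f \<and>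
     (\<forall>vs (k::nat). set vs \<subseteq> Basis \<longrightarrow> (\<exists>C. \<forall>x. japanese x ^ k * norm (iter_deriv vs f x) \<le> C))}"

text \<open>The norm of \<open>C\<^bsup>k,s\<^esup>\<close> with \<open>k = \<lfloor>t\<rfloor>\<close> and \<open>s = t - \<lfloor>t\<rfloor>\<close>, with values in \<open>[0,\<infinity>]\<close>. For integer \<open>t\<close>
  there is no difference quotient, so that \<open>C\<^bsup>k,0\<^esup>\<close> is the space of \<open>C\<^sup>k\<close> functions with bounded
  derivatives up to order \<open>k\<close>.\<close>

definition holder_norm :: "real \<Rightarrow> (real ^ 'n::finite \<Rightarrow> complex) \<Rightarrow> ennreal" where
  "holder_norm t f =
     (\<Sum>\<alpha> | mi_abs \<alpha> \<le> nat \<lfloor>t\<rfloor>. SUP x. ennreal (norm (mderiv \<alpha> f x))) +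
     (if frac t = 0 then 0
      else \<Sum>\<alpha> | mi_abs \<alpha> = nat \<lfloor>t\<rfloor>. SUP (x, y) \<in> {(x, y). x \<noteq> y}.
             ennreal (norm (mderiv \<alpha> f x - mderiv \<alpha> f y) / norm (x - y) powr frac t))"

definition holder_space :: "real \<Rightarrow> (real ^ 'n::finite \<Rightarrow> complex) set" where
  "holder_space t = {f. Ck (nat \<lfloor>t\<rfloor>) f \<and> holder_norm t f < \<infinity>}"


section \<open>Symbol classes and operators\<close>

text \<open>\<open>C\<^sup>\<tau>S\<^sup>m\<^sub>\<rho>\<^sub>,\<^sub>\<delta>\<close>; a symbol \<open>p(x,\<xi>)\<close> is curried as \<open>p x \<xi>\<close>.\<close>

definition CS :: "real \<Rightarrow> real \<Rightarrow> real \<Rightarrow> real \<Rightarrow> (real ^ 'n::finite \<Rightarrow> real ^ 'n \<Rightarrow> complex) set" where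
  "CS \<tau> m \<rho> \<delta> = {p.
     (\<forall>x. smooth (p x)) \<and>
     (\<forall>\<alpha> \<xi>. (\<lambda>x. mderiv \<alpha> (p x) \<xi>) \<in> holder_space \<tau>) \<and>
     (\<forall>\<alpha>. \<exists>C.
        (\<forall>x \<xi>. norm (mderiv \<alpha> (p x) \<xi>) \<le> C * japanese \<xi> powr (m - \<rho> * real (mi_abs \<alpha>))) \<and>
        (\<forall>t \<xi>. 0 \<le> t \<and> t \<le> \<tau> \<longrightarrow>
           holder_norm t (\<lambda>x. mderiv \<alpha> (p x) \<xi>)
             \<le> ennreal (C * japanese \<xi> powr (m - \<rho> * real (mi_abs \<alpha>) + \<delta> * t))))}"

definition smooth_symbols :: "real \<Rightarrow> real \<Rightarrow> real \<Rightarrow> (real ^ 'n::finite \<Rightarrow> real ^ 'n \<Rightarrow> complex) set" where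
  "smooth_symbols m \<rho> \<delta> = (\<Inter>\<tau>\<in>{0<..}. CS \<tau> m \<rho> \<delta>)"

definition fourier :: "(real ^ 'n::finite \<Rightarrow> complex) \<Rightarrow> real ^ 'n \<Rightarrow> complex" where
  "fourier u \<xi> = (LINT x|lborel. exp (- \<i> * complex_of_real (x \<bullet> \<xi>)) * u x)"

text \<open>\<open>p(X,D\<^sub>x)\<close> as an operator with domain the Schwartz space (\<^const>\<open>undefined\<close> elsewhere), so that
  equality of operators is equality on Schwartz functions, and a composition
  \<^term>\<open>compose schwartz S T\<close> is only meaningful if \<open>T\<close> maps Schwartz functions to
  Schwartz functions.\<close>

definition pseudo_op ::
  "(real ^ 'n::finite \<Rightarrow> real ^ 'n \<Rightarrow> complex) \<Rightarrow> (real ^ 'n \<Rightarrow> complex) \<Rightarrow> real ^ 'n \<Rightarrow> complex" where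
  "pseudo_op p = (\<lambda>u\<in>schwartz. \<lambda>x. complex_of_real (1 / (2 * pi) ^ CARD('n)) *
     (LINT \<xi>|lborel. exp (\<i> * complex_of_real (x \<bullet> \<xi>)) * p x \<xi> * fourier u \<xi>))"

definition OP ::
  "(real ^ 'n::finite \<Rightarrow> real ^ 'n \<Rightarrow> complex) set \<Rightarrow> ((real ^ 'n \<Rightarrow> complex) \<Rightarrow> real ^ 'n \<Rightarrow> complex) set" where
  "OP A = pseudo_op ` A"


section \<open>Oscillatory integrals and composed symbols\<close>

definition amplitude :: "(real ^ 'n::finite \<Rightarrow> real ^ 'n \<Rightarrow> complex) \<Rightarrow> bool" where
  "amplitude a \<longleftrightarrow> smooth (\<lambda>(\<eta>, y). a \<eta> y) \<and>
     (\<exists>m \<delta> \<kappa>. 0 \<le> \<delta> \<and> \<delta> < 1 \<and> 0 \<le> \<kappa> \<and>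
       (\<forall>\<alpha> \<beta>. \<exists>C. \<forall>\<eta> y.
          norm (mderiv \<alpha> (\<lambda>\<eta>'. mderiv \<beta> (a \<eta>') y) \<eta>)
            \<le> C * japanese \<eta> powr (m + \<delta> * real (mi_abs \<beta>)) * japanese y powr \<kappa>))"

definition has_osc_integral :: "(real ^ 'n::finite \<Rightarrow> real ^ 'n \<Rightarrow> complex) \<Rightarrow> complex \<Rightarrow> bool" where
  "has_osc_integral a I \<longleftrightarrow> amplitude a \<and>
     (\<forall>\<psi>\<in>schwartz. \<psi> (0, 0) = 1 \<longrightarrow>
       ((\<lambda>\<epsilon>::real. complex_of_real (1 / (2 * pi) ^ CARD('n)) *
           (integral\<^sup>L lborel (\<lambda>(\<eta>, y).
              exp (- \<i> * complex_of_real (y \<bullet> \<eta>)) * \<psi> (\<epsilon> *\<^sub>R \<eta>, \<epsilon> *\<^sub>R y) * a \<eta> y))) \<longlongrightarrow> I) (at 0))"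

definition osc_integral :: "(real ^ 'n::finite \<Rightarrow> real ^ 'n \<Rightarrow> complex) \<Rightarrow> complex" where
  "osc_integral a = (THE I. has_osc_integral a I)"

definition sharp_amplitude ::
  "(real ^ 'n::finite \<Rightarrow> real ^ 'n \<Rightarrow> complex) \<Rightarrow> (real ^ 'n \<Rightarrow> real ^ 'n \<Rightarrow> complex) \<Rightarrow>
   real ^ 'n \<Rightarrow> real ^ 'n \<Rightarrow> real ^ 'n \<Rightarrow> real ^ 'n \<Rightarrow> complex" where
  "sharp_amplitude p1 p2 x \<xi> = (\<lambda>\<eta> y. p1 x (\<xi> + \<eta>) * p2 (x + y) \<xi>)"

definition sharp ::
  "(real ^ 'n::finite \<Rightarrow> real ^ 'n \<Rightarrow> complex) \<Rightarrow> (real ^ 'n \<Rightarrow> real ^ 'n \<Rightarrow> complex) \<Rightarrow>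
   real ^ 'n \<Rightarrow> real ^ 'n \<Rightarrow> complex" where
  "sharp p1 p2 x \<xi> = osc_integral (sharp_amplitude p1 p2 x \<xi>)"

end

theory Submission
  imports Defs "HOL-Probability.Sinc_Integral" "HOL-Probability.Characteristic_Functions"
begin

text \<open>The operators \<open>\<langle>y\<rangle>\<^bsup>-2\<^esup> (1 - \<Delta>\<^sub>\<eta>)\<close> and \<open>\<langle>\<eta>\<rangle>\<^bsup>-2\<^esup> (1 - \<Delta>\<^sub>y)\<close> make the oscillatory integral of an amplitude
  \<open>f(\<eta>) g(y)\<close> absolutely convergent and bound it by finitely many seminorms of \<open>f\<close> and \<open>g\<close>. In
  \<open>p\<^sub>1(x, \<xi> + \<eta>) p\<^sub>2(x + y, \<xi>)\<close> the dilation \<open>\<eta> \<mapsto> \<langle>\<xi>\<rangle>\<^sup>\<delta> \<eta>\<close>, \<open>y \<mapsto> \<langle>\<xi>\<rangle>\<^bsup>-\<delta>\<^esup> y\<close> makes all \<open>y\<close>-derivatives of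
  size \<open>\<langle>\<xi>\<rangle>\<^bsup>m\<^sub>2\<^esup>\<close>, and every \<open>\<eta>\<close>-derivative gains \<open>\<langle>\<xi>\<rangle>\<^bsup>-(\<rho>-\<delta>)\<^esup>\<close>. The monomials of the Taylor polynomial
  of \<open>p\<^sub>1\<close> in \<open>\<eta>\<close> integrate to the terms of the expansion; what is left vanishes to order \<open>N + 1\<close> at
  \<open>\<eta> = 0\<close>, which gives a remainder of order \<open>m\<^sub>1 + m\<^sub>2 - (\<rho> - \<delta>) (N + 1)\<close>.

  The remainder is bilinear in \<open>(p\<^sub>1, p\<^sub>2)\<close> and obeys the Leibniz rule in \<open>x\<close> and \<open>\<xi>\<close>. Hence this
  supremum bound for all pairs of symbols, together with its analogue for difference quotients of
  exponent below 1, already gives membership in the symbol class.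

  For the operators, \<open>p\<^sub>1(X, D\<^sub>x) v (x)\<close> is the oscillatory integral of \<open>p\<^sub>1(x, \<eta>) v(x + y)\<close>. Inserting
  \<open>v = p\<^sub>2(X, D\<^sub>x) u\<close> and exchanging it with the integral over the frequencies of \<open>u\<close>, after a
  Gaussian cutoff, produces the composed symbol.\<close>

section \<open>Directional derivatives and smooth functions\<close>

text \<open>Since \<open>p1\<close> has only finite regularity in x, the amplitudes are not jointly
  smooth in x and the frequencies, and x has to stay a parameter. For fixed x and \<xi> the
  amplitude is a product of a function of \<eta> and one of y, and the constant of the basic
  estimate is the same for all such factors. Therefore one estimate also serves the Holder bounds:
  the difference \<open>p x - p z\<close> satisfies the symbol bounds of order
  \<open>m + \<delta> * t\<close> with a constant proportional to
  \<open>norm (x - z) powr t\<close>. The two remainders that the Leibniz rule produces have the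
  same total order, so derivatives of remainders need no estimate of their own. With an empty Taylor
  polynomial the remainder is the composed symbol; membership and expansion are thus one statement.
  The definitions ask for Frechet derivatives, while difference quotients under an integral give
  derivatives along lines only. The gap is closed by partial derivatives: if those of one order are
  bounded near each point, the order below is continuous, and continuous partial derivatives give
  differentiability.\<close>

lemma mean_value_affine:
  fixes \<phi> :: "real \<Rightarrow> 'b::real_normed_vector"
  assumes d: "\<And>u. u \<in> closed_segment 0 s \<Longrightarrow> (\<phi> has_vector_derivative \<phi>' u) (at u)"
    and b: "\<And>u. u \<in> closed_segment 0 s \<Longrightarrow> norm (\<phi>' u - c) \<le> e"
  shows "norm (\<phi> s - \<phi> 0 - s *\<^sub>R c) \<le> e * \<bar>s\<bar>"
proof -
  have "norm ((\<phi> s - s *\<^sub>R c) - (\<phi> 0 - 0 *\<^sub>R c)) \<le> e * norm (s - 0)"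
  proof (rule differentiable_bound[where S = "closed_segment 0 s" and f' = "\<lambda>u h. h *\<^sub>R (\<phi>' u - c)"])
    fix u assume u: "u \<in> closed_segment 0 s"
    have "((\<lambda>u. \<phi> u - u *\<^sub>R c) has_vector_derivative (\<phi>' u - c)) (at u)"
      by (rule derivative_eq_intros d[OF u] refl | simp)+
    then show "((\<lambda>u. \<phi> u - u *\<^sub>R c) has_derivative (\<lambda>h. h *\<^sub>R (\<phi>' u - c))) (at u within closed_segment 0 s)"
      unfolding has_vector_derivative_def by (rule has_derivative_at_withinI)
    show "onorm (\<lambda>h. h *\<^sub>R (\<phi>' u - c)) \<le> e"
      using b[OF u] by (intro onorm_le) (metis mult.commute mult_left_mono norm_ge_zero norm_scaleR real_norm_def)
  qed auto
  then show ?thesis by (simp add: algebra_simps)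
qed

text \<open>Differentiability along a single line, which is all that a limit of difference quotients
  under an integral yields directly.\<close>

definition has_dir_deriv :: "('a::real_normed_vector \<Rightarrow> 'b::real_normed_vector) \<Rightarrow> 'a \<Rightarrow> 'b \<Rightarrow> 'a \<Rightarrow> bool" where
  "has_dir_deriv f b d x \<longleftrightarrow> ((\<lambda>t. f (x + t *\<^sub>R b)) has_vector_derivative d) (at 0)"

lemma has_dir_deriv_line:
  assumes "has_dir_deriv f b d (x + s *\<^sub>R b)"
  shows "((\<lambda>t. f (x + t *\<^sub>R b)) has_vector_derivative d) (at s)"
proof -
  have "((\<lambda>t. f (x + s *\<^sub>R b + t *\<^sub>R b)) has_vector_derivative d) (at (s - s))"
    using assms by (simp add: has_dir_deriv_def)
  then have "((\<lambda>t. f (x + s *\<^sub>R b + (t - s) *\<^sub>R b)) has_vector_derivative d) (at s)"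
    using vector_diff_chain_at[of "\<lambda>t. t - s" 1 s "\<lambda>t. f (x + s *\<^sub>R b + t *\<^sub>R b)" d]
    by (force simp: o_def intro!: derivative_eq_intros)
  then show ?thesis by (simp add: algebra_simps)
qed

lemma has_dir_deriv_mean_value:
  assumes "\<And>u. u \<in> closed_segment 0 s \<Longrightarrow> has_dir_deriv f b (D (x + u *\<^sub>R b)) (x + u *\<^sub>R b)"
    and "\<And>u. u \<in> closed_segment 0 s \<Longrightarrow> norm (D (x + u *\<^sub>R b) - c) \<le> e"
  shows "norm (f (x + s *\<^sub>R b) - f x - s *\<^sub>R c) \<le> e * \<bar>s\<bar>"
proof -
  have "norm (f (x + s *\<^sub>R b) - f (x + 0 *\<^sub>R b) - s *\<^sub>R c) \<le> e * \<bar>s\<bar>"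
    by (rule mean_value_affine[where \<phi>' = "\<lambda>t. D (x + t *\<^sub>R b)"]) (use assms has_dir_deriv_line in blast)+
  then show ?thesis by simp
qed

lemma has_dir_deriv_unique: "has_dir_deriv f b d x \<Longrightarrow> has_dir_deriv f b d' x \<Longrightarrow> d = d'"
  unfolding has_dir_deriv_def by (rule vector_derivative_unique_at)

lemma has_dir_deriv_iff_tendsto:
  "has_dir_deriv f b d x \<longleftrightarrow> ((\<lambda>t. (f (x + t *\<^sub>R b) - f x) /\<^sub>R t) \<longlongrightarrow> d) (at 0)"
proof -
  have "norm (f (x + (0 + h) *\<^sub>R b) - f (x + 0 *\<^sub>R b) - h *\<^sub>R d) / norm h = norm ((f (x + h *\<^sub>R b) - f x) /\<^sub>R h - d)"
    if "h \<noteq> 0" for h :: real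
  proof -
    have "f (x + h *\<^sub>R b) - f x - h *\<^sub>R d = h *\<^sub>R ((f (x + h *\<^sub>R b) - f x) /\<^sub>R h - d)"
      using that by (simp add: algebra_simps)
    then show ?thesis using that by (metis add_0 add.right_neutral norm_scaleR nonzero_mult_div_cancel_left norm_eq_zero real_norm_def scaleR_zero_left)
  qed
  then have "((\<lambda>h. norm (f (x + (0 + h) *\<^sub>R b) - f (x + 0 *\<^sub>R b) - h *\<^sub>R d) / norm h) \<longlongrightarrow> 0) (at 0) \<longleftrightarrow>
      ((\<lambda>h. norm ((f (x + h *\<^sub>R b) - f x) /\<^sub>R h - d)) \<longlongrightarrow> 0) (at 0)"
    by (intro Lim_cong_within) auto
  then show ?thesis
    unfolding has_dir_deriv_def has_vector_derivative_def has_derivative_at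
    by (simp add: bounded_linear_scaleR_left tendsto_norm_zero_iff LIM_zero_iff)
qed

lemma has_derivative_imp_dir_deriv:
  assumes "(f has_derivative f') (at x)"
  shows "has_dir_deriv f b (f' b) x"
proof -
  have "((\<lambda>t. x + t *\<^sub>R b) has_vector_derivative b) (at 0)"
    by (auto intro!: derivative_eq_intros)
  moreover have "(f has_derivative f') (at (x + 0 *\<^sub>R b))" using assms by simp
  ultimately show ?thesis
    using vector_derivative_diff_chain_within[of "\<lambda>t. x + t *\<^sub>R b" b 0 UNIV f f']
    by (simp add: o_def has_dir_deriv_def has_derivative_at_withinI)
qed

lemma has_dir_deriv_frechet:
  "f differentiable (at x) \<Longrightarrow> has_dir_deriv f b (frechet_derivative f (at x) b) x"
  using frechet_derivative_works has_derivative_imp_dir_deriv by blast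

lemma has_dir_deriv_add:
  "has_dir_deriv f b d x \<Longrightarrow> has_dir_deriv g b d' x \<Longrightarrow> has_dir_deriv (\<lambda>x. f x + g x) b (d + d') x"
  unfolding has_dir_deriv_def by (rule has_vector_derivative_add)

lemma has_dir_deriv_mult:
  fixes f g :: "'a::real_normed_vector \<Rightarrow> 'b::real_normed_algebra"
  shows "has_dir_deriv f b d x \<Longrightarrow> has_dir_deriv g b d' x \<Longrightarrow>
    has_dir_deriv (\<lambda>x. f x * g x) b (f x * d' + d * g x) x"
  unfolding has_dir_deriv_def using has_vector_derivative_mult[of "\<lambda>t. f (x + t *\<^sub>R b)" d 0 UNIV "\<lambda>t. g (x + t *\<^sub>R b)" d']
  by simp

lemma has_dir_deriv_sum:
  "(\<And>i. i \<in> I \<Longrightarrow> has_dir_deriv (f i) b (d i) x) \<Longrightarrow> has_dir_deriv (\<lambda>x. \<Sum>i\<in>I. f i x) b (\<Sum>i\<in>I. d i) x"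
  unfolding has_dir_deriv_def by (rule has_vector_derivative_sum)

text \<open>On the way from x to x + v along the axes, one coordinate after the other, all
  intermediate points stay in the ball of radius \<open>norm v\<close>.\<close>

lemma sum_Basis_partial_norm_le:
  fixes v :: "'a::euclidean_space"
  assumes "S \<subseteq> Basis" "b0 \<in> Basis - S" "\<bar>s\<bar> \<le> \<bar>v \<bullet> b0\<bar>"
  shows "norm ((\<Sum>b\<in>S. (v \<bullet> b) *\<^sub>R b) + s *\<^sub>R b0) \<le> norm v"
proof (rule norm_le_componentwise)
  fix c :: 'a assume c: "c \<in> Basis"
  have fin: "finite S" using finite_subset[OF assms(1)] by simp
  have "(\<Sum>b\<in>S. (v \<bullet> b) *\<^sub>R b) \<bullet> c = (\<Sum>b\<in>S. if b = c then v \<bullet> b else 0)"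
    unfolding inner_sum_left using assms(1) c by (intro sum.cong) (auto simp: inner_Basis)
  also have "\<dots> = (if c \<in> S then v \<bullet> c else 0)" using fin by simp
  finally show "\<bar>((\<Sum>b\<in>S. (v \<bullet> b) *\<^sub>R b) + s *\<^sub>R b0) \<bullet> c\<bar> \<le> \<bar>v \<bullet> c\<bar>"
    using assms(2,3) c by (auto simp: inner_add_left inner_Basis)
qed

text \<open>Telescoping along a path that changes one coordinate at a time. The slopes E are free:
  the partial derivatives at x give differentiability, zero slopes give Lipschitz bounds.\<close>

lemma partials_mean_value:
  fixes f :: "'a::euclidean_space \<Rightarrow> 'b::real_normed_vector"
  assumes d: "\<And>z b. b \<in> Basis \<Longrightarrow> has_dir_deriv f b (D b z) z"
    and e: "\<And>z b. b \<in> Basis \<Longrightarrow> norm (z - x) \<le> norm v \<Longrightarrow> norm (D b z - E b) \<le> e"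
  shows "norm (f (x + v) - f x - (\<Sum>b\<in>Basis. (v \<bullet> b) *\<^sub>R E b)) \<le> e * (\<Sum>b\<in>Basis. \<bar>v \<bullet> b\<bar>)"
proof -
  let ?p = "\<lambda>S. \<Sum>b\<in>S. (v \<bullet> b) *\<^sub>R b"
  have "S \<subseteq> Basis \<Longrightarrow> norm (f (x + ?p S) - f x - (\<Sum>b\<in>S. (v \<bullet> b) *\<^sub>R E b)) \<le> e * (\<Sum>b\<in>S. \<bar>v \<bullet> b\<bar>)" for S :: "'a set"
  proof (induction rule: infinite_finite_induct)
    case (insert b0 S)
    have b0: "b0 \<in> Basis" "S \<subseteq> Basis" using insert by auto
    have n: "norm (?p S + u *\<^sub>R b0) \<le> norm v" if "u \<in> closed_segment 0 (v \<bullet> b0)" for u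
      using that insert b0 by (intro sum_Basis_partial_norm_le) (auto simp: closed_segment_eq_real_ivl split: if_splits)
    have "norm (f ((x + ?p S) + (v \<bullet> b0) *\<^sub>R b0) - f (x + ?p S) - (v \<bullet> b0) *\<^sub>R E b0) \<le> e * \<bar>v \<bullet> b0\<bar>"
      by (rule has_dir_deriv_mean_value[where D = "D b0"]) (use d b0 e n in \<open>auto simp: algebra_simps\<close>)
    moreover have "norm (f (x + ?p S) - f x - (\<Sum>b\<in>S. (v \<bullet> b) *\<^sub>R E b)) \<le> e * (\<Sum>b\<in>S. \<bar>v \<bullet> b\<bar>)"
      using insert by auto
    ultimately have "norm ((f ((x + ?p S) + (v \<bullet> b0) *\<^sub>R b0) - f (x + ?p S) - (v \<bullet> b0) *\<^sub>R E b0)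
        + (f (x + ?p S) - f x - (\<Sum>b\<in>S. (v \<bullet> b) *\<^sub>R E b))) \<le> e * \<bar>v \<bullet> b0\<bar> + e * (\<Sum>b\<in>S. \<bar>v \<bullet> b\<bar>)"
      by (rule norm_triangle_mono)
    then show ?case using insert by (simp add: algebra_simps)
  qed (auto dest: finite_subset)
  from this[of Basis] show ?thesis by (simp add: euclidean_representation)
qed

lemma sum_Basis_abs_le: "(\<Sum>b\<in>Basis. \<bar>v \<bullet> b\<bar>) \<le> real DIM('a) * norm (v::'a::euclidean_space)"
  using sum_bounded_above[of Basis "\<lambda>b. \<bar>v \<bullet> b\<bar>" "norm v"] by (auto simp: Basis_le_norm)

lemma has_derivative_of_partials:
  fixes f :: "'a::euclidean_space \<Rightarrow> 'b::real_normed_vector"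
  assumes d: "\<And>z b. b \<in> Basis \<Longrightarrow> has_dir_deriv f b (D b z) z"
    and c: "\<And>b. b \<in> Basis \<Longrightarrow> isCont (D b) x"
  shows "(f has_derivative (\<lambda>v. \<Sum>b\<in>Basis. (v \<bullet> b) *\<^sub>R D b x)) (at x)"
  unfolding has_derivative_at_alt
proof (intro conjI allI impI)
  show "bounded_linear (\<lambda>v. \<Sum>b\<in>Basis. (v \<bullet> b) *\<^sub>R D b x)"
    by (intro bounded_linear_sum bounded_linear_scaleR_const bounded_linear_inner_left)
  fix e :: real assume e: "0 < e"
  \<comment> \<open>The sum of the coordinates of v in absolute value is at most the dimension times
    \<open>norm v\<close>.\<close>
  define e' where "e' = e / real DIM('a)"
  have e': "e' > 0" using e by (simp add: e'_def)
  have "\<forall>b\<in>Basis. \<exists>d>0. \<forall>z. norm (z - x) < d \<longrightarrow> norm (D b z - D b x) < e'"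
    using c e' unfolding continuous_at_eps_delta dist_norm by blast
  then obtain d where d': "\<And>b. b \<in> Basis \<Longrightarrow> d b > 0"
    "\<And>b z. b \<in> Basis \<Longrightarrow> norm (z - x) < d b \<Longrightarrow> norm (D b z - D b x) < e'" by metis
  define d0 where "d0 = Min (d ` Basis)"
  have "d0 > 0" unfolding d0_def using d' by (subst Min_gr_iff) auto
  moreover have "norm (f y - f x - (\<Sum>b\<in>Basis. ((y - x) \<bullet> b) *\<^sub>R D b x)) \<le> e * norm (y - x)"
    if y: "norm (y - x) < d0" for y
  proof -
    have le: "d0 \<le> d b" if "b \<in> Basis" for b using that unfolding d0_def by auto
    have "norm (f (x + (y - x)) - f x - (\<Sum>b\<in>Basis. ((y - x) \<bullet> b) *\<^sub>R D b x)) \<le> e' * (\<Sum>b\<in>Basis. \<bar>(y - x) \<bullet> b\<bar>)"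
      by (rule partials_mean_value[OF d]) (use le y d' in \<open>force intro: less_imp_le\<close>)+
    also have "\<dots> \<le> e' * (real DIM('a) * norm (y - x))"
      using e' sum_Basis_abs_le by (intro mult_left_mono) auto
    finally show ?thesis by (simp add: e'_def)
  qed
  ultimately show "\<exists>d>0. \<forall>y. norm (y - x) < d \<longrightarrow>
      norm (f y - f x - (\<Sum>b\<in>Basis. ((y - x) \<bullet> b) *\<^sub>R D b x)) \<le> e * norm (y - x)" by blast
qed

text \<open>The mean value bound with zero slopes is a Lipschitz estimate at x. It yields continuity
  of the derivatives of one order from mere local boundedness of the next.\<close>

lemma isCont_of_bounded_partials:
  fixes f :: "'a::euclidean_space \<Rightarrow> 'b::real_normed_vector"
  assumes d: "\<And>z b. b \<in> Basis \<Longrightarrow> has_dir_deriv f b (D b z) z"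
    and c: "\<And>b z. b \<in> Basis \<Longrightarrow> norm (z - x) \<le> 1 \<Longrightarrow> norm (D b z) \<le> C"
  shows "isCont f x"
proof -
  have C: "C \<ge> 0" using c[OF SOME_Basis, of x] norm_ge_zero[of "D (SOME b. b \<in> Basis) x"]
    by (simp del: norm_ge_zero)
  have b: "norm (f (x + v) - f x) \<le> C * real DIM('a) * norm v" if "norm v \<le> 1" for v
  proof -
    have "norm (f (x + v) - f x - (\<Sum>b\<in>Basis. (v \<bullet> b) *\<^sub>R 0)) \<le> C * (\<Sum>b\<in>Basis. \<bar>v \<bullet> b\<bar>)"
      by (rule partials_mean_value[OF d]) (use c that in auto)
    also have "\<dots> \<le> C * (real DIM('a) * norm v)"
      using C sum_Basis_abs_le by (intro mult_left_mono) auto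
    finally show ?thesis by simp
  qed
  have "((\<lambda>v. f (x + v) - f x) \<longlongrightarrow> 0) (at 0)"
  proof (rule Lim_null_comparison)
    show "\<forall>\<^sub>F v in at 0. norm (f (x + v) - f x) \<le> C * real DIM('a) * norm v"
      unfolding eventually_at by (rule exI[of _ 1]) (use b in \<open>auto simp: dist_norm\<close>)
    show "((\<lambda>v. C * real DIM('a) * norm v) \<longlongrightarrow> 0) (at (0::'a))"
      by (rule tendsto_eq_intros refl | simp)+
  qed
  then show ?thesis
    unfolding isCont_iff by (subst Lim_null)
qed

lemma frechet_derivative_eqI: "(f has_derivative f') (at x) \<Longrightarrow> frechet_derivative f (at x) = f'"
  using frechet_derivative_at by metis

lemma frechet_derivative_of_partials:
  fixes f :: "'a::euclidean_space \<Rightarrow> 'b::real_normed_vector"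
  assumes d: "\<And>z b. b \<in> Basis \<Longrightarrow> has_dir_deriv f b (D b z) z"
    and c: "\<And>b x. b \<in> Basis \<Longrightarrow> isCont (D b) x"
  shows "f differentiable (at x)" "b \<in> Basis \<Longrightarrow> frechet_derivative f (at x) b = D b x"
proof -
  show *: "f differentiable (at x)"
    using has_derivative_of_partials[of f D x] d c by (auto simp: differentiable_def)
  show "b \<in> Basis \<Longrightarrow> frechet_derivative f (at x) b = D b x"
    using has_dir_deriv_frechet[OF *, of b] d[of b x] has_dir_deriv_unique by blast
qed

lemma iter_deriv_append: "iter_deriv (vs @ ws) f = iter_deriv vs (iter_deriv ws f)"
  by (induction vs) auto

abbreviation pd :: "'a::real_normed_vector \<Rightarrow> ('a \<Rightarrow> 'b::real_normed_vector) \<Rightarrow> 'a \<Rightarrow> 'b" where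
  "pd b f \<equiv> iter_deriv [b] f"

lemma iter_deriv_pd: "pd b (iter_deriv vs f) = iter_deriv (b # vs) f" by simp

lemma smooth_iff:
  "smooth f \<longleftrightarrow> (\<forall>vs. set vs \<subseteq> Basis \<longrightarrow> (\<forall>x. iter_deriv vs f differentiable (at x)))"
proof
  assume "smooth f"
  then show "\<forall>vs. set vs \<subseteq> Basis \<longrightarrow> (\<forall>x. iter_deriv vs f differentiable (at x))"
    unfolding smooth_def Ck_def differentiable_on_def using less_Suc_eq by (metis UNIV_I)
next
  assume r: "\<forall>vs. set vs \<subseteq> Basis \<longrightarrow> (\<forall>x. iter_deriv vs f differentiable (at x))"
  show "smooth f" unfolding smooth_def Ck_def differentiable_on_def
    using r by (auto intro!: continuous_at_imp_continuous_on differentiable_imp_continuous_within)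
qed

text \<open>A coinduction principle: it suffices to name a family of differentiable functions closed
  under partial derivatives, and no formula for the iterated derivatives is required.\<close>

lemma smooth_coinduct:
  assumes "f \<in> \<Phi>" and "\<And>f x. f \<in> \<Phi> \<Longrightarrow> f differentiable (at x)"
    and "\<And>f b. f \<in> \<Phi> \<Longrightarrow> b \<in> Basis \<Longrightarrow> pd b f \<in> \<Phi>"
  shows "smooth f"
proof -
  have "set vs \<subseteq> Basis \<Longrightarrow> iter_deriv vs f \<in> \<Phi>" for vs
    by (induction vs) (use assms in auto)
  then show ?thesis using assms(2) by (auto simp: smooth_iff)
qed

lemma smooth_differentiable: "smooth f \<Longrightarrow> f differentiable (at x)"
  using smooth_iff[of f] by (metis iter_deriv.simps(1) empty_set empty_subsetI)

lemma smooth_iter_deriv: "smooth f \<Longrightarrow> set vs \<subseteq> Basis \<Longrightarrow> smooth (iter_deriv vs f)"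
  unfolding smooth_iff iter_deriv_append[symmetric] by simp

lemma smooth_pd: "smooth f \<Longrightarrow> b \<in> Basis \<Longrightarrow> smooth (pd b f)"
  using smooth_iter_deriv[of f "[b]"] by simp

lemma smooth_continuous: "smooth f \<Longrightarrow> continuous_on UNIV f"
  by (simp add: continuous_at_imp_continuous_on differentiable_imp_continuous_within smooth_differentiable)

lemma smooth_borel: "smooth f \<Longrightarrow> f \<in> borel_measurable borel"
  by (rule borel_measurable_continuous_onI[OF smooth_continuous])

lemma smooth_dir_deriv: "smooth f \<Longrightarrow> has_dir_deriv f b (pd b f x) x"
  by (simp add: has_dir_deriv_frechet smooth_differentiable)

lemma smooth_iter_dir_deriv:
  "smooth f \<Longrightarrow> set vs \<subseteq> Basis \<Longrightarrow> has_dir_deriv (iter_deriv vs f) b (iter_deriv (b # vs) f x) x"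
  using smooth_dir_deriv[OF smooth_iter_deriv] by auto

lemma smooth_const: "smooth (\<lambda>x. c)"
  by (rule smooth_coinduct[where \<Phi> = "range (\<lambda>c x. c)"]) auto

inductive_set smooth_closure :: "('a::euclidean_space \<Rightarrow> complex) set" where
  base: "smooth f \<Longrightarrow> f \<in> smooth_closure"
| add: "f \<in> smooth_closure \<Longrightarrow> g \<in> smooth_closure \<Longrightarrow> (\<lambda>x. f x + g x) \<in> smooth_closure"
| mult: "f \<in> smooth_closure \<Longrightarrow> g \<in> smooth_closure \<Longrightarrow> (\<lambda>x. f x * g x) \<in> smooth_closure"

lemma pd_add:
  "(\<And>x. f differentiable (at x)) \<Longrightarrow> (\<And>x. g differentiable (at x)) \<Longrightarrow>
    pd b (\<lambda>x. f x + g x) = (\<lambda>x. pd b f x + pd b g x)"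
proof
  fix x
  assume "\<And>x. f differentiable (at x)" "\<And>x. g differentiable (at x)"
  then have "((\<lambda>x. f x + g x) has_derivative
      (\<lambda>h. frechet_derivative f (at x) h + frechet_derivative g (at x) h)) (at x)"
    using frechet_derivative_works by (intro has_derivative_add) blast+
  from frechet_derivative_eqI[OF this]
  show "pd b (\<lambda>x. f x + g x) x = pd b f x + pd b g x" by simp
qed

lemma pd_mult:
  fixes f g :: "'a::real_normed_vector \<Rightarrow> complex"
  assumes "\<And>x. f differentiable (at x)" "\<And>x. g differentiable (at x)"
  shows "pd b (\<lambda>x. f x * g x) = (\<lambda>x. f x * pd b g x + pd b f x * g x)"
proof
  fix x
  have "((\<lambda>x. f x * g x) has_derivative
      (\<lambda>h. f x * frechet_derivative g (at x) h + frechet_derivative f (at x) h * g x)) (at x)"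
    by (intro has_derivative_mult) (use assms frechet_derivative_works in blast)+
  from frechet_derivative_eqI[OF this]
  show "pd b (\<lambda>x. f x * g x) x = f x * pd b g x + pd b f x * g x" by simp
qed

lemma smooth_closure_closed:
  assumes "f \<in> smooth_closure"
  shows "(\<forall>x. f differentiable (at x)) \<and> (\<forall>b\<in>Basis. pd b f \<in> smooth_closure)"
  using assms
proof induction
  case (add f g)
  then show ?case using pd_add[of f g] by (auto intro!: differentiable_add smooth_closure.add)
next
  case (mult f g)
  then show ?case using pd_mult[of f g] by (auto intro!: differentiable_mult smooth_closure.add smooth_closure.mult)
qed (use smooth_differentiable smooth_pd smooth_closure.base in blast)

lemma smooth_closure_smooth: "f \<in> smooth_closure \<Longrightarrow> smooth f"
  using smooth_coinduct[of f smooth_closure] smooth_closure_closed by blast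

lemma smooth_add: "smooth f \<Longrightarrow> smooth g \<Longrightarrow> smooth (\<lambda>x. f x + g x :: complex)"
  by (simp add: smooth_closure.intros smooth_closure_smooth)

lemma smooth_mult: "smooth f \<Longrightarrow> smooth g \<Longrightarrow> smooth (\<lambda>x. f x * g x :: complex)"
  by (simp add: smooth_closure.intros smooth_closure_smooth)

lemma smooth_cmult: "smooth f \<Longrightarrow> smooth (\<lambda>x. c * f x :: complex)"
  using smooth_mult[OF smooth_const] .

lemma smooth_minus: "smooth f \<Longrightarrow> smooth (\<lambda>x. - f x :: complex)"
  using smooth_cmult[of f "-1"] by simp

lemma smooth_diff: "smooth f \<Longrightarrow> smooth g \<Longrightarrow> smooth (\<lambda>x. f x - g x :: complex)"
  using smooth_add[OF _ smooth_minus, of f g] by simp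

lemma smooth_sum: "(\<And>i. i \<in> I \<Longrightarrow> smooth (f i)) \<Longrightarrow> smooth (\<lambda>x. \<Sum>i\<in>I. f i x :: complex)"
  by (induction I rule: infinite_finite_induct) (auto intro: smooth_const smooth_add)

lemma smooth_power: "smooth f \<Longrightarrow> smooth (\<lambda>x. f x ^ k :: complex)"
  by (induction k) (auto intro: smooth_const smooth_mult)

lemma iter_deriv_const: "iter_deriv vs (\<lambda>x. c) = (\<lambda>x. if vs = [] then c else 0)"
  by (induction vs) (auto simp: if_distrib cong: if_cong)

lemma iter_deriv_add:
  fixes f g :: "'a::euclidean_space \<Rightarrow> complex"
  assumes "smooth f" "smooth g" "set vs \<subseteq> Basis"
  shows "iter_deriv vs (\<lambda>x. f x + g x) = (\<lambda>x. iter_deriv vs f x + iter_deriv vs g x)"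
  using assms(3)
proof (induction vs)
  case (Cons b vs)
  then have "iter_deriv vs (\<lambda>x. f x + g x) = (\<lambda>x. iter_deriv vs f x + iter_deriv vs g x)" by simp
  then have "iter_deriv (b # vs) (\<lambda>x. f x + g x) = pd b (\<lambda>x. iter_deriv vs f x + iter_deriv vs g x)" by simp
  also have "\<dots> = (\<lambda>x. iter_deriv (b # vs) f x + iter_deriv (b # vs) g x)"
    using Cons assms smooth_differentiable[OF smooth_iter_deriv[of _ vs]] by (subst pd_add) auto
  finally show ?case .
qed simp

lemma iter_deriv_cmult:
  fixes f :: "'a::euclidean_space \<Rightarrow> complex"
  assumes "smooth f" "set vs \<subseteq> Basis"
  shows "iter_deriv vs (\<lambda>x. c * f x) = (\<lambda>x. c * iter_deriv vs f x)"
  using assms(2)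
proof (induction vs)
  case (Cons b vs)
  then have "iter_deriv vs (\<lambda>x. c * f x) = (\<lambda>x. c * iter_deriv vs f x)" by simp
  then have "iter_deriv (b # vs) (\<lambda>x. c * f x) = pd b (\<lambda>x. c * iter_deriv vs f x)" by simp
  also have "\<dots> = (\<lambda>x. c * iter_deriv (b # vs) f x)"
    using Cons assms smooth_differentiable[OF smooth_iter_deriv[of _ vs]] by (subst pd_mult) auto
  finally show ?case .
qed simp

lemma iter_deriv_minus:
  fixes f :: "'a::euclidean_space \<Rightarrow> complex"
  shows "smooth f \<Longrightarrow> set vs \<subseteq> Basis \<Longrightarrow> iter_deriv vs (\<lambda>x. - f x) = (\<lambda>x. - iter_deriv vs f x)"
  using iter_deriv_cmult[of f vs "-1"] by simp

lemma iter_deriv_diff: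
  fixes f g :: "'a::euclidean_space \<Rightarrow> complex"
  shows "smooth f \<Longrightarrow> smooth g \<Longrightarrow> set vs \<subseteq> Basis \<Longrightarrow>
    iter_deriv vs (\<lambda>x. f x - g x) = (\<lambda>x. iter_deriv vs f x - iter_deriv vs g x)"
  using iter_deriv_add[OF _ smooth_minus, of f g vs] iter_deriv_minus[of g vs] by simp

lemma iter_deriv_sum:
  fixes f :: "'i \<Rightarrow> 'a::euclidean_space \<Rightarrow> complex"
  assumes "\<And>i. i \<in> I \<Longrightarrow> smooth (f i)" "set vs \<subseteq> Basis"
  shows "iter_deriv vs (\<lambda>x. \<Sum>i\<in>I. f i x) = (\<lambda>x. \<Sum>i\<in>I. iter_deriv vs (f i) x)"
  using assms(1)
proof (induction I rule: infinite_finite_induct)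
  case (insert i I)
  then show ?case using iter_deriv_add[of "f i" "\<lambda>x. \<Sum>i\<in>I. f i x" vs] assms(2) smooth_sum[of I f] by simp
qed (auto simp: iter_deriv_const)

text \<open>The last entry of the list is the innermost derivative. Applying the product rule there
  leaves iterated derivatives of products with a shorter list, which is the form an induction over
  the list can use.\<close>

lemma iter_deriv_snoc_mult:
  fixes f g :: "'a::euclidean_space \<Rightarrow> complex"
  assumes "smooth f" "smooth g" "set vs \<subseteq> Basis" "b \<in> Basis"
  shows "iter_deriv (vs @ [b]) (\<lambda>x. f x * g x) =
    (\<lambda>x. iter_deriv vs (\<lambda>x. f x * pd b g x) x + iter_deriv vs (\<lambda>x. pd b f x * g x) x)"
  unfolding iter_deriv_append
  by (subst pd_mult) (use assms smooth_pd smooth_differentiable in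
    \<open>auto intro!: iter_deriv_add smooth_mult simp del: iter_deriv.simps\<close>)

lemma pd_inner: "pd b (\<lambda>x. complex_of_real (x \<bullet> c)) = (\<lambda>x. complex_of_real (b \<bullet> c))"
proof
  fix x
  have "((\<lambda>x. complex_of_real (x \<bullet> c)) has_derivative (\<lambda>h. complex_of_real (h \<bullet> c))) (at x)"
    by (auto intro!: derivative_eq_intros)
  then show "pd b (\<lambda>x. complex_of_real (x \<bullet> c)) x = complex_of_real (b \<bullet> c)"
    by (simp add: frechet_derivative_eqI)
qed

lemma smooth_inner: "smooth (\<lambda>x. complex_of_real (x \<bullet> c))"
proof -
  have "((\<lambda>x. complex_of_real (x \<bullet> c)) has_derivative (\<lambda>h. complex_of_real (h \<bullet> c))) (at x)" for x :: 'a
    by (auto intro!: derivative_eq_intros)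
  then have "(\<lambda>x. complex_of_real (x \<bullet> c)) differentiable (at x)" for x
    by (auto simp: differentiable_def)
  then show ?thesis using pd_inner[of _ c]
    by (intro smooth_coinduct[where \<Phi> = "insert (\<lambda>x. complex_of_real (x \<bullet> c)) (range (\<lambda>c x. c))"]) auto
qed

lemma pd_exp:
  fixes g :: "'a::euclidean_space \<Rightarrow> complex"
  assumes "g differentiable (at x)"
  shows "(\<lambda>x. exp (g x)) differentiable (at x)" "pd b (\<lambda>x. exp (g x)) x = pd b g x * exp (g x)"
proof -
  have "((\<lambda>x. exp (g x)) has_derivative (\<lambda>h. exp (g x) * frechet_derivative g (at x) h)) (at x)"
    using has_derivative_compose[OF assms[unfolded frechet_derivative_works]
        DERIV_exp[THEN has_field_derivative_imp_has_derivative]] .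
  then show "(\<lambda>x. exp (g x)) differentiable (at x)" "pd b (\<lambda>x. exp (g x)) x = pd b g x * exp (g x)"
    using frechet_derivative_eqI by (fastforce simp: differentiable_def)+
qed

lemma smooth_exp:
  fixes g :: "'a::euclidean_space \<Rightarrow> complex"
  assumes "smooth g"
  shows "smooth (\<lambda>x. exp (g x))"
\<comment> \<open>A smooth multiple of the exponential is again one after differentiation.\<close>
proof (rule smooth_coinduct[where \<Phi> = "{\<lambda>x. h x * exp (g x) |h. smooth h}"])
  show "(\<lambda>x. exp (g x)) \<in> {\<lambda>x. h x * exp (g x) |h. smooth h}"
    using smooth_const[of 1] by force
next
  fix f x assume "f \<in> {\<lambda>x. h x * exp (g x) |h. smooth h}"
  then obtain h where f: "f = (\<lambda>x. h x * exp (g x))" and h: "smooth h" by blast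
  show "f differentiable (at x)" unfolding f
    by (intro differentiable_mult smooth_differentiable h pd_exp(1) assms)
next
  fix f and b :: 'a assume "f \<in> {\<lambda>x. h x * exp (g x) |h. smooth h}" and b: "b \<in> Basis"
  then obtain h where f: "f = (\<lambda>x. h x * exp (g x))" and h: "smooth h" by blast
  have "pd b f = (\<lambda>x. h x * pd b (\<lambda>x. exp (g x)) x + pd b h x * exp (g x))" unfolding f
    by (intro pd_mult smooth_differentiable h pd_exp(1) assms)
  also have "\<dots> = (\<lambda>x. (h x * pd b g x + pd b h x) * exp (g x))"
    using pd_exp(2)[OF smooth_differentiable[OF assms]] by (simp add: algebra_simps del: iter_deriv.simps)
  finally have *: "pd b f = (\<lambda>x. (h x * pd b g x + pd b h x) * exp (g x))" .
  have "smooth (\<lambda>x. h x * pd b g x + pd b h x)"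
    by (intro smooth_add smooth_mult smooth_pd h b assms)
  then show "pd b f \<in> {\<lambda>x. h x * exp (g x) |h. smooth h}"
    unfolding * by (intro CollectI exI[of _ "\<lambda>x. h x * pd b g x + pd b h x"] conjI refl)
qed

text \<open>Each axis is mapped into an axis, possibly with factor 0. Translations, dilations,
  coordinate projections and slices of a product space are all of this form, so the chain rule for
  iterated partials is needed only once.\<close>

lemma smooth_affine:
  fixes T :: "'a::euclidean_space \<Rightarrow> 'c::euclidean_space" and f :: "'c \<Rightarrow> complex"
  assumes T: "bounded_linear T" and f: "smooth f"
    and b: "\<And>b. b \<in> Basis \<Longrightarrow> \<sigma> b \<in> Basis \<and> T b = c b *\<^sub>R \<sigma> b"
  shows "smooth (\<lambda>x. f (a + T x))"
    and "set vs \<subseteq> Basis \<Longrightarrow> iter_deriv vs (\<lambda>x. f (a + T x)) =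
      (\<lambda>x. complex_of_real (prod_list (map c vs)) * iter_deriv (map \<sigma> vs) f (a + T x))"
proof -
  have d: "((\<lambda>x. g (a + T x)) has_derivative (\<lambda>h. frechet_derivative g (at (a + T x)) (T h))) (at x)"
    if "smooth g" for g x
  proof -
    have "((\<lambda>x. a + T x) has_derivative T) (at x)"
      using has_derivative_add[OF has_derivative_const bounded_linear_imp_has_derivative[OF T]] by simp
    from has_derivative_compose[OF this smooth_differentiable[OF that, unfolded frechet_derivative_works]]
    show ?thesis .
  qed
  have p: "pd b (\<lambda>x. g (a + T x)) x = complex_of_real (c b) * pd (\<sigma> b) g (a + T x)"
    if "smooth g" "b \<in> Basis" for g b x
  proof -
    have "linear (frechet_derivative g (at (a + T x)))"
      using linear_frechet_derivative smooth_differentiable that by blast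
    then show ?thesis
      using frechet_derivative_eqI[OF d[OF that(1)]] b[OF that(2)] by (simp add: linear_scale scaleR_conv_of_real)
  qed
  have df: "(\<lambda>x. g (a + T x)) differentiable (at x)" if "smooth g" for g x
    using d[OF that] by (auto simp: differentiable_def)
  have main: "set vs \<subseteq> Basis \<Longrightarrow> iter_deriv vs (\<lambda>x. f (a + T x)) =
      (\<lambda>x. complex_of_real (prod_list (map c vs)) * iter_deriv (map \<sigma> vs) f (a + T x))" for vs
  proof (induction vs)
    case (Cons b0 vs)
    have s: "smooth (iter_deriv (map \<sigma> vs) f)" using f b Cons(2) by (intro smooth_iter_deriv) auto
    have "iter_deriv (b0 # vs) (\<lambda>x. f (a + T x)) = pd b0 (\<lambda>x. complex_of_real (prod_list (map c vs)) * iter_deriv (map \<sigma> vs) f (a + T x))"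
      using Cons by simp
    also have "\<dots> = (\<lambda>x. complex_of_real (prod_list (map c vs)) * pd b0 (\<lambda>x. iter_deriv (map \<sigma> vs) f (a + T x)) x)"
      by (subst pd_mult) (use df[OF s] in auto)
    also have "\<dots> = (\<lambda>x. complex_of_real (prod_list (map c (b0 # vs))) * iter_deriv (map \<sigma> (b0 # vs)) f (a + T x))"
      using p[OF s] Cons by (auto simp: algebra_simps)
    finally show ?case .
  qed simp
  then show "set vs \<subseteq> Basis \<Longrightarrow> iter_deriv vs (\<lambda>x. f (a + T x)) =
      (\<lambda>x. complex_of_real (prod_list (map c vs)) * iter_deriv (map \<sigma> vs) f (a + T x))" .
  show "smooth (\<lambda>x. f (a + T x))" unfolding smooth_iff
  proof safe
    fix vs :: "'a list" and x assume vs: "set vs \<subseteq> Basis"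
    have "smooth (iter_deriv (map \<sigma> vs) f)" using f b vs by (intro smooth_iter_deriv) auto
    then show "iter_deriv vs (\<lambda>x. f (a + T x)) differentiable (at x)"
      unfolding main[OF vs] using df by (auto intro!: differentiable_mult)
  qed
qed

text \<open>Two mean value bounds: first for \<open>pd a f\<close> in direction b, then for the
  difference of f between two parallel lines in direction a. Continuity of the mixed derivative
  enters only at the point x.\<close>

lemma second_difference:
  fixes f :: "'a::real_normed_vector \<Rightarrow> 'b::real_normed_vector"
  assumes f: "\<And>x. f differentiable (at x)" and a: "\<And>x. pd a f differentiable (at x)"
    and c: "isCont (pd b (pd a f)) x" and e: "e > 0"
  shows "\<exists>d>0. \<forall>s t. \<bar>s\<bar> < d \<and> \<bar>t\<bar> < d \<longrightarrow>
    norm (f (x + s *\<^sub>R a + t *\<^sub>R b) - f (x + s *\<^sub>R a) - (f (x + t *\<^sub>R b) - f x) - (s * t) *\<^sub>R pd b (pd a f) x) \<le> e * \<bar>s * t\<bar>"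
proof -
  obtain d where d: "d > 0" "\<And>z. dist z x < d \<Longrightarrow> norm (pd b (pd a f) z - pd b (pd a f) x) < e"
    using c e unfolding continuous_at_eps_delta dist_norm by blast
  \<comment> \<open>Steps shorter than d' keep \<open>x + s a + t b\<close> within distance d of x;
    the summand 1 avoids a zero denominator.\<close>
  define d' where "d' = d / (norm a + norm b + 1)"
  have pos: "norm a + norm b + 1 > 0" by (smt (verit) norm_ge_zero)
  have d': "d' > 0" using d pos by (simp add: d'_def)
  have near: "dist (x + s *\<^sub>R a + t *\<^sub>R b) x < d" if "\<bar>s\<bar> < d'" "\<bar>t\<bar> < d'" for s t
  proof -
    have "dist (x + s *\<^sub>R a + t *\<^sub>R b) x \<le> \<bar>s\<bar> * norm a + \<bar>t\<bar> * norm b"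
      using norm_triangle_ineq[of "s *\<^sub>R a" "t *\<^sub>R b"] by (simp add: dist_norm add.assoc)
    also have "\<dots> \<le> d' * norm a + d' * norm b" using that by (intro add_mono mult_right_mono) auto
    also have "\<dots> < d' * (norm a + norm b + 1)" using d' by (simp add: algebra_simps)
    finally show ?thesis using pos by (simp add: d'_def)
  qed
  have seg: "\<bar>u\<bar> \<le> \<bar>s\<bar>" if "u \<in> closed_segment 0 s" for u s :: real
    using that by (auto simp: closed_segment_eq_real_ivl split: if_splits)
  have inner: "norm (pd a f (x + s *\<^sub>R a + t *\<^sub>R b) - pd a f (x + s *\<^sub>R a) - t *\<^sub>R pd b (pd a f) x) \<le> e * \<bar>t\<bar>"
    if "\<bar>s\<bar> < d'" "\<bar>t\<bar> < d'" for s t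
    using a that seg[of _ t] near d
    by (intro has_dir_deriv_mean_value[where D = "pd b (pd a f)"])
      (fastforce intro: has_dir_deriv_frechet less_imp_le)+
  show ?thesis
  proof (intro exI[of _ d'] conjI allI impI d')
    fix s t assume st: "\<bar>s\<bar> < d' \<and> \<bar>t\<bar> < d'"
    define \<phi> where "\<phi> u = f (x + t *\<^sub>R b + u *\<^sub>R a) - f (x + u *\<^sub>R a)" for u
    have "norm (\<phi> s - \<phi> 0 - s *\<^sub>R (t *\<^sub>R pd b (pd a f) x)) \<le> (e * \<bar>t\<bar>) * \<bar>s\<bar>"
    proof (rule mean_value_affine)
      fix u assume u: "u \<in> closed_segment 0 s"
      show "(\<phi> has_vector_derivative pd a f (x + t *\<^sub>R b + u *\<^sub>R a) - pd a f (x + u *\<^sub>R a)) (at u)"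
        unfolding \<phi>_def using f
        by (intro has_vector_derivative_diff has_dir_deriv_line) (auto intro: has_dir_deriv_frechet)
      show "norm (pd a f (x + t *\<^sub>R b + u *\<^sub>R a) - pd a f (x + u *\<^sub>R a) - t *\<^sub>R pd b (pd a f) x) \<le> e * \<bar>t\<bar>"
        using inner[of u t] st seg[OF u] by (simp add: algebra_simps)
    qed
    then show "norm (f (x + s *\<^sub>R a + t *\<^sub>R b) - f (x + s *\<^sub>R a) - (f (x + t *\<^sub>R b) - f x) - (s * t) *\<^sub>R pd b (pd a f) x) \<le> e * \<bar>s * t\<bar>"
      by (simp add: \<phi>_def algebra_simps abs_mult)
  qed
qed

text \<open>With equal steps t, both mixed derivatives times t^2 approximate the same second
  difference with error e t^2. Taking e as a third of their distance gives 3 e \<le> 2 e, a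
  contradiction.\<close>

lemma pd_commute:
  fixes f :: "'a::real_normed_vector \<Rightarrow> 'b::real_normed_vector"
  assumes f: "\<And>x. f differentiable (at x)" and a: "\<And>x. pd a f differentiable (at x)"
    and b: "\<And>x. pd b f differentiable (at x)"
    and c: "isCont (pd b (pd a f)) x" "isCont (pd a (pd b f)) x"
  shows "pd a (pd b f) x = pd b (pd a f) x"
proof (rule ccontr)
  let ?A = "pd b (pd a f) x" and ?B = "pd a (pd b f) x"
  assume ne: "?B \<noteq> ?A"
  define e where "e = norm (?B - ?A) / 3"
  have e: "e > 0" using ne by (simp add: e_def)
  obtain d1 where d1: "d1 > 0" "\<And>s t. \<bar>s\<bar> < d1 \<Longrightarrow> \<bar>t\<bar> < d1 \<Longrightarrow>
    norm (f (x + s *\<^sub>R a + t *\<^sub>R b) - f (x + s *\<^sub>R a) - (f (x + t *\<^sub>R b) - f x) - (s * t) *\<^sub>R ?A) \<le> e * \<bar>s * t\<bar>"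
    using second_difference[where f = f and a = a and b = b and x = x and e = e, OF f a c(1) e] by blast
  obtain d2 where d2: "d2 > 0" "\<And>s t. \<bar>s\<bar> < d2 \<Longrightarrow> \<bar>t\<bar> < d2 \<Longrightarrow>
    norm (f (x + s *\<^sub>R b + t *\<^sub>R a) - f (x + s *\<^sub>R b) - (f (x + t *\<^sub>R a) - f x) - (s * t) *\<^sub>R ?B) \<le> e * \<bar>s * t\<bar>"
    using second_difference[where f = f and a = b and b = a and x = x and e = e, OF f b c(2) e] by blast
  define t where "t = min d1 d2 / 2"
  have t: "t > 0" "\<bar>t\<bar> < d1" "\<bar>t\<bar> < d2" using d1(1) d2(1) by (auto simp: t_def)
  let ?\<Delta> = "f (x + t *\<^sub>R a + t *\<^sub>R b) - f (x + t *\<^sub>R a) - (f (x + t *\<^sub>R b) - f x)"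
  have "norm (?\<Delta> - (t * t) *\<^sub>R ?A) \<le> e * (t * t)" using d1(2)[OF t(2) t(2)] t(1) by simp
  moreover have "norm (?\<Delta> - (t * t) *\<^sub>R ?B) \<le> e * (t * t)" using d2(2)[OF t(3) t(3)] t(1) by (simp add: algebra_simps)
  ultimately have "norm ((?\<Delta> - (t * t) *\<^sub>R ?A) - (?\<Delta> - (t * t) *\<^sub>R ?B)) \<le> e * (t * t) + e * (t * t)"
    using norm_triangle_ineq4 by (smt (verit))
  moreover have "(?\<Delta> - (t * t) *\<^sub>R ?A) - (?\<Delta> - (t * t) *\<^sub>R ?B) = (t * t) *\<^sub>R (?B - ?A)"
    by (simp add: algebra_simps)
  ultimately have "(t * t) * norm (?B - ?A) \<le> (t * t) * (2 * e)" using t by simp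
  then have "norm (?B - ?A) \<le> 2 * e" using t by simp
  then show False using e by (simp add: e_def)
qed

lemma Ck_differentiable: "Ck k f \<Longrightarrow> set vs \<subseteq> Basis \<Longrightarrow> length vs < k \<Longrightarrow> iter_deriv vs f differentiable (at x)"
  by (auto simp: Ck_def differentiable_on_def)

lemma Ck_isCont: "Ck k f \<Longrightarrow> set vs \<subseteq> Basis \<Longrightarrow> length vs \<le> k \<Longrightarrow> isCont (iter_deriv vs f) x"
  by (auto simp: Ck_def continuous_on_eq_continuous_at)

lemma Ck_swap:
  assumes "Ck k f" "set vs \<subseteq> Basis" "a \<in> Basis" "b \<in> Basis" "length vs + 2 \<le> k"
  shows "iter_deriv (a # b # vs) f = iter_deriv (b # a # vs) f"
proof
  fix x
  have "pd a (pd b (iter_deriv vs f)) x = pd b (pd a (iter_deriv vs f)) x"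
    unfolding iter_deriv_pd
    by (rule pd_commute[of "iter_deriv vs f", unfolded iter_deriv_pd])
       (use assms in \<open>auto intro!: Ck_differentiable Ck_isCont simp del: iter_deriv.simps\<close>)
  then show "iter_deriv (a # b # vs) f x = iter_deriv (b # a # vs) f x" by simp
qed

lemma Ck_move_front:
  assumes "Ck k f" "set (ws @ b # vs) \<subseteq> Basis" "length (ws @ b # vs) \<le> k"
  shows "iter_deriv (ws @ b # vs) f = iter_deriv (b # ws @ vs) f"
  using assms(2,3)
proof (induction ws)
  case (Cons w ws)
  have "iter_deriv ((w # ws) @ b # vs) f = iter_deriv (w # b # ws @ vs) f" using Cons by simp
  also have "\<dots> = iter_deriv (b # w # ws @ vs) f"
    using Cons by (intro Ck_swap[OF assms(1)]) auto
  finally show ?case by simp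
qed simp

text \<open>Only the multiset of directions matters; this frees \<open>mderiv\<close> from the
  arbitrary enumeration \<open>coords\<close>.\<close>

lemma Ck_perm:
  assumes "Ck k f" "set vs \<subseteq> Basis" "length vs \<le> k" "mset vs = mset ws"
  shows "iter_deriv vs f = iter_deriv ws f"
  using assms(2-4)
proof (induction vs arbitrary: ws)
  case (Cons b vs)
  then have "b \<in> set ws" by (metis list.set_intros(1) mset_eq_setD)
  then obtain ws1 ws2 where ws: "ws = ws1 @ b # ws2" by (meson split_list)
  have m: "mset vs = mset (ws1 @ ws2)" using Cons(4) by (simp add: ws)
  have "iter_deriv vs f = iter_deriv (ws1 @ ws2) f" by (rule Cons(1)) (use Cons m in auto)
  moreover have "iter_deriv ws f = iter_deriv (b # ws1 @ ws2) f"
    unfolding ws using Cons(2,3) mset_eq_setD[OF Cons(4)] mset_eq_length[OF Cons(4)] ws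
    by (intro Ck_move_front[OF assms(1)]) auto
  ultimately show ?case by simp
qed simp

lemma smooth_Ck: "smooth f \<Longrightarrow> Ck k f" by (simp add: smooth_def)

lemma smooth_perm:
  "smooth f \<Longrightarrow> set vs \<subseteq> Basis \<Longrightarrow> mset vs = mset ws \<Longrightarrow> iter_deriv vs f = iter_deriv ws f"
  using Ck_perm smooth_Ck by blast

section \<open>Multi-indices as lists of coordinate directions\<close>

definition mi_list :: "('n::finite \<Rightarrow> nat) \<Rightarrow> (real ^ 'n) list" where
  "mi_list \<alpha> = concat (map (\<lambda>i. replicate (\<alpha> i) (axis i 1)) coords)"

definition mi_of :: "(real ^ 'n::finite) list \<Rightarrow> 'n \<Rightarrow> nat" where
  "mi_of vs i = count_list vs (axis i 1)"

lemma mderiv_mi_list: "mderiv \<alpha> f = iter_deriv (mi_list \<alpha>) f"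
  by (simp add: mderiv_def mi_list_def)

lemma coords: "distinct (coords :: 'n::finite list)" "set (coords :: 'n::finite list) = UNIV"
proof -
  have "\<exists>is. distinct is \<and> set is = (UNIV :: 'n set)" using finite_distinct_list[OF finite] by blast
  then have "distinct (coords :: 'n list) \<and> set (coords :: 'n list) = UNIV"
    unfolding coords_def by (rule someI_ex)
  then show "distinct (coords :: 'n::finite list)" "set (coords :: 'n::finite list) = UNIV" by auto
qed

lemma axis_eq_1: "axis i (1::real) = axis j 1 \<longleftrightarrow> i = j"
  by (auto simp: axis_eq_axis)

lemma Basis_vec_axis: "b \<in> Basis \<longleftrightarrow> (\<exists>i. b = axis i (1::real))"
  by (auto simp: Basis_vec_def)

lemma mi_list_Basis: "set (mi_list \<alpha>) \<subseteq> Basis"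
  by (auto simp: mi_list_def Basis_vec_axis)

lemma length_mi_list: "length (mi_list \<alpha>) = mi_abs \<alpha>"
  using sum_list_distinct_conv_sum_set[OF coords(1), of \<alpha>]
  by (simp add: mi_list_def length_concat o_def mi_abs_def coords(2))

lemma mi_of_mi_list: "mi_of (mi_list \<alpha>) = \<alpha>"
proof
  fix j
  have r: "count_list (replicate n a) a = n" for n and a :: "real ^ 'n" by (induction n) auto
  have "count_list (concat (map (\<lambda>i. replicate (\<alpha> i) (axis i (1::real))) is)) (axis j 1) = (\<Sum>i\<leftarrow>is. if i = j then \<alpha> i else 0)" for "is"
    by (induction "is") (auto simp: axis_eq_1 count_list_0_iff r)
  then show "mi_of (mi_list \<alpha>) j = \<alpha> j"
    using sum_list_distinct_conv_sum_set[OF coords(1), of "\<lambda>i. if i = j then \<alpha> i else 0"]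
    by (simp add: mi_of_def mi_list_def coords(2))
qed

lemma mset_eq_of_mi_of:
  assumes "set vs \<subseteq> Basis" "set ws \<subseteq> Basis" "mi_of vs = mi_of ws"
  shows "mset vs = mset ws"
proof (rule multiset_eqI)
  fix b
  show "count (mset vs) b = count (mset ws) b"
  proof (cases "b \<in> Basis")
    case True
    then obtain i where "b = axis i 1" by (auto simp: Basis_vec_axis)
    then show ?thesis using fun_cong[OF assms(3), of i] by (simp add: mi_of_def count_mset)
  next
    case False
    then have "b \<notin> set vs" "b \<notin> set ws" using assms by auto
    then show ?thesis by (simp add: count_list_0_iff count_mset)
  qed
qed

lemma mset_mi_list_mi_of: "set vs \<subseteq> Basis \<Longrightarrow> mset (mi_list (mi_of vs)) = mset vs"
  by (intro mset_eq_of_mi_of mi_list_Basis) (auto simp: mi_of_mi_list)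

lemma mi_abs_mi_of: "set vs \<subseteq> Basis \<Longrightarrow> mi_abs (mi_of vs) = length vs"
  by (metis length_mi_list mset_eq_length mset_mi_list_mi_of)

text \<open>The bridge between lists, which suit inductions on the order of differentiation, and the
  multi-indices of the definitions.\<close>

lemma Ck_iter_deriv_mderiv:
  "Ck k f \<Longrightarrow> set vs \<subseteq> Basis \<Longrightarrow> length vs \<le> k \<Longrightarrow> iter_deriv vs f = mderiv (mi_of vs) f"
  unfolding mderiv_mi_list by (rule Ck_perm) (auto simp: mset_mi_list_mi_of)

lemma smooth_iter_deriv_mderiv: "smooth f \<Longrightarrow> set vs \<subseteq> Basis \<Longrightarrow> iter_deriv vs f = mderiv (mi_of vs) f"
  using Ck_iter_deriv_mderiv smooth_Ck by blast

lemma finite_mi: "finite {\<alpha>::'n::finite \<Rightarrow> nat. mi_abs \<alpha> \<le> N}"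
proof (rule finite_subset)
  have "\<alpha> i \<le> mi_abs \<alpha>" for \<alpha> :: "'n \<Rightarrow> nat" and i
    using member_le_sum[of i UNIV \<alpha>] by (simp add: mi_abs_def)
  then show "{\<alpha>::'n \<Rightarrow> nat. mi_abs \<alpha> \<le> N} \<subseteq> PiE UNIV (\<lambda>_. {..N})"
    using order_trans by (fastforce simp: PiE_def extensional_def)
qed (rule finite_PiE, auto)

section \<open>Weighted bounds and Schwartz functions\<close>

text \<open>The constant is kept apart from the weight because the final estimate has to be linear
  in the constant of each factor.\<close>

definition bdd :: "nat \<Rightarrow> real \<Rightarrow> ('a::euclidean_space \<Rightarrow> real) \<Rightarrow> ('a \<Rightarrow> complex) \<Rightarrow> bool" where
  "bdd N C W f \<longleftrightarrow> (\<forall>vs. set vs \<subseteq> Basis \<and> length vs \<le> N \<longrightarrow> (\<forall>x. norm (iter_deriv vs f x) \<le> C * W x))"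

lemma bddD: "bdd N C W f \<Longrightarrow> set vs \<subseteq> Basis \<Longrightarrow> length vs \<le> N \<Longrightarrow> norm (iter_deriv vs f x) \<le> C * W x"
  by (auto simp: bdd_def)

lemma bdd0: "bdd N C W f \<Longrightarrow> norm (f x) \<le> C * W x"
  using bddD[of N C W f "[]" x] by simp

lemma bdd_pd: "bdd (Suc N) C W f \<Longrightarrow> b \<in> Basis \<Longrightarrow> bdd N C W (pd b f)"
  unfolding bdd_def
proof safe
  fix vs :: "'a list" and x
  assume a: "\<forall>vs. set vs \<subseteq> Basis \<and> length vs \<le> Suc N \<longrightarrow> (\<forall>x. norm (iter_deriv vs f x) \<le> C * W x)"
    "b \<in> Basis" "set vs \<subseteq> Basis" "length vs \<le> N"
  then show "norm (iter_deriv vs (pd b f) x) \<le> C * W x"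
    unfolding iter_deriv_append[symmetric] by (auto intro!: a(1)[rule_format])
qed

lemma bdd_Suc:
  assumes "\<And>x. norm (f x) \<le> C * W x" "\<And>b. b \<in> Basis \<Longrightarrow> bdd N C W (pd b f)"
  shows "bdd (Suc N) C W f"
  unfolding bdd_def
proof safe
  fix vs :: "'a list" and x assume vs: "set vs \<subseteq> Basis" "length vs \<le> Suc N"
  show "norm (iter_deriv vs f x) \<le> C * W x"
  proof (cases vs rule: rev_exhaust)
    case (snoc ws b)
    then show ?thesis using bddD[OF assms(2), of b ws x] vs by (simp add: iter_deriv_append)
  qed (use assms in simp)
qed

lemma bdd_mono:
  assumes "bdd N C W f" "N' \<le> N" "\<And>x. C * W x \<le> D * U x"
  shows "bdd N' D U f"
  using assms unfolding bdd_def by (meson order_trans)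

lemma bdd_mono_const: "bdd N C W f \<Longrightarrow> C \<le> D \<Longrightarrow> (\<And>x. 0 \<le> W x) \<Longrightarrow> bdd N D W f"
  by (erule bdd_mono) (auto intro: mult_right_mono)

lemma bdd_weight:
  assumes "bdd N C W f" "\<And>x. W x \<le> D * U x" "0 \<le> C"
  shows "bdd N (C * D) U f"
  by (rule bdd_mono[OF assms(1) order_refl]) (use mult_left_mono[OF assms(2,3)] in \<open>simp add: mult.assoc\<close>)

lemma bdd_add:
  assumes "smooth f" "smooth g" "bdd N C W f" "bdd N D W g"
  shows "bdd N (C + D) W (\<lambda>x. f x + g x)"
  unfolding bdd_def
proof safe
  fix vs :: "'a list" and x assume vs: "set vs \<subseteq> Basis" "length vs \<le> N"
  have "norm (iter_deriv vs f x + iter_deriv vs g x) \<le> C * W x + D * W x"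
    using bddD[OF assms(3) vs] bddD[OF assms(4) vs] by (intro norm_triangle_mono)
  then show "norm (iter_deriv vs (\<lambda>x. f x + g x) x) \<le> (C + D) * W x"
    by (simp add: iter_deriv_add assms vs algebra_simps)
qed

lemma bdd_cmult:
  assumes "smooth f" "bdd N C W f"
  shows "bdd N (norm c * C) W (\<lambda>x. c * f x)"
  unfolding bdd_def
  using bddD[OF assms(2)] by (auto simp: iter_deriv_cmult assms norm_mult mult.assoc intro!: mult_left_mono)

text \<open>Each further derivative turns one product into two, hence the factor
  \<open>2 ^ N\<close>.\<close>

lemma bdd_mult:
  assumes "smooth f" "smooth g" "bdd N C W f" "bdd N D U g" "0 \<le> C" "0 \<le> D"
    "\<And>x. 0 \<le> W x" "\<And>x. 0 \<le> U x"
  shows "bdd N (2 ^ N * C * D) (\<lambda>x. W x * U x) (\<lambda>x. f x * g x)"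
  using assms(1-4)
proof (induction N arbitrary: f g)
  case 0
  have "norm (f x) * norm (g x) \<le> (C * W x) * (D * U x)" for x
    using 0 bdd0 assms by (intro mult_mono) (auto intro: order_trans[OF norm_ge_zero])
  then show ?case by (auto simp: bdd_def norm_mult algebra_simps)
next
  case (Suc N)
  have p: "bdd N (2 ^ N * C * D) (\<lambda>x. W x * U x) (\<lambda>x. f x * pd b g x)"
    "bdd N (2 ^ N * C * D) (\<lambda>x. W x * U x) (\<lambda>x. pd b f x * g x)" if b: "b \<in> Basis" for b
    by (rule Suc.IH; use Suc b in \<open>auto simp del: iter_deriv.simps intro: smooth_pd bdd_pd bdd_mono\<close>)+
  show ?case
  proof (rule bdd_Suc)
    fix x
    have "norm (f x) * norm (g x) \<le> (C * W x) * (D * U x)"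
      using Suc bdd0 assms by (intro mult_mono) (auto intro: order_trans[OF norm_ge_zero])
    also have "\<dots> = (C * D) * (W x * U x)" by simp
    also have "\<dots> \<le> (2 ^ Suc N * C * D) * (W x * U x)"
    proof (rule mult_right_mono)
      have "1 * (C * D) \<le> 2 ^ Suc N * (C * D)" using assms by (intro mult_right_mono one_le_power) auto
      then show "C * D \<le> 2 ^ Suc N * C * D" by (simp add: mult.assoc)
    qed (use assms in auto)
    finally show "norm (f x * g x) \<le> (2 ^ Suc N * C * D) * (W x * U x)" by (simp add: norm_mult)
  next
    fix b :: 'a assume b: "b \<in> Basis"
    have "bdd N (2 ^ N * C * D + 2 ^ N * C * D) (\<lambda>x. W x * U x) (\<lambda>x. f x * pd b g x + pd b f x * g x)"
      by (intro bdd_add p b smooth_mult smooth_pd Suc)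
    then have "bdd N (2 ^ Suc N * C * D) (\<lambda>x. W x * U x) (\<lambda>x. f x * pd b g x + pd b f x * g x)"
      by (simp add: algebra_simps del: iter_deriv.simps)
    then show "bdd N (2 ^ Suc N * C * D) (\<lambda>x. W x * U x) (pd b (\<lambda>x. f x * g x))"
      by (simp only: pd_mult[OF smooth_differentiable[OF Suc(2)] smooth_differentiable[OF Suc(3)]])
  qed
qed

text \<open>There are finitely many lists of bounded length, so their constants can be summed. The
  index set I makes the constant uniform over a family, such as a sequence of functions.\<close>

lemma bdd_of_lists:
  fixes f :: "'i \<Rightarrow> 'a::euclidean_space \<Rightarrow> complex"
  assumes "\<And>vs. set vs \<subseteq> Basis \<Longrightarrow> length vs \<le> N \<Longrightarrow> \<exists>C. \<forall>i\<in>I. \<forall>x. norm (iter_deriv vs (f i) x) \<le> C * W i x"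
    and W: "\<And>i x. i \<in> I \<Longrightarrow> 0 \<le> W i x"
  shows "\<exists>C\<ge>0. \<forall>i\<in>I. bdd N C (W i) (f i)"
proof -
  define L where "L = {vs::'a list. set vs \<subseteq> Basis \<and> length vs \<le> N}"
  have fin: "finite L" unfolding L_def by (rule finite_lists_length_le) simp
  have "\<forall>vs\<in>L. \<exists>C. \<forall>i\<in>I. \<forall>x. norm (iter_deriv vs (f i) x) \<le> C * W i x"
    using assms(1) by (auto simp: L_def)
  then obtain C where C: "\<And>vs i x. vs \<in> L \<Longrightarrow> i \<in> I \<Longrightarrow> norm (iter_deriv vs (f i) x) \<le> C vs * W i x" by metis
  have "norm (iter_deriv vs (f i) x) \<le> (\<Sum>vs\<in>L. \<bar>C vs\<bar>) * W i x" if "vs \<in> L" "i \<in> I" for vs i x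
  proof -
    have "norm (iter_deriv vs (f i) x) \<le> C vs * W i x" using C that by blast
    also have "\<dots> \<le> (\<Sum>vs\<in>L. \<bar>C vs\<bar>) * W i x"
      using member_le_sum[of vs L "\<lambda>vs. \<bar>C vs\<bar>"] fin that W by (intro mult_right_mono) auto
    finally show ?thesis .
  qed
  then show ?thesis
    by (intro exI[of _ "\<Sum>vs\<in>L. \<bar>C vs\<bar>"]) (auto simp: bdd_def L_def intro: sum_nonneg)
qed

text \<open>One weight bounds the derivatives of every order; only the constant may depend on the
  order.\<close>

definition wcl :: "('a::euclidean_space \<Rightarrow> real) \<Rightarrow> ('a \<Rightarrow> complex) \<Rightarrow> bool" where
  "wcl W f \<longleftrightarrow> smooth f \<and> (\<forall>N. \<exists>C\<ge>0. bdd N C W f)"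

text \<open>The mode of convergence under which oscillatory integrals pass to the limit.\<close>

definition wconv :: "('a::euclidean_space \<Rightarrow> real) \<Rightarrow> (nat \<Rightarrow> 'a \<Rightarrow> complex) \<Rightarrow> ('a \<Rightarrow> complex) \<Rightarrow> bool" where
  "wconv W F f \<longleftrightarrow> (\<forall>n. smooth (F n)) \<and> smooth f \<and> (\<forall>N. \<exists>C\<ge>0. \<forall>n. bdd N C W (F n)) \<and>
     (\<forall>vs x. set vs \<subseteq> Basis \<longrightarrow> (\<lambda>n. iter_deriv vs (F n) x) \<longlonglongrightarrow> iter_deriv vs f x)"

lemma wcl_smooth: "wcl W f \<Longrightarrow> smooth f" by (simp add: wcl_def)

lemma wcl_of_lists:
  assumes "smooth f" "\<And>x. 0 \<le> W x"
    "\<And>vs. set vs \<subseteq> Basis \<Longrightarrow> \<exists>C. \<forall>x. norm (iter_deriv vs f x) \<le> C * W x"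
  shows "wcl W f"
  using bdd_of_lists[where I = "{()}" and f = "\<lambda>_. f" and W = "\<lambda>_. W"] assms by (auto simp: wcl_def)

lemma wcl_lists: "wcl W f \<Longrightarrow> set vs \<subseteq> Basis \<Longrightarrow> \<exists>C\<ge>0. \<forall>x. norm (iter_deriv vs f x) \<le> C * W x"
  unfolding wcl_def by (meson bddD order_refl)

lemma wcl_pd: "wcl W f \<Longrightarrow> b \<in> Basis \<Longrightarrow> wcl W (pd b f)"
  unfolding wcl_def using bdd_pd smooth_pd by blast

lemma wcl_add: "wcl W f \<Longrightarrow> wcl W g \<Longrightarrow> wcl W (\<lambda>x. f x + g x)"
  unfolding wcl_def using bdd_add smooth_add by (metis add_nonneg_nonneg)

lemma wcl_cmult: "wcl W f \<Longrightarrow> wcl W (\<lambda>x. c * f x)"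
  unfolding wcl_def using bdd_cmult smooth_cmult by (metis mult_nonneg_nonneg norm_ge_zero)

lemma wcl_diff: "wcl W f \<Longrightarrow> wcl W g \<Longrightarrow> wcl W (\<lambda>x. f x - g x)"
  using wcl_add[OF _ wcl_cmult, of W f g "-1"] by simp

lemma wcl_zero: "(\<And>x. 0 \<le> W x) \<Longrightarrow> wcl W (\<lambda>x. 0)"
  by (intro wcl_of_lists) (auto simp: smooth_const iter_deriv_const intro: exI[of _ 0])

lemma wcl_sum: "(\<And>x. 0 \<le> W x) \<Longrightarrow> (\<And>i. i \<in> I \<Longrightarrow> wcl W (f i)) \<Longrightarrow> wcl W (\<lambda>x. \<Sum>i\<in>I. f i x)"
  by (induction I rule: infinite_finite_induct) (auto intro: wcl_add wcl_zero)

lemma wcl_mult: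
  assumes "wcl W f" "wcl U g" "\<And>x. 0 \<le> W x" "\<And>x. 0 \<le> U x"
  shows "wcl (\<lambda>x. W x * U x) (\<lambda>x. f x * g x)"
  unfolding wcl_def
proof safe
  show "smooth (\<lambda>x. f x * g x)" using assms smooth_mult wcl_smooth by blast
  fix N
  obtain C D where "C \<ge> 0" "D \<ge> 0" "bdd N C W f" "bdd N D U g" using assms unfolding wcl_def by meson
  then show "\<exists>C\<ge>0. bdd N C (\<lambda>x. W x * U x) (\<lambda>x. f x * g x)"
    using bdd_mult[of f g N C W D U] assms wcl_smooth by (intro exI[of _ "2 ^ N * C * D"]) auto
qed

lemma wcl_mono:
  assumes "wcl W f" "\<And>x. W x \<le> D * U x" "D \<ge> 0"
  shows "wcl U f"
  unfolding wcl_def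
proof safe
  show "smooth f" using assms wcl_smooth by blast
  fix N
  obtain C where "C \<ge> 0" "bdd N C W f" using assms unfolding wcl_def by meson
  then show "\<exists>C\<ge>0. bdd N C U f" using assms(2,3) bdd_weight[of N C W f D U]
    by (intro exI[of _ "C * D"]) auto
qed

lemma wconv_smooth: "wconv W F f \<Longrightarrow> smooth (F n)" "wconv W F f \<Longrightarrow> smooth f" by (auto simp: wconv_def)

lemma wconv_lim: "wconv W F f \<Longrightarrow> set vs \<subseteq> Basis \<Longrightarrow> (\<lambda>n. iter_deriv vs (F n) x) \<longlonglongrightarrow> iter_deriv vs f x"
  by (auto simp: wconv_def)

lemma wconv_lim0: "wconv W F f \<Longrightarrow> (\<lambda>n. F n x) \<longlonglongrightarrow> f x"
  using wconv_lim[of W F f "[]" x] by simp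

lemma wconv_limit_bdd:
  assumes "wconv W F f" "\<forall>n. bdd N C W (F n)"
  shows "bdd N C W f"
  unfolding bdd_def
proof safe
  fix vs :: "'a list" and x assume "set vs \<subseteq> Basis" "length vs \<le> N"
  then have "norm (iter_deriv vs (F n) x) \<le> C * W x" for n using assms(2) bddD by blast
  then show "norm (iter_deriv vs f x) \<le> C * W x"
    by (intro Lim_bounded[OF tendsto_norm[OF wconv_lim[OF assms(1) \<open>set vs \<subseteq> Basis\<close>]]]) auto
qed

lemma wconv_wcl: "wconv W F f \<Longrightarrow> wcl W f"
  unfolding wcl_def using wconv_limit_bdd[of W F f] unfolding wconv_def by metis

lemma wconv_const: "wcl W f \<Longrightarrow> wconv W (\<lambda>_. f) f"
  by (auto simp: wconv_def wcl_def)

lemma wconv_pd: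
  assumes "wconv W F f" "b \<in> Basis"
  shows "wconv W (\<lambda>n. pd b (F n)) (pd b f)"
proof -
  have "(\<lambda>n. iter_deriv vs (pd b (F n)) x) \<longlonglongrightarrow> iter_deriv vs (pd b f) x" if "set vs \<subseteq> Basis" for vs x
    unfolding iter_deriv_append[symmetric] by (rule wconv_lim[OF assms(1)]) (use that assms in auto)
  moreover have "\<exists>C\<ge>0. \<forall>n. bdd N C W (pd b (F n))" for N
    using assms bdd_pd unfolding wconv_def by blast
  ultimately show ?thesis using assms smooth_pd unfolding wconv_def by blast
qed

lemma wconv_add:
  assumes "wconv W F f" "wconv W G g"
  shows "wconv W (\<lambda>n x. F n x + G n x) (\<lambda>x. f x + g x)"
  unfolding wconv_def
proof (intro conjI allI impI)
  note s = wconv_smooth[OF assms(1)] wconv_smooth[OF assms(2)]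
  show "smooth (\<lambda>x. F n x + G n x)" "smooth (\<lambda>x. f x + g x)" for n using s smooth_add by auto
  show "\<exists>C\<ge>0. \<forall>n. bdd N C W (\<lambda>x. F n x + G n x)" for N
  proof -
    obtain C D where "C \<ge> 0" "D \<ge> 0" "\<forall>n. bdd N C W (F n)" "\<forall>n. bdd N D W (G n)"
      using assms unfolding wconv_def by meson
    then show ?thesis by (intro exI[of _ "C + D"] conjI allI bdd_add s) auto
  qed
  show "(\<lambda>n. iter_deriv vs (\<lambda>x. F n x + G n x) x) \<longlonglongrightarrow> iter_deriv vs (\<lambda>x. f x + g x) x"
    if "set vs \<subseteq> Basis" for vs x
    using that s wconv_lim[OF assms(1) that] wconv_lim[OF assms(2) that]
    by (simp add: iter_deriv_add tendsto_add)
qed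

lemma wconv_mult:
  assumes "wconv W F f" "wconv U G g" "\<And>x. 0 \<le> W x" "\<And>x. 0 \<le> U x"
  shows "wconv (\<lambda>x. W x * U x) (\<lambda>n x. F n x * G n x) (\<lambda>x. f x * g x)"
  unfolding wconv_def
proof (intro conjI allI impI)
  note s = wconv_smooth[OF assms(1)] wconv_smooth[OF assms(2)]
  show "smooth (\<lambda>x. F n x * G n x)" "smooth (\<lambda>x. f x * g x)" for n using s smooth_mult by auto
  show "\<exists>C\<ge>0. \<forall>n. bdd N C (\<lambda>x. W x * U x) (\<lambda>x. F n x * G n x)" for N
  proof -
    obtain C D where "C \<ge> 0" "D \<ge> 0" "\<forall>n. bdd N C W (F n)" "\<forall>n. bdd N D U (G n)"
      using assms unfolding wconv_def by meson
    then show ?thesis by (intro exI[of _ "2 ^ N * C * D"] conjI allI bdd_mult s assms(3,4)) auto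
  qed
  show "(\<lambda>n. iter_deriv vs (\<lambda>x. F n x * G n x) x) \<longlonglongrightarrow> iter_deriv vs (\<lambda>x. f x * g x) x"
    if "set vs \<subseteq> Basis" for vs x
    using that assms(1,2)
  proof (induction vs arbitrary: F G f g rule: rev_induct)
    case Nil
    then show ?case using wconv_lim0[OF Nil(2)] wconv_lim0[OF Nil(3)] by (simp add: tendsto_mult)
  next
    case (snoc b vs)
    then have b: "b \<in> Basis" "set vs \<subseteq> Basis" by auto
    note s = wconv_smooth[OF snoc(3)] wconv_smooth[OF snoc(4)]
    have "(\<lambda>n. iter_deriv vs (\<lambda>x. F n x * pd b (G n) x) x + iter_deriv vs (\<lambda>x. pd b (F n) x * G n x) x)
      \<longlonglongrightarrow> iter_deriv vs (\<lambda>x. f x * pd b g x) x + iter_deriv vs (\<lambda>x. pd b f x * g x) x"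
      by (intro tendsto_add snoc.IH b wconv_pd snoc)
    then show ?case by (simp add: iter_deriv_snoc_mult s b del: iter_deriv.simps)
  qed
qed

lemma wconv_mono:
  assumes "wconv W F f" "\<And>x. W x \<le> D * U x" "D \<ge> 0"
  shows "wconv U F f"
proof -
  have "\<exists>C\<ge>0. \<forall>n. bdd N C U (F n)" for N
  proof -
    obtain C where "C \<ge> 0" "\<forall>n. bdd N C W (F n)" using assms unfolding wconv_def by meson
    then show ?thesis using assms(2,3) bdd_weight[of N C W _ D U]
      by (intro exI[of _ "C * D"]) auto
  qed
  then show ?thesis using assms(1) unfolding wconv_def by blast
qed

section \<open>The Japanese bracket: Peetre's inequality and integrability of powers\<close>

lemma japanese_Pair: "japanese x = norm (1::real, x)"
  by (simp add: japanese_def norm_Pair)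

lemma japanese_ge_1: "1 \<le> japanese x"
  by (simp add: japanese_def)

lemma japanese_pos: "0 < japanese x"
  using japanese_ge_1[of x] by linarith

lemma norm_le_japanese: "norm x \<le> japanese x"
  by (simp add: japanese_def real_le_rsqrt)

lemma japanese_le: "japanese x \<le> 1 + norm x"
  using norm_triangle_ineq[of "(1::real, 0)" "(0, x)"] by (simp add: japanese_Pair norm_Pair)

lemma japanese_triangle: "japanese (x + y) \<le> japanese x + norm y"
  using norm_triangle_ineq[of "(1::real, x)" "(0, y)"] by (simp add: japanese_Pair norm_Pair)

lemma japanese_mono: "norm x \<le> norm y \<Longrightarrow> japanese x \<le> japanese y"
  by (simp add: japanese_def)

lemma japanese_uminus: "japanese (- x) = japanese x"
  by (simp add: japanese_def)

lemma japanese_sq: "japanese x ^ 2 = 1 + norm x ^ 2"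
  by (simp add: japanese_def)

lemma japanese_add_le: "japanese (x + y) \<le> 2 * japanese x * japanese y"
proof -
  have "japanese x * 1 + 1 * norm y \<le> japanese x * japanese y + japanese x * japanese y"
    using japanese_ge_1[of x] japanese_ge_1[of y] norm_le_japanese[of y] by (intro add_mono mult_mono) auto
  then show ?thesis using japanese_triangle[of x y] by simp
qed

lemma japanese_powr_pos: "0 < japanese x powr s"
  using japanese_pos[of x] by simp

lemma japanese_powr_mono: "s \<le> t \<Longrightarrow> japanese x powr s \<le> japanese x powr t"
  using japanese_ge_1 by (auto intro: powr_mono)

text \<open>For negative s the roles of x and x + y are exchanged: x is the shift of x + y by - y,
  and the inequality for \<open>\<bar>s\<bar>\<close> is then inverted.\<close>

lemma peetre: "japanese (x + y) powr s \<le> 2 powr \<bar>s\<bar> * japanese x powr s * japanese y powr \<bar>s\<bar>"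
proof (cases "s \<ge> 0")
  case True
  have "japanese (x + y) powr s \<le> (2 * japanese x * japanese y) powr s"
    by (rule powr_mono2[OF True _ japanese_add_le]) (simp add: japanese_pos less_imp_le)
  then show ?thesis using True japanese_pos[of x] japanese_pos[of y] by (simp add: powr_mult)
next
  case False
  have "japanese x \<le> 2 * japanese (x + y) * japanese y"
    using japanese_add_le[of "x + y" "- y"] by (simp add: japanese_uminus)
  then have "japanese x powr \<bar>s\<bar> \<le> (2 * japanese (x + y) * japanese y) powr \<bar>s\<bar>"
    by (intro powr_mono2) (auto simp: japanese_pos less_imp_le)
  also have "\<dots> = 2 powr \<bar>s\<bar> * japanese (x + y) powr \<bar>s\<bar> * japanese y powr \<bar>s\<bar>"
    using japanese_pos[of "x + y"] japanese_pos[of y] by (simp add: powr_mult)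
  also have "\<dots> = (2 powr \<bar>s\<bar> * japanese y powr \<bar>s\<bar>) * inverse (japanese (x + y) powr s)"
    using False by (simp add: powr_minus[symmetric])
  finally have *: "japanese x powr \<bar>s\<bar> \<le> (2 powr \<bar>s\<bar> * japanese y powr \<bar>s\<bar>) * inverse (japanese (x + y) powr s)" .
  have "japanese (x + y) powr s = japanese x powr \<bar>s\<bar> * (japanese (x + y) powr s * japanese x powr s)"
    using False japanese_pos[of x] by (simp add: powr_add[symmetric] mult.left_commute)
  also have "\<dots> \<le> (2 powr \<bar>s\<bar> * japanese y powr \<bar>s\<bar>) * inverse (japanese (x + y) powr s) * (japanese (x + y) powr s * japanese x powr s)"
    by (intro mult_right_mono *) auto
  also have "\<dots> = 2 powr \<bar>s\<bar> * japanese x powr s * japanese y powr \<bar>s\<bar>"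
    using japanese_powr_pos[of "x + y" s] by simp
  finally show ?thesis .
qed

lemma continuous_on_japanese: "continuous_on A japanese"
  unfolding japanese_def[abs_def] by (intro continuous_intros)

lemma japanese_borel [measurable]: "japanese \<in> borel_measurable borel"
  by (rule borel_measurable_continuous_onI[OF continuous_on_japanese])

lemma integrable_inverse_square: "integrable lborel (\<lambda>t::real. inverse (1 + t\<^sup>2))"
  using integrable_inverse_1_plus_square by (simp add: set_integrable_def einterval_def)

lemma integrable_Basis_prod: "integrable lborel (\<lambda>x::'a::euclidean_space. \<Prod>b\<in>Basis. inverse (1 + (x \<bullet> b)\<^sup>2))"
proof (rule integrableI_nonneg)
  have "(\<integral>\<^sup>+x. ennreal (\<Prod>b\<in>Basis. inverse (1 + (x \<bullet> b)\<^sup>2)) \<partial>(lborel :: 'a measure)) =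
      (\<integral>\<^sup>+x. (\<Prod>b\<in>Basis. ennreal (inverse (1 + (x \<bullet> b)\<^sup>2))) \<partial>(lborel :: 'a measure))"
    by (simp add: prod_ennreal)
  also have "\<dots> = (\<Prod>b\<in>(Basis::'a set). (\<integral>\<^sup>+t. ennreal (inverse (1 + t\<^sup>2)) \<partial>(lborel :: real measure)))"
    by (subst nn_integral_lborel_prod) auto
  also have "\<dots> = ennreal (\<Prod>b\<in>(Basis::'a set). (\<integral>t. inverse (1 + t\<^sup>2) \<partial>(lborel :: real measure)))"
    by (subst nn_integral_eq_integral[OF integrable_inverse_square])
      (auto simp: ennreal_power integral_nonneg_AE)
  also have "\<dots> < \<infinity>" by simp
  finally show "(\<integral>\<^sup>+x. ennreal (\<Prod>b\<in>Basis. inverse (1 + (x \<bullet> b)\<^sup>2)) \<partial>(lborel :: 'a measure)) < \<infinity>" .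
qed (auto intro!: AE_I2 prod_nonneg)

lemma japanese_powr_le_Basis_prod:
  "s \<le> - 2 * real DIM('a) \<Longrightarrow> japanese x powr s \<le> (\<Prod>b\<in>Basis. inverse (1 + ((x::'a::euclidean_space) \<bullet> b)\<^sup>2))"
proof -
  assume s: "s \<le> - 2 * real DIM('a)"
  have "japanese x powr s \<le> japanese x powr (- 2 * real DIM('a))" using s by (rule japanese_powr_mono)
  also have "\<dots> = (\<Prod>b\<in>(Basis::'a set). inverse (japanese x ^ 2))"
  proof -
    have "japanese x powr (- 2 * real DIM('a)) = inverse (japanese x powr real (2 * DIM('a)))"
      by (simp add: powr_minus[symmetric])
    then show ?thesis
      by (simp only: powr_realpow[OF japanese_pos] prod_constant power_mult power_inverse)
  qed
  also have "\<dots> \<le> (\<Prod>b\<in>Basis. inverse (1 + (x \<bullet> b)\<^sup>2))"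
  proof (intro prod_mono conjI)
    fix b :: 'a assume "b \<in> Basis"
    then have "(x \<bullet> b)\<^sup>2 \<le> norm x ^ 2" by (simp add: Basis_le_norm abs_le_square_iff[symmetric])
    then show "inverse (japanese x ^ 2) \<le> inverse (1 + (x \<bullet> b)\<^sup>2)"
      unfolding japanese_sq by (intro le_imp_inverse_le) (auto simp: add_pos_nonneg)
  qed auto
  finally show ?thesis .
qed

text \<open>The power is dominated by the product of the functions 1 / (1 + t^2) of the single
  coordinates, whose integral factorizes. This comparison is the origin of twice the dimension in
  the exponents below.\<close>

lemma integrable_japanese:
  assumes "s \<le> - 2 * real DIM('a)"
  shows "integrable lborel (\<lambda>x::'a::euclidean_space. japanese x powr s)"
  by (rule Bochner_Integration.integrable_bound[OF integrable_Basis_prod])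
    (use japanese_powr_le_Basis_prod[OF assms] in \<open>auto intro!: AE_I2 order_trans[OF _ abs_ge_self]\<close>)

lemma integrable_japanese_prod:
  assumes "s \<le> - 2 * real DIM('a)" "t \<le> - 2 * real DIM('b)"
  shows "integrable lborel (\<lambda>z::'a::euclidean_space \<times> 'b::euclidean_space. japanese (fst z) powr s * japanese (snd z) powr t)"
proof (rule Bochner_Integration.integrable_bound[OF integrable_Basis_prod])
  have d: "(\<lambda>u. (u, 0)) ` (Basis::'a set) \<inter> Pair 0 ` (Basis::'b set) = {}" by auto
  have "(\<Prod>b\<in>Basis. inverse (1 + (fst z \<bullet> b)\<^sup>2)) * (\<Prod>b\<in>Basis. inverse (1 + (snd z \<bullet> b)\<^sup>2))
      = (\<Prod>b\<in>Basis. inverse (1 + (z \<bullet> b)\<^sup>2))" for z :: "'a \<times> 'b"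
    unfolding Basis_prod_def
    by (subst prod.union_disjoint[OF _ _ d]) (auto simp: prod.reindex inj_on_def inner_prod_def)
  moreover have "japanese (fst z) powr s * japanese (snd z) powr t \<le>
     (\<Prod>b\<in>Basis. inverse (1 + (fst z \<bullet> b)\<^sup>2)) * (\<Prod>b\<in>Basis. inverse (1 + (snd z \<bullet> b)\<^sup>2))" for z :: "'a \<times> 'b"
    by (intro mult_mono japanese_powr_le_Basis_prod assms) (auto intro!: prod_nonneg)
  ultimately have "japanese (fst z) powr s * japanese (snd z) powr t \<le> (\<Prod>b\<in>Basis. inverse (1 + (z \<bullet> b)\<^sup>2))" for z :: "'a \<times> 'b"
    by metis
  then show "AE z in lborel. norm (japanese (fst z) powr s * japanese (snd z) powr t) \<le> norm (\<Prod>b\<in>Basis. inverse (1 + ((z :: 'a \<times> 'b) \<bullet> b)\<^sup>2))"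
    by (auto intro!: AE_I2 order_trans[OF _ abs_ge_self])
  show "(\<lambda>z::'a \<times> 'b. japanese (fst z) powr s * japanese (snd z) powr t) \<in> borel_measurable lborel"
    by (auto intro!: borel_measurable_continuous_onI continuous_intros continuous_on_compose2[OF continuous_on_japanese]
       simp: japanese_pos less_imp_neq[THEN not_sym])
qed

text \<open>This is \<open>japanese x powr -2\<close> with complex values, written as the inverse of
  a quadratic polynomial so that it can be differentiated.\<close>

definition jw :: "'a::euclidean_space \<Rightarrow> complex" where
  "jw x = inverse (1 + complex_of_real (x \<bullet> x))"

lemma jw_nz: "1 + complex_of_real (x \<bullet> x) \<noteq> 0"
proof -
  have "Re (1 + complex_of_real (x \<bullet> x)) > 0" by (simp add: add_pos_nonneg)
  then show ?thesis by force
qed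

lemma jw_eq: "jw x = complex_of_real (japanese x powr - 2)"
proof -
  have "japanese x powr - 2 = inverse (japanese x ^ 2)"
    using japanese_pos[of x] by (simp add: powr_minus powr_numeral)
  then show ?thesis unfolding japanese_sq by (simp add: jw_def power2_norm_eq_inner)
qed

lemma norm_jw: "norm (jw x) = japanese x powr - 2"
  using japanese_powr_pos[of x "-2"] unfolding jw_eq by simp

lemma jw_pd: "(jw :: 'a::euclidean_space \<Rightarrow> complex) differentiable (at x)" "pd b jw = (\<lambda>x::'a. - 2 * complex_of_real (x \<bullet> b) * (jw x * jw x))"
proof -
  have d: "(jw has_derivative (\<lambda>h. - 2 * complex_of_real (x \<bullet> h) * (jw x * jw x))) (at x)" for x :: 'a
  proof -
    have "((\<lambda>x. 1 + complex_of_real (x \<bullet> x)) has_derivative (\<lambda>h. 2 * complex_of_real (x \<bullet> h))) (at x)"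
      by (auto intro!: derivative_eq_intros simp: inner_commute)
    from Deriv.has_derivative_inverse[OF jw_nz this] show ?thesis
      unfolding jw_def[abs_def] by (simp add: algebra_simps)
  qed
  then show "jw differentiable (at x)" by (auto simp: differentiable_def)
  show "pd b jw = (\<lambda>x. - 2 * complex_of_real (x \<bullet> b) * (jw x * jw x))"
    using frechet_derivative_eqI[OF d] by simp
qed

lemma smooth_jw: "smooth (jw :: 'a::euclidean_space \<Rightarrow> complex)"
\<comment> \<open>The derivative of \<open>jw\<close> contains \<open>jw\<close> squared. Since
  \<open>(1 + x \<bullet> x) * jw x = 1\<close>, the term in which h is differentiated can be raised
  to the same higher power, so the family is closed.\<close>
proof (rule smooth_coinduct[where \<Phi> = "{\<lambda>x. h x * jw x ^ Suc k |h k. smooth h}"])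
  show "(jw :: 'a \<Rightarrow> complex) \<in> {\<lambda>x. h x * jw x ^ Suc k |h k. smooth h}"
    using smooth_const[of 1] by (force intro!: exI[of _ 0] exI[of _ "\<lambda>x. 1"])
next
  fix f :: "'a \<Rightarrow> complex" and x assume "f \<in> {\<lambda>x. h x * jw x ^ Suc k |h k. smooth h}"
  then show "f differentiable (at x)" using jw_pd(1) smooth_differentiable
    by (auto intro!: differentiable_mult differentiable_power)
next
  fix f :: "'a \<Rightarrow> complex" and b :: 'a assume "f \<in> {\<lambda>x. h x * jw x ^ Suc k |h k. smooth h}" and b: "b \<in> Basis"
  then obtain h k where f: "f = (\<lambda>x. h x * jw x ^ Suc k)" and h: "smooth h" by blast
  have pw: "pd b (\<lambda>x. jw x ^ Suc k) x = - 2 * of_nat (Suc k) * complex_of_real (x \<bullet> b) * jw x ^ Suc (Suc k)" for x k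
  proof (induction k)
    case (Suc k)
    have "pd b (\<lambda>x. jw x * jw x ^ Suc k) x = jw x * pd b (\<lambda>x. jw x ^ Suc k) x + pd b jw x * jw x ^ Suc k"
      by (subst pd_mult) (auto intro!: jw_pd differentiable_power differentiable_mult)
    then show ?case unfolding Suc jw_pd(2) by (simp add: algebra_simps)
  qed (use jw_pd(2)[of b] in simp)
  have "pd b f = (\<lambda>x. h x * pd b (\<lambda>x. jw x ^ Suc k) x + pd b h x * jw x ^ Suc k)" unfolding f
    by (intro pd_mult smooth_differentiable h differentiable_power jw_pd)
  also have "\<dots> = (\<lambda>x. (- 2 * of_nat (Suc k) * complex_of_real (x \<bullet> b) * h x + pd b h x * (1 + complex_of_real (x \<bullet> x))) * jw x ^ Suc (Suc k))"
  proof
    fix x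
    have "h x * (- 2 * of_nat (Suc k) * complex_of_real (x \<bullet> b) * J) + pd b h x * J' =
        (- 2 * of_nat (Suc k) * complex_of_real (x \<bullet> b) * h x + pd b h x * (1 + complex_of_real (x \<bullet> x))) * J"
      if "J' = (1 + complex_of_real (x \<bullet> x)) * J" for J J'
      unfolding that by (simp add: algebra_simps)
    from this[of "jw x ^ Suc k" "jw x ^ Suc (Suc k)"]
    show "h x * pd b (\<lambda>x. jw x ^ Suc k) x + pd b h x * jw x ^ Suc k =
        (- 2 * of_nat (Suc k) * complex_of_real (x \<bullet> b) * h x + pd b h x * (1 + complex_of_real (x \<bullet> x))) * jw x ^ Suc (Suc k)"
      unfolding pw using jw_nz[of x] by (simp add: jw_def)
  qed
  finally have *: "pd b f = (\<lambda>x. (- 2 * of_nat (Suc k) * complex_of_real (x \<bullet> b) * h x + pd b h x * (1 + complex_of_real (x \<bullet> x))) * jw x ^ Suc (Suc k))" .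
  have xx: "(\<lambda>x::'a. complex_of_real (x \<bullet> x)) = (\<lambda>x. \<Sum>b\<in>Basis. complex_of_real (x \<bullet> b) * complex_of_real (x \<bullet> b))"
    by (subst euclidean_inner) simp
  have "smooth (\<lambda>x::'a. complex_of_real (x \<bullet> x))" unfolding xx by (intro smooth_sum smooth_mult smooth_inner)
  then have "smooth (\<lambda>x. - 2 * of_nat (Suc k) * complex_of_real (x \<bullet> b) * h x + pd b h x * (1 + complex_of_real (x \<bullet> x)))"
    using h b by (intro smooth_add smooth_mult smooth_const smooth_inner smooth_pd)
  then show "pd b f \<in> {\<lambda>x. h x * jw x ^ Suc k |h k. smooth h}" unfolding *
    by (intro CollectI exI[of _ "\<lambda>x. - 2 * of_nat (Suc k) * complex_of_real (x \<bullet> b) * h x + pd b h x * (1 + complex_of_real (x \<bullet> x))"]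
        exI[of _ "Suc k"] conjI refl)
qed

lemma bdd_inner:
  fixes b :: "'a::euclidean_space"
  assumes "b \<in> Basis"
  shows "bdd N 1 japanese (\<lambda>x. complex_of_real (x \<bullet> b))"
proof (cases N)
  case 0
  then show ?thesis using Basis_le_norm[OF assms] norm_le_japanese
    by (auto simp: bdd_def intro: order_trans)
next
  case (Suc M)
  show ?thesis unfolding Suc
  proof (rule bdd_Suc)
    show "norm (complex_of_real (x \<bullet> b)) \<le> 1 * japanese x" for x
      using order_trans[OF Basis_le_norm[OF assms] norm_le_japanese, of x] by simp
    show "bdd M 1 japanese (pd c (\<lambda>x. complex_of_real (x \<bullet> b)))" if "c \<in> Basis" for c
      unfolding pd_inner bdd_def iter_deriv_const using assms that japanese_ge_1
      by (auto simp: inner_Basis japanese_pos less_imp_le)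
  qed
qed

lemma wcl_inner: "b \<in> Basis \<Longrightarrow> wcl japanese (\<lambda>x. complex_of_real (x \<bullet> b))"
  unfolding wcl_def using bdd_inner smooth_inner by (metis zero_le_one)

text \<open>Induction on the order: the derivative is - 2 (x \<bullet> b) \<open>jw\<close>
  \<open>jw\<close>, and its weight, the bracket to the power 1 - 4, is again below the bracket to
  the power - 2. The same weight therefore survives at every order.\<close>

lemma wcl_jw: "wcl (\<lambda>x. japanese x powr - 2) jw"
  unfolding wcl_def
proof (intro conjI smooth_jw allI)
  fix N show "\<exists>C\<ge>0. bdd N C (\<lambda>x. japanese x powr - 2) (jw :: 'a \<Rightarrow> complex)"
  proof (induction N)
    case 0
    then show ?case by (intro exI[of _ 1]) (auto simp: bdd_def norm_jw)
  next
    case (Suc N)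
    then obtain C where C: "C \<ge> 0" "bdd N C (\<lambda>x. japanese x powr - 2) (jw :: 'a \<Rightarrow> complex)" by blast
    define D where "D = 2 * (2 ^ N * 1 * (2 ^ N * C * C))"
    have D: "D \<ge> 0" using C by (simp add: D_def)
    have "bdd (Suc N) (max 1 D) (\<lambda>x. japanese x powr - 2) (jw :: 'a \<Rightarrow> complex)"
    proof (rule bdd_Suc)
      show "norm (jw x) \<le> max 1 D * japanese x powr - 2" for x :: 'a
        using mult_right_mono[of 1 "max 1 D" "japanese x powr - 2"] by (simp add: norm_jw)
      fix b :: 'a assume b: "b \<in> Basis"
      have "bdd N (norm (-2::complex) * (2 ^ N * 1 * (2 ^ N * C * C))) (\<lambda>x. japanese x * (japanese x powr -2 * japanese x powr -2))
          (\<lambda>x. (-2) * (complex_of_real (x \<bullet> b) * (jw x * jw x)))"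
        using C b japanese_pos less_imp_le
        by (intro bdd_cmult bdd_mult bdd_inner smooth_mult smooth_inner smooth_jw) auto
      then have "bdd N (max 1 D) (\<lambda>x. japanese x powr - 2) (\<lambda>x. (-2) * (complex_of_real (x \<bullet> b) * (jw x * jw x)))"
      proof (rule bdd_mono)
        fix x :: 'a
        have "japanese x * (japanese x powr -2 * japanese x powr -2) = japanese x powr (1 + (-2 + -2))"
          using japanese_pos[of x] by (simp only: powr_add powr_one)
        also have "\<dots> \<le> japanese x powr - 2" by (rule japanese_powr_mono) simp
        finally show "norm (-2::complex) * (2 ^ N * 1 * (2 ^ N * C * C)) * (japanese x * (japanese x powr -2 * japanese x powr -2))
            \<le> max 1 D * japanese x powr - 2"
          using D japanese_pos[of x] by (intro mult_mono) (auto simp: D_def)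
      qed simp
      then show "bdd N (max 1 D) (\<lambda>x. japanese x powr - 2) (pd b jw)"
        unfolding jw_pd(2) by (simp add: mult.assoc)
    qed
    then show ?case by (intro exI[of _ "max 1 D"]) auto
  qed
qed

text \<open>\<open>O\<^sub>M\<close>, the multipliers of the Schwartz space.\<close>

definition om :: "('a::euclidean_space \<Rightarrow> complex) \<Rightarrow> bool" where
  "om f \<longleftrightarrow> smooth f \<and> (\<forall>N. \<exists>C\<ge>0. \<exists>K. bdd N C (\<lambda>x. japanese x powr K) f)"

lemma wcl_om: "wcl (\<lambda>x. japanese x powr K) f \<Longrightarrow> om f"
  unfolding wcl_def om_def by blast

lemma schwartz_iff: "f \<in> schwartz \<longleftrightarrow> (\<forall>s. wcl (\<lambda>x. japanese x powr s) f)"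
proof
  assume f: "f \<in> schwartz"
  show "\<forall>s. wcl (\<lambda>x. japanese x powr s) f"
  proof (intro allI wcl_of_lists)
    fix s :: real and vs :: "'a list" assume vs: "set vs \<subseteq> Basis"
    obtain C where C: "\<And>x. japanese x ^ nat \<lceil>-s\<rceil> * norm (iter_deriv vs f x) \<le> C"
      using f vs unfolding schwartz_def by blast
    have "norm (iter_deriv vs f x) \<le> C * japanese x powr s" for x
    proof -
      have "japanese x powr (-s) \<le> japanese x powr real (nat \<lceil>-s\<rceil>)" by (rule japanese_powr_mono) linarith
      also have "\<dots> = japanese x ^ nat \<lceil>-s\<rceil>" by (rule powr_realpow[OF japanese_pos])
      finally have "japanese x powr (-s) * norm (iter_deriv vs f x) \<le> C"
        by (meson C mult_right_mono norm_ge_zero order_trans)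
      then show ?thesis using japanese_powr_pos[of x s] by (simp add: powr_minus field_simps)
    qed
    then show "\<exists>C. \<forall>x. norm (iter_deriv vs f x) \<le> C * japanese x powr s" by blast
  qed (use f in \<open>auto simp: schwartz_def\<close>)
next
  assume r: "\<forall>s. wcl (\<lambda>x. japanese x powr s) f"
  then have "smooth f" using wcl_smooth by blast
  moreover have "\<exists>C. \<forall>x. japanese x ^ k * norm (iter_deriv vs f x) \<le> C" if vs: "set vs \<subseteq> Basis" for vs k
  proof -
    obtain C where C: "\<And>x. norm (iter_deriv vs f x) \<le> C * japanese x powr (- real k)"
      using r wcl_lists[OF _ vs] by blast
    have "japanese x ^ k * norm (iter_deriv vs f x) \<le> C" for x
      using C[of x] japanese_pos[of x] by (simp add: powr_minus powr_realpow[OF japanese_pos] field_simps)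
    then show ?thesis by blast
  qed
  ultimately show "f \<in> schwartz" unfolding schwartz_def by blast
qed

lemma schwartz_smooth: "f \<in> schwartz \<Longrightarrow> smooth f" by (simp add: schwartz_def)

lemma schwartz_wcl: "f \<in> schwartz \<Longrightarrow> wcl (\<lambda>x. japanese x powr s) f" by (simp add: schwartz_iff)

lemma schwartz_pd: "f \<in> schwartz \<Longrightarrow> b \<in> Basis \<Longrightarrow> pd b f \<in> schwartz"
  by (simp add: schwartz_iff wcl_pd del: iter_deriv.simps)

lemma schwartz_add: "f \<in> schwartz \<Longrightarrow> g \<in> schwartz \<Longrightarrow> (\<lambda>x. f x + g x) \<in> schwartz"
  by (simp add: schwartz_iff wcl_add)

lemma schwartz_cmult: "f \<in> schwartz \<Longrightarrow> (\<lambda>x. c * f x) \<in> schwartz"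
  by (simp add: schwartz_iff wcl_cmult)

lemma schwartz_sum: "(\<And>i. i \<in> I \<Longrightarrow> f i \<in> schwartz) \<Longrightarrow> (\<lambda>x. \<Sum>i\<in>I. f i x) \<in> schwartz"
  by (simp add: schwartz_iff wcl_sum less_imp_le japanese_powr_pos)

lemma schwartz_om:
  assumes "om g" "f \<in> schwartz"
  shows "(\<lambda>x. g x * f x) \<in> schwartz"
  unfolding schwartz_iff wcl_def
proof (intro allI conjI)
  have sm: "smooth g" "smooth f" using assms schwartz_smooth by (auto simp: om_def)
  then show "smooth (\<lambda>x. g x * f x)" by (rule smooth_mult)
  fix s N
  obtain C K where C: "C \<ge> 0" "bdd N C (\<lambda>x. japanese x powr K) g" using assms unfolding om_def by meson
  \<comment> \<open>The decay of f is chosen after the growth K of g, which may depend on the order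
    N.\<close>
  obtain D where D: "D \<ge> 0" "bdd N D (\<lambda>x. japanese x powr (s - K)) f"
    using schwartz_wcl[OF assms(2)] unfolding wcl_def by meson
  have "bdd N (2 ^ N * C * D) (\<lambda>x. japanese x powr K * japanese x powr (s - K)) (\<lambda>x. g x * f x)"
    by (rule bdd_mult) (use sm C D in auto)
  then show "\<exists>C\<ge>0. bdd N C (\<lambda>x. japanese x powr s) (\<lambda>x. g x * f x)"
    using C D by (intro exI[of _ "2 ^ N * C * D"]) (simp add: powr_add[symmetric])
qed

lemma integrable_of_bound:
  fixes f :: "'a::euclidean_space \<Rightarrow> complex"
  assumes "smooth f" "s \<le> - 2 * real DIM('a)" "\<And>x. norm (f x) \<le> C * japanese x powr s"
  shows "integrable lborel f"
  by (rule Bochner_Integration.integrable_bound[OF integrable_mult_right[OF integrable_japanese[OF assms(2)], of C]])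
   (use assms smooth_borel in \<open>auto intro!: AE_I2 order_trans[OF _ abs_ge_self]\<close>)

lemma schwartz_integrable:
  fixes f :: "'a::euclidean_space \<Rightarrow> complex"
  assumes "f \<in> schwartz"
  shows "integrable lborel f"
proof -
  obtain C where "\<And>x. norm (f x) \<le> C * japanese x powr (- 2 * real DIM('a))"
    using wcl_lists[OF schwartz_wcl[OF assms], of "[]" "- 2 * real DIM('a)"] by auto
  then show ?thesis by (rule integrable_of_bound[OF schwartz_smooth[OF assms] order_refl])
qed

lemma integral_translate:
  fixes f :: "'a::euclidean_space \<Rightarrow> complex"
  assumes "f \<in> borel_measurable borel"
  shows "(\<integral>x. f (x + c) \<partial>lborel) = (\<integral>x. f x \<partial>lborel)"
proof -
  have "(\<integral>x. f x \<partial>lborel) = (\<integral>x. f x \<partial>distr lborel borel ((+) c))" by (simp add: lborel_distr_plus)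
  also have "\<dots> = (\<integral>x. f (c + x) \<partial>lborel)" by (rule integral_distr) (use assms in auto)
  finally show ?thesis by (simp add: add.commute)
qed

lemma integrable_translate:
  fixes f :: "'a::euclidean_space \<Rightarrow> complex"
  assumes "integrable lborel f"
  shows "integrable lborel (\<lambda>x. f (x + c))"
proof -
  have "integrable (distr lborel borel ((+) c)) f" using assms by (simp add: lborel_distr_plus)
  then show ?thesis using assms by (subst (asm) integrable_distr_eq) (auto simp: add.commute)
qed

text \<open>The integral of a difference quotient is zero by translation invariance, and dominated
  convergence passes to the derivative. This is integration by parts without boundary terms.\<close>

lemma schwartz_integral_pd:
  fixes f :: "'a::euclidean_space \<Rightarrow> complex"
  assumes f: "f \<in> schwartz" and b: "b \<in> Basis"
  shows "(\<integral>x. pd b f x \<partial>lborel) = 0"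
proof -
  define t :: "nat \<Rightarrow> real" where "t n = 1 / real (Suc n)" for n
  have t: "t n > 0" "t n \<le> 1" for n by (auto simp: t_def)
  have t0: "t \<longlonglongrightarrow> 0" unfolding t_def by (rule LIMSEQ_Suc[OF lim_1_over_n])
  define s where "s = - 2 * real DIM('a)"
  obtain C where C: "C \<ge> 0" "\<And>x. norm (pd b f x) \<le> C * japanese x powr s"
    using wcl_lists[OF schwartz_wcl[OF f], of "[b]" s] b by auto
  define D where "D = C * (2 powr \<bar>s\<bar> * japanese b powr \<bar>s\<bar>)"
  \<comment> \<open>Peetre's inequality bounds the derivative on a whole unit segment by a multiple
    of the weight at its starting point; this gives the dominating function.\<close>
  have near: "norm (pd b f (x + u *\<^sub>R b)) \<le> D * japanese x powr s" if "\<bar>u\<bar> \<le> 1" for x u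
  proof -
    have "japanese (x + u *\<^sub>R b) powr s \<le> 2 powr \<bar>s\<bar> * japanese x powr s * japanese (u *\<^sub>R b) powr \<bar>s\<bar>"
      by (rule peetre)
    also have "\<dots> \<le> 2 powr \<bar>s\<bar> * japanese x powr s * japanese b powr \<bar>s\<bar>"
      using that b by (intro mult_left_mono powr_mono2 japanese_mono) (auto simp: japanese_pos less_imp_le)
    finally show ?thesis
      using C(2)[of "x + u *\<^sub>R b"] C(1) unfolding D_def
      by (auto simp: algebra_simps intro: order_trans mult_left_mono)
  qed
  define q where "q n x = (f (x + t n *\<^sub>R b) - f x) /\<^sub>R t n" for n x
  have int: "integrable lborel f" by (rule schwartz_integrable[OF f])
  have "(\<integral>x. q n x \<partial>lborel) = 0" for n
    unfolding q_def using integrable_translate[OF int] int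
    by (simp add: integral_translate[OF smooth_borel[OF schwartz_smooth[OF f]]])
  moreover have "(\<lambda>n. \<integral>x. q n x \<partial>lborel) \<longlonglongrightarrow> (\<integral>x. pd b f x \<partial>lborel)"
  proof (rule integral_dominated_convergence[where w = "\<lambda>x. D * japanese x powr s"])
    show "integrable lborel (\<lambda>x::'a. D * japanese x powr s)"
      by (intro integrable_mult_right integrable_japanese) (simp only: s_def order_refl)
    show "pd b f \<in> borel_measurable lborel" "\<And>n. q n \<in> borel_measurable lborel"
      using smooth_borel[OF schwartz_smooth[OF schwartz_pd[OF f b]]] int integrable_translate[OF int]
      unfolding q_def by (auto simp del: iter_deriv.simps)
    show "AE x in lborel. (\<lambda>n. q n x) \<longlonglongrightarrow> pd b f x"
    proof (rule AE_I2)
      fix x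
      have "((\<lambda>s. (f (x + s *\<^sub>R b) - f x) /\<^sub>R s) \<longlongrightarrow> pd b f x) (at 0)"
        using smooth_dir_deriv[OF schwartz_smooth[OF f], of b x]
        unfolding has_dir_deriv_iff_tendsto .
      then show "(\<lambda>n. q n x) \<longlonglongrightarrow> pd b f x"
        unfolding q_def tendsto_at_iff_sequentially o_def using t t0 by (auto simp: less_imp_neq[THEN not_sym])
    qed
    show "AE x in lborel. norm (q n x) \<le> D * japanese x powr s" for n
    proof (rule AE_I2)
      fix x
      have "norm (f (x + t n *\<^sub>R b) - f x - t n *\<^sub>R 0) \<le> (D * japanese x powr s) * \<bar>t n\<bar>"
        by (rule has_dir_deriv_mean_value[where D = "pd b f"])
         (use smooth_dir_deriv[OF schwartz_smooth[OF f]] near t[of n] in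
          \<open>auto simp: closed_segment_eq_real_ivl simp del: iter_deriv.simps\<close>)
      then show "norm (q n x) \<le> D * japanese x powr s" using t(1)[of n]
        by (simp add: q_def divide_inverse_commute[symmetric] pos_divide_le_eq)
    qed
  qed
  ultimately show ?thesis by (simp add: LIMSEQ_const_iff)
qed

section \<open>Affine substitutions and Gaussians\<close>

lemma prod_list_abs_le:
  assumes "\<And>b. b \<in> set vs \<Longrightarrow> \<bar>c b\<bar> \<le> R" "1 \<le> R" "length vs \<le> N"
  shows "\<bar>prod_list (map c vs)\<bar> \<le> (R::real) ^ N"
  using assms(1,3)
proof (induction vs arbitrary: N)
  case Nil
  then show ?case using assms(2) by (simp add: one_le_power)
next
  case (Cons b vs)
  then obtain M where N: "N = Suc M" "length vs \<le> M" by (cases N) auto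
  have "\<bar>c b\<bar> * \<bar>prod_list (map c vs)\<bar> \<le> R * R ^ M"
    using Cons N assms(2) by (intro mult_mono) auto
  then show ?case by (simp add: N abs_mult)
qed

lemma bdd_affine:
  fixes T :: "'a::euclidean_space \<Rightarrow> 'c::euclidean_space" and f :: "'c \<Rightarrow> complex"
  assumes T: "bounded_linear T" and f: "smooth f"
    and b: "\<And>b. b \<in> Basis \<Longrightarrow> \<sigma> b \<in> Basis \<and> T b = c b *\<^sub>R \<sigma> b"
    and bd: "bdd N C W f" and c: "\<And>b. b \<in> Basis \<Longrightarrow> \<bar>c b\<bar> \<le> R" "1 \<le> R"
  shows "bdd N (C * R ^ N) (\<lambda>x. W (a + T x)) (\<lambda>x. f (a + T x))"
  unfolding bdd_def
proof (intro allI impI)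
  fix vs :: "'a list" and x assume vs: "set vs \<subseteq> Basis \<and> length vs \<le> N"
  have "norm (iter_deriv (map \<sigma> vs) f (a + T x)) \<le> C * W (a + T x)"
    by (rule bddD[OF bd]) (use vs b in auto)
  moreover have "\<bar>prod_list (map c vs)\<bar> \<le> R ^ N" using vs c by (intro prod_list_abs_le) auto
  ultimately have "\<bar>prod_list (map c vs)\<bar> * norm (iter_deriv (map \<sigma> vs) f (a + T x)) \<le> R ^ N * (C * W (a + T x))"
    using c by (intro mult_mono) auto
  then show "norm (iter_deriv vs (\<lambda>x. f (a + T x)) x) \<le> C * R ^ N * W (a + T x)"
    using smooth_affine(2)[OF T f b, of vs a] vs by (simp add: norm_mult mult_ac)
qed

lemma wcl_affine:
  fixes T :: "'a::euclidean_space \<Rightarrow> 'c::euclidean_space" and f :: "'c \<Rightarrow> complex"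
  assumes T: "bounded_linear T" and f: "wcl W f"
    and b: "\<And>b. b \<in> Basis \<Longrightarrow> \<sigma> b \<in> Basis \<and> T b = c b *\<^sub>R \<sigma> b"
  shows "wcl (\<lambda>x. W (a + T x)) (\<lambda>x. f (a + T x))"
  unfolding wcl_def
proof (intro conjI allI)
  note s = wcl_smooth[OF f]
  show "smooth (\<lambda>x. f (a + T x))" by (rule smooth_affine(1)[OF T s b])
  fix N
  obtain C where C: "C \<ge> 0" "bdd N C W f" using f unfolding wcl_def by blast
  define R where "R = 1 + (\<Sum>b\<in>Basis. \<bar>c b\<bar>)"
  have R: "\<bar>c b\<bar> \<le> R" if "b \<in> Basis" for b
    using member_le_sum[of b Basis "\<lambda>b. \<bar>c b\<bar>"] that by (simp add: R_def)
  have "1 \<le> R" by (simp add: R_def sum_nonneg)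
  then show "\<exists>C\<ge>0. bdd N C (\<lambda>x. W (a + T x)) (\<lambda>x. f (a + T x))"
    using bdd_affine[OF T s b C(2) R] C(1) by (intro exI[of _ "C * R ^ N"]) auto
qed

lemma wconv_affine:
  fixes T :: "'a::euclidean_space \<Rightarrow> 'c::euclidean_space" and f :: "'c \<Rightarrow> complex"
  assumes T: "bounded_linear T" and f: "wconv W F f"
    and b: "\<And>b. b \<in> Basis \<Longrightarrow> \<sigma> b \<in> Basis \<and> T b = c b *\<^sub>R \<sigma> b"
  shows "wconv (\<lambda>x. W (a + T x)) (\<lambda>n x. F n (a + T x)) (\<lambda>x. f (a + T x))"
  unfolding wconv_def
proof (intro conjI allI impI)
  note s = wconv_smooth[OF f]
  show "smooth (\<lambda>x. f (a + T x))" "smooth (\<lambda>x. F n (a + T x))" for n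
    using smooth_affine(1)[OF T _ b] s by blast+
  show "\<exists>C\<ge>0. \<forall>n. bdd N C (\<lambda>x. W (a + T x)) (\<lambda>x. F n (a + T x))" for N
  proof -
    obtain C where C: "C \<ge> 0" "\<And>n. bdd N C W (F n)" using f unfolding wconv_def by blast
    define R where "R = 1 + (\<Sum>b\<in>Basis. \<bar>c b\<bar>)"
    have R: "\<bar>c b\<bar> \<le> R" if "b \<in> Basis" for b
      using member_le_sum[of b Basis "\<lambda>b. \<bar>c b\<bar>"] that by (simp add: R_def)
    have "1 \<le> R" by (simp add: R_def sum_nonneg)
    then show ?thesis
      using bdd_affine[OF T s(1) b C(2) R] C(1) by (intro exI[of _ "C * R ^ N"]) auto
  qed
  fix vs :: "'a list" and x assume vs: "set vs \<subseteq> Basis"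
  then have "set (map \<sigma> vs) \<subseteq> Basis" using b by auto
  from wconv_lim[OF f this, of "a + T x"]
  show "(\<lambda>n. iter_deriv vs (\<lambda>x. F n (a + T x)) x) \<longlonglongrightarrow> iter_deriv vs (\<lambda>x. f (a + T x)) x"
  proof -
    have "iter_deriv vs (\<lambda>x. g (a + T x)) x = complex_of_real (prod_list (map c vs)) * iter_deriv (map \<sigma> vs) g (a + T x)"
      if "smooth g" for g
      using fun_cong[OF smooth_affine(2)[OF T that b vs]] by simp
    then show ?thesis using s by (simp add: tendsto_mult_left \<open>(\<lambda>n. iter_deriv (map \<sigma> vs) (F n) (a + T x)) \<longlonglongrightarrow> iter_deriv (map \<sigma> vs) f (a + T x)\<close>)
  qed
qed

text \<open>The condition on B says that \<open>a + T x\<close> grows at least like x. It excludes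
  projections, along which decay in the lost variables would not survive.\<close>

lemma schwartz_affine:
  fixes T :: "'a::euclidean_space \<Rightarrow> 'c::euclidean_space" and f :: "'c \<Rightarrow> complex"
  assumes T: "bounded_linear T" and f: "f \<in> schwartz"
    and b: "\<And>b. b \<in> Basis \<Longrightarrow> \<sigma> b \<in> Basis \<and> T b = c b *\<^sub>R \<sigma> b"
    and B: "\<And>x. japanese x \<le> B * japanese (a + T x)"
  shows "(\<lambda>x. f (a + T x)) \<in> schwartz"
  unfolding schwartz_iff
proof
  fix s :: real
  have B1: "B > 0" using B[of 0] japanese_pos[of "a + T 0"] japanese_pos[of 0] by (smt (verit) mult_nonpos_nonneg)
  have w: "wcl (\<lambda>x. japanese (a + T x) powr (- \<bar>s\<bar>)) (\<lambda>x. f (a + T x))"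
    by (rule wcl_affine[OF T schwartz_wcl[OF f] b])
  show "wcl (\<lambda>x. japanese x powr s) (\<lambda>x. f (a + T x))"
  proof (rule wcl_mono[OF w])
    fix x
    have "japanese x powr \<bar>s\<bar> \<le> (B * japanese (a + T x)) powr \<bar>s\<bar>"
      using B by (intro powr_mono2) (auto simp: japanese_pos less_imp_le)
    then have "japanese x powr \<bar>s\<bar> \<le> B powr \<bar>s\<bar> * japanese (a + T x) powr \<bar>s\<bar>"
      using B1 japanese_pos[of "a + T x"] by (simp add: powr_mult)
    then have "japanese (a + T x) powr (- \<bar>s\<bar>) \<le> B powr \<bar>s\<bar> * japanese x powr (- \<bar>s\<bar>)"
      using japanese_powr_pos[of x "\<bar>s\<bar>"] japanese_powr_pos[of "a + T x" "\<bar>s\<bar>"]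
      by (simp add: powr_minus field_simps)
    also have "\<dots> \<le> B powr \<bar>s\<bar> * japanese x powr s"
      by (intro mult_left_mono japanese_powr_mono) auto
    finally show "japanese (a + T x) powr (- \<bar>s\<bar>) \<le> B powr \<bar>s\<bar> * japanese x powr s" .
  qed simp
qed

lemma affine_translate:
  fixes a :: "'a::euclidean_space"
  assumes "smooth f" shows "smooth (\<lambda>x. f (a + x))" "set vs \<subseteq> Basis \<Longrightarrow> iter_deriv vs (\<lambda>x. f (a + x) :: complex) = (\<lambda>x. iter_deriv vs f (a + x))"
proof -
  have "prod_list (map (\<lambda>b. 1) vs) = (1::real)" by (induction vs) auto
  then show "smooth (\<lambda>x. f (a + x))" "set vs \<subseteq> Basis \<Longrightarrow> iter_deriv vs (\<lambda>x. f (a + x)) = (\<lambda>x. iter_deriv vs f (a + x))"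
    using smooth_affine[where T = "\<lambda>x. x" and f = f and \<sigma> = "\<lambda>b. b" and c = "\<lambda>b. 1" and a = a] assms
    by (auto simp: bounded_linear_ident)
qed

lemma affine_scale:
  fixes f :: "'a::euclidean_space \<Rightarrow> complex"
  assumes "smooth f" shows "smooth (\<lambda>x. f (a + r *\<^sub>R x))" "set vs \<subseteq> Basis \<Longrightarrow> iter_deriv vs (\<lambda>x. f (a + r *\<^sub>R x)) = (\<lambda>x. complex_of_real (r ^ length vs) * iter_deriv vs f (a + r *\<^sub>R x))"
proof -
  have "prod_list (map (\<lambda>b. r) vs) = r ^ length vs" by (induction vs) auto
  then show "smooth (\<lambda>x. f (a + r *\<^sub>R x))" "set vs \<subseteq> Basis \<Longrightarrow> iter_deriv vs (\<lambda>x. f (a + r *\<^sub>R x)) = (\<lambda>x. complex_of_real (r ^ length vs) * iter_deriv vs f (a + r *\<^sub>R x))"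
    using smooth_affine[where T = "\<lambda>x. r *\<^sub>R x" and f = f and \<sigma> = "\<lambda>b. b" and c = "\<lambda>b. r" and a = a] assms
    by (auto simp: bounded_linear_scaleR_right)
qed

text \<open>\<open>smooth_affine\<close> wants a basis vector as image direction even where the
  image is 0. An arbitrary one is taken there and multiplied by 0.\<close>

definition fst_dir :: "'a::euclidean_space \<times> 'b::euclidean_space \<Rightarrow> 'a" where
  "fst_dir b = (if fst b = 0 then (SOME b. b \<in> Basis) else fst b)"
definition snd_dir :: "'a::euclidean_space \<times> 'b::euclidean_space \<Rightarrow> 'b" where
  "snd_dir b = (if snd b = 0 then (SOME b. b \<in> Basis) else snd b)"

lemma fst_dir: "b \<in> Basis \<Longrightarrow> fst_dir b \<in> Basis \<and> fst b = (if fst b = 0 then 0 else 1) *\<^sub>R fst_dir b"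
  by (auto simp: fst_dir_def Basis_prod_def intro: SOME_Basis)
lemma snd_dir: "b \<in> Basis \<Longrightarrow> snd_dir b \<in> Basis \<and> snd b = (if snd b = 0 then 0 else 1) *\<^sub>R snd_dir b"
  by (auto simp: snd_dir_def Basis_prod_def intro: SOME_Basis)

lemma wcl_fst: "wcl W f \<Longrightarrow> wcl (\<lambda>z. W (fst z)) (\<lambda>z. f (fst z))"
  using wcl_affine[OF bounded_linear_fst _ fst_dir, of W f 0] by simp
lemma wcl_snd: "wcl W f \<Longrightarrow> wcl (\<lambda>z. W (snd z)) (\<lambda>z. f (snd z))"
  using wcl_affine[OF bounded_linear_snd _ snd_dir, of W f 0] by simp
lemma wconv_fst: "wconv W F f \<Longrightarrow> wconv (\<lambda>z. W (fst z)) (\<lambda>n z. F n (fst z)) (\<lambda>z. f (fst z))"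
  using wconv_affine[OF bounded_linear_fst _ fst_dir, of W F f 0] by simp
lemma wconv_snd: "wconv W F f \<Longrightarrow> wconv (\<lambda>z. W (snd z)) (\<lambda>n z. F n (snd z)) (\<lambda>z. f (snd z))"
  using wconv_affine[OF bounded_linear_snd _ snd_dir, of W F f 0] by simp

section \<open>Gaussians and their Fourier transforms\<close>

definition gauss :: "'a::euclidean_space \<Rightarrow> complex" where
  "gauss x = exp (- complex_of_real (x \<bullet> x) / 2)"

lemma pd_gauss: "gauss differentiable (at (x::'a::euclidean_space))" "pd b gauss = (\<lambda>x::'a. - (complex_of_real (x \<bullet> b) * gauss x))"
proof -
  have d: "((\<lambda>x. - complex_of_real (x \<bullet> x) / 2) has_derivative (\<lambda>h. - complex_of_real (x \<bullet> h))) (at x)" for x :: 'a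
    by (auto intro!: derivative_eq_intros simp: inner_commute)
  then have df: "(\<lambda>x. - complex_of_real (x \<bullet> x) / 2) differentiable (at x)" for x :: 'a
    by (auto simp: differentiable_def)
  show "gauss differentiable (at (x::'a))" unfolding gauss_def[abs_def] by (rule pd_exp(1)[OF df])
  show "pd b gauss = (\<lambda>x. - (complex_of_real (x \<bullet> b) * gauss x))"
  proof
    fix x :: 'a
    have "pd b (\<lambda>x. exp (- complex_of_real (x \<bullet> x) / 2)) x =
        pd b (\<lambda>x. - complex_of_real (x \<bullet> x) / 2) x * exp (- complex_of_real (x \<bullet> x) / 2)"
      by (rule pd_exp(2)[OF df])
    also have "pd b (\<lambda>x. - complex_of_real (x \<bullet> x) / 2) x = - complex_of_real (x \<bullet> b)"
      by (simp only: iter_deriv.simps frechet_derivative_eqI[OF d])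
    finally show "pd b gauss x = - (complex_of_real (x \<bullet> b) * gauss x)"
      unfolding gauss_def[abs_def] by (simp only: mult_minus_left)
  qed
qed

lemma inner_self_Basis: "complex_of_real (x \<bullet> x) = (\<Sum>b\<in>Basis. complex_of_real (x \<bullet> b) * complex_of_real (x \<bullet> b))"
  by (subst euclidean_inner) simp

lemma smooth_gauss: "smooth gauss"
proof -
  have "smooth (\<lambda>x::'a. (- 1 / 2) * (\<Sum>b\<in>Basis. complex_of_real (x \<bullet> b) * complex_of_real (x \<bullet> b)))"
    by (intro smooth_mult smooth_const smooth_sum smooth_inner)
  then have "smooth (\<lambda>x::'a. exp ((- 1 / 2) * (\<Sum>b\<in>Basis. complex_of_real (x \<bullet> b) * complex_of_real (x \<bullet> b))))"
    by (rule smooth_exp)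
  then show ?thesis unfolding gauss_def[abs_def] inner_self_Basis by simp
qed

lemma norm_gauss: "norm (gauss x) = exp (- (norm x)\<^sup>2 / 2)"
  by (simp add: gauss_def power2_norm_eq_inner)

text \<open>From (1 + u / m)^m \<le> exp u with u half the squared norm, where m is large enough
  that the power 2 m of the bracket dominates the power - s.\<close>

lemma gauss_bound: "\<exists>C\<ge>0. \<forall>x::'a::euclidean_space. norm (gauss x) \<le> C * japanese x powr s"
proof -
  define m where "m = nat \<lceil>\<bar>s\<bar>\<rceil> + 1"
  have m: "real m \<ge> 1" "- s \<le> 2 * real m" by (auto simp: m_def) linarith
  have "norm (gauss x) \<le> (2 * real m) ^ m * japanese x powr s" for x :: 'a
  proof -
    let ?r = "(norm x)\<^sup>2"
    have "(japanese x ^ 2 / (2 * m)) ^ m \<le> (1 + (?r / 2) / m) ^ m"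
      using m by (intro power_mono) (auto simp: japanese_sq field_simps)
    also have "\<dots> \<le> exp (?r / 2)" using m by (intro exp_ge_one_plus_x_over_n_power_n) (auto intro: order_trans[of _ 0])
    finally have "japanese x ^ (2 * m) \<le> (2 * real m) ^ m * exp (?r / 2)"
      using m by (simp add: power_divide power_mult[symmetric] field_simps)
    moreover have "japanese x powr (- s) \<le> japanese x ^ (2 * m)"
      using japanese_powr_mono[OF m(2), of x] powr_realpow[OF japanese_pos, of x "2 * m"] by simp
    ultimately have "japanese x powr (- s) \<le> (2 * real m) ^ m * exp (?r / 2)" by linarith
    then show ?thesis using japanese_powr_pos[of x s] unfolding norm_gauss
      by (simp add: powr_minus exp_minus field_simps)
  qed
  then show ?thesis by (intro exI[of _ "(2 * real m) ^ m"]) auto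
qed

lemma gauss_schwartz: "gauss \<in> schwartz"
proof -
  \<comment> \<open>The induction runs over all weights at once, since the bound for a derivative
    with exponent s uses the Gaussian with exponent s - 1.\<close>
  have "\<forall>s. \<exists>C\<ge>0. bdd N C (\<lambda>x. japanese x powr s) (gauss :: 'a \<Rightarrow> complex)" for N
  proof (induction N)
    case 0
    then show ?case using gauss_bound by (auto simp: bdd_def)
  next
    case (Suc N)
    show ?case
    proof
      fix s :: real
      obtain C where C: "C \<ge> 0" "\<And>x. norm (gauss (x :: 'a)) \<le> C * japanese x powr s" using gauss_bound by blast
      obtain D where D: "D \<ge> 0" "bdd N D (\<lambda>x. japanese x powr (s - 1)) (gauss :: 'a \<Rightarrow> complex)" using Suc by blast
      have "bdd (Suc N) (max C (2 ^ N * 1 * D)) (\<lambda>x. japanese x powr s) (gauss :: 'a \<Rightarrow> complex)"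
      proof (rule bdd_Suc)
        show "norm (gauss x) \<le> max C (2 ^ N * 1 * D) * japanese x powr s" for x :: 'a
          using C(2)[of x] mult_right_mono[of C "max C (2 ^ N * 1 * D)" "japanese x powr s"] by simp
        fix b :: 'a assume b: "b \<in> Basis"
        have "bdd N (norm (-1 :: complex) * (2 ^ N * 1 * D)) (\<lambda>x. japanese x * japanese x powr (s - 1)) (\<lambda>x::'a. -1 * (complex_of_real (x \<bullet> b) * gauss x))"
          using D b by (intro bdd_cmult bdd_mult smooth_mult smooth_inner smooth_gauss bdd_inner) (auto simp: japanese_pos less_imp_le)
        moreover have "japanese x * japanese x powr (s - 1) = japanese x powr s" for x :: 'a
          using japanese_pos[of x] by (simp add: powr_diff)
        ultimately have "bdd N (2 ^ N * 1 * D) (\<lambda>x. japanese x powr s) (pd b gauss)" by (simp add: pd_gauss(2) del: iter_deriv.simps)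
        then show "bdd N (max C (2 ^ N * 1 * D)) (\<lambda>x. japanese x powr s) (pd b gauss)"
          by (rule bdd_mono_const) auto
      qed
      then show "\<exists>C\<ge>0. bdd (Suc N) C (\<lambda>x. japanese x powr s) (gauss :: 'a \<Rightarrow> complex)"
        using C by (intro exI[of _ "max C (2 ^ N * 1 * D)"]) auto
    qed
  qed
  then show ?thesis unfolding schwartz_iff wcl_def using smooth_gauss by blast
qed

lemma integral_lborel_prod:
  fixes f :: "'a::euclidean_space \<Rightarrow> real \<Rightarrow> complex"
  assumes int: "\<And>b. b \<in> Basis \<Longrightarrow> integrable lborel (f b)"
  shows "(\<integral>x. (\<Prod>b\<in>Basis. f b (x \<bullet> b)) \<partial>lborel) = (\<Prod>b\<in>Basis. (\<integral>t. f b t \<partial>lborel))"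
proof -
  interpret product_sigma_finite "\<lambda>b::'a. lborel :: real measure" ..
  have m: "(\<lambda>x. (\<Prod>b\<in>Basis. f b (x \<bullet> b))) \<in> borel_measurable borel"
  proof (intro borel_measurable_prod)
    fix b :: 'a assume "b \<in> Basis"
    have "f b \<in> borel_measurable borel" using int[OF \<open>b \<in> Basis\<close>] by auto
    then show "(\<lambda>x. f b (x \<bullet> b)) \<in> borel_measurable borel" by (rule measurable_compose[rotated]) auto
  qed
  have "(\<integral>x. (\<Prod>b\<in>Basis. f b (x \<bullet> b)) \<partial>lborel) =
      (\<integral>g. (\<Prod>b\<in>Basis. f b ((\<Sum>c\<in>Basis. g c *\<^sub>R c) \<bullet> b)) \<partial>(\<Pi>\<^sub>M b\<in>Basis. lborel))"
    by (subst lborel_eq, subst integral_distr) (use m in auto)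
  also have "\<dots> = (\<integral>g. (\<Prod>b\<in>Basis. f b (g b)) \<partial>(\<Pi>\<^sub>M b\<in>Basis. lborel))"
    by (intro Bochner_Integration.integral_cong prod.cong refl) (simp add: inner_sum_left inner_Basis if_distrib cong: if_cong)
  also have "\<dots> = (\<Prod>b\<in>Basis. (\<integral>t. f b t \<partial>lborel))"
    by (rule product_integral_prod) (use int in auto)
  finally show ?thesis .
qed

text \<open>Read off from the characteristic function of the standard normal distribution at the
  point - s.\<close>

lemma fourier_std_normal:
  "integrable lborel (\<lambda>t. exp (- \<i> * complex_of_real (s * t)) * complex_of_real (exp (- t\<^sup>2 / 2)))" (is "integrable _ ?f")
  "(\<integral>t. exp (- \<i> * complex_of_real (s * t)) * complex_of_real (exp (- t\<^sup>2 / 2)) \<partial>lborel) = complex_of_real (sqrt (2 * pi) * exp (- s\<^sup>2 / 2))"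
proof -
  have d: "exp (- t\<^sup>2 / 2) = sqrt (2 * pi) * std_normal_density t" for t :: real
    by (simp add: std_normal_density_def)
  show i: "integrable lborel ?f"
  proof (rule Bochner_Integration.integrable_bound)
    show "integrable lborel (\<lambda>t. sqrt (2 * pi) * std_normal_density t)"
      using integrable_std_normal_moment[of 0] by simp
    show "AE t in lborel. norm (?f t) \<le> norm (sqrt (2 * pi) * std_normal_density t)"
      by (auto simp: norm_mult d[symmetric])
  qed (auto simp: power2_eq_square)
  have "complex_of_real (exp (- s\<^sup>2 / 2)) = char std_normal_distribution (- s)"
    by (simp add: char_std_normal_distribution)
  also have "\<dots> = (\<integral>t. std_normal_density t *\<^sub>R exp (\<i> * complex_of_real (- s * t)) \<partial>lborel)"
    unfolding char_def by (subst integral_density) auto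
  also have "complex_of_real (sqrt (2 * pi)) * \<dots> = (\<integral>t. ?f t \<partial>lborel)"
    by (subst Bochner_Integration.integral_mult_right_zero[symmetric])
      (intro Bochner_Integration.integral_cong refl, simp only: d of_real_mult scaleR_conv_of_real, simp add: mult_ac)
  finally show "(\<integral>t. ?f t \<partial>lborel) = complex_of_real (sqrt (2 * pi) * exp (- s\<^sup>2 / 2))" by simp
qed

lemma fourier_gauss:
  "(\<integral>x. exp (- \<i> * complex_of_real (x \<bullet> y)) * gauss x \<partial>lborel) = complex_of_real (sqrt (2 * pi) ^ DIM('a)) * gauss (y::'a::euclidean_space)"
proof -
  have "exp (- \<i> * complex_of_real (x \<bullet> y)) * gauss x =
      (\<Prod>b\<in>Basis. exp (- \<i> * complex_of_real ((y \<bullet> b) * (x \<bullet> b))) * complex_of_real (exp (- (x \<bullet> b)\<^sup>2 / 2)))" for x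
  proof -
    have "exp (- \<i> * complex_of_real (x \<bullet> y)) = (\<Prod>b\<in>Basis. exp (- \<i> * complex_of_real ((y \<bullet> b) * (x \<bullet> b))))"
      by (subst euclidean_inner) (simp add: exp_sum[symmetric] sum_distrib_left sum_negf mult_ac)
    moreover have "gauss x = (\<Prod>b\<in>Basis. complex_of_real (exp (- (x \<bullet> b)\<^sup>2 / 2)))"
      unfolding gauss_def inner_self_Basis
      by (simp add: exp_sum[symmetric] exp_of_real[symmetric] power2_eq_square sum_negf sum_divide_distrib)
    ultimately show ?thesis by (simp add: prod.distrib)
  qed
  then have "(\<integral>x. exp (- \<i> * complex_of_real (x \<bullet> y)) * gauss x \<partial>lborel) =
      (\<Prod>b\<in>Basis. complex_of_real (sqrt (2 * pi) * exp (- (y \<bullet> b)\<^sup>2 / 2)))"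
    using integral_lborel_prod[of "\<lambda>b t. exp (- \<i> * complex_of_real ((y \<bullet> b) * t)) * complex_of_real (exp (- t\<^sup>2 / 2))"]
    using fourier_std_normal(1) fourier_std_normal(2) by (simp only:)
  also have "\<dots> = complex_of_real (sqrt (2 * pi) ^ DIM('a)) * gauss y"
    unfolding gauss_def inner_self_Basis
    by (simp add: exp_sum[symmetric] exp_of_real[symmetric] prod.distrib power2_eq_square sum_negf sum_divide_distrib)
  finally show ?thesis .
qed

section \<open>Oscillatory integrals\<close>

text \<open>The pair is z = (\<eta>, y): \<open>fst\<close> is the frequency and \<open>snd\<close>
  the position.\<close>

definition osc_exp :: "'a::euclidean_space \<times> 'a \<Rightarrow> complex" where
  "osc_exp z = exp (- \<i> * complex_of_real (snd z \<bullet> fst z))"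

lemma norm_osc_exp: "norm (osc_exp z) = 1"
  by (simp add: osc_exp_def)

lemma smooth_osc_exp: "smooth (osc_exp :: 'a::euclidean_space \<times> 'a \<Rightarrow> complex)"
proof -
  have "smooth (\<lambda>z::'a \<times> 'a. (- \<i>) * (\<Sum>b\<in>Basis. complex_of_real (z \<bullet> (0, b)) * complex_of_real (z \<bullet> (b, 0))))"
    by (intro smooth_mult smooth_const smooth_sum smooth_inner)
  then have "smooth (\<lambda>z::'a \<times> 'a. exp ((- \<i>) * (\<Sum>b\<in>Basis. complex_of_real (z \<bullet> (0, b)) * complex_of_real (z \<bullet> (b, 0)))))"
    by (rule smooth_exp)
  moreover have "osc_exp z = exp ((- \<i>) * (\<Sum>b\<in>Basis. complex_of_real (z \<bullet> (0, b)) * complex_of_real (z \<bullet> (b, 0))))" for z :: "'a \<times> 'a"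
    unfolding osc_exp_def by (subst euclidean_inner) (simp add: inner_prod_def)
  ultimately show ?thesis by presburger
qed

text \<open>The phase is bilinear, so differentiation along an \<eta>-axis brings down the matching
  y-coordinate and conversely; hence the swap.\<close>

lemma pd_osc_exp: "pd c osc_exp = (\<lambda>z::'a::euclidean_space \<times> 'a. - \<i> * complex_of_real (z \<bullet> prod.swap c) * osc_exp z)"
proof
  fix z :: "'a \<times> 'a"
  have d: "((\<lambda>z::'a \<times> 'a. - \<i> * complex_of_real (snd z \<bullet> fst z)) has_derivative
      (\<lambda>h. - \<i> * complex_of_real (snd z \<bullet> fst h + snd h \<bullet> fst z))) (at z)"
    by (auto intro!: derivative_eq_intros)
  have "pd c (\<lambda>z::'a \<times> 'a. exp (- \<i> * complex_of_real (snd z \<bullet> fst z))) z =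
      - \<i> * complex_of_real (snd z \<bullet> fst c + snd c \<bullet> fst z) * exp (- \<i> * complex_of_real (snd z \<bullet> fst z))"
    using d by (subst pd_exp(2)) (auto simp only: differentiable_def iter_deriv.simps frechet_derivative_eqI[OF d])
  then show "pd c osc_exp z = - \<i> * complex_of_real (z \<bullet> prod.swap c) * osc_exp z"
    unfolding osc_exp_def[abs_def] by (simp add: inner_prod_def inner_commute add.commute del: iter_deriv.simps)
qed

lemma swap_Basis: "c \<in> Basis \<Longrightarrow> prod.swap c \<in> (Basis :: ('a::euclidean_space \<times> 'a) set)"
  by (auto simp: Basis_prod_def)

text \<open>Every derivative brings down one more coordinate, so the growth exponent increases with
  the order. This is why multipliers are described by \<open>om\<close> and not by a class with one
  fixed weight.\<close>

lemma om_osc_exp: "om (osc_exp :: 'a::euclidean_space \<times> 'a \<Rightarrow> complex)"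
proof -
  have "\<exists>C\<ge>0. bdd N C (\<lambda>x. japanese x powr real N) (osc_exp :: 'a \<times> 'a \<Rightarrow> complex)" for N
  proof (induction N)
    case 0
    have "japanese x \<noteq> 0" for x :: "'a \<times> 'a" using japanese_pos[of x] by simp
    then show ?case by (intro exI[of _ 1]) (auto simp: bdd_def norm_osc_exp)
  next
    case (Suc N)
    then obtain C where C: "C \<ge> 0" "bdd N C (\<lambda>x. japanese x powr real N) (osc_exp :: 'a \<times> 'a \<Rightarrow> complex)" by blast
    have "bdd (Suc N) (max 1 (2 ^ N * 1 * C)) (\<lambda>x. japanese x powr real (Suc N)) (osc_exp :: 'a \<times> 'a \<Rightarrow> complex)"
    proof (rule bdd_Suc)
      fix z :: "'a \<times> 'a"
      have "1 * 1 \<le> max 1 (2 ^ N * 1 * C) * japanese z powr real (Suc N)"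
        by (intro mult_mono ge_one_powr_ge_zero japanese_ge_1) auto
      then show "norm (osc_exp z) \<le> max 1 (2 ^ N * 1 * C) * japanese z powr real (Suc N)" by (simp add: norm_osc_exp)
    next
      fix c :: "'a \<times> 'a" assume c: "c \<in> Basis"
      have "bdd N (norm (-\<i>) * (2 ^ N * 1 * C)) (\<lambda>x. japanese x * japanese x powr real N) (\<lambda>z::'a \<times> 'a. - \<i> * (complex_of_real (z \<bullet> prod.swap c) * osc_exp z))"
        using C swap_Basis[OF c] by (intro bdd_cmult bdd_mult smooth_mult smooth_inner smooth_osc_exp bdd_inner) (auto simp: japanese_pos less_imp_le)
      moreover have "japanese x * japanese x powr real N = japanese x powr real (Suc N)" for x :: "'a \<times> 'a"
        using japanese_pos[of x] by (simp add: powr_add)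
      ultimately have "bdd N (2 ^ N * 1 * C) (\<lambda>x. japanese x powr real (Suc N)) (pd c osc_exp)"
        unfolding pd_osc_exp by (simp add: mult.assoc)
      then show "bdd N (max 1 (2 ^ N * 1 * C)) (\<lambda>x. japanese x powr real (Suc N)) (pd c osc_exp)"
        by (rule bdd_mono_const) auto
    qed
    then show ?case by (intro exI[of _ "max 1 (2 ^ N * 1 * C)"]) auto
  qed
  then show ?thesis unfolding om_def using smooth_osc_exp by blast
qed

lemma om_inner: "b \<in> Basis \<Longrightarrow> om (\<lambda>x. complex_of_real (x \<bullet> b))"
  by (rule wcl_om[of 1]) (use wcl_inner[of b] in \<open>simp add: japanese_pos less_imp_le\<close>)

lemma osc_exp_ibp:
  assumes a: "a \<in> schwartz" and c: "c \<in> (Basis :: ('a::euclidean_space \<times> 'a) set)"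
  shows "(\<integral>z. osc_exp z * pd c a z \<partial>lborel) = \<i> * (\<integral>z. osc_exp z * (complex_of_real (z \<bullet> prod.swap c) * a z) \<partial>lborel)"
proof -
  have "pd c (\<lambda>z. osc_exp z * a z) = (\<lambda>z. osc_exp z * pd c a z + pd c osc_exp z * a z)"
    by (intro pd_mult smooth_differentiable smooth_osc_exp schwartz_smooth a)
  then have "0 = (\<integral>z. osc_exp z * pd c a z + (- \<i>) * (osc_exp z * (complex_of_real (z \<bullet> prod.swap c) * a z)) \<partial>lborel)"
    using schwartz_integral_pd[OF schwartz_om[OF om_osc_exp a] c]
    by (simp add: pd_osc_exp mult_ac del: iter_deriv.simps)
  also have "\<dots> = (\<integral>z. osc_exp z * pd c a z \<partial>lborel) + (- \<i>) * (\<integral>z. osc_exp z * (complex_of_real (z \<bullet> prod.swap c) * a z) \<partial>lborel)"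
    by (subst Bochner_Integration.integral_add)
      (intro integrable_mult_right schwartz_integrable schwartz_om om_osc_exp schwartz_pd a c om_inner swap_Basis
        Bochner_Integration.integral_mult_right_zero refl arg_cong2[where f = "(+)"])+
  finally show ?thesis by (simp add: algebra_simps)
qed

text \<open>Since \<open>(1 - \<Delta>\<^sub>\<eta>) e\<^bsup>-iy\<eta>\<^esup> = \<langle>y\<rangle>\<^sup>2 e\<^bsup>-iy\<eta>\<^esup>\<close>, the operator \<open>a \<mapsto> \<langle>y\<rangle>\<^bsup>-2\<^esup> (1 - \<Delta>\<^sub>\<eta>) a\<close> does not change the
  oscillatory integral of \<open>a\<close> but gains decay in \<open>y\<close>; likewise with \<open>\<eta>\<close> and \<open>y\<close> exchanged. These
  two operators are \<open>A1\<close> and \<open>A2\<close> below.\<close>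

definition Lop :: "'a::euclidean_space set \<Rightarrow> ('a \<Rightarrow> complex) \<Rightarrow> 'a \<Rightarrow> complex" where
  "Lop S a z = a z - (\<Sum>c\<in>S. pd c (pd c a) z)"

definition Aop :: "'a::euclidean_space set \<Rightarrow> ('a \<Rightarrow> complex) \<Rightarrow> ('a \<Rightarrow> complex) \<Rightarrow> 'a \<Rightarrow> complex" where
  "Aop S u a z = u z * Lop S a z"

lemma schwartz_diff: "f \<in> schwartz \<Longrightarrow> g \<in> schwartz \<Longrightarrow> (\<lambda>x. f x - g x) \<in> schwartz"
  by (simp add: schwartz_iff wcl_diff)

lemma schwartz_Lop: "S \<subseteq> Basis \<Longrightarrow> a \<in> schwartz \<Longrightarrow> Lop S a \<in> schwartz"
  unfolding Lop_def[abs_def] by (intro schwartz_diff schwartz_sum schwartz_pd) auto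

lemma schwartz_Aop: "S \<subseteq> Basis \<Longrightarrow> om u \<Longrightarrow> a \<in> schwartz \<Longrightarrow> Aop S u a \<in> schwartz"
  unfolding Aop_def[abs_def] by (intro schwartz_om schwartz_Lop)

lemma smooth_Lop: "S \<subseteq> Basis \<Longrightarrow> smooth a \<Longrightarrow> smooth (Lop S a)"
  unfolding Lop_def[abs_def] by (intro smooth_diff smooth_sum smooth_pd) auto

lemma wconv_cmult: "wconv W F f \<Longrightarrow> (\<And>x. 0 \<le> W x) \<Longrightarrow> wconv W (\<lambda>n x. c * F n x) (\<lambda>x. c * f x)"
proof -
  assume w: "wconv W F f" and W: "\<And>x. 0 \<le> W x"
  have "wcl (\<lambda>_. 1) (\<lambda>_. c)"
    by (rule wcl_of_lists) (auto simp: smooth_const iter_deriv_const)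
  from wconv_mult[OF wconv_const[OF this] w _ W] show ?thesis by simp
qed

lemma wconv_sum: "finite I \<Longrightarrow> (\<And>x. 0 \<le> W x) \<Longrightarrow> (\<And>i. i \<in> I \<Longrightarrow> wconv W (F i) (f i)) \<Longrightarrow>
    wconv W (\<lambda>n x. \<Sum>i\<in>I. F i n x) (\<lambda>x. \<Sum>i\<in>I. f i x)"
  by (induction I rule: finite_induct) (auto intro!: wconv_add wconv_const wcl_zero)

lemma wconv_diff: "wconv W F f \<Longrightarrow> wconv W G g \<Longrightarrow> (\<And>x. 0 \<le> W x) \<Longrightarrow> wconv W (\<lambda>n x. F n x - G n x) (\<lambda>x. f x - g x)"
  using wconv_add[OF _ wconv_cmult, of W F f G g "-1"] by simp

lemma wconv_Lop: "S \<subseteq> Basis \<Longrightarrow> (\<And>x. 0 \<le> W x) \<Longrightarrow> wconv W F a \<Longrightarrow> wconv W (\<lambda>n. Lop S (F n)) (Lop S a)"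
  unfolding Lop_def[abs_def] by (intro wconv_diff wconv_sum wconv_pd) (auto intro: finite_subset)

lemma Lop_bound:
  assumes "S \<subseteq> Basis" "smooth a" "bdd (N + 2) C W a"
  shows "bdd N ((1 + real (card S)) * C) W (Lop S a)"
  unfolding bdd_def
proof (intro allI impI)
  fix vs :: "'a list" and x assume vs: "set vs \<subseteq> Basis \<and> length vs \<le> N"
  have e: "iter_deriv vs (Lop S a) x = iter_deriv vs a x - (\<Sum>c\<in>S. iter_deriv (vs @ [c, c]) a x)"
  proof -
    have s: "smooth (\<lambda>z. pd c (pd c a) z)" if "c \<in> S" for c using assms that by (intro smooth_pd) auto
    have "iter_deriv vs (\<lambda>z. a z - (\<Sum>c\<in>S. pd c (pd c a) z)) x
        = iter_deriv vs a x - iter_deriv vs (\<lambda>z. \<Sum>c\<in>S. pd c (pd c a) z) x"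
      using assms(2) smooth_sum[OF s] vs by (subst iter_deriv_diff) auto
    also have "iter_deriv vs (\<lambda>z. \<Sum>c\<in>S. pd c (pd c a) z) x = (\<Sum>c\<in>S. iter_deriv vs (pd c (pd c a)) x)"
      using s vs by (subst iter_deriv_sum) auto
    finally show ?thesis unfolding Lop_def[abs_def] iter_deriv_append by simp
  qed
  have "norm (iter_deriv vs (Lop S a) x) \<le> norm (iter_deriv vs a x) + (\<Sum>c\<in>S. norm (iter_deriv (vs @ [c, c]) a x))"
    unfolding e by (intro norm_triangle_le_diff add_left_mono norm_sum)
  also have "\<dots> \<le> C * W x + (\<Sum>c\<in>S. C * W x)"
    using assms(1) vs by (intro add_mono sum_mono bddD[OF assms(3)]) auto
  finally show "norm (iter_deriv vs (Lop S a) x) \<le> (1 + real (card S)) * C * W x" by (simp add: algebra_simps)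
qed

lemma Lop_integral:
  assumes v: "v \<in> schwartz" and S: "S \<subseteq> (Basis :: ('a::euclidean_space \<times> 'a) set)"
  shows "(\<integral>z. osc_exp z * Lop S v z \<partial>lborel) =
    (\<integral>z. osc_exp z * ((1 + (\<Sum>c\<in>S. (complex_of_real (z \<bullet> prod.swap c))\<^sup>2)) * v z) \<partial>lborel)"
proof -
  have i: "integrable lborel (\<lambda>z. osc_exp z * f z)" if "f \<in> schwartz" for f :: "'a \<times> 'a \<Rightarrow> complex"
    by (rule schwartz_integrable[OF schwartz_om[OF om_osc_exp that]])
  have s1: "pd c (pd c v) \<in> schwartz" if "c \<in> S" for c using v S that schwartz_pd by blast
  have s2: "(\<lambda>z. (complex_of_real (z \<bullet> prod.swap c))\<^sup>2 * v z) \<in> schwartz" if "c \<in> S" for c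
  proof -
    have "prod.swap c \<in> Basis" using that S swap_Basis by blast
    from schwartz_om[OF om_inner[OF this] schwartz_om[OF om_inner[OF this] v]]
    show ?thesis by (simp add: power2_eq_square mult.assoc)
  qed
  have c: "(\<integral>z. osc_exp z * pd c (pd c v) z \<partial>lborel) = - (\<integral>z. osc_exp z * ((complex_of_real (z \<bullet> prod.swap c))\<^sup>2 * v z) \<partial>lborel)"
    if "c \<in> S" for c
  proof -
    have cB: "c \<in> Basis" "prod.swap c \<in> Basis" using S that swap_Basis by blast+
    \<comment> \<open>The coordinate brought down by the first integration by parts belongs to the
      other variable. It is constant along c, so the second integration by parts produces its square
      and no further term.\<close>
    have "c \<bullet> prod.swap c = 0" using cB(1) by (auto simp: Basis_prod_def inner_prod_def)
    then have "pd c (\<lambda>z. complex_of_real (z \<bullet> prod.swap c) * v z) = (\<lambda>z. complex_of_real (z \<bullet> prod.swap c) * pd c v z)"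
      by (subst pd_mult) (auto simp: pd_inner smooth_differentiable smooth_inner schwartz_smooth v simp del: iter_deriv.simps)
    then have "(\<integral>z. osc_exp z * (complex_of_real (z \<bullet> prod.swap c) * pd c v z) \<partial>lborel) =
        \<i> * (\<integral>z. osc_exp z * (complex_of_real (z \<bullet> prod.swap c) * (complex_of_real (z \<bullet> prod.swap c) * v z)) \<partial>lborel)"
      using osc_exp_ibp[OF schwartz_om[OF om_inner[OF cB(2)] v] cB(1)] by (simp del: iter_deriv.simps)
    then show ?thesis
      using osc_exp_ibp[OF schwartz_pd[OF v cB(1)] cB(1)] by (simp add: power2_eq_square mult_ac del: iter_deriv.simps)
  qed
  have "(\<integral>z. osc_exp z * Lop S v z \<partial>lborel) = (\<integral>z. osc_exp z * v z - (\<Sum>c\<in>S. osc_exp z * pd c (pd c v) z) \<partial>lborel)"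
    unfolding Lop_def by (simp add: right_diff_distrib sum_distrib_left)
  also have "\<dots> = (\<integral>z. osc_exp z * v z \<partial>lborel) - (\<Sum>c\<in>S. (\<integral>z. osc_exp z * pd c (pd c v) z \<partial>lborel))"
    using i s1 v by (subst Bochner_Integration.integral_diff) (auto intro!: Bochner_Integration.integral_sum simp del: iter_deriv.simps)
  also have "\<dots> = (\<integral>z. osc_exp z * v z \<partial>lborel) + (\<Sum>c\<in>S. (\<integral>z. osc_exp z * ((complex_of_real (z \<bullet> prod.swap c))\<^sup>2 * v z) \<partial>lborel))"
    using c by (simp add: sum_negf)
  also have "\<dots> = (\<integral>z. osc_exp z * v z + (\<Sum>c\<in>S. osc_exp z * ((complex_of_real (z \<bullet> prod.swap c))\<^sup>2 * v z)) \<partial>lborel)"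
    using i s2 v by (subst Bochner_Integration.integral_add) (auto intro!: Bochner_Integration.integral_sum[symmetric])
  finally show ?thesis by (simp add: distrib_left distrib_right sum_distrib_left sum_distrib_right)
qed

text \<open>The factor u is constant along the directions in S and commutes with
  \<open>Lop S\<close>. Moving \<open>Lop S\<close> to the phase then produces the polynomial that u
  inverts.\<close>

lemma Aop_integral:
  assumes a: "a \<in> schwartz" and S: "S \<subseteq> (Basis :: ('a::euclidean_space \<times> 'a) set)"
    and u: "om u" "\<And>c. c \<in> S \<Longrightarrow> pd c u = (\<lambda>z. 0)"
    and w: "\<And>z. (1 + (\<Sum>c\<in>S. (complex_of_real (z \<bullet> prod.swap c))\<^sup>2)) * u z = 1"
  shows "(\<integral>z. osc_exp z * Aop S u a z \<partial>lborel) = (\<integral>z. osc_exp z * a z \<partial>lborel)"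
proof -
  have su: "smooth u" using u by (simp add: om_def)
  have p: "pd c (\<lambda>z. u z * f z) = (\<lambda>z. u z * pd c f z)" if "c \<in> S" "smooth f" for c and f
    using that u(2)[OF that(1)] by (subst pd_mult) (auto simp: smooth_differentiable su simp del: iter_deriv.simps)
  have "pd c (pd c (\<lambda>z. u z * a z)) = (\<lambda>z. u z * pd c (pd c a) z)" if "c \<in> S" for c
    using p[OF that schwartz_smooth[OF a]] p[OF that smooth_pd[OF schwartz_smooth[OF a]], of c] S that
    by (auto simp del: iter_deriv.simps)
  then have "Aop S u a = Lop S (\<lambda>z. u z * a z)"
    unfolding Aop_def[abs_def] Lop_def[abs_def]
    by (simp add: right_diff_distrib sum_distrib_left cong: sum.cong del: iter_deriv.simps)
  then show ?thesis
    using Lop_integral[OF schwartz_om[OF u(1) a] S] w by (simp add: mult.assoc[symmetric])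
qed

definition fst_Basis :: "('a::euclidean_space \<times> 'b::euclidean_space) set" where "fst_Basis = (\<lambda>b. (b, 0)) ` Basis"
definition snd_Basis :: "('a::euclidean_space \<times> 'b::euclidean_space) set" where "snd_Basis = (\<lambda>b. (0, b)) ` Basis"

abbreviation "A1 \<equiv> Aop fst_Basis (\<lambda>z. jw (snd z))"
abbreviation "A2 \<equiv> Aop snd_Basis (\<lambda>z. jw (fst z))"

lemma fst_snd_Basis: "fst_Basis \<subseteq> Basis" "snd_Basis \<subseteq> Basis"
  by (auto simp: fst_Basis_def snd_Basis_def Basis_prod_def)

text \<open>The exponents of the two variables are kept apart because \<open>A2\<close> lowers the
  first and \<open>A1\<close> the second by 2, each without affecting the other.\<close>

definition WW :: "real \<Rightarrow> real \<Rightarrow> ('a::euclidean_space \<times> 'b::euclidean_space) \<Rightarrow> real" where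
  "WW s t z = japanese (fst z) powr s * japanese (snd z) powr t"

lemma WW_nonneg: "0 \<le> WW s t z" by (simp add: WW_def)

lemma WW_mult: "WW s t z * WW s' t' z = WW (s + s') (t + t') z"
  using japanese_pos[of "fst z"] japanese_pos[of "snd z"] by (simp add: WW_def powr_add)

lemma wcl_jw_fst: "wcl (WW (-2) 0) (\<lambda>z. jw (fst z))"
  using wcl_fst[OF wcl_jw] by (simp add: WW_def[abs_def] japanese_pos less_imp_neq[THEN not_sym])
lemma wcl_jw_snd: "wcl (WW 0 (-2)) (\<lambda>z. jw (snd z))"
  using wcl_snd[OF wcl_jw] by (simp add: WW_def[abs_def] japanese_pos less_imp_neq[THEN not_sym])

lemma wconv_A1: "wconv (WW s t) F a \<Longrightarrow> wconv (WW s (t - 2)) (\<lambda>n. A1 (F n)) (A1 a)"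
proof -
  assume "wconv (WW s t) F a"
  then have "wconv (\<lambda>z. WW 0 (-2) z * WW s t z) (\<lambda>n z. jw (snd z) * Lop fst_Basis (F n) z) (\<lambda>z. jw (snd z) * Lop fst_Basis a z)"
    by (intro wconv_mult wconv_const[OF wcl_jw_snd] wconv_Lop fst_snd_Basis WW_nonneg)
  then show ?thesis by (simp add: WW_mult Aop_def[abs_def])
qed

lemma wconv_A2: "wconv (WW s t) F a \<Longrightarrow> wconv (WW (s - 2) t) (\<lambda>n. A2 (F n)) (A2 a)"
proof -
  assume "wconv (WW s t) F a"
  then have "wconv (\<lambda>z. WW (-2) 0 z * WW s t z) (\<lambda>n z. jw (fst z) * Lop snd_Basis (F n) z) (\<lambda>z. jw (fst z) * Lop snd_Basis a z)"
    by (intro wconv_mult wconv_const[OF wcl_jw_fst] wconv_Lop fst_snd_Basis WW_nonneg)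
  then show ?thesis by (simp add: WW_mult Aop_def[abs_def])
qed

lemma wconv_A1_pow: "wconv (WW s t) F a \<Longrightarrow> wconv (WW s (t - 2 * real l)) (\<lambda>n. (A1 ^^ l) (F n)) ((A1 ^^ l) a)"
proof (induction l)
  case (Suc l)
  from wconv_A1[OF Suc.IH[OF Suc.prems]] show ?case by (simp add: algebra_simps)
qed simp

lemma wconv_A2_pow: "wconv (WW s t) F a \<Longrightarrow> wconv (WW (s - 2 * real l) t) (\<lambda>n. (A2 ^^ l) (F n)) ((A2 ^^ l) a)"
proof (induction l)
  case (Suc l)
  from wconv_A2[OF Suc.IH[OF Suc.prems]] show ?case by (simp add: algebra_simps)
qed simp

lemma WW_le: "WW s t z \<le> japanese z powr (\<bar>s\<bar> + \<bar>t\<bar>)"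
proof -
  have "japanese (fst z) powr s \<le> japanese (fst z) powr \<bar>s\<bar>" "japanese (snd z) powr t \<le> japanese (snd z) powr \<bar>t\<bar>"
    by (auto intro: japanese_powr_mono)
  moreover have "japanese (fst z) powr \<bar>s\<bar> \<le> japanese z powr \<bar>s\<bar>" "japanese (snd z) powr \<bar>t\<bar> \<le> japanese z powr \<bar>t\<bar>"
    using norm_fst_le[of "fst z" "snd z"] norm_snd_le[of "snd z" "fst z"]
    by (auto intro!: powr_mono2 japanese_mono simp: japanese_pos less_imp_le)
  ultimately have "WW s t z \<le> japanese z powr \<bar>s\<bar> * japanese z powr \<bar>t\<bar>"
    unfolding WW_def by (intro mult_mono) auto
  then show ?thesis by (simp add: powr_add)
qed

lemma wcl_WW_om: "wcl (WW s t) a \<Longrightarrow> om a"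
  using wcl_om[OF wcl_mono[where D = 1, of "WW s t" a "\<lambda>x. japanese x powr (\<bar>s\<bar> + \<bar>t\<bar>)"]] WW_le[of s t] by auto

lemma A1_integral:
  assumes a: "a \<in> schwartz" shows "(\<integral>z. osc_exp z * A1 a z \<partial>lborel) = (\<integral>z. osc_exp z * a z \<partial>lborel)"
proof (rule Aop_integral[OF a fst_snd_Basis(1) wcl_WW_om[OF wcl_jw_snd]])
  fix c :: "'a \<times> 'a" assume "c \<in> fst_Basis"
  then have "snd c = 0" by (auto simp: fst_Basis_def)
  have "((\<lambda>z::'a \<times> 'a. jw (snd z)) has_derivative (\<lambda>h. frechet_derivative jw (at (snd z)) (snd h))) (at z)" for z
    by (rule has_derivative_compose[OF has_derivative_snd[OF has_derivative_ident]])
       (use jw_pd(1) frechet_derivative_works in blast)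
  note d = frechet_derivative_eqI[OF this]
  have "linear (frechet_derivative jw (at (snd z)))" for z :: "'a \<times> 'a"
    using linear_frechet_derivative jw_pd(1) by blast
  then show "pd c (\<lambda>z. jw (snd z)) = (\<lambda>z. 0)" using \<open>snd c = 0\<close> by (simp add: d linear_0)
next
  fix z :: "'a \<times> 'a"
  have "(\<Sum>c\<in>fst_Basis. (complex_of_real (z \<bullet> prod.swap c))\<^sup>2) = complex_of_real (snd z \<bullet> snd z)"
    unfolding fst_Basis_def inner_self_Basis
    by (subst sum.reindex) (auto simp: inj_on_def inner_prod_def power2_eq_square)
  then show "(1 + (\<Sum>c\<in>fst_Basis. (complex_of_real (z \<bullet> prod.swap c))\<^sup>2)) * jw (snd z) = 1"
    using jw_nz[of "snd z"] by (simp add: jw_def)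
qed

lemma A2_integral:
  assumes a: "a \<in> schwartz" shows "(\<integral>z. osc_exp z * A2 a z \<partial>lborel) = (\<integral>z. osc_exp z * a z \<partial>lborel)"
proof (rule Aop_integral[OF a fst_snd_Basis(2) wcl_WW_om[OF wcl_jw_fst]])
  fix c :: "'a \<times> 'a" assume "c \<in> snd_Basis"
  then have "fst c = 0" by (auto simp: snd_Basis_def)
  have "((\<lambda>z::'a \<times> 'a. jw (fst z)) has_derivative (\<lambda>h. frechet_derivative jw (at (fst z)) (fst h))) (at z)" for z
    by (rule has_derivative_compose[OF has_derivative_fst[OF has_derivative_ident]])
       (use jw_pd(1) frechet_derivative_works in blast)
  note d = frechet_derivative_eqI[OF this]
  have "linear (frechet_derivative jw (at (fst z)))" for z :: "'a \<times> 'a"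
    using linear_frechet_derivative jw_pd(1) by blast
  then show "pd c (\<lambda>z. jw (fst z)) = (\<lambda>z. 0)" using \<open>fst c = 0\<close> by (simp add: d linear_0)
next
  fix z :: "'a \<times> 'a"
  have "(\<Sum>c\<in>snd_Basis. (complex_of_real (z \<bullet> prod.swap c))\<^sup>2) = complex_of_real (fst z \<bullet> fst z)"
    unfolding snd_Basis_def inner_self_Basis
    by (subst sum.reindex) (auto simp: inj_on_def inner_prod_def power2_eq_square)
  then show "(1 + (\<Sum>c\<in>snd_Basis. (complex_of_real (z \<bullet> prod.swap c))\<^sup>2)) * jw (fst z) = 1"
    using jw_nz[of "fst z"] by (simp add: jw_def)
qed

definition osc_fac :: "'a::euclidean_space itself \<Rightarrow> complex" where
  "osc_fac _ = complex_of_real (1 / (2 * pi) ^ DIM('a))"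

text \<open>The absolutely convergent form of the oscillatory integral of an amplitude of order \<open>K\<close>, valid
  as soon as \<open>K - 2 k\<close> is at most minus twice the dimension.\<close>

definition oscJ :: "nat \<Rightarrow> ('a::euclidean_space \<times> 'a \<Rightarrow> complex) \<Rightarrow> complex" where
  "oscJ k a = osc_fac TYPE('a) * (\<integral>z. osc_exp z * (A1 ^^ DIM('a)) ((A2 ^^ k) a) z \<partial>lborel)"

text \<open>For Schwartz amplitudes the integrations by parts change nothing, whatever k is. On the
  larger classes only the right hand side makes sense as an absolutely convergent integral.\<close>

lemma oscJ_schwartz:
  fixes a :: "'a::euclidean_space \<times> 'a \<Rightarrow> complex"
  assumes "a \<in> schwartz"
  shows "osc_fac TYPE('a) * (\<integral>z. osc_exp z * a z \<partial>lborel) = oscJ k a"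
proof -
  have "(A2 ^^ k) b \<in> schwartz \<and> (\<integral>z. osc_exp z * (A2 ^^ k) b z \<partial>lborel) = (\<integral>z. osc_exp z * b z \<partial>lborel)"
    if "b \<in> schwartz" for b :: "'a \<times> 'a \<Rightarrow> complex" and k
    using that by (induction k) (auto simp: A2_integral intro!: schwartz_Aop fst_snd_Basis wcl_WW_om[OF wcl_jw_fst])
  moreover have "(A1 ^^ k) b \<in> schwartz \<and> (\<integral>z. osc_exp z * (A1 ^^ k) b z \<partial>lborel) = (\<integral>z. osc_exp z * b z \<partial>lborel)"
    if "b \<in> schwartz" for b :: "'a \<times> 'a \<Rightarrow> complex" and k
    using that by (induction k) (auto simp: A1_integral intro!: schwartz_Aop fst_snd_Basis wcl_WW_om[OF wcl_jw_snd])
  ultimately show ?thesis using assms by (simp add: oscJ_def)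
qed

text \<open>The uniform bounds contained in \<open>wconv\<close> pass through \<open>A2\<close> and
  \<open>A1\<close> and become one integrable majorant, with exponent at most minus twice the
  dimension in each variable.\<close>

lemma oscJ_tendsto:
  fixes a :: "'a::euclidean_space \<times> 'a \<Rightarrow> complex"
  assumes w: "wconv (WW K 0) F a" and k: "K - 2 * real k \<le> - 2 * real DIM('a)"
  shows "(\<lambda>n. oscJ k (F n)) \<longlonglongrightarrow> oscJ k a"
proof -
  let ?B = "\<lambda>a. (A1 ^^ DIM('a)) ((A2 ^^ k) a)"
  have c: "wconv (WW (K - 2 * real k) (0 - 2 * real DIM('a))) (\<lambda>n. ?B (F n)) (?B a)"
    by (rule wconv_A1_pow[OF wconv_A2_pow[OF w]])
  note s = wconv_smooth[OF c]
  obtain C where C: "C \<ge> 0" "\<And>n. bdd 0 C (WW (K - 2 * real k) (0 - 2 * real DIM('a))) (?B (F n))"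
    using c unfolding wconv_def by blast
  have "(\<lambda>n. (\<integral>z. osc_exp z * ?B (F n) z \<partial>lborel)) \<longlonglongrightarrow> (\<integral>z. osc_exp z * ?B a z \<partial>lborel)"
  proof (rule integral_dominated_convergence[where w = "\<lambda>z. C * WW (K - 2 * real k) (0 - 2 * real DIM('a)) z"])
    show "(\<lambda>z. osc_exp z * ?B a z) \<in> borel_measurable lborel" "\<And>n. (\<lambda>z. osc_exp z * ?B (F n) z) \<in> borel_measurable lborel"
      using smooth_borel[OF s(1)] smooth_borel[OF s(2)] smooth_borel[OF smooth_osc_exp[where 'a = 'a]] by auto
    show "integrable lborel (\<lambda>z::'a \<times> 'a. C * WW (K - 2 * real k) (0 - 2 * real DIM('a)) z)"
      unfolding WW_def by (intro integrable_mult_right integrable_japanese_prod) (use k in auto)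
    show "AE z in lborel. (\<lambda>n. osc_exp z * ?B (F n) z) \<longlonglongrightarrow> osc_exp z * ?B a z"
      using wconv_lim0[OF c] by (auto intro!: tendsto_intros)
    show "\<And>n. AE z in lborel. norm (osc_exp z * ?B (F n) z) \<le> C * WW (K - 2 * real k) (0 - 2 * real DIM('a)) z"
      using bdd0[OF C(2)] by (auto simp: norm_mult norm_osc_exp)
  qed
  then show ?thesis unfolding oscJ_def by (rule tendsto_mult_left)
qed

lemma japanese_scale: "\<epsilon> \<noteq> 0 \<Longrightarrow> japanese x \<le> max 1 (1 / \<bar>\<epsilon>\<bar>) * japanese (\<epsilon> *\<^sub>R x)"
proof -
  assume e: "\<epsilon> \<noteq> 0"
  define M where "M = max 1 (1 / \<bar>\<epsilon>\<bar>)"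
  have M: "1 \<le> M" "1 \<le> M * \<bar>\<epsilon>\<bar>" using e by (auto simp: M_def max_def field_simps)
  have "japanese x ^ 2 \<le> M\<^sup>2 + (M * \<bar>\<epsilon>\<bar>)\<^sup>2 * (norm x)\<^sup>2"
    unfolding japanese_sq using M by (intro add_mono) (auto simp: one_le_power mult_le_cancel_right1)
  also have "\<dots> = (M * japanese (\<epsilon> *\<^sub>R x)) ^ 2"
    by (simp add: power_mult_distrib japanese_sq algebra_simps)
  finally show ?thesis using M japanese_pos[of "\<epsilon> *\<^sub>R x"] unfolding M_def[symmetric]
    by (intro power2_le_imp_le[of "japanese x"]) auto
qed

lemma schwartz_scale: "f \<in> schwartz \<Longrightarrow> \<epsilon> \<noteq> 0 \<Longrightarrow> (\<lambda>x. f (\<epsilon> *\<^sub>R x)) \<in> schwartz"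
  using schwartz_affine[OF bounded_linear_scaleR_right, where f = f and \<sigma> = "\<lambda>b. b" and c = "\<lambda>b. \<epsilon>" and B = "max 1 (1 / \<bar>\<epsilon>\<bar>)" and a = 0] japanese_scale[of \<epsilon>] by auto

text \<open>A derivative of order j of the dilated cutoff carries the factor
  \<open>\<epsilon> ^ j\<close>. So all positive orders vanish in the limit while the bounds stay
  uniform.\<close>

lemma wconv_cutoff:
  assumes \<psi>: "wcl (\<lambda>_. 1) \<psi>" and e: "\<epsilon> \<longlonglongrightarrow> (0::real)"
  shows "wconv (\<lambda>_. 1) (\<lambda>n x::'a::euclidean_space. \<psi> (\<epsilon> n *\<^sub>R x)) (\<lambda>_. \<psi> 0)"
  unfolding wconv_def
proof (intro conjI allI impI)
  note s = wcl_smooth[OF \<psi>]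
  have sc: "smooth (\<lambda>x. \<psi> (r *\<^sub>R x))" "set vs \<subseteq> Basis \<Longrightarrow> iter_deriv vs (\<lambda>x. \<psi> (r *\<^sub>R x)) = (\<lambda>x. complex_of_real (r ^ length vs) * iter_deriv vs \<psi> (r *\<^sub>R x))" for r vs
    using affine_scale(1)[OF s, of 0 r] affine_scale(2)[OF s, where vs = vs and a = 0 and r = r] by simp_all
  show "smooth (\<lambda>x. \<psi> (\<epsilon> n *\<^sub>R x))" "smooth (\<lambda>_. \<psi> 0)" for n using sc smooth_const by auto
  show "\<exists>C\<ge>0. \<forall>n. bdd N C (\<lambda>_. 1) (\<lambda>x. \<psi> (\<epsilon> n *\<^sub>R x))" for N
  proof -
    obtain C where C: "C \<ge> 0" "bdd N C (\<lambda>_. 1) \<psi>" using \<psi> unfolding wcl_def by blast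
    obtain B where B: "\<And>n. \<bar>\<epsilon> n\<bar> \<le> B" "B > 0"
      using convergent_imp_Bseq[OF convergentI[OF e]] unfolding Bseq_def by auto
    have "bdd N (C * (B + 1) ^ N) (\<lambda>x. 1) (\<lambda>x. \<psi> (0 + \<epsilon> n *\<^sub>R x))" for n
      by (rule bdd_affine[OF bounded_linear_scaleR_right s _ C(2), where \<sigma> = "\<lambda>b. b" and c = "\<lambda>b. \<epsilon> n"])
        (use B(1)[of n] B(2) in auto)
    then have "bdd N (C * (B + 1) ^ N) (\<lambda>_. 1) (\<lambda>x. \<psi> (\<epsilon> n *\<^sub>R x))" for n
      by simp
    then show ?thesis using B C by (intro exI[of _ "C * (B + 1) ^ N"]) auto
  qed
  fix vs :: "'a list" and x :: 'a assume vs: "set vs \<subseteq> Basis"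
  have "isCont (iter_deriv vs \<psi>) 0"
    using smooth_continuous[OF smooth_iter_deriv[OF s vs]] by (simp add: continuous_on_eq_continuous_at)
  moreover have "(\<lambda>n. \<epsilon> n *\<^sub>R x) \<longlonglongrightarrow> 0" using tendsto_scaleR[OF e tendsto_const, where b = x] by simp
  ultimately have "(\<lambda>n. iter_deriv vs \<psi> (\<epsilon> n *\<^sub>R x)) \<longlonglongrightarrow> iter_deriv vs \<psi> 0"
    by (rule isCont_tendsto_compose)
  moreover have "(\<lambda>n. \<epsilon> n ^ length vs) \<longlonglongrightarrow> 0 ^ length vs" by (intro tendsto_power e)
  ultimately have "(\<lambda>n. complex_of_real (\<epsilon> n ^ length vs) * iter_deriv vs \<psi> (\<epsilon> n *\<^sub>R x)) \<longlonglongrightarrow> complex_of_real (0 ^ length vs) * iter_deriv vs \<psi> 0"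
    by (intro tendsto_mult tendsto_of_real)
  \<comment> \<open>As \<open>0 ^ 0 = 1\<close>, the empty list gives \<psi> at 0 and every other
    list gives 0, exactly the derivatives of a constant.\<close>
  moreover have "complex_of_real (0 ^ length vs) * iter_deriv vs \<psi> 0 = iter_deriv vs (\<lambda>_. \<psi> 0) x"
    by (cases vs) (auto simp: iter_deriv_const)
  ultimately show "(\<lambda>n. iter_deriv vs (\<lambda>x. \<psi> (\<epsilon> n *\<^sub>R x)) x) \<longlonglongrightarrow> iter_deriv vs (\<lambda>_. \<psi> 0) x"
    by (simp add: sc(2)[OF vs])
qed

lemma cutoff_amplitude:
  assumes \<psi>: "\<psi> \<in> schwartz" "\<psi> 0 = 1" and e: "\<epsilon> \<longlonglongrightarrow> (0::real)" "\<And>n. \<epsilon> n \<noteq> 0"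
    and a: "wcl W a" "om a" "\<And>z. 0 \<le> W z"
  shows "(\<lambda>z. \<psi> (\<epsilon> n *\<^sub>R z) * a z) \<in> schwartz" "wconv W (\<lambda>n z. \<psi> (\<epsilon> n *\<^sub>R z) * a z) a"
proof -
  have "wcl (\<lambda>_. 1) \<psi>"
    by (rule wcl_mono[OF schwartz_wcl[OF \<psi>(1), of 0], of 1]) (auto simp: powr_def)
  from wconv_mult[OF wconv_cutoff[OF this e(1)] wconv_const[OF a(1)] _ a(3)]
  show "wconv W (\<lambda>n z. \<psi> (\<epsilon> n *\<^sub>R z) * a z) a" by (simp add: \<psi>(2))
  show "(\<lambda>z. \<psi> (\<epsilon> n *\<^sub>R z) * a z) \<in> schwartz"
    using schwartz_om[OF a(2) schwartz_scale[OF \<psi>(1) e(2)]] by (simp add: mult.commute)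
qed

lemma japanese_neq_0 [simp]: "japanese x \<noteq> 0"
  using japanese_pos[of x] by simp

lemma schwartz_wcl_1: "f \<in> schwartz \<Longrightarrow> wcl (\<lambda>_. 1) f"
  by (rule wcl_mono[OF schwartz_wcl[of f 0], of 1]) (auto simp: powr_def)

lemma WW_0: "WW 0 0 = (\<lambda>_. 1)"
  using japanese_pos by (auto simp: WW_def fun_eq_iff less_imp_neq[THEN not_sym])

lemma japanese_le_scaled:
  assumes "norm x \<le> M * norm y" "1 \<le> M"
  shows "japanese x \<le> M * japanese y"
proof (rule power2_le_imp_le)
  have "(norm x)\<^sup>2 \<le> (M * norm y)\<^sup>2" using assms by (intro power_mono) auto
  moreover have "1 \<le> M\<^sup>2" using assms by (simp add: one_le_power)
  ultimately show "japanese x ^ 2 \<le> (M * japanese y) ^ 2"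
    by (simp add: power_mult_distrib japanese_sq algebra_simps)
qed (use assms japanese_pos[of y] in auto)

lemma japanese_powr_comparable:
  assumes "japanese x \<le> M * japanese y" "japanese y \<le> M * japanese x" "1 \<le> M"
  shows "japanese x powr s \<le> M powr \<bar>s\<bar> * japanese y powr s"
proof (cases "s \<ge> 0")
  case True
  have "japanese x powr s \<le> (M * japanese y) powr s"
    by (rule powr_mono2[OF True _ assms(1)]) (simp add: japanese_pos less_imp_le)
  then show ?thesis using True assms japanese_pos[of y] by (simp add: powr_mult)
next
  case False
  have "japanese y powr (-s) \<le> (M * japanese x) powr (-s)"
    using False by (intro powr_mono2) (auto simp: japanese_pos less_imp_le assms)
  then have "japanese y powr (-s) \<le> M powr (-s) * japanese x powr (-s)"
    using assms japanese_pos[of x] by (simp add: powr_mult)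
  then have "japanese y powr (-s) * (japanese x powr s * japanese y powr s) \<le>
      M powr (-s) * japanese x powr (-s) * (japanese x powr s * japanese y powr s)"
    by (intro mult_right_mono) auto
  moreover have "japanese y powr (-s) * (japanese x powr s * japanese y powr s) = japanese x powr s * (japanese y powr (-s) * japanese y powr s)"
    "M powr (-s) * japanese x powr (-s) * (japanese x powr s * japanese y powr s) = M powr (-s) * japanese y powr s * (japanese x powr (-s) * japanese x powr s)"
    by (simp_all only: mult_ac)
  moreover have "japanese y powr (-s) * japanese y powr s = 1" "japanese x powr (-s) * japanese x powr s = 1"
    by (simp_all add: powr_add[symmetric])
  ultimately show ?thesis using False by simp
qed

lemma schwartz_tensor:
  assumes f: "f \<in> schwartz" and g: "g \<in> schwartz"
  shows "(\<lambda>z. f (fst z) * g (snd z)) \<in> schwartz"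
  unfolding schwartz_iff
proof
  fix s :: real
  have "wcl (\<lambda>z. japanese (fst z) powr (-\<bar>s\<bar>) * japanese (snd z) powr (-\<bar>s\<bar>)) (\<lambda>z. f (fst z) * g (snd z))"
    by (intro wcl_mult wcl_fst wcl_snd schwartz_wcl f g) auto
  then show "wcl (\<lambda>z. japanese z powr s) (\<lambda>z. f (fst z) * g (snd z))"
  proof (rule wcl_mono[where D = 1])
    fix z :: "'a \<times> 'b"
    have "japanese z ^ 2 \<le> (japanese (fst z) * japanese (snd z)) ^ 2"
      by (cases z) (simp add: power_mult_distrib japanese_sq norm_Pair algebra_simps)
    then have "japanese z \<le> japanese (fst z) * japanese (snd z)"
      by (rule power2_le_imp_le) (simp add: japanese_pos less_imp_le)
    then have "(japanese (fst z) * japanese (snd z)) powr (-\<bar>s\<bar>) \<le> japanese z powr (-\<bar>s\<bar>)"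
      by (intro powr_mono2') (auto simp: japanese_pos)
    also have "\<dots> \<le> japanese z powr s" by (rule japanese_powr_mono) simp
    finally show "japanese (fst z) powr (-\<bar>s\<bar>) * japanese (snd z) powr (-\<bar>s\<bar>) \<le> 1 * japanese z powr s"
      by (simp add: powr_mult japanese_pos less_imp_le)
  qed simp
qed

lemma wcl_tensor:
  assumes "wcl (\<lambda>x. japanese x powr s) f" "wcl (\<lambda>_. 1) g"
  shows "wcl (WW s 0) (\<lambda>z. f (fst z) * g (snd z))"
  using wcl_mult[OF wcl_fst[OF assms(1)] wcl_snd[OF assms(2)]] japanese_pos
  by (simp add: WW_def[abs_def] less_imp_neq[THEN not_sym])

lemma wconv_tensor:
  assumes "wconv (\<lambda>x. japanese x powr s) F f" "wconv (\<lambda>_. 1) G g"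
  shows "wconv (WW s 0) (\<lambda>n z. F n (fst z) * G n (snd z)) (\<lambda>z. f (fst z) * g (snd z))"
  using wconv_mult[OF wconv_fst[OF assms(1)] wconv_snd[OF assms(2)]] japanese_pos
  by (simp add: WW_def[abs_def] less_imp_neq[THEN not_sym])

section \<open>The oscillatory integral as a functional on amplitudes\<close>

definition osc :: "((real ^ 'n::finite) \<times> (real ^ 'n) \<Rightarrow> complex) \<Rightarrow> complex" where
  "osc a = osc_integral (\<lambda>\<eta> y. a (\<eta>, y))"

lemma iter_deriv_snd_slice:
  fixes a :: "'a::euclidean_space \<times> 'b::euclidean_space \<Rightarrow> complex"
  assumes "smooth a" "set vs \<subseteq> Basis"
  shows "smooth (\<lambda>y. a (\<eta>, y))" "iter_deriv vs (\<lambda>y. a (\<eta>, y)) y = iter_deriv (map (Pair 0) vs) a (\<eta>, y)"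
proof -
  have T: "bounded_linear (\<lambda>y::'b. (0::'a, y))" by (intro bounded_linear_Pair bounded_linear_zero bounded_linear_ident)
  have B: "\<And>b::'b. b \<in> Basis \<Longrightarrow> (0::'a, b) \<in> Basis \<and> (0, b) = 1 *\<^sub>R (0::'a, b)" by (auto simp: Basis_prod_def)
  have p: "prod_list (map (\<lambda>b::'b. 1::real) vs) = 1" by (induction vs) auto
  show "smooth (\<lambda>y. a (\<eta>, y))" "iter_deriv vs (\<lambda>y. a (\<eta>, y)) y = iter_deriv (map (Pair 0) vs) a (\<eta>, y)"
    using smooth_affine(1)[OF T assms(1) B, of "(\<eta>, 0)"] smooth_affine(2)[OF T assms(1) B assms(2), of "(\<eta>, 0)"] p by simp_all
qed

lemma iter_deriv_fst_slice:
  fixes a :: "'a::euclidean_space \<times> 'b::euclidean_space \<Rightarrow> complex"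
  assumes "smooth a" "set vs \<subseteq> Basis"
  shows "smooth (\<lambda>x. a (x, y))" "iter_deriv vs (\<lambda>x. a (x, y)) x = iter_deriv (map (\<lambda>b. (b, 0)) vs) a (x, y)"
proof -
  have T: "bounded_linear (\<lambda>x::'a. (x, 0::'b))" by (intro bounded_linear_Pair bounded_linear_zero bounded_linear_ident)
  have B: "\<And>b::'a. b \<in> Basis \<Longrightarrow> (b, 0::'b) \<in> Basis \<and> (b, 0) = 1 *\<^sub>R (b, 0::'b)" by (auto simp: Basis_prod_def)
  have p: "prod_list (map (\<lambda>b::'a. 1::real) vs) = 1" by (induction vs) auto
  show "smooth (\<lambda>x. a (x, y))" "iter_deriv vs (\<lambda>x. a (x, y)) x = iter_deriv (map (\<lambda>b. (b, 0)) vs) a (x, y)"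
    using smooth_affine(1)[OF T assms(1) B, of "(0, y)"] smooth_affine(2)[OF T assms(1) B assms(2), of "(0, y)"] p by simp_all
qed

text \<open>The witnesses for the amplitude class are the order K, \<delta> = 0 and \<kappa> = 0: in
  \<open>wcl\<close> derivatives in y do not worsen the bound.\<close>

lemma wcl_WW_amplitude:
  fixes a :: "(real ^ 'n::finite) \<times> (real ^ 'n) \<Rightarrow> complex"
  assumes a: "wcl (WW K 0) a"
  shows "amplitude (\<lambda>\<eta> y. a (\<eta>, y))"
proof -
  note s = wcl_smooth[OF a]
  have bd: "\<exists>C. \<forall>\<eta> y. norm (mderiv \<alpha> (\<lambda>\<eta>'. mderiv \<beta> (\<lambda>y. a (\<eta>', y)) y) \<eta>)
      \<le> C * japanese \<eta> powr (K + 0 * real (mi_abs \<beta>)) * japanese y powr 0" for \<alpha> \<beta> :: "'n \<Rightarrow> nat"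
  proof -
    let ?vs = "map (\<lambda>b. (b, 0::real^'n)) (mi_list \<alpha>)" and ?ws = "map (Pair (0::real^'n)) (mi_list \<beta>)"
    have B: "set ?vs \<subseteq> Basis" "set ?ws \<subseteq> Basis" using mi_list_Basis[of \<alpha>] mi_list_Basis[of \<beta>] by (auto simp: Basis_prod_def)
    have e: "mderiv \<alpha> (\<lambda>\<eta>'. mderiv \<beta> (\<lambda>y. a (\<eta>', y)) y) \<eta> = iter_deriv (?vs @ ?ws) a (\<eta>, y)" for \<eta> y
      unfolding mderiv_mi_list iter_deriv_append
      by (simp add: iter_deriv_snd_slice(2)[OF s mi_list_Basis] iter_deriv_fst_slice(2)[OF smooth_iter_deriv[OF s B(2)] mi_list_Basis])
    have "set (?vs @ ?ws) \<subseteq> Basis" using B by simp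
    from wcl_lists[OF a this] obtain C where "\<forall>z. norm (iter_deriv (?vs @ ?ws) a z) \<le> C * WW K 0 z" by blast
    then show ?thesis unfolding e WW_def by (intro exI[of _ C]) (simp add: mult.assoc)
  qed
  show ?thesis unfolding amplitude_def
    by (rule conjI, use s in \<open>simp add: case_prod_eta\<close>, rule exI[of _ K], rule exI[of _ 0], rule exI[of _ 0])
      (use bd in auto)
qed

lemma osc_fac_vec: "osc_fac TYPE(real ^ 'n::finite) = complex_of_real (1 / (2 * pi) ^ CARD('n))"
  by (simp add: osc_fac_def)

text \<open>Along any null sequence of \<epsilon> the cut-off amplitudes are Schwartz functions, for
  which \<open>oscJ\<close> equals the defining integral, and they converge to a in the sense of
  \<open>wconv\<close>. As \<open>oscJ\<close> does not mention the cutoff, the limit does not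
  depend on it.\<close>

lemma has_osc_integral_oscJ:
  fixes a :: "(real ^ 'n::finite) \<times> (real ^ 'n) \<Rightarrow> complex"
  assumes a: "wcl (WW K 0) a" and k: "K - 2 * real k \<le> - 2 * real DIM(real ^ 'n)"
  shows "has_osc_integral (\<lambda>\<eta> y. a (\<eta>, y)) (oscJ k a)"
  unfolding has_osc_integral_def
proof (intro conjI ballI impI wcl_WW_amplitude[OF a])
  fix \<psi> :: "(real ^ 'n) \<times> (real ^ 'n) \<Rightarrow> complex" assume \<psi>: "\<psi> \<in> schwartz" "\<psi> (0, 0) = 1"
  have p: "\<psi> 0 = 1" using \<psi>(2) by (simp add: zero_prod_def)
  have e: "(\<lambda>(\<eta>, y). exp (- \<i> * complex_of_real (y \<bullet> \<eta>)) * \<psi> (\<epsilon> *\<^sub>R \<eta>, \<epsilon> *\<^sub>R y) * a (\<eta>, y))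
    = (\<lambda>z. osc_exp z * (\<psi> (\<epsilon> *\<^sub>R z) * a z))" for \<epsilon>
    by (auto simp: osc_exp_def fun_eq_iff)
  show "((\<lambda>\<epsilon>. complex_of_real (1 / (2 * pi) ^ CARD('n)) * integral\<^sup>L lborel
      (\<lambda>(\<eta>, y). exp (- \<i> * complex_of_real (y \<bullet> \<eta>)) * \<psi> (\<epsilon> *\<^sub>R \<eta>, \<epsilon> *\<^sub>R y) * a (\<eta>, y))) \<longlongrightarrow> oscJ k a) (at 0)"
    unfolding e osc_fac_vec[symmetric] tendsto_at_iff_sequentially o_def
  proof (intro allI impI)
    fix X :: "nat \<Rightarrow> real" assume X: "\<forall>i. X i \<in> UNIV - {0}" "X \<longlonglongrightarrow> 0"
    then have nz: "\<And>n. X n \<noteq> 0" by auto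
    note c = cutoff_amplitude[OF \<psi>(1) p X(2) nz a wcl_WW_om[OF a] WW_nonneg]
    show "(\<lambda>i. osc_fac TYPE(real ^ 'n) * (\<integral>z. osc_exp z * (\<psi> (X i *\<^sub>R z) * a z) \<partial>lborel)) \<longlonglongrightarrow> oscJ k a"
      unfolding oscJ_schwartz[OF c(1), where k = k] by (rule oscJ_tendsto[OF c(2) k])
  qed
qed

text \<open>The Gaussian shows that an admissible cutoff exists; otherwise the quantifier over
  \<psi> would be vacuous and every value would qualify.\<close>

lemma has_osc_integral_unique:
  assumes "has_osc_integral a I" "has_osc_integral a J" shows "I = J"
proof -
  have "gauss (0::real^'n, 0::real^'n) = 1" by (simp add: gauss_def inner_prod_def)
  with gauss_schwartz assms show ?thesis unfolding has_osc_integral_def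
    by (meson tendsto_unique trivial_limit_at)
qed

lemma osc_eq_oscJ:
  fixes a :: "(real ^ 'n::finite) \<times> (real ^ 'n) \<Rightarrow> complex"
  assumes a: "wcl (WW K 0) a" and k: "K - 2 * real k \<le> - 2 * real DIM(real ^ 'n)"
  shows "osc a = oscJ k a"
  unfolding osc_def osc_integral_def
  using has_osc_integral_oscJ[OF a k] has_osc_integral_unique by (intro the_equality) blast+

lemma exists_osc_order: "\<exists>k. K - 2 * real k \<le> - 2 * real d"
  using real_arch_simple[of "(K + 2 * real d) / 2"] by (auto simp: field_simps)

lemma wconv_elem_wcl: "wconv W F a \<Longrightarrow> wcl W (F n)"
  unfolding wconv_def wcl_def by meson

text \<open>The continuity that carries the whole calculus: an identity is verified for Schwartz
  amplitudes, where \<open>osc\<close> is an ordinary integral, and extended by Gaussian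
  cutoffs.\<close>

lemma osc_tendsto:
  assumes w: "wconv (WW K 0) F a"
  shows "(\<lambda>n. osc (F n)) \<longlonglongrightarrow> osc (a :: (real ^ 'n::finite) \<times> (real ^ 'n) \<Rightarrow> complex)"
proof -
  obtain k where k: "K - 2 * real k \<le> - 2 * real DIM(real ^ 'n)" using exists_osc_order by blast
  show ?thesis using oscJ_tendsto[OF w k]
    by (simp add: osc_eq_oscJ[OF wconv_elem_wcl[OF w] k] osc_eq_oscJ[OF wconv_wcl[OF w] k])
qed

lemma osc_schwartz:
  fixes a :: "(real ^ 'n::finite) \<times> (real ^ 'n) \<Rightarrow> complex"
  assumes a: "a \<in> schwartz"
  shows "osc a = osc_fac TYPE(real ^ 'n) * (\<integral>z. osc_exp z * a z \<partial>lborel)"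
proof -
  obtain k where k: "0 - 2 * real k \<le> - 2 * real DIM(real ^ 'n)" using exists_osc_order by blast
  show ?thesis using osc_eq_oscJ[OF _ k, of a] schwartz_wcl_1[OF a] oscJ_schwartz[OF a, of k] by (simp add: WW_0)
qed

definition gauss_cut :: "nat \<Rightarrow> ('a::euclidean_space \<Rightarrow> complex) \<Rightarrow> 'a \<Rightarrow> complex" where
  "gauss_cut n a z = gauss ((1 / real (Suc n)) *\<^sub>R z) * a z"

lemma cutoff_seq: "(\<lambda>n. 1 / real (Suc n)) \<longlonglongrightarrow> 0"
  by (rule LIMSEQ_Suc[OF lim_1_over_n])

lemma gauss_0: "gauss 0 = 1" by (simp add: gauss_def)

lemma gauss_cut:
  assumes "wcl W a" "om a" "\<And>z. 0 \<le> W z"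
  shows "gauss_cut n a \<in> schwartz" "wconv W (\<lambda>n. gauss_cut n a) a"
  unfolding gauss_cut_def[abs_def]
  by (rule cutoff_amplitude[OF gauss_schwartz gauss_0 cutoff_seq _ assms]; simp)+

lemma gauss_cut_WW:
  assumes "wcl (WW K 0) a"
  shows "gauss_cut n a \<in> schwartz" "wconv (WW K 0) (\<lambda>n. gauss_cut n a) a"
  by (rule gauss_cut[OF assms wcl_WW_om[OF assms] WW_nonneg])+

lemma osc_exp_integrable: "a \<in> schwartz \<Longrightarrow> integrable lborel (\<lambda>z. osc_exp z * a z)"
  by (rule schwartz_integrable[OF schwartz_om[OF om_osc_exp]])

lemma osc_eqI:
  fixes a b :: "(real ^ 'n::finite) \<times> (real ^ 'n) \<Rightarrow> complex"
  assumes "wconv (WW K 0) F a" "wconv (WW L 0) G b" "\<And>n. osc (F n) = osc (G n)"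
  shows "osc a = osc b"
  using LIMSEQ_unique[OF osc_tendsto[OF assms(1)]] osc_tendsto[OF assms(2)] assms(3) by simp

lemma osc_add:
  fixes a b :: "(real ^ 'n::finite) \<times> (real ^ 'n) \<Rightarrow> complex"
  assumes "wcl (WW K 0) a" "wcl (WW K 0) b"
  shows "osc (\<lambda>z. a z + b z) = osc a + osc b"
proof -
  note a = gauss_cut_WW[OF assms(1)] and b = gauss_cut_WW[OF assms(2)]
  have "osc (\<lambda>z. gauss_cut n a z + gauss_cut n b z) = osc (gauss_cut n a) + osc (gauss_cut n b)" for n
    using osc_schwartz[OF schwartz_add[OF a(1) b(1)], of n n] osc_exp_integrable[OF a(1), of n] osc_exp_integrable[OF b(1), of n]
    by (simp add: osc_schwartz[OF a(1)] osc_schwartz[OF b(1)] distrib_left)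
  then have "(\<lambda>n. osc (gauss_cut n a) + osc (gauss_cut n b)) \<longlonglongrightarrow> osc (\<lambda>z. a z + b z)"
    using osc_tendsto[OF wconv_add[OF a(2) b(2)]] by simp
  moreover have "(\<lambda>n. osc (gauss_cut n a) + osc (gauss_cut n b)) \<longlonglongrightarrow> osc a + osc b"
    by (intro tendsto_add osc_tendsto[OF a(2)] osc_tendsto[OF b(2)])
  ultimately show ?thesis by (rule LIMSEQ_unique)
qed

lemma osc_cmult:
  fixes a :: "(real ^ 'n::finite) \<times> (real ^ 'n) \<Rightarrow> complex"
  assumes "wcl (WW K 0) a"
  shows "osc (\<lambda>z. c * a z) = c * osc a"
proof -
  note a = gauss_cut_WW[OF assms]
  have "osc (\<lambda>z. c * gauss_cut n a z) = c * osc (gauss_cut n a)" for n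
    using osc_schwartz[OF schwartz_cmult[OF a(1)], of c n]
    by (simp add: osc_schwartz[OF a(1)] mult.left_commute[of _ c])
  then have "(\<lambda>n. c * osc (gauss_cut n a)) \<longlonglongrightarrow> osc (\<lambda>z. c * a z)"
    using osc_tendsto[OF wconv_cmult[OF a(2) WW_nonneg], of c] by simp
  then show ?thesis using tendsto_mult_left[OF osc_tendsto[OF a(2)]] LIMSEQ_unique by blast
qed

lemma osc_diff:
  fixes a b :: "(real ^ 'n::finite) \<times> (real ^ 'n) \<Rightarrow> complex"
  assumes "wcl (WW K 0) a" "wcl (WW K 0) b"
  shows "osc (\<lambda>z. a z - b z) = osc a - osc b"
  using osc_add[OF assms(1) wcl_cmult[OF assms(2), of "-1"]] osc_cmult[OF assms(2), of "-1"] by simp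

lemma osc_sum:
  fixes a :: "'i \<Rightarrow> (real ^ 'n::finite) \<times> (real ^ 'n) \<Rightarrow> complex"
  assumes "finite I" "\<And>i. i \<in> I \<Longrightarrow> wcl (WW K 0) (a i)"
  shows "osc (\<lambda>z. \<Sum>i\<in>I. a i z) = (\<Sum>i\<in>I. osc (a i))"
  using assms
proof (induction I rule: finite_induct)
  case empty
  have "wcl (WW 0 0) (\<lambda>_ :: (real ^ 'n) \<times> (real ^ 'n). 0)" by (rule wcl_zero[OF WW_nonneg])
  from osc_cmult[OF this, of 0] show ?case by simp
next
  case (insert i I)
  then have "wcl (WW K 0) (\<lambda>z. \<Sum>i\<in>I. a i z)" by (intro wcl_sum WW_nonneg) auto
  then show ?case using insert osc_add[of K "a i" "\<lambda>z. \<Sum>i\<in>I. a i z"] by simp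
qed

lemma wcl_fst_inner: "b \<in> Basis \<Longrightarrow> wcl (WW 1 0) (\<lambda>z. complex_of_real (fst z \<bullet> b))"
  using wcl_fst[OF wcl_inner, of b] by (simp add: WW_def[abs_def] abs_of_pos[OF japanese_pos])

text \<open>Integration by parts: a factor \<eta> in the amplitude becomes a derivative - \<i>
  \<partial> in y. Iterated, it evaluates monomials in \<eta>.\<close>

lemma osc_mult_fst:
  fixes a :: "(real ^ 'n::finite) \<times> (real ^ 'n) \<Rightarrow> complex"
  assumes a: "wcl (WW K 0) a" and b: "b \<in> Basis"
  shows "osc (\<lambda>z. complex_of_real (fst z \<bullet> b) * a z) = osc (\<lambda>z. - \<i> * pd (0, b) a z)"
proof (rule osc_eqI)
  note c = gauss_cut_WW[OF a]
  have B: "(0, b) \<in> Basis" "(b, 0) \<in> Basis" using b by (auto simp: Basis_prod_def)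
  have "wconv (\<lambda>z. WW 1 0 z * WW K 0 z) (\<lambda>n z. complex_of_real (fst z \<bullet> b) * gauss_cut n a z) (\<lambda>z. complex_of_real (fst z \<bullet> b) * a z)"
    by (intro wconv_mult wconv_const wcl_fst_inner b c WW_nonneg)
  then show "wconv (WW (1 + K) 0) (\<lambda>n z. complex_of_real (fst z \<bullet> b) * gauss_cut n a z) (\<lambda>z. complex_of_real (fst z \<bullet> b) * a z)"
    by (simp add: WW_mult)
  show "wconv (WW K 0) (\<lambda>n z. - \<i> * pd (0, b) (gauss_cut n a) z) (\<lambda>z. - \<i> * pd (0, b) a z)"
    by (intro wconv_cmult wconv_pd c B WW_nonneg)
  fix n
  have e: "complex_of_real (fst z \<bullet> b) = complex_of_real (z \<bullet> (b, 0))" for z :: "(real ^ 'n) \<times> (real ^ 'n)"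
    by (simp add: inner_prod_def)
  have "(\<integral>z. osc_exp z * (complex_of_real (z \<bullet> (b, 0)) * gauss_cut n a z) \<partial>lborel) = - \<i> * (\<integral>z. osc_exp z * pd (0, b) (gauss_cut n a) z \<partial>lborel)"
    using osc_exp_ibp[OF c(1) B(1), of n] by (simp del: iter_deriv.simps)
  moreover have "(\<lambda>z. complex_of_real (z \<bullet> (b, 0)) * gauss_cut n a z) \<in> schwartz"
    by (rule schwartz_om[OF om_inner[OF B(2)] c(1)])
  moreover have "(\<lambda>z. - \<i> * pd (0, b) (gauss_cut n a) z) \<in> schwartz"
    by (rule schwartz_cmult[OF schwartz_pd[OF c(1) B(1)]])
  ultimately show "osc (\<lambda>z. complex_of_real (fst z \<bullet> b) * gauss_cut n a z) = osc (\<lambda>z. - \<i> * pd (0, b) (gauss_cut n a) z)"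
    unfolding e by (simp add: osc_schwartz mult.left_commute[of _ \<i>] del: iter_deriv.simps)
qed

text \<open>The factors r and 1 / r occur equally often, so the Jacobian determinant is 1.\<close>

lemma integral_dilate:
  fixes f :: "'a::euclidean_space \<times> 'a \<Rightarrow> complex"
  assumes "f \<in> borel_measurable borel" "r > 0"
  shows "(\<integral>z. f (r *\<^sub>R fst z, (1 / r) *\<^sub>R snd z) \<partial>lborel) = (\<integral>z. f z \<partial>lborel)"
proof -
  define c :: "'a \<times> 'a \<Rightarrow> real" where "c j = (if snd j = 0 then r else 1 / r)" for j
  define T :: "'a \<times> 'a \<Rightarrow> 'a \<times> 'a" where "T z = (r *\<^sub>R fst z, (1 / r) *\<^sub>R snd z)" for z
  have nz: "c j \<noteq> 0" for j using assms(2) by (simp add: c_def)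
  have dj: "(\<lambda>u. (u, 0::'a)) ` (Basis::'a set) \<inter> Pair (0::'a) ` (Basis::'a set) = {}" by auto
  have c: "c (u, 0) = r" "v \<in> Basis \<Longrightarrow> c (0, v) = 1 / r" for u v by (auto simp: c_def)
  have T: "0 + (\<Sum>j\<in>Basis. (c j * (z \<bullet> j)) *\<^sub>R j) = T z" for z
    unfolding Basis_prod_def
    by (subst sum.union_disjoint[OF _ _ dj])
      (auto simp: sum.reindex inj_on_def c T_def inner_prod_def sum_prod scaleR_sum_right[symmetric]
        euclidean_representation scaleR_scaleR[symmetric] simp del: scaleR_scaleR cong: sum.cong)
  have p: "(\<Prod>j\<in>Basis. \<bar>c j\<bar>) = 1"
    unfolding Basis_prod_def using assms(2)
    by (subst prod.union_disjoint[OF _ _ dj]) (auto simp: prod.reindex inj_on_def c power_mult_distrib[symmetric] cong: prod.cong)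
  have "lborel = density (distr lborel borel T) (\<lambda>_. 1)"
    using lborel_affine_euclidean[where c = c and t = 0, OF nz] unfolding T p by simp
  then have l: "lborel = distr lborel borel T" by (simp add: density_1)
  have "(\<integral>z. f z \<partial>lborel) = (\<integral>z. f z \<partial>distr lborel borel T)" using l by simp
  also have "\<dots> = (\<integral>z. f (T z) \<partial>lborel)"
    by (rule integral_distr) (use assms in \<open>auto simp: T_def[abs_def] intro!: borel_measurable_continuous_onI continuous_intros\<close>)
  finally show ?thesis by (simp add: T_def)
qed

text \<open>The phase and Lebesgue measure are both invariant under this dilation. Invariance of the
  integral for Schwartz amplitudes extends because the weights before and after dilation are
  comparable.\<close>

lemma osc_dilate:
  fixes a :: "(real ^ 'n::finite) \<times> (real ^ 'n) \<Rightarrow> complex"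
  assumes a: "wcl (WW K 0) a" and r: "r > 0"
  shows "osc (\<lambda>z. a (r *\<^sub>R fst z, (1 / r) *\<^sub>R snd z)) = osc a"
proof (rule osc_eqI)
  define T :: "(real ^ 'n) \<times> (real ^ 'n) \<Rightarrow> (real ^ 'n) \<times> (real ^ 'n)" where "T z = (r *\<^sub>R fst z, (1 / r) *\<^sub>R snd z)" for z
  \<comment> \<open>M bounds both dilation factors and hence compares the brackets of a point and
    its image in either direction.\<close>
  define M where "M = max r (1 / r)"
  have M: "r \<le> M" "1 / r \<le> M" "1 \<le> M"
    using r by (simp_all add: M_def le_max_iff_disj) (cases "r \<ge> 1"; simp)
  have bl: "bounded_linear T" unfolding T_def[abs_def]
    by (intro bounded_linear_Pair bounded_linear_const_scaleR bounded_linear_fst bounded_linear_snd)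
  have b: "b \<in> Basis \<Longrightarrow> b \<in> Basis \<and> T b = (if snd b = 0 then r else 1 / r) *\<^sub>R b" for b
    by (auto simp: T_def Basis_prod_def)
  note c = gauss_cut_WW[OF a]
  have J: "japanese (r *\<^sub>R x) \<le> M * japanese x" "japanese x \<le> M * japanese (r *\<^sub>R x)" for x :: "real ^ 'n"
  proof -
    have "1 \<le> M * r" using M(2) r by (simp add: field_simps)
    then have "norm x * 1 \<le> norm x * (M * r)" by (intro mult_left_mono) auto
    then show "japanese (r *\<^sub>R x) \<le> M * japanese x" "japanese x \<le> M * japanese (r *\<^sub>R x)"
      using r M by (auto intro!: japanese_le_scaled mult_right_mono simp: mult_ac)
  qed
  have W: "WW K 0 (T z) \<le> M powr \<bar>K\<bar> * WW K 0 z" for z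
    using japanese_powr_comparable[OF J M(3), of "fst z" K] japanese_pos
    by (simp add: WW_def T_def less_imp_neq[THEN not_sym])
  have "wconv (WW K 0) (\<lambda>n z. F n (T z)) (\<lambda>z. f (T z))" if "wconv (WW K 0) F f" for F and f
    by (rule wconv_mono[where D = "M powr \<bar>K\<bar>"]) (use wconv_affine[OF bl that b, of 0] W M in auto)
  from this[OF c(2)] show "wconv (WW K 0) (\<lambda>n z. gauss_cut n a (T z)) (\<lambda>z. a (r *\<^sub>R fst z, (1 / r) *\<^sub>R snd z))"
    by (simp add: T_def)
  show "wconv (WW K 0) (\<lambda>n. gauss_cut n a) a" by (rule c(2))
  fix n
  have "norm z \<le> M * norm (T z)" for z
  proof -
    have "(norm (fst z))\<^sup>2 = (norm (r *\<^sub>R fst z) * (1 / r))\<^sup>2" using r by simp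
    also have "\<dots> \<le> (norm (r *\<^sub>R fst z) * M)\<^sup>2" using M r by (intro power_mono mult_left_mono) auto
    finally have 1: "(norm (fst z))\<^sup>2 \<le> (norm (fst (T z)) * M)\<^sup>2" by (simp add: T_def)
    have "(norm (snd z))\<^sup>2 = (norm ((1 / r) *\<^sub>R snd z) * r)\<^sup>2" using r by simp
    also have "\<dots> \<le> (norm ((1 / r) *\<^sub>R snd z) * M)\<^sup>2" using M r by (intro power_mono mult_left_mono) auto
    finally have 2: "(norm (snd z))\<^sup>2 \<le> (norm (snd (T z)) * M)\<^sup>2" by (simp add: T_def)
    have "(norm z)\<^sup>2 \<le> (M * norm (T z))\<^sup>2"
      using add_mono[OF 1 2] by (cases z; cases "T z") (simp add: norm_Pair power_mult_distrib algebra_simps)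
    then show ?thesis by (rule power2_le_imp_le) (use M in auto)
  qed
  from japanese_le_scaled[OF this M(3)] have "japanese z \<le> M * japanese (0 + T z)" for z by simp
  then have s: "(\<lambda>z. gauss_cut n a (T z)) \<in> schwartz"
    using schwartz_affine[OF bl c(1) b, where a = 0 and B = M] by auto
  have E: "osc_exp z = osc_exp (T z)" for z :: "(real ^ 'n) \<times> (real ^ 'n)" using r by (simp add: osc_exp_def T_def)
  have "(\<integral>z. osc_exp z * gauss_cut n a (T z) \<partial>lborel) = (\<integral>z. osc_exp z * gauss_cut n a z \<partial>lborel)"
    using integral_dilate[of "\<lambda>z. osc_exp z * gauss_cut n a z" r] r smooth_borel[OF schwartz_smooth[OF schwartz_om[OF om_osc_exp c(1)]]]
    by (subst E) (simp add: T_def[symmetric])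
  then show "osc (\<lambda>z. gauss_cut n a (T z)) = osc (gauss_cut n a)"
    by (simp add: osc_schwartz[OF s] osc_schwartz[OF c(1)])
qed

lemma osc_exp_integral_iterated:
  fixes f g :: "'a::euclidean_space \<Rightarrow> complex"
  assumes f: "f \<in> schwartz" and g: "g \<in> schwartz"
  shows "(\<integral>z. osc_exp z * (f (fst z) * g (snd z)) \<partial>lborel) =
    (\<integral>\<eta>. f \<eta> * (\<integral>y. exp (- \<i> * complex_of_real (y \<bullet> \<eta>)) * g y \<partial>lborel) \<partial>lborel)"
proof -
  have i: "integrable (lborel \<Otimes>\<^sub>M lborel) (\<lambda>(\<eta>, y). osc_exp (\<eta>, y) * (f \<eta> * g y))"
    using osc_exp_integrable[OF schwartz_tensor[OF f g]] by (simp add: lborel_prod case_prod_beta')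
  show ?thesis
    using lborel_pair.integral_fst[OF i]
    by (simp add: lborel_prod case_prod_beta' osc_exp_def mult.left_commute[of _ "f _"])
qed

text \<open>This fixes the normalization: the integral over y and the integral over \<eta> each
  contribute a factor sqrt (2 pi) to the power of the dimension, and together they cancel the
  prefactor. A cutoff is needed in \<eta> only, since the Gaussian already decays in y.\<close>

lemma osc_one: "osc (\<lambda>z :: (real ^ 'n::finite) \<times> (real ^ 'n). gauss (snd z)) = 1"
proof -
  let ?g = "gauss :: real ^ 'n \<Rightarrow> complex"
  let ?c = "complex_of_real (sqrt (2 * pi) ^ DIM(real ^ 'n))"
  define F :: "nat \<Rightarrow> (real ^ 'n) \<times> (real ^ 'n) \<Rightarrow> complex" where
    "F n z = ?g ((1 / real (Suc n)) *\<^sub>R fst z) * ?g (snd z)" for n z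
  have w1: "wcl (\<lambda>_. 1) ?g" by (rule schwartz_wcl_1[OF gauss_schwartz])
  have "wconv (\<lambda>z. 1 * 1) F (\<lambda>z. ?g 0 * ?g (snd z))" unfolding F_def[abs_def]
    by (rule wconv_mult[OF wconv_fst[OF wconv_cutoff[OF w1 cutoff_seq]] wconv_const[OF wcl_snd[OF w1]]]) auto
  then have w: "wconv (WW 0 0) F (\<lambda>z. ?g (snd z))" by (simp add: WW_0 gauss_0)
  have gs: "(\<lambda>x. ?g ((1 / real (Suc n)) *\<^sub>R x)) \<in> schwartz" for n
    by (rule schwartz_scale[OF gauss_schwartz]) simp
  have Fs: "F n \<in> schwartz" for n unfolding F_def[abs_def] by (rule schwartz_tensor[OF gs gauss_schwartz])
  have h1: "osc (F n) = osc_fac TYPE(real ^ 'n) * (\<integral>\<eta>. ?g ((1 / real (Suc n)) *\<^sub>R \<eta>) * (?c * ?g \<eta>) \<partial>lborel)" for n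
    unfolding osc_schwartz[OF Fs] unfolding F_def osc_exp_integral_iterated[OF gs gauss_schwartz] fourier_gauss ..
  have h2: "(\<lambda>n. (\<integral>\<eta>. ?g ((1 / real (Suc n)) *\<^sub>R \<eta>) * (?c * ?g \<eta>) \<partial>lborel)) \<longlonglongrightarrow> (\<integral>\<eta>. 1 * (?c * ?g \<eta>) \<partial>lborel)"
  proof (rule integral_dominated_convergence[where w = "\<lambda>\<eta>. norm (?c * ?g \<eta>)"])
    show "integrable lborel (\<lambda>\<eta>. norm (?c * ?g \<eta>))"
      by (intro integrable_norm integrable_mult_right schwartz_integrable gauss_schwartz)
    have "(\<lambda>n. ?g ((1 / real (Suc n)) *\<^sub>R \<eta>)) \<longlonglongrightarrow> ?g 0" for \<eta>
      using wconv_lim0[OF wconv_cutoff[OF w1 cutoff_seq]] .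
    then show "AE \<eta> in lborel. (\<lambda>n. ?g ((1 / real (Suc n)) *\<^sub>R \<eta>) * (?c * ?g \<eta>)) \<longlonglongrightarrow> 1 * (?c * ?g \<eta>)"
      by (intro AE_I2 tendsto_mult_right) (simp add: gauss_0)
    show "\<And>n. AE \<eta> in lborel. norm (?g ((1 / real (Suc n)) *\<^sub>R \<eta>) * (?c * ?g \<eta>)) \<le> norm (?c * ?g \<eta>)"
      by (intro AE_I2) (simp add: norm_mult norm_gauss mult_left_le_one_le)
    show "(\<lambda>\<eta>. 1 * (?c * ?g \<eta>)) \<in> borel_measurable lborel"
      "\<And>n. (\<lambda>\<eta>. ?g ((1 / real (Suc n)) *\<^sub>R \<eta>) * (?c * ?g \<eta>)) \<in> borel_measurable lborel"
      using smooth_borel[OF smooth_gauss[where 'a = "real ^ 'n"]] smooth_borel[OF schwartz_smooth[OF gs]] by auto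
  qed
  have h3: "osc_fac TYPE(real ^ 'n) * (\<integral>\<eta>. 1 * (?c * ?g \<eta>) \<partial>lborel) = 1"
  proof -
    have "(\<integral>\<eta>. ?g \<eta> \<partial>lborel) = ?c" using fourier_gauss[of "0 :: real ^ 'n"] by (simp add: gauss_0)
    moreover have "?c * ?c = complex_of_real ((2 * pi) ^ DIM(real ^ 'n))"
    proof -
      have "sqrt (2 * pi) ^ d * sqrt (2 * pi) ^ d = (2 * pi) ^ d" for d
        using power_mult_distrib[of "sqrt (2 * pi)" "sqrt (2 * pi)" d] by simp
      then show ?thesis by (metis of_real_mult)
    qed
    ultimately show ?thesis by (simp add: osc_fac_def)
  qed
  have "(\<lambda>n. osc (F n)) \<longlonglongrightarrow> 1"
    using tendsto_mult_left[OF h2, where c = "osc_fac TYPE(real ^ 'n)"] unfolding h3 h1 .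
  then show ?thesis using osc_tendsto[OF w] LIMSEQ_unique by blast
qed

text \<open>Fourier inversion at the origin. Dilation does not change the value, while g (y / r)
  tends to g 0 as r grows; so the value is g 0 times that of the amplitude 1. The latter is found by
  taking the Gaussian for g.\<close>

lemma osc_snd:
  fixes g :: "real ^ 'n::finite \<Rightarrow> complex"
  assumes g: "wcl (\<lambda>_. 1) g"
  shows "osc (\<lambda>z. g (snd z)) = g 0"
proof -
  have *: "osc (\<lambda>z. g (snd z)) = g 0 * osc (\<lambda>_ :: (real ^ 'n) \<times> (real ^ 'n). 1)" if g: "wcl (\<lambda>_. 1) g" for g :: "real ^ 'n \<Rightarrow> complex"
  proof -
    have a: "wcl (WW 0 0) (\<lambda>z :: (real ^ 'n) \<times> (real ^ 'n). g (snd z))" using wcl_snd[OF g] by (simp add: WW_0)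
    have o: "wcl (WW 0 0) (\<lambda>z :: (real ^ 'n) \<times> (real ^ 'n). 1)"
      unfolding WW_0 by (rule wcl_of_lists) (auto simp: smooth_const iter_deriv_const)
    have e: "osc (\<lambda>z :: (real ^ 'n) \<times> (real ^ 'n). g ((1 / real (Suc n)) *\<^sub>R snd z)) = osc (\<lambda>z. g (snd z))" for n
      using osc_dilate[OF a, of "real (Suc n)"] by simp
    have "wconv (WW 0 0) (\<lambda>n z :: (real ^ 'n) \<times> (real ^ 'n). g ((1 / real (Suc n)) *\<^sub>R snd z)) (\<lambda>z. g 0)"
      using wconv_snd[OF wconv_cutoff[OF g cutoff_seq]] by (simp add: WW_0)
    from osc_tendsto[OF this] have "osc (\<lambda>z. g (snd z)) = osc (\<lambda>_ :: (real ^ 'n) \<times> (real ^ 'n). g 0)"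
      unfolding e by (simp add: LIMSEQ_const_iff)
    also have "\<dots> = g 0 * osc (\<lambda>_ :: (real ^ 'n) \<times> (real ^ 'n). 1)" using osc_cmult[OF o, of "g 0"] by simp
    finally show ?thesis .
  qed
  have "osc (\<lambda>_ :: (real ^ 'n) \<times> (real ^ 'n). 1) = 1"
    using *[OF schwartz_wcl_1[OF gauss_schwartz]] osc_one[where 'n = 'n] by (simp add: gauss_0)
  then show ?thesis using *[OF g] by simp
qed

section \<open>Amplitudes of product form and the basic estimate\<close>

lemma pd_tensor:
  fixes f :: "'a::euclidean_space \<Rightarrow> complex" and g :: "'b::euclidean_space \<Rightarrow> complex"
  assumes "smooth f" "smooth g" "b \<in> Basis" "c \<in> Basis"
  shows "pd (b, 0) (\<lambda>z. f (fst z) * g (snd z)) = (\<lambda>z. pd b f (fst z) * g (snd z))"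
    and "pd (0, c) (\<lambda>z. f (fst z) * g (snd z)) = (\<lambda>z. f (fst z) * pd c g (snd z))"
proof -
  have s: "smooth (\<lambda>z::'a \<times> 'b. f (fst z))" "smooth (\<lambda>z::'a \<times> 'b. g (snd z))"
    using smooth_affine(1)[OF bounded_linear_fst assms(1) fst_dir, of 0] smooth_affine(1)[OF bounded_linear_snd assms(2) snd_dir, of 0] by auto
  have B: "(b, 0) \<in> (Basis :: ('a \<times> 'b) set)" "(0, c) \<in> (Basis :: ('a \<times> 'b) set)" "b \<noteq> 0" "c \<noteq> 0" using assms by (auto simp: Basis_prod_def)
  have f: "pd v (\<lambda>z::'a \<times> 'b. f (fst z)) = (\<lambda>z. complex_of_real (if fst v = 0 then 0 else 1) * pd (fst_dir v) f (fst z))" if "v \<in> Basis" for v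
    using smooth_affine(2)[OF bounded_linear_fst assms(1) fst_dir, of "[v]" 0] that by (simp del: iter_deriv.simps)
  have g: "pd v (\<lambda>z::'a \<times> 'b. g (snd z)) = (\<lambda>z. complex_of_real (if snd v = 0 then 0 else 1) * pd (snd_dir v) g (snd z))" if "v \<in> Basis" for v
    using smooth_affine(2)[OF bounded_linear_snd assms(2) snd_dir, of "[v]" 0] that by (simp del: iter_deriv.simps)
  note m = pd_mult[OF smooth_differentiable[OF s(1)] smooth_differentiable[OF s(2)]]
  show "pd (b, 0) (\<lambda>z. f (fst z) * g (snd z)) = (\<lambda>z. pd b f (fst z) * g (snd z))"
    "pd (0, c) (\<lambda>z. f (fst z) * g (snd z)) = (\<lambda>z. f (fst z) * pd c g (snd z))"
    unfolding m f[OF B(1)] f[OF B(2)] g[OF B(1)] g[OF B(2)] using B(3,4) by (auto simp: fst_dir_def snd_dir_def simp del: iter_deriv.simps)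
qed

lemma Lop_tensor:
  fixes f :: "'a::euclidean_space \<Rightarrow> complex" and g :: "'b::euclidean_space \<Rightarrow> complex"
  assumes f: "smooth f" and g: "smooth g"
  shows "Lop fst_Basis (\<lambda>z. f (fst z) * g (snd z)) = (\<lambda>z. Lop Basis f (fst z) * g (snd z))"
    and "Lop snd_Basis (\<lambda>z. f (fst z) * g (snd z)) = (\<lambda>z. f (fst z) * Lop Basis g (snd z))"
proof -
  have 1: "pd (b, 0) (pd (b, 0) (\<lambda>z. f (fst z) * g (snd z))) z = pd b (pd b f) (fst z) * g (snd z)" if b: "b \<in> Basis" for b z
    by (simp only: pd_tensor(1)[OF f g b SOME_Basis] pd_tensor(1)[OF smooth_pd[OF f b] g b SOME_Basis])
  have 2: "pd (0, b) (pd (0, b) (\<lambda>z. f (fst z) * g (snd z))) z = f (fst z) * pd b (pd b g) (snd z)" if b: "b \<in> Basis" for b z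
    by (simp only: pd_tensor(2)[OF f g SOME_Basis b] pd_tensor(2)[OF f smooth_pd[OF g b] SOME_Basis b])
  have "(\<Sum>c\<in>fst_Basis. pd c (pd c (\<lambda>z. f (fst z) * g (snd z))) z) = (\<Sum>b\<in>Basis. pd b (pd b f) (fst z) * g (snd z))" for z
    unfolding fst_Basis_def by (subst sum.reindex) (auto simp: inj_on_def 1 simp del: iter_deriv.simps)
  then show "Lop fst_Basis (\<lambda>z. f (fst z) * g (snd z)) = (\<lambda>z. Lop Basis f (fst z) * g (snd z))"
    by (simp add: Lop_def fun_eq_iff left_diff_distrib sum_distrib_right del: iter_deriv.simps)
  have "(\<Sum>c\<in>snd_Basis. pd c (pd c (\<lambda>z. f (fst z) * g (snd z))) z) = (\<Sum>b\<in>Basis. f (fst z) * pd b (pd b g) (snd z))" for z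
    unfolding snd_Basis_def by (subst sum.reindex) (auto simp: inj_on_def 2 simp del: iter_deriv.simps)
  then show "Lop snd_Basis (\<lambda>z. f (fst z) * g (snd z)) = (\<lambda>z. f (fst z) * Lop Basis g (snd z))"
    by (simp add: Lop_def fun_eq_iff right_diff_distrib sum_distrib_left del: iter_deriv.simps)
qed

lemma smooth_Lop_pow: "smooth f \<Longrightarrow> smooth ((Lop Basis ^^ k) f)"
  by (induction k) (auto intro: smooth_Lop)

text \<open>The product form survives: the weight in \<eta> joins the first factor and the
  differential operator acts on the second. Hence the estimate of the integrand splits into one for
  each factor.\<close>

lemma A2_pow_tensor:
  assumes "smooth f" "smooth g"
  shows "(A2 ^^ k) (\<lambda>z. f (fst z) * g (snd z)) = (\<lambda>z. (jw (fst z) ^ k * f (fst z)) * (Lop Basis ^^ k) g (snd z))"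
proof (induction k)
  case (Suc k)
  have "smooth (\<lambda>x. jw x ^ k * f x)" by (intro smooth_mult smooth_power smooth_jw assms)
  note e = Lop_tensor(2)[OF this smooth_Lop_pow[OF assms(2)]]
  have "(A2 ^^ Suc k) (\<lambda>z. f (fst z) * g (snd z)) = A2 (\<lambda>z. (jw (fst z) ^ k * f (fst z)) * (Lop Basis ^^ k) g (snd z))"
    by (simp add: Suc)
  also have "\<dots> = (\<lambda>z. (jw (fst z) ^ Suc k * f (fst z)) * (Lop Basis ^^ Suc k) g (snd z))"
    unfolding Aop_def[abs_def] e by (simp add: mult.assoc)
  finally show ?case .
qed simp

lemma A1_pow_tensor:
  assumes "smooth f" "smooth g"
  shows "(A1 ^^ k) (\<lambda>z. f (fst z) * g (snd z)) = (\<lambda>z. (Lop Basis ^^ k) f (fst z) * (jw (snd z) ^ k * g (snd z)))"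
proof (induction k)
  case (Suc k)
  have "smooth (\<lambda>x. jw x ^ k * g x)" by (intro smooth_mult smooth_power smooth_jw assms)
  note e = Lop_tensor(1)[OF smooth_Lop_pow[OF assms(1)] this]
  have "(A1 ^^ Suc k) (\<lambda>z. f (fst z) * g (snd z)) = A1 (\<lambda>z. (Lop Basis ^^ k) f (fst z) * (jw (snd z) ^ k * g (snd z)))"
    by (simp add: Suc)
  also have "\<dots> = (\<lambda>z. (Lop Basis ^^ Suc k) f (fst z) * (jw (snd z) ^ Suc k * g (snd z)))"
    unfolding Aop_def[abs_def] e by (simp add: mult_ac)
  finally show ?case .
qed simp

lemma Lop_pow_bound:
  fixes f :: "'a::euclidean_space \<Rightarrow> complex"
  assumes "smooth f" "bdd (N + 2 * l) C W f"
  shows "bdd N ((1 + real DIM('a)) ^ l * C) W ((Lop Basis ^^ l) f)"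
  using assms(2)
proof (induction l arbitrary: N)
  case (Suc l)
  have "bdd (N + 2) ((1 + real DIM('a)) ^ l * C) W ((Lop Basis ^^ l) f)" by (rule Suc.IH) (use Suc in simp)
  from Lop_bound[OF subset_refl smooth_Lop_pow[OF assms(1)] this] show ?case by (simp add: mult.assoc)
qed simp

lemma wcl_jw_power: "wcl (\<lambda>x. japanese x powr (- 2 * real k)) (\<lambda>x. jw x ^ k)"
proof (induction k)
  case 0
  show ?case by (rule wcl_of_lists) (auto simp: smooth_const iter_deriv_const intro!: exI[of _ 1])
next
  case (Suc k)
  then have "wcl (\<lambda>x::'a. japanese x powr - 2 * japanese x powr (- 2 * real k)) (\<lambda>x. jw x * jw x ^ k)"
    by (intro wcl_mult wcl_jw) auto
  then show ?case by (simp add: powr_add[symmetric] algebra_simps)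
qed

text \<open>The absolutely convergent form needs \<open>2 * DIM\<close> derivatives of f and
  \<open>2 * k\<close> of g. The constant depends only on the dimension, K and k, and the bound is
  linear in A and in B; both facts are essential for symbols depending on parameters.\<close>

lemma osc_tensor_bound:
  fixes K :: real
  assumes k: "K - 2 * real k \<le> - 2 * real DIM(real ^ 'n::finite)"
  shows "\<exists>C\<ge>0. \<forall>(f :: real ^ 'n \<Rightarrow> complex) g A B. wcl (\<lambda>x. japanese x powr K) f \<and> wcl (\<lambda>_. 1) g \<and> 0 \<le> A \<and> 0 \<le> B \<and>
    bdd (2 * DIM(real ^ 'n)) A (\<lambda>x. japanese x powr K) f \<and> bdd (2 * k) B (\<lambda>_. 1) g \<longrightarrow>
    norm (osc (\<lambda>z. f (fst z) * g (snd z))) \<le> C * A * B"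
proof -
  define d where "d = DIM(real ^ 'n)"
  obtain C1 where C1: "C1 \<ge> 0" "bdd (2 * d) C1 (\<lambda>x. japanese x powr (- 2 * real k)) (\<lambda>x::real ^ 'n. jw x ^ k)"
    using wcl_jw_power unfolding wcl_def by blast
  \<comment> \<open>The powers of 1 + d come from the d + k applications of \<open>Lop\<close>, each
    a sum of 1 + d terms; the middle factor comes from the product rule for \<open>jw\<close> to the
    power k times f.\<close>
  define c where "c = (1 + real d) ^ d * (2 ^ (2 * d) * C1) * (1 + real d) ^ k"
  have c0: "c \<ge> 0" using C1 by (simp add: c_def)
  define I where "I = (\<integral>z. WW (K - 2 * real k) (- 2 * real d) z \<partial>(lborel :: ((real ^ 'n) \<times> (real ^ 'n)) measure))"
  have I0: "I \<ge> 0" unfolding I_def by (intro integral_nonneg_AE AE_I2 WW_nonneg)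
  have int: "integrable lborel (WW (K - 2 * real k) (- 2 * real d) :: (real ^ 'n) \<times> (real ^ 'n) \<Rightarrow> real)"
    unfolding WW_def[abs_def] by (rule integrable_japanese_prod) (use k in \<open>auto simp: d_def\<close>)
  have "norm (osc (\<lambda>z. f (fst z) * g (snd z))) \<le> (norm (osc_fac TYPE(real ^ 'n)) * (c * I)) * A * B"
    if w: "wcl (\<lambda>x. japanese x powr K) f" "wcl (\<lambda>_. 1) g" and AB: "0 \<le> A" "0 \<le> B"
      and b: "bdd (2 * DIM(real ^ 'n)) A (\<lambda>x. japanese x powr K) f" "bdd (2 * k) B (\<lambda>_. 1) g"
    for f g :: "real ^ 'n \<Rightarrow> complex" and A B
  proof -
    note s = wcl_smooth[OF w(1)] wcl_smooth[OF w(2)]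
    have sj: "smooth (\<lambda>x. jw x ^ k * f x)" by (intro smooth_mult smooth_power smooth_jw s)
    have "bdd (2 * d) (2 ^ (2 * d) * C1 * A) (\<lambda>x. japanese x powr (- 2 * real k) * japanese x powr K) (\<lambda>x. jw x ^ k * f x)"
      by (rule bdd_mult) (use C1 b AB s in \<open>auto simp: d_def intro: smooth_power smooth_jw\<close>)
    then have "bdd (0 + 2 * d) (2 ^ (2 * d) * C1 * A) (\<lambda>x. japanese x powr (K - 2 * real k)) (\<lambda>x. jw x ^ k * f x)"
      by (simp add: powr_add[symmetric])
    from bdd0[OF Lop_pow_bound[OF sj this]]
    have 1: "norm ((Lop Basis ^^ d) (\<lambda>x. jw x ^ k * f x) x) \<le> (1 + real d) ^ d * (2 ^ (2 * d) * C1 * A) * japanese x powr (K - 2 * real k)" for x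
      by (simp add: d_def)
    have "bdd (0 + 2 * k) B (\<lambda>_. 1) g" using b by simp
    from bdd0[OF Lop_pow_bound[OF s(2) this]]
    have 2: "norm ((Lop Basis ^^ k) g y) \<le> (1 + real d) ^ k * B" for y by (simp add: d_def)
    have 3: "norm (jw y ^ d) = japanese y powr (- 2 * real d)" for y :: "real ^ 'n"
    proof -
      have "norm (jw y ^ d) = (japanese y powr - 2) powr real d"
        by (simp only: norm_power norm_jw powr_realpow[OF japanese_powr_pos])
      then show ?thesis by (simp add: powr_powr)
    qed
    have E: "(A1 ^^ d) ((A2 ^^ k) (\<lambda>z. f (fst z) * g (snd z))) =
       (\<lambda>z. (Lop Basis ^^ d) (\<lambda>x. jw x ^ k * f x) (fst z) * (jw (snd z) ^ d * (Lop Basis ^^ k) g (snd z)))"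
      unfolding A2_pow_tensor[OF s] by (rule A1_pow_tensor[OF sj smooth_Lop_pow[OF s(2)]])
    have pt: "norm ((A1 ^^ d) ((A2 ^^ k) (\<lambda>z. f (fst z) * g (snd z))) z) \<le> (c * A * B) * WW (K - 2 * real k) (- 2 * real d) z" for z
    proof -
      have "norm ((A1 ^^ d) ((A2 ^^ k) (\<lambda>z. f (fst z) * g (snd z))) z) \<le>
        ((1 + real d) ^ d * (2 ^ (2 * d) * C1 * A) * japanese (fst z) powr (K - 2 * real k)) *
        (japanese (snd z) powr (- 2 * real d) * ((1 + real d) ^ k * B))"
        unfolding E norm_mult 3 using C1 AB by (intro mult_mono 1 2 order_refl mult_left_mono) auto
      then show ?thesis by (simp add: c_def WW_def mult_ac)
    qed
    have "osc (\<lambda>z. f (fst z) * g (snd z)) = oscJ k (\<lambda>z. f (fst z) * g (snd z))"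
      by (rule osc_eq_oscJ[OF wcl_tensor[OF w] k])
    also have "norm \<dots> \<le> norm (osc_fac TYPE(real ^ 'n)) * (\<integral>z. (c * A * B) * WW (K - 2 * real k) (- 2 * real d) z \<partial>(lborel :: ((real ^ 'n) \<times> (real ^ 'n)) measure))"
    proof -
      let ?a = "\<lambda>z. osc_exp z * (A1 ^^ d) ((A2 ^^ k) (\<lambda>z. f (fst z) * g (snd z))) z"
      have "smooth ?a"
        using wconv_smooth(2)[OF wconv_A1_pow[OF wconv_A2_pow[OF wconv_const[OF wcl_tensor[OF w]]]]]
        by (intro smooth_mult smooth_osc_exp)
      note m = smooth_borel[OF this]
      have i2: "integrable lborel (\<lambda>z. c * A * B * WW (K - 2 * real k) (- 2 * real d) (z :: (real ^ 'n) \<times> (real ^ 'n)))"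
        by (rule integrable_mult_right[OF int])
      have n: "norm (?a z) \<le> c * A * B * WW (K - 2 * real k) (- 2 * real d) z" for z
        using pt[of z] by (simp add: norm_mult norm_osc_exp)
      have i1: "integrable lborel ?a"
        by (rule Bochner_Integration.integrable_bound[OF i2])
          (use m n in \<open>auto intro!: AE_I2 order_trans[OF _ abs_ge_self]\<close>)
      have "norm (\<integral>z. ?a z \<partial>lborel) \<le> (\<integral>z. (c * A * B) * WW (K - 2 * real k) (- 2 * real d) z \<partial>(lborel :: ((real ^ 'n) \<times> (real ^ 'n)) measure))"
        by (rule order_trans[OF integral_norm_bound integral_mono[OF integrable_norm[OF i1] i2 n]])
      then show ?thesis unfolding oscJ_def norm_mult d_def by (rule mult_left_mono) simp
    qed
    also have "\<dots> = (norm (osc_fac TYPE(real ^ 'n)) * (c * I)) * A * B"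
      by (simp add: I_def mult_ac)
    finally show ?thesis .
  qed
  then show ?thesis using c0 I0 by (intro exI[of _ "norm (osc_fac TYPE(real ^ 'n)) * (c * I)"]) auto
qed

section \<open>Symbol classes\<close>

lemma holder_norm_deriv_le:
  assumes "holder_norm t f \<le> ennreal c" "0 \<le> c" "mi_abs \<beta> \<le> nat \<lfloor>t\<rfloor>"
  shows "norm (mderiv \<beta> f x) \<le> c"
proof -
  have "ennreal (norm (mderiv \<beta> f x)) \<le> (SUP x. ennreal (norm (mderiv \<beta> f x)))" by (rule SUP_upper) simp
  also have "\<dots> \<le> (\<Sum>\<alpha> | mi_abs \<alpha> \<le> nat \<lfloor>t\<rfloor>. SUP x. ennreal (norm (mderiv \<alpha> f x)))"
    using assms(3) by (intro member_le_sum finite_mi) auto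
  also have "\<dots> \<le> holder_norm t f" unfolding holder_norm_def by simp
  also note assms(1)
  finally show ?thesis using assms(2) by (simp add: ennreal_le_iff)
qed

lemma finite_mi_eq: "finite {\<alpha>::'n::finite \<Rightarrow> nat. mi_abs \<alpha> = N}"
  by (rule finite_subset[OF _ finite_mi[of N]]) auto

lemma holder_norm_diff_le:
  assumes h: "holder_norm t f \<le> ennreal c" and c: "0 \<le> c" and b: "mi_abs \<beta> = nat \<lfloor>t\<rfloor>" and t: "frac t \<noteq> 0"
  shows "norm (mderiv \<beta> f x - mderiv \<beta> f z) \<le> c * norm (x - z) powr frac t"
proof (cases "x = z")
  case False
  let ?F = "\<lambda>\<alpha>. SUP (x, y) \<in> {(x, y). x \<noteq> y}. ennreal (norm (mderiv \<alpha> f x - mderiv \<alpha> f y) / norm (x - y) powr frac t)"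
  have "ennreal (norm (mderiv \<beta> f x - mderiv \<beta> f z) / norm (x - z) powr frac t) \<le> ?F \<beta>"
    by (rule SUP_upper2[where i = "(x, z)"]) (use False in auto)
  also have "\<dots> \<le> (\<Sum>\<alpha> | mi_abs \<alpha> = nat \<lfloor>t\<rfloor>. ?F \<alpha>)"
    using b by (intro member_le_sum finite_mi_eq) auto
  also have "\<dots> \<le> holder_norm t f" unfolding holder_norm_def using t by simp
  also note h
  finally have "norm (mderiv \<beta> f x - mderiv \<beta> f z) / norm (x - z) powr frac t \<le> c" using c by (simp add: ennreal_le_iff)
  then show ?thesis using False by (simp add: field_simps)
qed simp

text \<open>The two parts of the norm each have at most as many terms as there are multi-indices of
  order up to N. Counting up to N instead of the integer part of t makes the constant uniform in
  t.\<close>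

lemma holder_norm_leI:
  fixes f :: "real ^ 'n::finite \<Rightarrow> complex"
  assumes d: "\<And>\<beta> x. mi_abs \<beta> \<le> nat \<lfloor>t\<rfloor> \<Longrightarrow> norm (mderiv \<beta> f x) \<le> c"
    and h: "\<And>\<beta> x z. frac t \<noteq> 0 \<Longrightarrow> mi_abs \<beta> = nat \<lfloor>t\<rfloor> \<Longrightarrow> norm (mderiv \<beta> f x - mderiv \<beta> f z) \<le> c * norm (x - z) powr frac t"
    and c: "0 \<le> c" and N: "nat \<lfloor>t\<rfloor> \<le> N"
  shows "holder_norm t f \<le> ennreal (2 * real (card {\<beta>::'n \<Rightarrow> nat. mi_abs \<beta> \<le> N}) * c)"
proof -
  let ?n = "real (card {\<beta>::'n \<Rightarrow> nat. mi_abs \<beta> \<le> N})"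
  have "(\<Sum>\<alpha> | mi_abs \<alpha> \<le> nat \<lfloor>t\<rfloor>. SUP x. ennreal (norm (mderiv \<alpha> f x))) \<le> (\<Sum>\<alpha>::'n \<Rightarrow> nat | mi_abs \<alpha> \<le> nat \<lfloor>t\<rfloor>. ennreal c)"
    using d by (intro sum_mono SUP_least) (auto intro: ennreal_leI)
  also have "\<dots> \<le> (\<Sum>\<alpha>::'n \<Rightarrow> nat | mi_abs \<alpha> \<le> N. ennreal c)"
    using N by (intro sum_mono2 finite_mi) auto
  also have "\<dots> = ennreal (?n * c)" using c by (simp add: ennreal_mult ennreal_of_nat_eq_real_of_nat)
  finally have 1: "(\<Sum>\<alpha> | mi_abs \<alpha> \<le> nat \<lfloor>t\<rfloor>. SUP x. ennreal (norm (mderiv \<alpha> f x))) \<le> ennreal (?n * c)" .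
  have 2: "(if frac t = 0 then 0 else \<Sum>\<alpha> | mi_abs \<alpha> = nat \<lfloor>t\<rfloor>. SUP (x, y) \<in> {(x, y). x \<noteq> y}.
      ennreal (norm (mderiv \<alpha> f x - mderiv \<alpha> f y) / norm (x - y) powr frac t)) \<le> ennreal (?n * c)"
  proof (cases "frac t = 0")
    case False
    have "(\<Sum>\<alpha> | mi_abs \<alpha> = nat \<lfloor>t\<rfloor>. SUP (x, y) \<in> {(x, y). x \<noteq> y}.
        ennreal (norm (mderiv \<alpha> f x - mderiv \<alpha> f y) / norm (x - y) powr frac t)) \<le> (\<Sum>\<alpha>::'n \<Rightarrow> nat | mi_abs \<alpha> = nat \<lfloor>t\<rfloor>. ennreal c)"
      using h[OF False] by (intro sum_mono SUP_least) (auto intro!: ennreal_leI simp: divide_le_eq)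
    also have "\<dots> \<le> (\<Sum>\<alpha>::'n \<Rightarrow> nat | mi_abs \<alpha> \<le> N. ennreal c)"
      using N by (intro sum_mono2 finite_mi) auto
    also have "\<dots> = ennreal (?n * c)" using c by (simp add: ennreal_mult ennreal_of_nat_eq_real_of_nat)
    finally show ?thesis using False by simp
  qed simp
  have "holder_norm t f \<le> ennreal (?n * c) + ennreal (?n * c)"
    unfolding holder_norm_def by (intro add_mono 1 2)
  also have "\<dots> = ennreal (2 * ?n * c)" using c by (simp add: ennreal_plus[symmetric] del: ennreal_plus)
  finally show ?thesis .
qed

lemma japanese_le_2: "norm x \<le> 1 \<Longrightarrow> japanese x \<le> 2"
  using japanese_le[of x] by simp

text \<open>One factor 2 comes from Peetre's inequality and one from the bracket of z - \<xi>, which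
  is at most 2 on the unit ball.\<close>

lemma japanese_powr_near: "norm (z - \<xi>) \<le> 1 \<Longrightarrow> japanese z powr e \<le> 4 powr \<bar>e\<bar> * japanese \<xi> powr e"
proof -
  assume "norm (z - \<xi>) \<le> 1"
  have "japanese z powr e = japanese (\<xi> + (z - \<xi>)) powr e" by simp
  also have "\<dots> \<le> 2 powr \<bar>e\<bar> * japanese \<xi> powr e * japanese (z - \<xi>) powr \<bar>e\<bar>" by (rule peetre)
  also have "\<dots> \<le> 2 powr \<bar>e\<bar> * japanese \<xi> powr e * 2 powr \<bar>e\<bar>"
    using \<open>norm (z - \<xi>) \<le> 1\<close> by (intro mult_left_mono powr_mono2 japanese_le_2) (auto simp: japanese_pos less_imp_le)
  also have "\<dots> = 4 powr \<bar>e\<bar> * japanese \<xi> powr e" by (simp add: powr_mult[symmetric])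
  finally show ?thesis .
qed

text \<open>Holder norms of every order of all \<open>\<xi>\<close>-derivatives are reduced to supremum bounds and to
  difference quotients of exponent below 1, at the price of considering a family of functions
  that is closed under first derivatives in \<open>x\<close> and \<open>\<xi>\<close>.\<close>

lemma CS_coinduct:
  fixes S :: "real \<Rightarrow> real \<Rightarrow> (real ^ 'n::finite \<Rightarrow> real ^ 'n \<Rightarrow> complex) set"
  assumes s: "s \<in> S \<tau> m" and \<tau>: "0 \<le> \<tau>" and \<delta>: "0 \<le> \<delta>"
    and bd: "\<And>\<tau> m s. 0 \<le> \<tau> \<Longrightarrow> s \<in> S \<tau> m \<Longrightarrow> \<exists>C. \<forall>x \<xi>. norm (s x \<xi>) \<le> C * japanese \<xi> powr m"
    and ct: "\<And>\<tau> m s x \<xi>. 0 \<le> \<tau> \<Longrightarrow> s \<in> S \<tau> m \<Longrightarrow> isCont (\<lambda>x. s x \<xi>) x"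
    and dxi: "\<And>\<tau> m s b. 0 \<le> \<tau> \<Longrightarrow> s \<in> S \<tau> m \<Longrightarrow> b \<in> Basis \<Longrightarrow>
      \<exists>s'\<in>S \<tau> (m - \<rho>). \<forall>x \<xi>. has_dir_deriv (s x) b (s' x \<xi>) \<xi>"
    and dx: "\<And>\<tau> m s b. 1 \<le> \<tau> \<Longrightarrow> s \<in> S \<tau> m \<Longrightarrow> b \<in> Basis \<Longrightarrow>
      \<exists>s'\<in>S (\<tau> - 1) (m + \<delta>). \<forall>x \<xi>. has_dir_deriv (\<lambda>x. s x \<xi>) b (s' x \<xi>) x"
    and hd: "\<And>\<tau> m s. 0 \<le> \<tau> \<Longrightarrow> s \<in> S \<tau> m \<Longrightarrow> \<exists>C. \<forall>t x z \<xi>. 0 < t \<and> t < 1 \<and> t \<le> \<tau> \<longrightarrow>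
      norm (s x \<xi> - s z \<xi>) \<le> C * japanese \<xi> powr (m + \<delta> * t) * norm (x - z) powr t"
  shows "s \<in> CS \<tau> m \<rho> \<delta>"
proof -
  \<comment> \<open>Continuity in \<xi> follows from the bounds on the first \<xi>-derivatives,
    which are uniform in a unit ball around each point.\<close>
  have contxi: "isCont (s x) \<xi>" if "0 \<le> \<tau>" "s \<in> S \<tau> m" for \<tau> m s x \<xi>
  proof -
    note hyp = that
    obtain D where D: "\<And>b. b \<in> Basis \<Longrightarrow> D b \<in> S \<tau> (m - \<rho>)"
      "\<And>b x \<xi>. b \<in> Basis \<Longrightarrow> has_dir_deriv (s x) b (D b x \<xi>) \<xi>" using dxi[OF hyp] by metis
    obtain C where C: "\<And>b x \<xi>. b \<in> Basis \<Longrightarrow> norm (D b x \<xi>) \<le> C b * japanese \<xi> powr (m - \<rho>)"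
      using bd[OF hyp(1) D(1)] by metis
    define B where "B = (\<Sum>b\<in>Basis. \<bar>C b\<bar>) * (4 powr \<bar>m - \<rho>\<bar> * japanese \<xi> powr (m - \<rho>))"
    show ?thesis
    proof (rule isCont_of_bounded_partials[of "s x" "\<lambda>b. D b x" \<xi> B])
      fix b z :: "real ^ 'n" assume b: "b \<in> Basis" and z: "norm (z - \<xi>) \<le> 1"
      have "norm (D b x z) \<le> C b * japanese z powr (m - \<rho>)" by (rule C[OF b])
      also have "\<dots> \<le> (\<Sum>b\<in>Basis. \<bar>C b\<bar>) * (4 powr \<bar>m - \<rho>\<bar> * japanese \<xi> powr (m - \<rho>))"
        using member_le_sum[of b Basis "\<lambda>b. \<bar>C b\<bar>"] b japanese_powr_near[OF z]
        by (intro mult_mono) (auto intro: sum_nonneg)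
      finally show "norm (D b x z) \<le> B" by (simp add: B_def)
    qed (use D in auto)
  qed
  have A: "\<exists>s'\<in>S \<tau> (m - \<rho> * real (length ws)). \<forall>x. iter_deriv ws (s x) = s' x"
    if "set ws \<subseteq> Basis" "0 \<le> \<tau>" "s \<in> S \<tau> m" for ws \<tau> m s
    using that
  proof (induction ws)
    case (Cons b ws)
    then obtain s' where s': "s' \<in> S \<tau> (m - \<rho> * real (length ws))" "\<And>x. iter_deriv ws (s x) = s' x" by auto
    obtain D where D: "\<And>b. b \<in> Basis \<Longrightarrow> D b \<in> S \<tau> (m - \<rho> * real (length ws) - \<rho>)"
      "\<And>b x \<xi>. b \<in> Basis \<Longrightarrow> has_dir_deriv (s' x) b (D b x \<xi>) \<xi>"
      using dxi[OF Cons.prems(2) s'(1)] by metis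
    have cD: "b \<in> Basis \<Longrightarrow> isCont (D b x) \<xi>" for b x \<xi> by (rule contxi[OF Cons.prems(2) D(1)])
    have "frechet_derivative (s' x) (at \<xi>) b = D b x \<xi>" for x \<xi>
      by (rule frechet_derivative_of_partials(2)) (use D(2) cD Cons.prems(1) in auto)
    then have "iter_deriv (b # ws) (s x) = D b x" for x by (simp add: s'(2))
    moreover have "m - \<rho> * real (length (b # ws)) = m - \<rho> * real (length ws) - \<rho>" by (simp add: algebra_simps)
    ultimately show ?case using D(1)[of b] Cons.prems(1) by (simp only: list.set insert_subset) blast
  qed auto
  have smooth: "smooth (s x)" if "0 \<le> \<tau>" "s \<in> S \<tau> m" for \<tau> m s x
    unfolding smooth_iff
  proof (intro allI impI)
    note hyp = that
    fix ws :: "(real ^ 'n) list" and \<xi> assume "set ws \<subseteq> Basis"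
    then obtain s' where s': "s' \<in> S \<tau> (m - \<rho> * real (length ws))" "\<And>x. iter_deriv ws (s x) = s' x"
      using A[OF _ hyp] by blast
    obtain D where D: "\<And>b. b \<in> Basis \<Longrightarrow> D b \<in> S \<tau> (m - \<rho> * real (length ws) - \<rho>)"
      "\<And>b x \<xi>. b \<in> Basis \<Longrightarrow> has_dir_deriv (s' x) b (D b x \<xi>) \<xi>"
      using dxi[OF hyp(1) s'(1)] by metis
    have cD: "b \<in> Basis \<Longrightarrow> isCont (D b x) \<xi>" for b x \<xi> by (rule contxi[OF hyp(1) D(1)])
    show "iter_deriv ws (s x) differentiable (at \<xi>)" unfolding s'(2)
      by (rule frechet_derivative_of_partials(1)[OF D(2) cD])
  qed
  have pdx: "(\<lambda>x. s x \<xi>) differentiable (at x)" "\<exists>D\<in>S (\<tau> - 1) (m + \<delta>). \<forall>\<xi>. pd b (\<lambda>x. s x \<xi>) = (\<lambda>x. D x \<xi>)"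
    if "1 \<le> \<tau>" "s \<in> S \<tau> m" "b \<in> Basis" for \<tau> m s x \<xi> b
  proof -
    note hyp = that
    obtain D where D: "\<And>b. b \<in> Basis \<Longrightarrow> D b \<in> S (\<tau> - 1) (m + \<delta>)"
      "\<And>b x \<xi>. b \<in> Basis \<Longrightarrow> has_dir_deriv (\<lambda>x. s x \<xi>) b (D b x \<xi>) x" using dx[OF hyp(1,2)] by metis
    have t1: "0 \<le> \<tau> - 1" using hyp(1) by simp
    have cD: "b \<in> Basis \<Longrightarrow> isCont (\<lambda>x. D b x \<xi>) x" for b x \<xi> by (rule ct[OF t1 D(1)])
    show "(\<lambda>x. s x \<xi>) differentiable (at x)"
      by (rule frechet_derivative_of_partials(1)[of "\<lambda>x. s x \<xi>" "\<lambda>b x. D b x \<xi>", OF D(2) cD])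
    have "frechet_derivative (\<lambda>x. s x \<xi>) (at x) b = D b x \<xi>" for x \<xi>
      by (rule frechet_derivative_of_partials(2)[of "\<lambda>x. s x \<xi>" "\<lambda>b x. D b x \<xi>"])
        (use D(2) cD hyp(3) in auto)
    then show "\<exists>D\<in>S (\<tau> - 1) (m + \<delta>). \<forall>\<xi>. pd b (\<lambda>x. s x \<xi>) = (\<lambda>x. D x \<xi>)"
      using D(1)[OF hyp(3)] by auto
  qed
  \<comment> \<open>Each x-derivative trades one unit of regularity for \<delta> in the order, so
    the remaining regularity stays nonnegative up to the integer part of \<tau>.\<close>
  have B: "\<exists>s'\<in>S (\<tau> - real (length vs)) (m + \<delta> * real (length vs)). \<forall>\<xi>. iter_deriv vs (\<lambda>x. s x \<xi>) = (\<lambda>x. s' x \<xi>)"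
    if "set vs \<subseteq> Basis" "length vs \<le> nat \<lfloor>\<tau>\<rfloor>" "0 \<le> \<tau>" "s \<in> S \<tau> m" for vs \<tau> m s
    using that
  proof (induction vs)
    case (Cons b vs)
    then obtain s' where s': "s' \<in> S (\<tau> - real (length vs)) (m + \<delta> * real (length vs))" "\<And>\<xi>. iter_deriv vs (\<lambda>x. s x \<xi>) = (\<lambda>x. s' x \<xi>)"
      by auto
    have "1 \<le> \<tau> - real (length vs)" using Cons.prems(2,3) by simp linarith
    from pdx(2)[OF this s'(1), of b] Cons.prems
    obtain D where "D \<in> S (\<tau> - real (length vs) - 1) (m + \<delta> * real (length vs) + \<delta>)" "\<And>\<xi>. pd b (\<lambda>x. s' x \<xi>) = (\<lambda>x. D x \<xi>)" by auto
    moreover have "\<tau> - real (length vs) - 1 = \<tau> - real (length (b # vs))" "m + \<delta> * real (length vs) + \<delta> = m + \<delta> * real (length (b # vs))"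
      by (simp_all add: algebra_simps)
    ultimately show ?case using s'(2) by (intro bexI[of _ D]) auto
  qed auto
  have Ck: "Ck (nat \<lfloor>\<tau>\<rfloor>) (\<lambda>x. s x \<xi>)" if "0 \<le> \<tau>" "s \<in> S \<tau> m" for \<tau> m s \<xi>
    unfolding Ck_def
  proof (intro conjI allI impI)
    note hyp = that
    fix vs :: "(real ^ 'n) list" assume vs: "set vs \<subseteq> Basis \<and> length vs < nat \<lfloor>\<tau>\<rfloor>"
    then obtain s' where s': "s' \<in> S (\<tau> - real (length vs)) (m + \<delta> * real (length vs))" "iter_deriv vs (\<lambda>x. s x \<xi>) = (\<lambda>x. s' x \<xi>)"
      using B[OF _ _ hyp, of vs] by auto
    have "1 \<le> \<tau> - real (length vs)" using vs hyp by linarith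
    from pdx(1)[OF this s'(1) SOME_Basis]
    show "iter_deriv vs (\<lambda>x. s x \<xi>) differentiable_on UNIV" unfolding s'(2) differentiable_on_def by auto
  next
    note hyp = that
    fix vs :: "(real ^ 'n) list" assume vs: "set vs \<subseteq> Basis \<and> length vs \<le> nat \<lfloor>\<tau>\<rfloor>"
    then obtain s' where s': "s' \<in> S (\<tau> - real (length vs)) (m + \<delta> * real (length vs))" "iter_deriv vs (\<lambda>x. s x \<xi>) = (\<lambda>x. s' x \<xi>)"
      using B[OF _ _ hyp, of vs] by auto
    have "0 \<le> \<tau> - real (length vs)" using vs hyp by linarith
    from ct[OF this s'(1)] show "continuous_on UNIV (iter_deriv vs (\<lambda>x. s x \<xi>))"
      unfolding s'(2) by (auto intro: continuous_at_imp_continuous_on)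
  qed
  define N where "N = nat \<lfloor>\<tau>\<rfloor>"
  have main: "\<exists>C\<ge>0. (\<forall>x \<xi>. norm (s x \<xi>) \<le> C * japanese \<xi> powr m) \<and>
      (\<forall>t \<xi>. 0 \<le> t \<and> t \<le> \<tau> \<longrightarrow> holder_norm t (\<lambda>x. s x \<xi>) \<le> ennreal (C * japanese \<xi> powr (m + \<delta> * t)))"
    if s: "s \<in> S \<tau> m" for m s
  proof -
    have "\<forall>\<beta>\<in>{\<beta>::'n \<Rightarrow> nat. mi_abs \<beta> \<le> N}. \<exists>s'\<in>S (\<tau> - real (mi_abs \<beta>)) (m + \<delta> * real (mi_abs \<beta>)). \<forall>\<xi>. mderiv \<beta> (\<lambda>x. s x \<xi>) = (\<lambda>x. s' x \<xi>)"
      using B[OF mi_list_Basis _ \<tau> s] unfolding mderiv_mi_list length_mi_list N_def by auto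
    then obtain sb where sb: "\<And>\<beta>. mi_abs \<beta> \<le> N \<Longrightarrow> sb \<beta> \<in> S (\<tau> - real (mi_abs \<beta>)) (m + \<delta> * real (mi_abs \<beta>))"
      "\<And>\<beta> \<xi>. mi_abs \<beta> \<le> N \<Longrightarrow> mderiv \<beta> (\<lambda>x. s x \<xi>) = (\<lambda>x. sb \<beta> x \<xi>)" by (metis mem_Collect_eq)
    have nn: "0 \<le> \<tau> - real (mi_abs \<beta>)" if "mi_abs \<beta> \<le> N" for \<beta> :: "'n \<Rightarrow> nat" using that \<tau> unfolding N_def by linarith
    obtain C1 where C1: "\<And>\<beta> x \<xi>. mi_abs \<beta> \<le> N \<Longrightarrow> norm (sb \<beta> x \<xi>) \<le> C1 \<beta> * japanese \<xi> powr (m + \<delta> * real (mi_abs \<beta>))"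
      using bd[OF nn sb(1)] by metis
    obtain C2 where C2: "\<And>\<beta> t x z \<xi>. mi_abs \<beta> \<le> N \<Longrightarrow> 0 < t \<Longrightarrow> t < 1 \<Longrightarrow> t \<le> \<tau> - real (mi_abs \<beta>) \<Longrightarrow>
      norm (sb \<beta> x \<xi> - sb \<beta> z \<xi>) \<le> C2 \<beta> * japanese \<xi> powr (m + \<delta> * real (mi_abs \<beta>) + \<delta> * t) * norm (x - z) powr t"
      using hd[OF nn sb(1)] by metis
    obtain C0 where C0: "\<And>x \<xi>. norm (s x \<xi>) \<le> C0 * japanese \<xi> powr m" using bd[OF \<tau> s] by blast
    define M where "M = (\<Sum>\<beta> | mi_abs \<beta> \<le> N. \<bar>C1 \<beta>\<bar> + \<bar>C2 \<beta>\<bar>)"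
    have M: "\<bar>C1 \<beta>\<bar> \<le> M" "\<bar>C2 \<beta>\<bar> \<le> M" if "mi_abs \<beta> \<le> N" for \<beta>
      using member_le_sum[of \<beta> "{\<beta>. mi_abs \<beta> \<le> N}" "\<lambda>\<beta>. \<bar>C1 \<beta>\<bar> + \<bar>C2 \<beta>\<bar>"] that
      by (auto simp: M_def finite_mi)
    have M0: "M \<ge> 0" unfolding M_def by (intro sum_nonneg) auto
    define n where "n = real (card {\<beta>::'n \<Rightarrow> nat. mi_abs \<beta> \<le> N})"
    \<comment> \<open>The first summand serves the supremum bound and the second the Holder norms. M
      and n range over all multi-indices up to the integer part of \<tau>, so C does not depend on
      t.\<close>
    define C where "C = \<bar>C0\<bar> + 2 * n * M"
    have hn: "holder_norm t (\<lambda>x. s x \<xi>) \<le> ennreal (C * japanese \<xi> powr (m + \<delta> * t))" if t: "0 \<le> t" "t \<le> \<tau>" for t \<xi>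
    proof -
      let ?c = "M * japanese \<xi> powr (m + \<delta> * t)"
      have tN: "nat \<lfloor>t\<rfloor> \<le> N" unfolding N_def using t by (intro nat_mono floor_mono)
      have "holder_norm t (\<lambda>x. s x \<xi>) \<le> ennreal (2 * real (card {\<beta>::'n \<Rightarrow> nat. mi_abs \<beta> \<le> N}) * ?c)"
      proof (rule holder_norm_leI)
        show "nat \<lfloor>t\<rfloor> \<le> N" by (rule tN)
        show "0 \<le> ?c" using M0 by simp
      next
        fix \<beta> :: "'n \<Rightarrow> nat" and x assume b: "mi_abs \<beta> \<le> nat \<lfloor>t\<rfloor>"
        then have bN: "mi_abs \<beta> \<le> N" using tN by simp
        have "real (mi_abs \<beta>) \<le> t" using b t by linarith
        then have le: "m + \<delta> * real (mi_abs \<beta>) \<le> m + \<delta> * t" using \<delta> by (simp add: mult_left_mono)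
        have "norm (sb \<beta> x \<xi>) \<le> C1 \<beta> * japanese \<xi> powr (m + \<delta> * real (mi_abs \<beta>))" by (rule C1[OF bN])
        also have "\<dots> \<le> ?c" using M(1)[OF bN] M0 japanese_powr_mono[OF le] by (intro mult_mono) auto
        finally show "norm (mderiv \<beta> (\<lambda>x. s x \<xi>) x) \<le> ?c" by (simp add: sb(2)[OF bN])
      next
        fix \<beta> :: "'n \<Rightarrow> nat" and x z assume f: "frac t \<noteq> 0" and b: "mi_abs \<beta> = nat \<lfloor>t\<rfloor>"
        then have bN: "mi_abs \<beta> \<le> N" using tN by simp
        \<comment> \<open>The losses add up to \<delta> t: the derivatives cost \<delta> times their
          number, and the difference quotient costs \<delta> times the fractional part.\<close>
        have tt: "t = real (mi_abs \<beta>) + frac t" using b t by (simp add: frac_def)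
        have fr: "0 < frac t" "frac t < 1" using f frac_ge_0[of t] frac_lt_1[of t] by auto
        have "norm (sb \<beta> x \<xi> - sb \<beta> z \<xi>) \<le> C2 \<beta> * japanese \<xi> powr (m + \<delta> * real (mi_abs \<beta>) + \<delta> * frac t) * norm (x - z) powr frac t"
          by (rule C2[OF bN fr]) (use tt t in linarith)
        also have "m + \<delta> * real (mi_abs \<beta>) + \<delta> * frac t = m + \<delta> * t"
          using arg_cong[OF tt, of "\<lambda>t. \<delta> * t"] by (simp add: distrib_left)
        also have "C2 \<beta> * japanese \<xi> powr (m + \<delta> * t) * norm (x - z) powr frac t \<le> ?c * norm (x - z) powr frac t"
          using M(2)[OF bN] by (intro mult_right_mono) auto
        finally show "norm (mderiv \<beta> (\<lambda>x. s x \<xi>) x - mderiv \<beta> (\<lambda>x. s x \<xi>) z) \<le> ?c * norm (x - z) powr frac t" by (simp add: sb(2)[OF bN])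
      qed
      also have "\<dots> \<le> ennreal (C * japanese \<xi> powr (m + \<delta> * t))"
        unfolding C_def n_def[symmetric] using M0 by (intro ennreal_leI) (simp add: distrib_right mult.assoc)
      finally show ?thesis .
    qed
    have n0: "0 \<le> n" by (simp add: n_def)
    have "norm (s x \<xi>) \<le> C * japanese \<xi> powr m" for x \<xi>
    proof (rule order_trans[OF C0 mult_right_mono])
      have "0 \<le> 2 * n * M" using n0 M0 by simp
      then show "C0 \<le> C" unfolding C_def by linarith
    qed simp
    then show ?thesis using hn n0 M0 by (intro exI[of _ C]) (auto simp: C_def)
  qed
  show ?thesis unfolding CS_def
  proof (intro CollectI conjI allI)
    show "smooth (s x)" for x by (rule smooth[OF \<tau> s])
    fix \<alpha> :: "'n \<Rightarrow> nat"
    obtain s' where s': "s' \<in> S \<tau> (m - \<rho> * real (mi_abs \<alpha>))" "\<And>x. mderiv \<alpha> (s x) = s' x"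
      using A[OF mi_list_Basis \<tau> s, of \<alpha>] unfolding mderiv_mi_list length_mi_list by auto
    obtain C where C: "C \<ge> 0" "\<And>x \<xi>. norm (s' x \<xi>) \<le> C * japanese \<xi> powr (m - \<rho> * real (mi_abs \<alpha>))"
      "\<And>t \<xi>. 0 \<le> t \<and> t \<le> \<tau> \<Longrightarrow> holder_norm t (\<lambda>x. s' x \<xi>) \<le> ennreal (C * japanese \<xi> powr (m - \<rho> * real (mi_abs \<alpha>) + \<delta> * t))"
      using main[OF s'(1)] by blast
    show "\<exists>C. (\<forall>x \<xi>. norm (mderiv \<alpha> (s x) \<xi>) \<le> C * japanese \<xi> powr (m - \<rho> * real (mi_abs \<alpha>))) \<and>
        (\<forall>t \<xi>. 0 \<le> t \<and> t \<le> \<tau> \<longrightarrow> holder_norm t (\<lambda>x. mderiv \<alpha> (s x) \<xi>)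
             \<le> ennreal (C * japanese \<xi> powr (m - \<rho> * real (mi_abs \<alpha>) + \<delta> * t)))"
      unfolding s'(2) using C by (intro exI[of _ C]) auto
    show "(\<lambda>x. mderiv \<alpha> (s x) \<xi>) \<in> holder_space \<tau>" for \<xi>
      unfolding holder_space_def s'(2) using Ck[OF \<tau> s'(1)] C(3)[of \<tau> \<xi>] \<tau>
      by (auto intro: le_less_trans[OF _ ennreal_less_top])
  qed
qed

text \<open>The \<xi>-derivatives are taken first because \<open>CS\<close> controls the
  x-regularity of \<xi>-derivatives; nothing is given directly about the other order.\<close>

definition mixed_deriv :: "'a::real_normed_vector list \<Rightarrow> 'b::real_normed_vector list \<Rightarrow> ('a \<Rightarrow> 'b \<Rightarrow> complex) \<Rightarrow> 'a \<Rightarrow> 'b \<Rightarrow> complex" where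
  "mixed_deriv vs ws p x \<xi> = iter_deriv vs (\<lambda>x. iter_deriv ws (p x) \<xi>) x"

lemma mixed_deriv_Nil: "mixed_deriv [] ws p x = iter_deriv ws (p x)" "mixed_deriv [] [] p = p" "mixed_deriv vs [] p x \<xi> = iter_deriv vs (\<lambda>x. p x \<xi>) x"
  by (auto simp: mixed_deriv_def fun_eq_iff)

lemma CS_smooth: "p \<in> CS \<tau> m \<rho> \<delta> \<Longrightarrow> smooth (p x)" by (auto simp: CS_def)

lemma CS_Ck:
  fixes p :: "real ^ 'n::finite \<Rightarrow> real ^ 'n \<Rightarrow> complex"
  assumes "p \<in> CS \<tau> m \<rho> \<delta>" "set ws \<subseteq> Basis"
  shows "Ck (nat \<lfloor>\<tau>\<rfloor>) (\<lambda>x. iter_deriv ws (p x) \<xi>)"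
  using assms unfolding smooth_iter_deriv_mderiv[OF CS_smooth[OF assms(1)] assms(2)]
  by (auto simp: CS_def holder_space_def)

lemma CS_const:
  fixes p :: "real ^ 'n::finite \<Rightarrow> real ^ 'n \<Rightarrow> complex"
  assumes p: "p \<in> CS \<tau> m \<rho> \<delta>" and ws: "set ws \<subseteq> Basis"
  shows "\<exists>C\<ge>0. \<forall>t \<xi>. 0 \<le> t \<and> t \<le> \<tau> \<longrightarrow> holder_norm t (\<lambda>x. iter_deriv ws (p x) \<xi>) \<le> ennreal (C * japanese \<xi> powr (m - \<rho> * real (length ws) + \<delta> * t))"
proof -
  obtain C where C: "\<And>x \<xi>. norm (mderiv (mi_of ws) (p x) \<xi>) \<le> C * japanese \<xi> powr (m - \<rho> * real (mi_abs (mi_of ws)))"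
    "\<And>t \<xi>. 0 \<le> t \<and> t \<le> \<tau> \<Longrightarrow> holder_norm t (\<lambda>x. mderiv (mi_of ws) (p x) \<xi>)
             \<le> ennreal (C * japanese \<xi> powr (m - \<rho> * real (mi_abs (mi_of ws)) + \<delta> * t))"
    using p unfolding CS_def by blast
  have "C \<ge> 0" using order_trans[OF norm_ge_zero C(1)[of 0 0]] japanese_powr_pos[of 0]
    by (simp add: zero_le_mult_iff japanese_def)
  then show ?thesis
    using C(2) unfolding smooth_iter_deriv_mderiv[OF CS_smooth[OF p] ws] mi_abs_mi_of[OF ws] by blast
qed

lemma CS_mixed_deriv_mderiv:
  fixes p :: "real ^ 'n::finite \<Rightarrow> real ^ 'n \<Rightarrow> complex"
  assumes p: "p \<in> CS \<tau> m \<rho> \<delta>" and ws: "set ws \<subseteq> Basis" "set vs \<subseteq> Basis" "length vs \<le> nat \<lfloor>\<tau>\<rfloor>"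
  shows "mixed_deriv vs ws p x \<xi> = mderiv (mi_of vs) (\<lambda>x. iter_deriv ws (p x) \<xi>) x"
  unfolding mixed_deriv_def by (simp add: Ck_iter_deriv_mderiv[OF CS_Ck[OF p ws(1)] ws(2,3)])

text \<open>The Holder norm at the integer t = \<open>length vs\<close> contains the supremum of
  this x-derivative.\<close>

lemma CS_bound:
  fixes p :: "real ^ 'n::finite \<Rightarrow> real ^ 'n \<Rightarrow> complex"
  assumes p: "p \<in> CS \<tau> m \<rho> \<delta>" and \<tau>: "0 \<le> \<tau>" and ws: "set ws \<subseteq> Basis" "set vs \<subseteq> Basis" "length vs \<le> nat \<lfloor>\<tau>\<rfloor>"
  shows "\<exists>C\<ge>0. \<forall>x \<xi>. norm (mixed_deriv vs ws p x \<xi>) \<le> C * japanese \<xi> powr (m - \<rho> * real (length ws) + \<delta> * real (length vs))"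
proof -
  obtain C where C: "C \<ge> 0" "\<And>t \<xi>. 0 \<le> t \<and> t \<le> \<tau> \<Longrightarrow> holder_norm t (\<lambda>x. iter_deriv ws (p x) \<xi>) \<le> ennreal (C * japanese \<xi> powr (m - \<rho> * real (length ws) + \<delta> * t))"
    using CS_const[OF p ws(1)] by blast
  have le: "0 \<le> real (length vs) \<and> real (length vs) \<le> \<tau>" using ws \<tau> by linarith
  have "norm (mixed_deriv vs ws p x \<xi>) \<le> C * japanese \<xi> powr (m - \<rho> * real (length ws) + \<delta> * real (length vs))" for x \<xi>
    unfolding CS_mixed_deriv_mderiv[OF p ws]
    by (rule holder_norm_deriv_le[OF C(2)[OF le]]) (use C ws in \<open>auto simp: mi_abs_mi_of\<close>)
  then show ?thesis using C by blast
qed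

text \<open>The Holder norm is taken at \<open>length vs + t\<close>, whose integer part is
  \<open>length vs\<close> and whose fractional part is t.\<close>

lemma CS_holder:
  fixes p :: "real ^ 'n::finite \<Rightarrow> real ^ 'n \<Rightarrow> complex"
  assumes p: "p \<in> CS \<tau> m \<rho> \<delta>" and ws: "set ws \<subseteq> Basis" "set vs \<subseteq> Basis"
  shows "\<exists>C\<ge>0. \<forall>t x z \<xi>. 0 < t \<and> t < 1 \<and> real (length vs) + t \<le> \<tau> \<longrightarrow> norm (mixed_deriv vs ws p x \<xi> - mixed_deriv vs ws p z \<xi>) \<le>
    C * japanese \<xi> powr (m - \<rho> * real (length ws) + \<delta> * real (length vs) + \<delta> * t) * norm (x - z) powr t"
proof -
  obtain C where C: "C \<ge> 0" "\<And>t \<xi>. 0 \<le> t \<and> t \<le> \<tau> \<Longrightarrow> holder_norm t (\<lambda>x. iter_deriv ws (p x) \<xi>) \<le> ennreal (C * japanese \<xi> powr (m - \<rho> * real (length ws) + \<delta> * t))"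
    using CS_const[OF p ws(1)] by blast
  have "norm (mixed_deriv vs ws p x \<xi> - mixed_deriv vs ws p z \<xi>) \<le>
    C * japanese \<xi> powr (m - \<rho> * real (length ws) + \<delta> * real (length vs) + \<delta> * t) * norm (x - z) powr t"
    if t: "0 < t" "t < 1" "real (length vs) + t \<le> \<tau>" for t x z \<xi>
  proof -
    let ?t = "real (length vs) + t"
    have fl: "\<lfloor>?t\<rfloor> = int (length vs)" using t by linarith
    then have fr: "frac ?t = t" by (simp add: frac_def)
    have le: "length vs \<le> nat \<lfloor>\<tau>\<rfloor>" using t fl floor_mono[OF t(3)] by linarith
    have b: "0 \<le> ?t \<and> ?t \<le> \<tau>" using t by linarith
    have e: "m - \<rho> * real (length ws) + \<delta> * ?t = m - \<rho> * real (length ws) + \<delta> * real (length vs) + \<delta> * t"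
      by (simp add: algebra_simps)
    show ?thesis
      using holder_norm_diff_le[OF C(2)[OF b], where \<beta> = "mi_of vs" and x = x and z = z] C(1) t
      unfolding fr e fl by (simp add: CS_mixed_deriv_mderiv[OF p ws le] mi_abs_mi_of[OF ws(2)])
  qed
  then show ?thesis using C by blast
qed

text \<open>For finite regularity in \<open>x\<close> the joint continuity of the mixed derivative is not at hand. The
  bound on \<open>\<partial>\<^sub>x \<partial>\<^sub>\<xi>\<^sup>2 h\<close> replaces it: it makes the second difference of \<open>h\<close> with steps \<open>\<epsilon>\<close> in \<open>x\<close> and
  \<open>s\<close> in \<open>\<xi>\<close> equal to \<open>s\<close> times a first difference of \<open>k\<close> up to \<open>O(\<epsilon> s\<^sup>2)\<close>.\<close>

lemma swap_dir_deriv: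
  fixes h k k2 hc kc k2c :: "'a::real_normed_vector \<Rightarrow> 'b::real_normed_vector \<Rightarrow> complex"
  assumes hk: "\<And>x \<xi>. has_dir_deriv (h x) b (k x \<xi>) \<xi>" and kk: "\<And>x \<xi>. has_dir_deriv (k x) b (k2 x \<xi>) \<xi>"
    and hc: "\<And>x \<xi>. has_dir_deriv (\<lambda>x. h x \<xi>) c (hc x \<xi>) x" and kc: "\<And>x \<xi>. has_dir_deriv (\<lambda>x. k x \<xi>) c (kc x \<xi>) x"
    and k2c: "\<And>x \<xi>. has_dir_deriv (\<lambda>x. k2 x \<xi>) c (k2c x \<xi>) x"
    and bd: "\<And>x u. \<bar>u\<bar> \<le> 1 \<Longrightarrow> norm (k2c x (\<xi> + u *\<^sub>R b)) \<le> B"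
  shows "has_dir_deriv (hc x) b (kc x \<xi>) \<xi>"
proof -
  have seg: "\<bar>u\<bar> \<le> \<bar>s\<bar>" if "u \<in> closed_segment 0 s" for u s :: real
    using that by (auto simp: closed_segment_eq_real_ivl split: if_splits)
  \<comment> \<open>Three mean value bounds in succession: the first differences of
    \<open>k2\<close> in x give B \<bar>\<epsilon>\<bar>, and passing to k and then to h contributes
    a factor \<bar>s\<bar> each.\<close>
  have fin: "norm (h (x + \<epsilon> *\<^sub>R c) (\<xi> + s *\<^sub>R b) - h x (\<xi> + s *\<^sub>R b) - (h (x + \<epsilon> *\<^sub>R c) \<xi> - h x \<xi>)
      - s *\<^sub>R (k (x + \<epsilon> *\<^sub>R c) \<xi> - k x \<xi>)) \<le> (B * \<bar>\<epsilon>\<bar> * \<bar>s\<bar>) * \<bar>s\<bar>" if s: "\<bar>s\<bar> \<le> 1" for \<epsilon> s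
  proof -
    have k2b: "norm (k2 (x + \<epsilon> *\<^sub>R c) (\<xi> + u *\<^sub>R b) - k2 x (\<xi> + u *\<^sub>R b)) \<le> B * \<bar>\<epsilon>\<bar>" if "\<bar>u\<bar> \<le> 1" for u
      using has_dir_deriv_mean_value[of \<epsilon> "\<lambda>x. k2 x (\<xi> + u *\<^sub>R b)" c "\<lambda>x. k2c x (\<xi> + u *\<^sub>R b)" x 0 B] k2c bd[OF that] by simp
    have kb: "norm (k (x + \<epsilon> *\<^sub>R c) (\<xi> + u *\<^sub>R b) - k x (\<xi> + u *\<^sub>R b) - (k (x + \<epsilon> *\<^sub>R c) \<xi> - k x \<xi>)) \<le> B * \<bar>\<epsilon>\<bar> * \<bar>u\<bar>" if u: "\<bar>u\<bar> \<le> 1" for u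
    proof -
      have "norm ((k (x + \<epsilon> *\<^sub>R c) (\<xi> + u *\<^sub>R b) - k x (\<xi> + u *\<^sub>R b)) - (k (x + \<epsilon> *\<^sub>R c) (\<xi> + 0 *\<^sub>R b) - k x (\<xi> + 0 *\<^sub>R b)) - u *\<^sub>R 0) \<le> (B * \<bar>\<epsilon>\<bar>) * \<bar>u\<bar>"
      proof (rule mean_value_affine[where \<phi>' = "\<lambda>u. k2 (x + \<epsilon> *\<^sub>R c) (\<xi> + u *\<^sub>R b) - k2 x (\<xi> + u *\<^sub>R b)"])
        fix v assume v: "v \<in> closed_segment 0 u"
        show "((\<lambda>u. k (x + \<epsilon> *\<^sub>R c) (\<xi> + u *\<^sub>R b) - k x (\<xi> + u *\<^sub>R b)) has_vector_derivative
            k2 (x + \<epsilon> *\<^sub>R c) (\<xi> + v *\<^sub>R b) - k2 x (\<xi> + v *\<^sub>R b)) (at v)"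
          by (intro has_vector_derivative_diff has_dir_deriv_line kk)
        have "\<bar>v\<bar> \<le> 1" using seg[OF v] u by simp
        from k2b[OF this] show "norm (k2 (x + \<epsilon> *\<^sub>R c) (\<xi> + v *\<^sub>R b) - k2 x (\<xi> + v *\<^sub>R b) - 0) \<le> B * \<bar>\<epsilon>\<bar>" by simp
      qed
      then show ?thesis by simp
    qed
    have "norm ((h (x + \<epsilon> *\<^sub>R c) (\<xi> + s *\<^sub>R b) - h x (\<xi> + s *\<^sub>R b)) - (h (x + \<epsilon> *\<^sub>R c) (\<xi> + 0 *\<^sub>R b) - h x (\<xi> + 0 *\<^sub>R b))
      - s *\<^sub>R (k (x + \<epsilon> *\<^sub>R c) \<xi> - k x \<xi>)) \<le> (B * \<bar>\<epsilon>\<bar> * \<bar>s\<bar>) * \<bar>s\<bar>"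
    proof (rule mean_value_affine[where \<phi>' = "\<lambda>u. k (x + \<epsilon> *\<^sub>R c) (\<xi> + u *\<^sub>R b) - k x (\<xi> + u *\<^sub>R b)"])
      fix u assume u: "u \<in> closed_segment 0 s"
      show "((\<lambda>u. h (x + \<epsilon> *\<^sub>R c) (\<xi> + u *\<^sub>R b) - h x (\<xi> + u *\<^sub>R b)) has_vector_derivative
          k (x + \<epsilon> *\<^sub>R c) (\<xi> + u *\<^sub>R b) - k x (\<xi> + u *\<^sub>R b)) (at u)"
        using hk by (intro has_vector_derivative_diff has_dir_deriv_line) auto
      have "0 \<le> B" using bd[of 0] norm_ge_zero order_trans by (metis abs_zero zero_le_one)
      then have "B * \<bar>\<epsilon>\<bar> * \<bar>u\<bar> \<le> B * \<bar>\<epsilon>\<bar> * \<bar>s\<bar>" using seg[OF u] by (intro mult_left_mono) auto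
      then show "norm (k (x + \<epsilon> *\<^sub>R c) (\<xi> + u *\<^sub>R b) - k x (\<xi> + u *\<^sub>R b) - (k (x + \<epsilon> *\<^sub>R c) \<xi> - k x \<xi>)) \<le> B * \<bar>\<epsilon>\<bar> * \<bar>s\<bar>"
        using kb[of u] seg[OF u] s by linarith
    qed
    then show ?thesis by simp
  qed
  \<comment> \<open>The previous estimate divided by \<epsilon>, in the limit where \<epsilon> tends
    to 0: the error is quadratic in s, which is enough for differentiability.\<close>
  have lim: "norm (hc x (\<xi> + s *\<^sub>R b) - hc x \<xi> - s *\<^sub>R kc x \<xi>) \<le> B * \<bar>s\<bar> * \<bar>s\<bar>" if s: "\<bar>s\<bar> \<le> 1" for s
  proof (rule tendsto_upperbound)
    let ?q = "\<lambda>f \<epsilon>. (f (x + \<epsilon> *\<^sub>R c) - f x) /\<^sub>R \<epsilon>"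
    have "((\<lambda>\<epsilon>. ?q (\<lambda>x. h x (\<xi> + s *\<^sub>R b)) \<epsilon> - ?q (\<lambda>x. h x \<xi>) \<epsilon> - s *\<^sub>R ?q (\<lambda>x. k x \<xi>) \<epsilon>) \<longlongrightarrow> hc x (\<xi> + s *\<^sub>R b) - hc x \<xi> - s *\<^sub>R kc x \<xi>) (at 0)"
      using hc kc unfolding has_dir_deriv_iff_tendsto by (intro tendsto_diff tendsto_scaleR tendsto_const) auto
    then show "((\<lambda>\<epsilon>. norm (?q (\<lambda>x. h x (\<xi> + s *\<^sub>R b)) \<epsilon> - ?q (\<lambda>x. h x \<xi>) \<epsilon> - s *\<^sub>R ?q (\<lambda>x. k x \<xi>) \<epsilon>)) \<longlongrightarrow> norm (hc x (\<xi> + s *\<^sub>R b) - hc x \<xi> - s *\<^sub>R kc x \<xi>)) (at 0)"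
      by (rule tendsto_norm)
    show "\<forall>\<^sub>F \<epsilon> in at 0. norm (?q (\<lambda>x. h x (\<xi> + s *\<^sub>R b)) \<epsilon> - ?q (\<lambda>x. h x \<xi>) \<epsilon> - s *\<^sub>R ?q (\<lambda>x. k x \<xi>) \<epsilon>) \<le> B * \<bar>s\<bar> * \<bar>s\<bar>"
      unfolding eventually_at
    proof (rule exI[of _ 1], safe)
      fix \<epsilon> :: real assume e: "\<epsilon> \<noteq> 0"
      have "?q (\<lambda>x. h x (\<xi> + s *\<^sub>R b)) \<epsilon> - ?q (\<lambda>x. h x \<xi>) \<epsilon> - s *\<^sub>R ?q (\<lambda>x. k x \<xi>) \<epsilon> =
        (h (x + \<epsilon> *\<^sub>R c) (\<xi> + s *\<^sub>R b) - h x (\<xi> + s *\<^sub>R b) - (h (x + \<epsilon> *\<^sub>R c) \<xi> - h x \<xi>)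
      - s *\<^sub>R (k (x + \<epsilon> *\<^sub>R c) \<xi> - k x \<xi>)) /\<^sub>R \<epsilon>"
        by (simp add: algebra_simps)
      then have "norm (?q (\<lambda>x. h x (\<xi> + s *\<^sub>R b)) \<epsilon> - ?q (\<lambda>x. h x \<xi>) \<epsilon> - s *\<^sub>R ?q (\<lambda>x. k x \<xi>) \<epsilon>) =
        norm (h (x + \<epsilon> *\<^sub>R c) (\<xi> + s *\<^sub>R b) - h x (\<xi> + s *\<^sub>R b) - (h (x + \<epsilon> *\<^sub>R c) \<xi> - h x \<xi>)
      - s *\<^sub>R (k (x + \<epsilon> *\<^sub>R c) \<xi> - k x \<xi>)) / \<bar>\<epsilon>\<bar>" by (simp add: divide_inverse_commute)
      also have "\<dots> \<le> ((B * \<bar>\<epsilon>\<bar> * \<bar>s\<bar>) * \<bar>s\<bar>) / \<bar>\<epsilon>\<bar>" by (intro divide_right_mono fin[OF s]) simp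
      finally show "norm (?q (\<lambda>x. h x (\<xi> + s *\<^sub>R b)) \<epsilon> - ?q (\<lambda>x. h x \<xi>) \<epsilon> - s *\<^sub>R ?q (\<lambda>x. k x \<xi>) \<epsilon>) \<le> B * \<bar>s\<bar> * \<bar>s\<bar>"
        using e by simp
    qed simp
  qed simp
  show ?thesis unfolding has_dir_deriv_iff_tendsto
  proof (rule LIM_zero_cancel, rule Lim_null_comparison)
    show "((\<lambda>s. B * \<bar>s\<bar>) \<longlongrightarrow> 0) (at 0)" by (rule tendsto_eq_intros refl | simp)+
    show "\<forall>\<^sub>F s in at 0. norm ((hc x (\<xi> + s *\<^sub>R b) - hc x \<xi>) /\<^sub>R s - kc x \<xi>) \<le> B * \<bar>s\<bar>"
      unfolding eventually_at
    proof (rule exI[of _ 1], safe)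
      fix s :: real assume s: "s \<noteq> 0" "dist s 0 < 1"
      have "(hc x (\<xi> + s *\<^sub>R b) - hc x \<xi>) /\<^sub>R s - kc x \<xi> = (hc x (\<xi> + s *\<^sub>R b) - hc x \<xi> - s *\<^sub>R kc x \<xi>) /\<^sub>R s"
        using s by (simp add: algebra_simps)
      then have "norm ((hc x (\<xi> + s *\<^sub>R b) - hc x \<xi>) /\<^sub>R s - kc x \<xi>) = norm (hc x (\<xi> + s *\<^sub>R b) - hc x \<xi> - s *\<^sub>R kc x \<xi>) / \<bar>s\<bar>"
        by (simp add: divide_inverse_commute)
      also have "\<dots> \<le> (B * \<bar>s\<bar> * \<bar>s\<bar>) / \<bar>s\<bar>" using s by (intro divide_right_mono lim) auto
      finally show "norm ((hc x (\<xi> + s *\<^sub>R b) - hc x \<xi>) /\<^sub>R s - kc x \<xi>) \<le> B * \<bar>s\<bar>" using s by simp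
    qed simp
  qed
qed

lemma CS_mixed_deriv_dir_x:
  fixes p :: "real ^ 'n::finite \<Rightarrow> real ^ 'n \<Rightarrow> complex"
  assumes p: "p \<in> CS \<tau> m \<rho> \<delta>" and ws: "set ws \<subseteq> Basis" "set vs \<subseteq> Basis" "length vs < nat \<lfloor>\<tau>\<rfloor>"
  shows "has_dir_deriv (\<lambda>x. mixed_deriv vs ws p x \<xi>) b (mixed_deriv (b # vs) ws p x \<xi>) x"
  unfolding mixed_deriv_def using has_dir_deriv_frechet[OF Ck_differentiable[OF CS_Ck[OF p ws(1)] ws(2,3)]] by simp

text \<open>Induction on the x-derivatives, exchanging the outermost one with the \<xi>-derivative
  by \<open>swap_dir_deriv\<close>. The bound required there is on one x-derivative of a second
  \<xi>-derivative and is a symbol estimate, locally uniform in \<xi>. The list ws is generalized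
  because the hypothesis is used for ws and for b # ws.\<close>

lemma CS_mixed_deriv_dir_xi:
  fixes p :: "real ^ 'n::finite \<Rightarrow> real ^ 'n \<Rightarrow> complex"
  assumes p: "p \<in> CS \<tau> m \<rho> \<delta>" and \<tau>: "0 \<le> \<tau>" and b: "b \<in> Basis" and "set ws \<subseteq> Basis" "set vs \<subseteq> Basis" "length vs \<le> nat \<lfloor>\<tau>\<rfloor>"
  shows "has_dir_deriv (mixed_deriv vs ws p x) b (mixed_deriv vs (b # ws) p x \<xi>) \<xi>"
  using assms(4-)
proof (induction vs arbitrary: ws x \<xi>)
  case Nil
  then show ?case unfolding mixed_deriv_Nil by (intro smooth_iter_dir_deriv CS_smooth[OF p])
next
  case (Cons c vs)
  then have B: "set (b # ws) \<subseteq> Basis" "set (b # b # ws) \<subseteq> Basis" "set ws \<subseteq> Basis" "set vs \<subseteq> Basis" "length vs < nat \<lfloor>\<tau>\<rfloor>" "length vs \<le> nat \<lfloor>\<tau>\<rfloor>"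
    using b by auto
  define e where "e = m - \<rho> * real (length (b # b # ws)) + \<delta> * real (length (c # vs))"
  obtain C where C: "C \<ge> 0" "\<And>x \<xi>. norm (mixed_deriv (c # vs) (b # b # ws) p x \<xi>) \<le> C * japanese \<xi> powr e"
    using CS_bound[OF p \<tau> B(2) Cons.prems(2,3)] unfolding e_def by blast
  have "norm (mixed_deriv (c # vs) (b # b # ws) p x (\<xi> + u *\<^sub>R b)) \<le> C * (4 powr \<bar>e\<bar> * japanese \<xi> powr e)" if "\<bar>u\<bar> \<le> 1" for x u
  proof -
    have "norm (\<xi> + u *\<^sub>R b - \<xi>) \<le> 1" using that b by simp
    from japanese_powr_near[OF this, of e] C(1) show ?thesis
      by (intro order_trans[OF C(2)] mult_left_mono)
  qed
  note bd = this
  show ?case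
  proof (rule swap_dir_deriv[where h = "mixed_deriv vs ws p" and k = "mixed_deriv vs (b # ws) p" and ?k2.0 = "mixed_deriv vs (b # b # ws) p" and ?k2c.0 = "mixed_deriv (c # vs) (b # b # ws) p" and c = c])
    show "has_dir_deriv (mixed_deriv vs ws p x) b (mixed_deriv vs (b # ws) p x \<xi>) \<xi>" for x \<xi> by (rule Cons.IH[OF B(3,4,6)])
    show "has_dir_deriv (mixed_deriv vs (b # ws) p x) b (mixed_deriv vs (b # b # ws) p x \<xi>) \<xi>" for x \<xi> by (rule Cons.IH[OF B(1,4,6)])
    show "has_dir_deriv (\<lambda>x. mixed_deriv vs ws p x \<xi>) c (mixed_deriv (c # vs) ws p x \<xi>) x" for x \<xi> by (rule CS_mixed_deriv_dir_x[OF p B(3,4,5)])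
    show "has_dir_deriv (\<lambda>x. mixed_deriv vs (b # ws) p x \<xi>) c (mixed_deriv (c # vs) (b # ws) p x \<xi>) x" for x \<xi> by (rule CS_mixed_deriv_dir_x[OF p B(1,4,5)])
    show "has_dir_deriv (\<lambda>x. mixed_deriv vs (b # b # ws) p x \<xi>) c (mixed_deriv (c # vs) (b # b # ws) p x \<xi>) x" for x \<xi> by (rule CS_mixed_deriv_dir_x[OF p B(2,4,5)])
  qed (rule bd)
qed

text \<open>The family admits any regularity up to the available one, so that lowering \<tau> is the
  special case without derivatives.\<close>

lemma CS_mixed_deriv:
  fixes p :: "real ^ 'n::finite \<Rightarrow> real ^ 'n \<Rightarrow> complex"
  assumes p: "p \<in> CS \<tau> m \<rho> \<delta>" and \<tau>: "0 \<le> \<tau>" and \<delta>: "0 \<le> \<delta>" and B: "set ws \<subseteq> Basis" "set vs \<subseteq> Basis" "length vs \<le> nat \<lfloor>\<tau>\<rfloor>"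
    and \<tau>': "0 \<le> \<tau>'" "\<tau>' \<le> \<tau> - real (length vs)"
  shows "mixed_deriv vs ws p \<in> CS \<tau>' (m - \<rho> * real (length ws) + \<delta> * real (length vs)) \<rho> \<delta>"
proof -
  define S where "S \<tau>' m' = {mixed_deriv vs ws p |vs ws. set ws \<subseteq> Basis \<and> set vs \<subseteq> Basis \<and> length vs \<le> nat \<lfloor>\<tau>\<rfloor> \<and>
    \<tau>' \<le> \<tau> - real (length vs) \<and> m' = m - \<rho> * real (length ws) + \<delta> * real (length vs)}" for \<tau>' m'
  show ?thesis
  proof (rule CS_coinduct[where S = S])
    show "mixed_deriv vs ws p \<in> S \<tau>' (m - \<rho> * real (length ws) + \<delta> * real (length vs))"
      unfolding S_def using B \<tau>'(2) by blast
    show "0 \<le> \<tau>'" by (rule \<tau>'(1))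
    show "0 \<le> \<delta>" by (rule \<delta>)
  next
    fix \<tau>' m' s assume "s \<in> S \<tau>' m'"
    then obtain vs ws where s: "s = mixed_deriv vs ws p" "set ws \<subseteq> Basis" "set vs \<subseteq> Basis" "length vs \<le> nat \<lfloor>\<tau>\<rfloor>"
      and t: "\<tau>' \<le> \<tau> - real (length vs)" "m' = m - \<rho> * real (length ws) + \<delta> * real (length vs)" by (auto simp: S_def)
    show "\<exists>C. \<forall>x \<xi>. norm (s x \<xi>) \<le> C * japanese \<xi> powr m'"
      using CS_bound[OF p \<tau> s(2-4)] unfolding s(1) t(2) by blast
    show "isCont (\<lambda>x. s x \<xi>) x" for x \<xi>
      unfolding s mixed_deriv_def by (rule Ck_isCont[OF CS_Ck[OF p s(2)] s(3,4)])
    show "\<exists>C. \<forall>t x z \<xi>. 0 < t \<and> t < 1 \<and> t \<le> \<tau>' \<longrightarrow>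
      norm (s x \<xi> - s z \<xi>) \<le> C * japanese \<xi> powr (m' + \<delta> * t) * norm (x - z) powr t"
    proof -
      obtain C where "\<forall>t x z \<xi>. 0 < t \<and> t < 1 \<and> real (length vs) + t \<le> \<tau> \<longrightarrow> norm (mixed_deriv vs ws p x \<xi> - mixed_deriv vs ws p z \<xi>) \<le>
        C * japanese \<xi> powr (m - \<rho> * real (length ws) + \<delta> * real (length vs) + \<delta> * t) * norm (x - z) powr t"
        using CS_holder[OF p s(2,3)] by blast
      moreover have "real (length vs) + u \<le> \<tau>" if "u \<le> \<tau>'" for u using that t(1) by linarith
      ultimately show ?thesis unfolding s(1) t(2) by (intro exI[of _ C]) simp
    qed
    show "\<exists>s'\<in>S \<tau>' (m' - \<rho>). \<forall>x \<xi>. has_dir_deriv (s x) b (s' x \<xi>) \<xi>" if b: "b \<in> Basis" for b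
    proof
      show "mixed_deriv vs (b # ws) p \<in> S \<tau>' (m' - \<rho>)" unfolding S_def t(2) using s t(1) b
        by (intro CollectI exI[of _ vs] exI[of _ "b # ws"]) (auto simp: algebra_simps)
      show "\<forall>x \<xi>. has_dir_deriv (s x) b (mixed_deriv vs (b # ws) p x \<xi>) \<xi>"
        using CS_mixed_deriv_dir_xi[OF p \<tau> b s(2-4)] unfolding s(1) by blast
    qed
    show "\<exists>s'\<in>S (\<tau>' - 1) (m' + \<delta>). \<forall>x \<xi>. has_dir_deriv (\<lambda>x. s x \<xi>) b (s' x \<xi>) x" if b: "b \<in> Basis" and t1: "1 \<le> \<tau>'" for b
    proof
      have lt: "length vs < nat \<lfloor>\<tau>\<rfloor>" using t1 t(1) by linarith
      show "mixed_deriv (b # vs) ws p \<in> S (\<tau>' - 1) (m' + \<delta>)" unfolding S_def t(2) using s t(1) b lt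
        by (intro CollectI exI[of _ "b # vs"] exI[of _ ws]) (auto simp: algebra_simps)
      show "\<forall>x \<xi>. has_dir_deriv (\<lambda>x. s x \<xi>) b (mixed_deriv (b # vs) ws p x \<xi>) x"
        using CS_mixed_deriv_dir_x[OF p s(2,3) lt] unfolding s(1) by blast
    qed
  qed
qed

lemma CS_mono:
  fixes p :: "real ^ 'n::finite \<Rightarrow> real ^ 'n \<Rightarrow> complex"
  assumes "p \<in> CS \<tau> m \<rho> \<delta>" "0 \<le> \<delta>" "0 \<le> \<tau>'" "\<tau>' \<le> \<tau>"
  shows "p \<in> CS \<tau>' m \<rho> \<delta>"
  using CS_mixed_deriv[OF assms(1) _ assms(2), of "[]" "[]" \<tau>'] assms(3,4) by (simp add: mixed_deriv_Nil)

lemma iter_deriv_mixed_deriv: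
  fixes p :: "real ^ 'n::finite \<Rightarrow> real ^ 'n \<Rightarrow> complex"
  assumes p: "p \<in> CS \<tau> m \<rho> \<delta>" and \<tau>: "0 \<le> \<tau>" and \<delta>: "0 \<le> \<delta>" and B: "set ws \<subseteq> Basis" "set vs \<subseteq> Basis" "length vs \<le> nat \<lfloor>\<tau>\<rfloor>"
    and us: "set us \<subseteq> Basis"
  shows "iter_deriv us (mixed_deriv vs ws p x) = mixed_deriv vs (us @ ws) p x"
  using us
proof (induction us)
  case (Cons b us)
  have B': "set (us @ ws) \<subseteq> Basis" "b \<in> Basis" using Cons B by auto
  have "0 \<le> \<tau> - real (length vs)" using B(3) \<tau> by linarith
  then have "smooth (mixed_deriv vs (us @ ws) p x)" by (rule CS_smooth[OF CS_mixed_deriv[OF p \<tau> \<delta> B'(1) B(2,3) _ order_refl]])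
  then have "has_dir_deriv (mixed_deriv vs (us @ ws) p x) b (pd b (mixed_deriv vs (us @ ws) p x) \<xi>) \<xi>" for \<xi> by (rule smooth_dir_deriv)
  then have "pd b (mixed_deriv vs (us @ ws) p x) \<xi> = mixed_deriv vs (b # us @ ws) p x \<xi>" for \<xi>
    using CS_mixed_deriv_dir_xi[OF p \<tau> B'(2) B'(1) B(2,3)] has_dir_deriv_unique by blast
  then show ?case using Cons by auto
qed simp

section \<open>First derivatives as operations between symbol classes\<close>

definition dxi :: "real ^ 'n::finite \<Rightarrow> (real ^ 'n \<Rightarrow> real ^ 'n \<Rightarrow> complex) \<Rightarrow> real ^ 'n \<Rightarrow> real ^ 'n \<Rightarrow> complex" where
  "dxi b p = mixed_deriv [] [b] p"
definition dx :: "real ^ 'n::finite \<Rightarrow> (real ^ 'n \<Rightarrow> real ^ 'n \<Rightarrow> complex) \<Rightarrow> real ^ 'n \<Rightarrow> real ^ 'n \<Rightarrow> complex" where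
  "dx b p = mixed_deriv [b] [] p"

lemma CS_dxi: "p \<in> CS \<tau> m \<rho> \<delta> \<Longrightarrow> 0 \<le> \<tau> \<Longrightarrow> 0 \<le> \<delta> \<Longrightarrow> b \<in> Basis \<Longrightarrow> dxi b p \<in> CS \<tau> (m - \<rho>) \<rho> \<delta>"
  using CS_mixed_deriv[of p \<tau> m \<rho> \<delta> "[b]" "[]" \<tau>] by (simp add: dxi_def)

lemma CS_dx: "p \<in> CS \<tau> m \<rho> \<delta> \<Longrightarrow> 1 \<le> \<tau> \<Longrightarrow> 0 \<le> \<delta> \<Longrightarrow> b \<in> Basis \<Longrightarrow> dx b p \<in> CS (\<tau> - 1) (m + \<delta>) \<rho> \<delta>"
  using CS_mixed_deriv[of p \<tau> m \<rho> \<delta> "[]" "[b]" "\<tau> - 1"] by (simp add: dx_def le_nat_iff)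

lemma CS_dxi_dir:
  assumes "p \<in> CS \<tau> m \<rho> \<delta>" "0 \<le> \<tau>" "0 \<le> \<delta>" "b \<in> Basis" "set ws \<subseteq> Basis"
  shows "has_dir_deriv (iter_deriv ws (p x)) b (iter_deriv ws (dxi b p x) \<xi>) \<xi>"
proof -
  have "iter_deriv ws (dxi b p x) = iter_deriv (ws @ [b]) (p x)" by (simp add: dxi_def mixed_deriv_Nil iter_deriv_append)
  also have "\<dots> = iter_deriv (b # ws) (p x)" by (rule smooth_perm[OF CS_smooth[OF assms(1)]]) (use assms in auto)
  finally show ?thesis using smooth_iter_dir_deriv[OF CS_smooth[OF assms(1)] assms(5)] by simp
qed

lemma CS_dx_dir:
  assumes p: "p \<in> CS \<tau> m \<rho> \<delta>" "1 \<le> \<tau>" "0 \<le> \<delta>" "b \<in> Basis" "set ws \<subseteq> Basis"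
  shows "has_dir_deriv (\<lambda>x. iter_deriv ws (p x) \<xi>) b (iter_deriv ws (dx b p x) \<xi>) x"
proof -
  have "iter_deriv ws (dx b p x) = mixed_deriv [b] (ws @ []) p x"
    unfolding dx_def by (rule iter_deriv_mixed_deriv[OF p(1) _ p(3)]) (use assms in \<open>auto simp: le_nat_iff\<close>)
  moreover have "has_dir_deriv (\<lambda>x. mixed_deriv [] ws p x \<xi>) b (mixed_deriv [b] ws p x \<xi>) x"
    by (rule CS_mixed_deriv_dir_x[OF p(1)]) (use assms in \<open>auto simp: zless_nat_eq_int_zless less_le_trans\<close>)
  ultimately show ?thesis by (simp add: mixed_deriv_Nil)
qed

lemma smooth_symbolsD: "q \<in> smooth_symbols m \<rho> \<delta> \<Longrightarrow> 0 < \<tau> \<Longrightarrow> q \<in> CS \<tau> m \<rho> \<delta>"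
  by (auto simp: smooth_symbols_def)

lemma smooth_symbols_dxi: "q \<in> smooth_symbols m \<rho> \<delta> \<Longrightarrow> 0 \<le> \<delta> \<Longrightarrow> b \<in> Basis \<Longrightarrow> dxi b q \<in> smooth_symbols (m - \<rho>) \<rho> \<delta>"
  unfolding smooth_symbols_def by (auto intro: CS_dxi)

lemma smooth_symbols_dx: "q \<in> smooth_symbols m \<rho> \<delta> \<Longrightarrow> 0 \<le> \<delta> \<Longrightarrow> b \<in> Basis \<Longrightarrow> dx b q \<in> smooth_symbols (m + \<delta>) \<rho> \<delta>"
  unfolding smooth_symbols_def
proof safe
  fix \<tau> :: real assume a: "q \<in> (\<Inter>\<tau>\<in>{0<..}. CS \<tau> m \<rho> \<delta>)" "0 \<le> \<delta>" "b \<in> Basis" "\<tau> > 0"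
  then have "q \<in> CS (\<tau> + 1) m \<rho> \<delta>" by auto
  from CS_dx[OF this] a show "dx b q \<in> CS \<tau> (m + \<delta>) \<rho> \<delta>" by simp
qed

lemma smooth_symbols_smooth_x:
  assumes "q \<in> smooth_symbols m \<rho> \<delta>" shows "smooth (\<lambda>x. q x \<xi>)"
  unfolding smooth_def
proof
  fix k
  have "q \<in> CS (real k + 1) m \<rho> \<delta>" by (rule smooth_symbolsD[OF assms]) simp
  from CS_Ck[OF this, of "[]" \<xi>] have "Ck (nat \<lfloor>real k + 1\<rfloor>) (\<lambda>x. q x \<xi>)" by simp
  moreover have "nat \<lfloor>real k + 1\<rfloor> = k + 1" by linarith
  ultimately show "Ck k (\<lambda>x. q x \<xi>)" by (auto simp: Ck_def)
qed

lemma smooth_symbols_smooth_xi: "q \<in> smooth_symbols m \<rho> \<delta> \<Longrightarrow> smooth (q x)"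
  using CS_smooth smooth_symbolsD[of q m \<rho> \<delta> 1] by simp blast

lemma smooth_symbols_bound:
  fixes q :: "real ^ 'n::finite \<Rightarrow> real ^ 'n \<Rightarrow> complex"
  assumes q: "q \<in> smooth_symbols m \<rho> \<delta>" and vs: "set vs \<subseteq> Basis"
  shows "\<exists>C\<ge>0. \<forall>x \<xi>. norm (iter_deriv vs (\<lambda>x. q x \<xi>) x) \<le> C * japanese \<xi> powr (m + \<delta> * real (length vs))"
proof -
  have "length vs \<le> nat \<lfloor>real (length vs) + 1\<rfloor>" by linarith
  then show ?thesis
    using CS_bound[OF smooth_symbolsD[OF q], of "real (length vs) + 1" "[]" vs] vs by (simp add: mixed_deriv_Nil)
qed

lemma smooth_symbols_holder:
  fixes q :: "real ^ 'n::finite \<Rightarrow> real ^ 'n \<Rightarrow> complex"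
  assumes q: "q \<in> smooth_symbols m \<rho> \<delta>" and vs: "set vs \<subseteq> Basis"
  shows "\<exists>C\<ge>0. \<forall>t x z \<xi>. 0 < t \<and> t < 1 \<longrightarrow> norm (iter_deriv vs (\<lambda>x. q x \<xi>) x - iter_deriv vs (\<lambda>x. q x \<xi>) z) \<le>
    C * japanese \<xi> powr (m + \<delta> * real (length vs) + \<delta> * t) * norm (x - z) powr t"
proof -
  from CS_holder[OF smooth_symbolsD[OF q], of "real (length vs) + 1" "[]" vs] vs
  obtain C where "C \<ge> 0" "\<forall>t x z \<xi>. 0 < t \<and> t < 1 \<and> real (length vs) + t \<le> real (length vs) + 1 \<longrightarrow> norm (mixed_deriv vs [] q x \<xi> - mixed_deriv vs [] q z \<xi>) \<le>
    C * japanese \<xi> powr (m - \<rho> * real (length []) + \<delta> * real (length vs) + \<delta> * t) * norm (x - z) powr t" by auto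
  then show ?thesis by (intro exI[of _ C]) (auto simp: mixed_deriv_Nil)
qed

lemma smooth_symbols_dxi_dir:
  fixes q :: "real ^ 'n::finite \<Rightarrow> real ^ 'n \<Rightarrow> complex"
  assumes q: "q \<in> smooth_symbols m \<rho> \<delta>" and b: "b \<in> Basis" and vs: "set vs \<subseteq> Basis"
  shows "has_dir_deriv (\<lambda>\<xi>. iter_deriv vs (\<lambda>x. q x \<xi>) x) b (iter_deriv vs (\<lambda>x. dxi b q x \<xi>) x) \<xi>"
proof -
  have "has_dir_deriv (mixed_deriv vs [] q x) b (mixed_deriv vs [b] q x \<xi>) \<xi>"
    by (rule CS_mixed_deriv_dir_xi[OF smooth_symbolsD[OF q, of "real (length vs) + 1"]]) (use b vs in \<open>auto simp: le_nat_iff le_floor_iff\<close>)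
  moreover have "mixed_deriv vs [b] q x \<xi> = iter_deriv vs (\<lambda>x. dxi b q x \<xi>) x" by (simp add: mixed_deriv_def dxi_def)
  ultimately show ?thesis by (simp add: mixed_deriv_Nil[abs_def])
qed

lemma smooth_symbols_dx_dir:
  fixes q :: "real ^ 'n::finite \<Rightarrow> real ^ 'n \<Rightarrow> complex"
  assumes q: "q \<in> smooth_symbols m \<rho> \<delta>" and b: "b \<in> Basis" and vs: "set vs \<subseteq> Basis"
  shows "has_dir_deriv (iter_deriv vs (\<lambda>x. q x \<xi>)) b (iter_deriv vs (\<lambda>x. dx b q x \<xi>) x) x"
proof -
  note s = smooth_symbols_smooth_x[OF q]
  have "iter_deriv vs (\<lambda>x. dx b q x \<xi>) = iter_deriv (vs @ [b]) (\<lambda>x. q x \<xi>)" by (simp add: dx_def mixed_deriv_Nil iter_deriv_append)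
  also have "\<dots> = iter_deriv (b # vs) (\<lambda>x. q x \<xi>)" by (rule smooth_perm[OF s]) (use b vs in auto)
  finally show ?thesis using smooth_iter_dir_deriv[OF s vs] by simp
qed

section \<open>Taylor expansion under the oscillatory integral\<close>

text \<open>The exponent \<open>\<kappa>\<close> arises because \<open>\<xi> + \<langle>\<xi>\<rangle>\<^sup>\<delta> \<eta>\<close> can only be much smaller than \<open>\<xi>\<close> if \<open>|\<eta>|\<close> is at
  least of size \<open>\<langle>\<xi>\<rangle>\<^bsup>1-\<delta>\<^esup>\<close>.\<close>

lemma japanese_dilated_shift:
  fixes \<xi> \<eta> :: "'a::real_normed_vector"
  assumes \<delta>: "0 \<le> \<delta>" "\<delta> < 1"
  defines "\<kappa> \<equiv> 1 / (1 - \<delta>)" and "r \<equiv> japanese \<xi> powr \<delta>"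
  shows "japanese (\<xi> + r *\<^sub>R \<eta>) powr s \<le> 2 powr (\<kappa> * \<bar>s\<bar>) * japanese \<xi> powr s * japanese \<eta> powr (\<kappa> * \<bar>s\<bar>)"
proof -
  let ?R = "japanese \<xi>" and ?\<zeta> = "\<xi> + r *\<^sub>R \<eta>"
  have \<kappa>: "\<kappa> \<ge> 1" using \<delta> by (simp add: \<kappa>_def)
  define M where "M = (2 * japanese \<eta>) powr \<kappa>"
  have j: "1 \<le> 2 * japanese \<eta>" using japanese_ge_1[of \<eta>] by simp
  have M1: "2 * japanese \<eta> \<le> M" unfolding M_def using powr_mono[OF \<kappa> j] j by simp
  then have M: "1 \<le> M" "2 \<le> M" using j japanese_ge_1[of \<eta>] by linarith+
  have r: "0 < r" "r \<le> ?R"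
    using japanese_powr_mono[of \<delta> 1 \<xi>] \<delta> japanese_pos[of \<xi>] by (auto simp: r_def)
  have up: "japanese ?\<zeta> \<le> M * ?R"
  proof -
    have "japanese ?\<zeta> \<le> ?R + r * norm \<eta>" using japanese_triangle[of \<xi> "r *\<^sub>R \<eta>"] r by simp
    also have "\<dots> \<le> ?R * japanese \<eta> + ?R * japanese \<eta>"
      using r japanese_ge_1[of \<eta>] norm_le_japanese[of \<eta>] japanese_pos[of \<xi>]
      by (intro add_mono mult_mono) auto
    also have "\<dots> = (2 * japanese \<eta>) * ?R" by simp
    also have "\<dots> \<le> M * ?R" using M1 japanese_pos[of \<xi>] by (intro mult_right_mono) auto
    finally show ?thesis .
  qed
  have lo: "?R \<le> M * japanese ?\<zeta>"
  proof (cases "r * norm \<eta> \<le> ?R / 2")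
    case True
    have "?R \<le> japanese ?\<zeta> + r * norm \<eta>" using japanese_triangle[of ?\<zeta> "- (r *\<^sub>R \<eta>)"] r by simp
    then have "?R \<le> 2 * japanese ?\<zeta>" using True by simp
    also have "\<dots> \<le> M * japanese ?\<zeta>" using M japanese_pos[of ?\<zeta>] by (intro mult_right_mono) auto
    finally show ?thesis .
  next
    \<comment> \<open>Here the norm of \<eta> exceeds half the power 1 - \<delta> of the bracket of
      \<xi>. Raising to the power \<kappa> shows that M alone dominates that bracket.\<close>
    case False
    have "?R powr (1 - \<delta>) = ?R / r" using japanese_pos[of \<xi>] by (simp add: r_def powr_diff)
    also have "\<dots> < 2 * norm \<eta>" using False r by (simp add: field_simps)
    also have "\<dots> \<le> 2 * japanese \<eta>" using norm_le_japanese by simp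
    finally have "(?R powr (1 - \<delta>)) powr \<kappa> \<le> (2 * japanese \<eta>) powr \<kappa>"
      using \<kappa> by (intro powr_mono2) auto
    then have "?R \<le> M" using \<delta> japanese_pos[of \<xi>] by (simp add: powr_powr \<kappa>_def M_def)
    also have "\<dots> \<le> M * japanese ?\<zeta>" using mult_left_mono[OF japanese_ge_1[of ?\<zeta>], of M] M by simp
    finally show ?thesis .
  qed
  have "japanese ?\<zeta> powr s \<le> M powr \<bar>s\<bar> * ?R powr s"
    by (rule japanese_powr_comparable[OF up lo M(1)])
  also have "M powr \<bar>s\<bar> = 2 powr (\<kappa> * \<bar>s\<bar>) * japanese \<eta> powr (\<kappa> * \<bar>s\<bar>)"
    using japanese_pos[of \<eta>] by (simp add: M_def powr_powr powr_mult)
  finally show ?thesis by (simp add: mult_ac)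
qed

section \<open>Monomials and Taylor polynomials\<close>

definition mi_power :: "('n::finite \<Rightarrow> nat) \<Rightarrow> real ^ 'n \<Rightarrow> complex" where
  "mi_power \<alpha> \<eta> = (\<Prod>i\<in>UNIV. complex_of_real (\<eta> $ i) ^ \<alpha> i)"

lemma smooth_prod: "(\<And>i. i \<in> I \<Longrightarrow> smooth (f i)) \<Longrightarrow> smooth (\<lambda>x. \<Prod>i\<in>I. f i x :: complex)"
  by (induction I rule: infinite_finite_induct) (auto intro: smooth_const smooth_mult)

lemma smooth_mi_power: "smooth (mi_power \<alpha>)"
proof -
  have "smooth (\<lambda>\<eta>::real ^ 'a. \<Prod>i\<in>UNIV. complex_of_real (\<eta> \<bullet> axis i 1) ^ \<alpha> i)"
    by (intro smooth_prod smooth_power smooth_inner)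
  then show ?thesis by (simp add: mi_power_def[abs_def] inner_axis)
qed

lemma pd_mi_power: "pd (axis j 1) (mi_power \<alpha>) = (\<lambda>\<eta>. of_nat (\<alpha> j) * mi_power (\<alpha>(j := \<alpha> j - 1)) \<eta>)"
proof
  fix \<eta> :: "real ^ 'a"
  let ?P = "\<Prod>i\<in>UNIV - {j}. complex_of_real (\<eta> $ i) ^ \<alpha> i"
  have e: "mi_power \<beta> (\<eta> + t *\<^sub>R axis j 1) = complex_of_real (\<eta> $ j + t) ^ \<beta> j * ?P"
    if "\<And>i. i \<noteq> j \<Longrightarrow> \<beta> i = \<alpha> i" for t \<beta>
    unfolding mi_power_def by (subst prod.remove[of UNIV j]) (use that in \<open>auto simp: axis_def intro!: prod.cong\<close>)
  have "((\<lambda>t. complex_of_real (\<eta> $ j + t) ^ \<alpha> j) has_vector_derivative of_nat (\<alpha> j) * complex_of_real (\<eta> $ j) ^ (\<alpha> j - 1)) (at 0)"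
    unfolding has_vector_derivative_def by (auto intro!: derivative_eq_intros simp: scaleR_conv_of_real mult_ac)
  then have "((\<lambda>t. complex_of_real (\<eta> $ j + t) ^ \<alpha> j * ?P) has_vector_derivative of_nat (\<alpha> j) * complex_of_real (\<eta> $ j) ^ (\<alpha> j - 1) * ?P) (at 0)"
    by (rule has_vector_derivative_mult_left)
  then have "has_dir_deriv (mi_power \<alpha>) (axis j 1) (of_nat (\<alpha> j) * complex_of_real (\<eta> $ j) ^ (\<alpha> j - 1) * ?P) \<eta>"
    unfolding has_dir_deriv_def by (simp add: e)
  then have "pd (axis j 1) (mi_power \<alpha>) \<eta> = of_nat (\<alpha> j) * complex_of_real (\<eta> $ j) ^ (\<alpha> j - 1) * ?P"
    using smooth_dir_deriv[OF smooth_mi_power] has_dir_deriv_unique by blast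
  also have "\<dots> = of_nat (\<alpha> j) * mi_power (\<alpha>(j := \<alpha> j - 1)) \<eta>"
    using e[of "\<alpha>(j := \<alpha> j - 1)" 0] by simp
  finally show "pd (axis j 1) (mi_power \<alpha>) \<eta> = of_nat (\<alpha> j) * mi_power (\<alpha>(j := \<alpha> j - 1)) \<eta>" .
qed

lemma mi_power_0: "mi_power \<alpha> 0 = (if \<alpha> = (\<lambda>_. 0) then 1 else 0)"
proof (cases "\<alpha> = (\<lambda>_. 0)")
  case False
  then obtain i where "\<alpha> i \<noteq> 0" by auto
  then have "mi_power \<alpha> 0 = 0" unfolding mi_power_def by (intro prod_zero) (auto intro!: bexI[of _ i])
  then show ?thesis using False by simp
qed (simp add: mi_power_def)

lemma mi_of_snoc: "mi_of (vs @ [axis j 1]) = (mi_of vs)(j := Suc (mi_of vs j))"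
  by (auto simp: mi_of_def fun_eq_iff axis_eq_1)

lemma mi_of_Cons: "mi_of (axis j 1 # vs) = (mi_of vs)(j := Suc (mi_of vs j))"
  by (auto simp: mi_of_def fun_eq_iff axis_eq_1)

lemma mi_fact_upd: "\<alpha> j \<noteq> 0 \<Longrightarrow> mi_fact \<alpha> = \<alpha> j * mi_fact (\<alpha>(j := \<alpha> j - 1))"
proof -
  assume "\<alpha> j \<noteq> 0"
  then have "fact (\<alpha> j) = \<alpha> j * fact (\<alpha> j - 1)" by (simp add: fact_reduce)
  then show ?thesis unfolding mi_fact_def
    by (subst (1 2) prod.remove[of UNIV j]) (auto simp: mult.assoc intro!: arg_cong2[where f = "(*)"] prod.cong)
qed

lemma mi_abs_upd: "\<alpha> j \<noteq> 0 \<Longrightarrow> mi_abs \<alpha> = Suc (mi_abs (\<alpha>(j := \<alpha> j - 1)))"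
  unfolding mi_abs_def by (subst (1 2) sum.remove[of UNIV j]) auto

lemma iter_deriv_snoc_mi_power:
  "set vs \<subseteq> Basis \<Longrightarrow> iter_deriv (vs @ [axis j 1]) (mi_power \<alpha>) = (\<lambda>\<eta>. of_nat (\<alpha> j) * iter_deriv vs (mi_power (\<alpha>(j := \<alpha> j - 1))) \<eta>)"
  unfolding iter_deriv_append pd_mi_power by (rule iter_deriv_cmult[OF smooth_mi_power])

text \<open>Monomials and derivatives at 0 are dual up to factorials; this makes the derivatives of
  the Taylor polynomial at 0 agree with those of the function.\<close>

lemma iter_deriv_mi_power_0:
  "set vs \<subseteq> Basis \<Longrightarrow> iter_deriv vs (mi_power \<alpha>) 0 = (if mi_of vs = \<alpha> then of_nat (mi_fact \<alpha>) else 0)"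
proof (induction vs arbitrary: \<alpha> rule: rev_induct)
  case Nil
  have "mi_of [] = (\<lambda>_. 0)" by (simp add: mi_of_def fun_eq_iff)
  then show ?case by (auto simp: mi_power_0 mi_fact_def)
next
  case (snoc b vs)
  then obtain j where b: "b = axis j 1" by (auto simp: Basis_vec_axis)
  show ?case
  proof (cases "\<alpha> j = 0")
    case True
    then have "mi_of (vs @ [b]) \<noteq> \<alpha>" unfolding b mi_of_snoc by (metis fun_upd_same nat.distinct(1))
    then show ?thesis using snoc True unfolding b by (simp add: iter_deriv_snoc_mi_power)
  next
    case False
    have "mi_of vs = \<alpha>(j := \<alpha> j - 1) \<longleftrightarrow> mi_of (vs @ [b]) = \<alpha>"
      unfolding b mi_of_snoc using False by (auto simp: fun_eq_iff split: if_splits)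
    then show ?thesis using snoc mi_fact_upd[of \<alpha> j, OF False] unfolding b by (simp add: iter_deriv_snoc_mi_power)
  qed
qed

lemma iter_deriv_mi_power_high:
  "set vs \<subseteq> Basis \<Longrightarrow> mi_abs \<alpha> < length vs \<Longrightarrow> iter_deriv vs (mi_power \<alpha>) = (\<lambda>_. 0)"
proof (induction vs arbitrary: \<alpha> rule: rev_induct)
  case (snoc b vs)
  then obtain j where b: "b = axis j 1" by (auto simp: Basis_vec_axis)
  show ?case
  proof (cases "\<alpha> j = 0")
    case False
    then show ?thesis using snoc mi_abs_upd[of \<alpha> j, OF False] unfolding b by (simp add: iter_deriv_snoc_mi_power)
  qed (use snoc in \<open>simp add: b iter_deriv_snoc_mi_power\<close>)
qed simp

lemma mi_power_Cons: "mi_power (mi_of (axis j 1 # vs)) \<eta> = complex_of_real (\<eta> \<bullet> axis j 1) * mi_power (mi_of vs) \<eta>"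
  unfolding mi_of_Cons mi_power_def inner_axis
  by (subst (1 2) prod.remove[of UNIV j]) (auto simp: mult.assoc intro!: arg_cong2[where f = "(*)"] prod.cong)

lemma wcl_mi_power: "wcl (\<lambda>\<eta>. japanese \<eta> powr real (mi_abs \<alpha>)) (mi_power \<alpha>)"
proof -
  have "set vs \<subseteq> Basis \<Longrightarrow> wcl (\<lambda>\<eta>. japanese \<eta> powr real (length vs)) (mi_power (mi_of vs))" for vs :: "(real ^ 'a) list"
  proof (induction vs)
    case Nil
    have "mi_power (mi_of []) = (\<lambda>\<eta>::real ^ 'a. 1)" by (simp add: mi_power_def mi_of_def fun_eq_iff)
    then show ?case by (intro wcl_of_lists smooth_mi_power) (auto simp: iter_deriv_const intro!: exI[of _ 1])
  next
    case (Cons b vs)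
    then obtain j where b: "b = axis j 1" by (auto simp: Basis_vec_axis)
    have "wcl (\<lambda>\<eta>. japanese \<eta> * japanese \<eta> powr real (length vs)) (\<lambda>\<eta>. complex_of_real (\<eta> \<bullet> b) * mi_power (mi_of vs) \<eta>)"
      using Cons by (intro wcl_mult wcl_inner) (auto simp: japanese_pos less_imp_le)
    moreover have "japanese \<eta> * japanese \<eta> powr real (length vs) = japanese \<eta> powr real (length (b # vs))" for \<eta> :: "real ^ 'a"
      using japanese_pos[of \<eta>] by (simp add: powr_add)
    moreover have "mi_power (mi_of (b # vs)) = (\<lambda>\<eta>. complex_of_real (\<eta> \<bullet> b) * mi_power (mi_of vs) \<eta>)"
      unfolding b by (rule ext) (rule mi_power_Cons)
    ultimately show ?case by simp
  qed
  from this[OF mi_list_Basis, of \<alpha>] show ?thesis by (simp add: mi_of_mi_list length_mi_list)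
qed

text \<open>Each factor of the monomial is moved onto g by integration by parts; what remains has no
  \<eta> and is evaluated at 0 by \<open>osc_snd\<close>. This produces the terms of the
  expansion.\<close>

lemma osc_mi_power:
  fixes g :: "real ^ 'n::finite \<Rightarrow> complex"
  assumes "wcl (\<lambda>_. 1) g"
  shows "osc (\<lambda>z. mi_power \<alpha> (fst z) * g (snd z)) = Dderiv \<alpha> g 0"
proof -
  have "set vs \<subseteq> Basis \<Longrightarrow> wcl (\<lambda>_. 1) g \<Longrightarrow> osc (\<lambda>z. mi_power (mi_of vs) (fst z) * g (snd z)) = (- \<i>) ^ length vs * iter_deriv vs g 0" for vs
    and g :: "real ^ 'n \<Rightarrow> complex"
  proof (induction vs arbitrary: g)
    case Nil
    have "mi_power (mi_of []) = (\<lambda>\<eta>::real ^ 'n. 1)" by (simp add: mi_power_def mi_of_def fun_eq_iff)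
    then show ?case using osc_snd[OF Nil(2)] by simp
  next
    case (Cons b vs)
    then obtain j where b: "b = axis j 1" by (auto simp: Basis_vec_axis)
    have bB: "b \<in> Basis" "set vs \<subseteq> Basis" using Cons by auto
    have sg: "smooth g" by (rule wcl_smooth[OF Cons.prems(2)])
    have wg: "wcl (\<lambda>_. 1) (pd b g)" by (rule wcl_pd[OF Cons.prems(2) bB(1)])
    have w: "wcl (WW (real (mi_abs (mi_of vs))) 0) (\<lambda>z. mi_power (mi_of vs) (fst z) * h (snd z))" if "wcl (\<lambda>_. 1) h" for h
      by (rule wcl_tensor[OF wcl_mi_power that])
    have "osc (\<lambda>z. mi_power (mi_of (b # vs)) (fst z) * g (snd z)) = osc (\<lambda>z. complex_of_real (fst z \<bullet> b) * (mi_power (mi_of vs) (fst z) * g (snd z)))"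
      unfolding b mi_power_Cons by (simp add: mult.assoc)
    also have "\<dots> = osc (\<lambda>z. - \<i> * pd (0, b) (\<lambda>z. mi_power (mi_of vs) (fst z) * g (snd z)) z)"
      by (rule osc_mult_fst[OF w[OF Cons.prems(2)] bB(1)])
    also have "\<dots> = osc (\<lambda>z. - \<i> * (mi_power (mi_of vs) (fst z) * pd b g (snd z)))"
      by (simp only: pd_tensor(2)[OF smooth_mi_power sg SOME_Basis bB(1)])
    also have "\<dots> = - \<i> * osc (\<lambda>z. mi_power (mi_of vs) (fst z) * pd b g (snd z))"
      by (rule osc_cmult[OF w[OF wg]])
    also have "\<dots> = - \<i> * ((- \<i>) ^ length vs * iter_deriv vs (pd b g) 0)"
      by (simp only: Cons.IH[OF bB(2) wg])
    \<comment> \<open>The induction delivers b as the innermost derivative; symmetry of derivatives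
      brings it to the front.\<close>
    also have "iter_deriv vs (pd b g) = iter_deriv (b # vs) g"
      unfolding iter_deriv_append[symmetric] by (rule smooth_perm[OF sg]) (use bB in auto)
    finally show ?case by simp
  qed
  from this[OF mi_list_Basis assms, of \<alpha>] show ?thesis
    by (simp add: mi_of_mi_list length_mi_list Dderiv_def mderiv_mi_list)
qed

text \<open>The inequality is strict, so that M = 0 gives the empty sum and the difference to f
  vanishes to order M at 0.\<close>

definition taylor :: "nat \<Rightarrow> (real ^ 'n::finite \<Rightarrow> complex) \<Rightarrow> real ^ 'n \<Rightarrow> complex" where
  "taylor M f \<eta> = (\<Sum>\<alpha> | mi_abs \<alpha> < M. (1 / of_nat (mi_fact \<alpha>) * mderiv \<alpha> f 0) * mi_power \<alpha> \<eta>)"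

lemma finite_mi_less: "finite {\<alpha>::'n::finite \<Rightarrow> nat. mi_abs \<alpha> < M}"
  by (rule finite_subset[OF _ finite_mi[of M]]) auto

lemma mi_fact_nz: "complex_of_nat (mi_fact \<alpha>) \<noteq> 0"
  by (simp add: mi_fact_def)

lemma smooth_taylor: "smooth (taylor M f)"
  unfolding taylor_def[abs_def] by (intro smooth_sum smooth_cmult smooth_mi_power)

lemma iter_deriv_taylor:
  assumes vs: "set vs \<subseteq> Basis"
  shows "iter_deriv vs (taylor M f) = (\<lambda>\<eta>. \<Sum>\<alpha> | mi_abs \<alpha> < M. (1 / of_nat (mi_fact \<alpha>) * mderiv \<alpha> f 0) * iter_deriv vs (mi_power \<alpha>) \<eta>)"
  unfolding taylor_def[abs_def]
  by (subst iter_deriv_sum[OF smooth_cmult[OF smooth_mi_power] vs]) (simp only: iter_deriv_cmult[OF smooth_mi_power vs])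

lemma taylor_deriv_0:
  assumes "smooth f" "set vs \<subseteq> Basis" "length vs < M"
  shows "iter_deriv vs (taylor M f) 0 = iter_deriv vs f 0"
proof -
  have "mi_of vs \<in> {\<alpha>. mi_abs \<alpha> < M}" using assms by (simp add: mi_abs_mi_of)
  then have "iter_deriv vs (taylor M f) 0 = (1 / of_nat (mi_fact (mi_of vs)) * mderiv (mi_of vs) f 0) * of_nat (mi_fact (mi_of vs))"
    unfolding iter_deriv_taylor[OF assms(2)] iter_deriv_mi_power_0[OF assms(2)]
    by (simp add: if_distrib[of "(*) _"] finite_mi_less cong: if_cong)
  then show ?thesis using mi_fact_nz[of "mi_of vs"] by (simp add: smooth_iter_deriv_mderiv[OF assms(1,2)])
qed

lemma taylor_deriv_high:
  assumes "set vs \<subseteq> Basis" "M \<le> length vs"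
  shows "iter_deriv vs (taylor M f) = (\<lambda>_. 0)"
  unfolding iter_deriv_taylor[OF assms(1)] using assms by (simp add: iter_deriv_mi_power_high)

text \<open>From order M the bound is integrated downwards from the origin, where the lower
  derivatives vanish. Every order lost costs one power of the bracket of \<eta> and one factor of
  the dimension.\<close>

lemma vanishing_bound:
  fixes h :: "'a::euclidean_space \<Rightarrow> complex"
  assumes h: "smooth h" and z: "\<And>vs. set vs \<subseteq> Basis \<Longrightarrow> length vs < M \<Longrightarrow> iter_deriv vs h 0 = 0"
    and b: "\<And>vs \<eta>. set vs \<subseteq> Basis \<Longrightarrow> M \<le> length vs \<Longrightarrow> length vs \<le> N \<Longrightarrow> norm (iter_deriv vs h \<eta>) \<le> X * japanese \<eta> powr L"
    and X: "0 \<le> X" "0 \<le> L" and MN: "M \<le> N"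
  shows "bdd N (X * real DIM('a) ^ M) (\<lambda>\<eta>. japanese \<eta> powr (L + real M)) h"
proof -
  have n1: "1 \<le> real DIM('a)" by (simp add: Suc_leI)
  \<comment> \<open>The number k counts how far the order has descended below M; for k = 0 the claim
    is the assumption.\<close>
  have "set vs \<subseteq> Basis \<Longrightarrow> M - k \<le> length vs \<Longrightarrow> length vs \<le> N \<Longrightarrow>
      norm (iter_deriv vs h \<eta>) \<le> (X * real DIM('a) ^ k) * japanese \<eta> powr (L + real k)" for k vs \<eta>
  proof (induction k arbitrary: vs \<eta>)
    case (Suc k)
    show ?case
    proof (cases "M - k \<le> length vs")
      case True
      have "norm (iter_deriv vs h \<eta>) \<le> (X * real DIM('a) ^ k) * japanese \<eta> powr (L + real k)"
        using Suc True by blast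
      also have "\<dots> \<le> (X * real DIM('a) ^ Suc k) * japanese \<eta> powr (L + real (Suc k))"
        using X n1 by (intro mult_mono mult_left_mono power_increasing japanese_powr_mono) auto
      finally show ?thesis .
    next
      case False
      then have l: "length vs < M" "length vs < N" using MN by auto
      let ?e = "(X * real DIM('a) ^ k) * japanese \<eta> powr (L + real k)"
      have "norm (iter_deriv vs h (0 + \<eta>) - iter_deriv vs h 0 - (\<Sum>b\<in>Basis. (\<eta> \<bullet> b) *\<^sub>R 0)) \<le> ?e * (\<Sum>b\<in>Basis. \<bar>\<eta> \<bullet> b\<bar>)"
      proof (rule partials_mean_value[where D = "\<lambda>b. iter_deriv (b # vs) h"])
        fix z and b :: 'a assume bB: "b \<in> Basis"
        show "has_dir_deriv (iter_deriv vs h) b (iter_deriv (b # vs) h z) z"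
          by (rule smooth_iter_dir_deriv[OF h Suc.prems(1)])
        assume "norm (z - 0) \<le> norm \<eta>"
        have "norm (iter_deriv (b # vs) h z) \<le> (X * real DIM('a) ^ k) * japanese z powr (L + real k)"
          by (rule Suc.IH) (use bB Suc.prems l in auto)
        also have "\<dots> \<le> ?e"
          using X \<open>norm (z - 0) \<le> norm \<eta>\<close> by (intro mult_left_mono powr_mono2 japanese_mono) (auto simp: japanese_pos less_imp_le)
        finally show "norm (iter_deriv (b # vs) h z - 0) \<le> ?e" by simp
      qed
      then have "norm (iter_deriv vs h \<eta>) \<le> ?e * (\<Sum>b\<in>Basis. \<bar>\<eta> \<bullet> b\<bar>)"
        using z[OF Suc.prems(1) l(1)] by simp
      also have "\<dots> \<le> ?e * (real DIM('a) * japanese \<eta>)"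
        using X by (intro mult_left_mono order_trans[OF sum_Basis_abs_le] norm_le_japanese) auto
      also have "\<dots> = (X * real DIM('a) ^ Suc k) * japanese \<eta> powr (L + real (Suc k))"
        using japanese_pos[of \<eta>] by (simp add: powr_add algebra_simps)
      finally show ?thesis .
    qed
  qed (use b in auto)
  from this[of _ M] show ?thesis unfolding bdd_def by auto
qed

lemma Dderiv_scale:
  assumes "smooth g" shows "Dderiv \<alpha> (\<lambda>y. g (s *\<^sub>R y)) 0 = complex_of_real (s ^ mi_abs \<alpha>) * Dderiv \<alpha> g 0"
proof -
  have "mderiv \<alpha> (\<lambda>y. g (0 + s *\<^sub>R y)) = (\<lambda>y. complex_of_real (s ^ length (mi_list \<alpha>)) * mderiv \<alpha> g (0 + s *\<^sub>R y))"
    unfolding mderiv_mi_list by (rule affine_scale(2)[OF assms mi_list_Basis])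
  then show ?thesis by (simp add: Dderiv_def length_mi_list)
qed

text \<open>The remainder at frozen x and \<xi>: f is the first symbol as a function of the
  frequency, and g is the second one with x moved to the origin. It is bilinear in (f, g) with no
  regularity in x or \<xi> involved.\<close>

definition osc_taylor_diff :: "nat \<Rightarrow> real ^ 'n::finite \<Rightarrow> (real ^ 'n \<Rightarrow> complex) \<Rightarrow> (real ^ 'n \<Rightarrow> complex) \<Rightarrow> complex" where
  "osc_taylor_diff M \<xi> f g = osc (\<lambda>z. f (\<xi> + fst z) * g (snd z)) -
     (\<Sum>\<alpha> | mi_abs \<alpha> < M. 1 / of_nat (mi_fact \<alpha>) * mderiv \<alpha> f \<xi> * Dderiv \<alpha> g 0)"

text \<open>The dilation \<open>(\<eta>, y) \<mapsto> (r \<eta>, y / r)\<close> with \<open>r = \<langle>\<xi>\<rangle>\<^sup>\<delta>\<close> makes the bounds on the derivatives of \<open>g\<close>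
  independent of their order, while every derivative of \<open>f\<close> gains the factor \<open>\<langle>\<xi>\<rangle>\<^bsup>\<delta>-\<rho>\<^esup>\<close>. The Taylor
  polynomial of the dilated \<open>f\<close> contributes exactly the finite sum in \<^const>\<open>osc_taylor_diff\<close>.\<close>

lemma osc_taylor_diff_bound:
  fixes mb :: real
  assumes \<delta>: "0 \<le> \<delta>" "\<delta> < \<rho>" "\<rho> \<le> 1" "\<delta> < 1" and mb: "0 \<le> mb"
  shows "\<exists>C\<ge>0. \<exists>N. \<forall>m (\<xi> :: real ^ 'n::finite) f g A B. \<bar>m\<bar> \<le> mb \<and> wcl (\<lambda>x. japanese x powr mb) f \<and> wcl (\<lambda>_. 1) g \<and>
    0 \<le> A \<and> 0 \<le> B \<and>
    (\<forall>vs \<eta>. set vs \<subseteq> Basis \<and> length vs \<le> N \<longrightarrow> norm (iter_deriv vs f \<eta>) \<le> A * japanese \<eta> powr (m - \<rho> * real (length vs))) \<and>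
    (\<forall>vs y. set vs \<subseteq> Basis \<and> length vs \<le> N \<longrightarrow> norm (iter_deriv vs g y) \<le> B * japanese \<xi> powr (\<delta> * real (length vs))) \<longrightarrow>
    norm (osc_taylor_diff M \<xi> f g) \<le> C * A * B * japanese \<xi> powr (m - (\<rho> - \<delta>) * real M)"
proof -
  define d where "d = DIM(real ^ 'n)"
  define \<kappa> where "\<kappa> = 1 / (1 - \<delta>)"
  have \<kappa>: "\<kappa> \<ge> 1" using \<delta> by (simp add: \<kappa>_def)
  \<comment> \<open>The basic estimate asks for 2 d derivatives in \<eta>; adding M ensures that
    order M, where the bound of the Taylor remainder starts, is in range.\<close>
  define Nf where "Nf = 2 * d + M"
  \<comment> \<open>The orders m - \<rho> j for j up to Nf are at most mb + Nf in absolute value,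
    and \<open>japanese_dilated_shift\<close> multiplies this by \<kappa>. The Taylor remainder adds
    a further M to the growth, which gives K.\<close>
  define L where "L = \<kappa> * (mb + real Nf)"
  have L: "mb + real Nf \<le> L" using \<kappa> mb mult_right_mono[of 1 \<kappa> "mb + real Nf"] by (simp add: L_def)
  then have L0: "0 \<le> L" using mb by simp
  define K where "K = L + real M"
  obtain k where k: "K - 2 * real k \<le> - 2 * real DIM(real ^ 'n)" using exists_osc_order by blast
  obtain C0 where C0: "C0 \<ge> 0" "\<And>(f :: real ^ 'n \<Rightarrow> complex) g A B. wcl (\<lambda>x. japanese x powr K) f \<Longrightarrow> wcl (\<lambda>_. 1) g \<Longrightarrow> 0 \<le> A \<Longrightarrow> 0 \<le> B \<Longrightarrow>
    bdd (2 * DIM(real ^ 'n)) A (\<lambda>x. japanese x powr K) f \<Longrightarrow> bdd (2 * k) B (\<lambda>_. 1) g \<Longrightarrow>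
    norm (osc (\<lambda>z. f (fst z) * g (snd z))) \<le> C0 * A * B" using osc_tensor_bound[OF k] by blast
  \<comment> \<open>Nf derivatives of f and 2 k of g are used; k depends on K but not on the
    functions or on \<xi>.\<close>
  define N where "N = max Nf (2 * k)"
  define C where "C = C0 * (2 powr L * real d ^ M)"
  have "norm (osc_taylor_diff M \<xi> f g) \<le> C * A * B * japanese \<xi> powr (m - (\<rho> - \<delta>) * real M)"
    if m: "\<bar>m\<bar> \<le> mb" and wf: "wcl (\<lambda>x. japanese x powr mb) f" and wg: "wcl (\<lambda>_. 1) g" and AB: "0 \<le> A" "0 \<le> B"
      and bf: "\<And>vs \<eta>. set vs \<subseteq> Basis \<Longrightarrow> length vs \<le> N \<Longrightarrow> norm (iter_deriv vs f \<eta>) \<le> A * japanese \<eta> powr (m - \<rho> * real (length vs))"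
      and bg: "\<And>vs y. set vs \<subseteq> Basis \<Longrightarrow> length vs \<le> N \<Longrightarrow> norm (iter_deriv vs g y) \<le> B * japanese \<xi> powr (\<delta> * real (length vs))"
    for m and \<xi> :: "real ^ 'n" and f g A B
  proof -
    define r where "r = japanese \<xi> powr \<delta>"
    have r: "r > 0" by (simp add: r_def japanese_powr_pos)
    note sf = wcl_smooth[OF wf] and sg = wcl_smooth[OF wg]
    note sh = japanese_dilated_shift[OF \<delta>(1,4), of \<xi>, folded \<kappa>_def r_def]
    define f' where "f' \<eta> = f (\<xi> + r *\<^sub>R \<eta>)" for \<eta>
    define g' where "g' y = g ((1 / r) *\<^sub>R y)" for y
    have sf': "smooth f'" unfolding f'_def[abs_def] by (rule affine_scale(1)[OF sf])
    have df': "iter_deriv vs f' \<eta> = complex_of_real (r ^ length vs) * iter_deriv vs f (\<xi> + r *\<^sub>R \<eta>)" if "set vs \<subseteq> Basis" for vs \<eta>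
      unfolding f'_def[abs_def] by (simp add: affine_scale(2)[OF sf that])
    have dg': "iter_deriv vs g' y = complex_of_real ((1 / r) ^ length vs) * iter_deriv vs g ((1 / r) *\<^sub>R y)" if "set vs \<subseteq> Basis" for vs y
      unfolding g'_def[abs_def] using affine_scale(2)[OF sg that, of 0 "1 / r"] by simp
    have wf': "wcl (\<lambda>\<eta>. japanese \<eta> powr K) f'"
    proof (rule wcl_mono)
      show "wcl (\<lambda>\<eta>. japanese (\<xi> + r *\<^sub>R \<eta>) powr mb) f'" unfolding f'_def[abs_def]
        by (rule wcl_affine[OF bounded_linear_scaleR_right wf, where \<sigma> = "\<lambda>b. b" and c = "\<lambda>b. r"]) auto
      fix \<eta> :: "real ^ 'n"
      have "\<kappa> * mb \<le> K" using \<kappa> unfolding K_def L_def by (simp add: algebra_simps)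
      then have "2 powr (\<kappa> * \<bar>mb\<bar>) * japanese \<xi> powr mb * japanese \<eta> powr (\<kappa> * \<bar>mb\<bar>) \<le> 2 powr (\<kappa> * \<bar>mb\<bar>) * japanese \<xi> powr mb * japanese \<eta> powr K"
        using mb by (intro mult_left_mono japanese_powr_mono) auto
      then show "japanese (\<xi> + r *\<^sub>R \<eta>) powr mb \<le> 2 powr (\<kappa> * \<bar>mb\<bar>) * japanese \<xi> powr mb * japanese \<eta> powr K"
        using sh[of \<eta> mb] by linarith
    qed simp
    have wg': "wcl (\<lambda>_. 1) g'" unfolding g'_def[abs_def]
      using wcl_affine[OF bounded_linear_scaleR_right wg, where \<sigma> = "\<lambda>b. b" and c = "\<lambda>b. 1 / r" and a = 0] by simp
    have wT: "wcl (\<lambda>\<eta>. japanese \<eta> powr K) (mi_power \<alpha>)" if "mi_abs \<alpha> < M" for \<alpha> :: "'n \<Rightarrow> nat"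
    proof (rule wcl_mono[OF wcl_mi_power, where D = 1])
      have "real (mi_abs \<alpha>) \<le> K" using that L0 by (simp add: K_def)
      then show "japanese \<eta> powr real (mi_abs \<alpha>) \<le> 1 * japanese \<eta> powr K" for \<eta> :: "real ^ 'n" by (simp add: japanese_powr_mono)
    qed simp
    define h where "h \<eta> = f' \<eta> - taylor M f' \<eta>" for \<eta>
    have wtay: "wcl (\<lambda>\<eta>. japanese \<eta> powr K) (taylor M f')" unfolding taylor_def[abs_def]
      using wT by (intro wcl_sum wcl_cmult) auto
    have wh: "wcl (\<lambda>\<eta>. japanese \<eta> powr K) h" unfolding h_def[abs_def] by (rule wcl_diff[OF wf' wtay])
    have dh: "iter_deriv vs h \<eta> = iter_deriv vs f' \<eta> - iter_deriv vs (taylor M f') \<eta>" if "set vs \<subseteq> Basis" for vs \<eta>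
      unfolding h_def[abs_def] by (simp add: iter_deriv_diff[OF sf' smooth_taylor that])
    \<comment> \<open>A derivative of order j of the dilated f has the order m - (\<rho> - \<delta>)
      j in \<xi>. Only orders j of at least M count, and as \<delta> < \<rho> the worst of them is j
      = M.\<close>
    define X where "X = A * (2 powr L * japanese \<xi> powr (m - (\<rho> - \<delta>) * real M))"
    have X0: "X \<ge> 0" using AB by (simp add: X_def)
    have "bdd Nf (X * real DIM(real ^ 'n) ^ M) (\<lambda>\<eta>. japanese \<eta> powr (L + real M)) h"
    proof (rule vanishing_bound[OF wcl_smooth[OF wh] _ _ X0 L0])
      show "M \<le> Nf" by (simp add: Nf_def)
      show "iter_deriv vs h 0 = 0" if "set vs \<subseteq> Basis" "length vs < M" for vs
        using taylor_deriv_0[OF sf' that] dh[OF that(1)] by simp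
      fix vs :: "(real ^ 'n) list" and \<eta> :: "real ^ 'n" assume vs: "set vs \<subseteq> Basis" "M \<le> length vs" "length vs \<le> Nf"
      define s where "s = m - \<rho> * real (length vs)"
      have "\<rho> * real (length vs) \<le> 1 * real Nf" using vs \<delta> by (intro mult_mono) auto
      moreover have "0 \<le> \<rho> * real (length vs)" using \<delta> by simp
      ultimately have s: "\<bar>s\<bar> \<le> mb + real Nf" using m by (simp add: s_def)
      then have sL: "\<kappa> * \<bar>s\<bar> \<le> L" unfolding L_def using \<kappa> by (intro mult_left_mono) auto
      have "norm (iter_deriv vs h \<eta>) = r ^ length vs * norm (iter_deriv vs f (\<xi> + r *\<^sub>R \<eta>))"
        using r by (simp add: dh[OF vs(1)] df'[OF vs(1)] taylor_deriv_high[OF vs(1,2)] norm_mult norm_power)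
      also have "\<dots> \<le> r ^ length vs * (A * japanese (\<xi> + r *\<^sub>R \<eta>) powr s)"
        unfolding s_def using r vs by (intro mult_left_mono bf) (auto simp: N_def)
      also have "\<dots> \<le> r ^ length vs * (A * (2 powr L * japanese \<xi> powr s * japanese \<eta> powr L))"
      proof -
        have "2 powr (\<kappa> * \<bar>s\<bar>) * japanese \<xi> powr s * japanese \<eta> powr (\<kappa> * \<bar>s\<bar>) \<le> 2 powr L * japanese \<xi> powr s * japanese \<eta> powr L"
          using sL by (intro mult_mono japanese_powr_mono powr_mono) auto
        with sh[of \<eta> s] r AB show ?thesis by (intro mult_left_mono) (auto intro: order_trans)
      qed
      also have "\<dots> = (A * (2 powr L * (r ^ length vs * japanese \<xi> powr s))) * japanese \<eta> powr L" by (simp add: mult_ac)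
      also have "r ^ length vs * japanese \<xi> powr s = japanese \<xi> powr (m - (\<rho> - \<delta>) * real (length vs))"
        using japanese_pos[of \<xi>] by (simp add: r_def s_def powr_realpow[symmetric] powr_powr powr_add[symmetric] algebra_simps)
      also have "(A * (2 powr L * japanese \<xi> powr (m - (\<rho> - \<delta>) * real (length vs)))) * japanese \<eta> powr L \<le> X * japanese \<eta> powr L"
        unfolding X_def using AB vs \<delta> by (intro mult_right_mono mult_left_mono japanese_powr_mono) (auto intro!: mult_left_mono)
      finally show "norm (iter_deriv vs h \<eta>) \<le> X * japanese \<eta> powr L" .
    qed
    then have bh: "bdd (2 * DIM(real ^ 'n)) (X * real d ^ M) (\<lambda>\<eta>. japanese \<eta> powr K) h"
      unfolding K_def by (rule bdd_mono) (auto simp: Nf_def d_def)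
    have bg': "bdd (2 * k) B (\<lambda>_. 1) g'"
      unfolding bdd_def
    proof (intro allI impI)
      fix vs :: "(real ^ 'n) list" and y :: "real ^ 'n" assume vs: "set vs \<subseteq> Basis \<and> length vs \<le> 2 * k"
      have "norm (iter_deriv vs g' y) = (1 / r) ^ length vs * norm (iter_deriv vs g ((1 / r) *\<^sub>R y))"
        using r vs by (simp add: dg' norm_mult norm_divide norm_power)
      also have "\<dots> \<le> (1 / r) ^ length vs * (B * japanese \<xi> powr (\<delta> * real (length vs)))"
        using r vs by (intro mult_left_mono bg) (auto simp: N_def)
      also have "japanese \<xi> powr (\<delta> * real (length vs)) = r ^ length vs"
        using r by (simp add: r_def powr_powr powr_realpow[symmetric])
      finally show "norm (iter_deriv vs g' y) \<le> B * 1" using r by (simp add: power_one_over)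
    qed
    have wfx: "wcl (\<lambda>\<eta>. japanese \<eta> powr mb) (\<lambda>\<eta>. f (\<xi> + \<eta>))"
    proof (rule wcl_mono)
      show "wcl (\<lambda>\<eta>. japanese (\<xi> + \<eta>) powr mb) (\<lambda>\<eta>. f (\<xi> + \<eta>))"
        by (rule wcl_affine[OF bounded_linear_ident wf, where \<sigma> = "\<lambda>b. b" and c = "\<lambda>b. 1"]) auto
      show "japanese (\<xi> + \<eta>) powr mb \<le> 2 powr \<bar>mb\<bar> * japanese \<xi> powr mb * japanese \<eta> powr mb" for \<eta>
        using peetre[of \<xi> \<eta> mb] mb by simp
    qed simp
    have "osc (\<lambda>z. f (\<xi> + fst z) * g (snd z)) = osc (\<lambda>z. f' (fst z) * g' (snd z))"
      using osc_dilate[OF wcl_tensor[OF wfx wg] r] by (simp add: f'_def g'_def)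
    also have "\<dots> = osc (\<lambda>z. h (fst z) * g' (snd z) + taylor M f' (fst z) * g' (snd z))"
      by (simp add: h_def left_diff_distrib)
    also have "\<dots> = osc (\<lambda>z. h (fst z) * g' (snd z)) + osc (\<lambda>z. taylor M f' (fst z) * g' (snd z))"
      by (rule osc_add[OF wcl_tensor[OF wh wg'] wcl_tensor[OF wtay wg']])
    also have "osc (\<lambda>z. taylor M f' (fst z) * g' (snd z)) =
        osc (\<lambda>z. \<Sum>\<alpha> | mi_abs \<alpha> < M. (1 / of_nat (mi_fact \<alpha>) * mderiv \<alpha> f' 0) * (mi_power \<alpha> (fst z) * g' (snd z)))"
      by (simp add: taylor_def sum_distrib_right mult.assoc)
    also have "\<dots> = (\<Sum>\<alpha> | mi_abs \<alpha> < M. osc (\<lambda>z. (1 / of_nat (mi_fact \<alpha>) * mderiv \<alpha> f' 0) * (mi_power \<alpha> (fst z) * g' (snd z))))"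
      by (rule osc_sum[where K = K, OF finite_mi_less wcl_cmult[OF wcl_tensor[OF wT wg']]]) simp
    also have "\<dots> = (\<Sum>\<alpha> | mi_abs \<alpha> < M. 1 / of_nat (mi_fact \<alpha>) * mderiv \<alpha> f \<xi> * Dderiv \<alpha> g 0)"
    proof (rule sum.cong[OF refl])
      fix \<alpha> :: "'n \<Rightarrow> nat" assume a: "\<alpha> \<in> {\<alpha>. mi_abs \<alpha> < M}"
      then have e1: "osc (\<lambda>z. (1 / of_nat (mi_fact \<alpha>) * mderiv \<alpha> f' 0) * (mi_power \<alpha> (fst z) * g' (snd z))) =
        (1 / of_nat (mi_fact \<alpha>) * mderiv \<alpha> f' 0) * Dderiv \<alpha> g' 0"
        by (subst osc_cmult[OF wcl_tensor[OF wT wg']]) (auto simp: osc_mi_power[OF wg'])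
      \<comment> \<open>The powers of r from the derivatives of g and of f cancel, so the terms of
        the expansion do not see the dilation.\<close>
      have e2: "Dderiv \<alpha> g' 0 = complex_of_real ((1 / r) ^ mi_abs \<alpha>) * Dderiv \<alpha> g 0"
        unfolding g'_def[abs_def] by (rule Dderiv_scale[OF sg])
      have e3: "mderiv \<alpha> f' 0 = complex_of_real (r ^ mi_abs \<alpha>) * mderiv \<alpha> f \<xi>"
        using df'[OF mi_list_Basis, of \<alpha> 0] by (simp add: mderiv_mi_list length_mi_list)
      show "osc (\<lambda>z. (1 / of_nat (mi_fact \<alpha>) * mderiv \<alpha> f' 0) * (mi_power \<alpha> (fst z) * g' (snd z))) =
        1 / of_nat (mi_fact \<alpha>) * mderiv \<alpha> f \<xi> * Dderiv \<alpha> g 0"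
        using r unfolding e1 by (simp add: e2 e3 power_one_over)
    qed
    finally have "osc_taylor_diff M \<xi> f g = osc (\<lambda>z. h (fst z) * g' (snd z))" by (simp add: osc_taylor_diff_def)
    also have "norm \<dots> \<le> C0 * (X * real d ^ M) * B"
      by (rule C0(2)[OF wh wg' _ AB(2) bh bg']) (use X0 in simp)
    finally show ?thesis by (simp add: X_def C_def mult_ac)
  qed
  moreover have "C \<ge> 0" using C0(1) by (simp add: C_def)
  ultimately show ?thesis by (intro exI[of _ C] conjI exI[of _ N]) auto
qed

section \<open>The composed symbol\<close>

text \<open>A one-parameter family with derivative \<open>f'\<close> in the parameter, with the bounds that
  let limits of difference quotients pass through the oscillatory integral.\<close>

definition wfam :: "('a::euclidean_space \<Rightarrow> real) \<Rightarrow> (real \<Rightarrow> 'a \<Rightarrow> complex) \<Rightarrow> (real \<Rightarrow> 'a \<Rightarrow> complex) \<Rightarrow> bool" where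
  "wfam W f f' \<longleftrightarrow> (\<forall>t. smooth (f t) \<and> smooth (f' t)) \<and>
     (\<forall>vs. set vs \<subseteq> Basis \<longrightarrow>
       (\<forall>t x. ((\<lambda>t. iter_deriv vs (f t) x) has_vector_derivative iter_deriv vs (f' t) x) (at t)) \<and>
       (\<exists>C. \<forall>t x. \<bar>t\<bar> \<le> 1 \<longrightarrow> norm (iter_deriv vs (f t) x) \<le> C * W x \<and> norm (iter_deriv vs (f' t) x) \<le> C * W x))"

lemma wconv_of_lists:
  fixes F :: "nat \<Rightarrow> 'a::euclidean_space \<Rightarrow> complex"
  assumes "\<And>n. smooth (F n)" "smooth f" "\<And>x. 0 \<le> W x"
    and b: "\<And>vs. set vs \<subseteq> Basis \<Longrightarrow> \<exists>C. \<forall>n x. norm (iter_deriv vs (F n) x) \<le> C * W x"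
    and "\<And>vs x. set vs \<subseteq> Basis \<Longrightarrow> (\<lambda>n. iter_deriv vs (F n) x) \<longlonglongrightarrow> iter_deriv vs f x"
  shows "wconv W F f"
  unfolding wconv_def
proof (intro conjI allI impI)
  fix N
  have "\<exists>C\<ge>0. \<forall>n\<in>UNIV. bdd N C W (F n)"
    by (rule bdd_of_lists[where W = "\<lambda>_. W"]) (use assms in auto)
  then show "\<exists>C\<ge>0. \<forall>n. bdd N C W (F n)" by simp
qed (use assms in auto)

text \<open>The difference quotients of all derivatives are bounded by the derivative in t through
  the mean value bound; this uniformity is what convergence under \<open>osc\<close> needs.\<close>

lemma wfam_wconv:
  assumes f: "wfam W f f'" and W: "\<And>x. 0 \<le> W x" and t: "t \<longlonglongrightarrow> 0" "\<And>n. t n \<noteq> 0" "\<And>n. \<bar>t n\<bar> \<le> (1::real)"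
  shows "wconv W (\<lambda>n. f (t n)) (f 0)"
    and "wconv W (\<lambda>n x. complex_of_real (1 / t n) * (f (t n) x - f 0 x)) (f' 0)"
proof -
  have s: "smooth (f t)" "smooth (f' t)" for t using f by (auto simp: wfam_def)
  have d: "((\<lambda>t. iter_deriv vs (f t) x) has_vector_derivative iter_deriv vs (f' t) x) (at t)" if "set vs \<subseteq> Basis" for vs t x
    using f that by (auto simp: wfam_def)
  have b: "\<exists>C. \<forall>t x. \<bar>t\<bar> \<le> 1 \<longrightarrow> norm (iter_deriv vs (f t) x) \<le> C * W x \<and> norm (iter_deriv vs (f' t) x) \<le> C * W x" if "set vs \<subseteq> Basis" for vs
    using f that by (auto simp: wfam_def)
  show "wconv W (\<lambda>n. f (t n)) (f 0)"
  proof (rule wconv_of_lists[OF s(1) s(1) W])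
    fix vs :: "'a list" and x assume vs: "set vs \<subseteq> Basis"
    show "\<exists>C. \<forall>n x. norm (iter_deriv vs (f (t n)) x) \<le> C * W x" using b[OF vs] t(3) by blast
    have "isCont (\<lambda>t. iter_deriv vs (f t) x) 0"
      using d[OF vs] has_vector_derivative_continuous by blast
    from isCont_tendsto_compose[OF this t(1)]
    show "(\<lambda>n. iter_deriv vs (f (t n)) x) \<longlonglongrightarrow> iter_deriv vs (f 0) x" .
  qed
  have e: "iter_deriv vs (\<lambda>x. complex_of_real (1 / t n) * (f (t n) x - f 0 x)) x = (iter_deriv vs (f (t n)) x - iter_deriv vs (f 0) x) /\<^sub>R t n"
    if "set vs \<subseteq> Basis" for vs n x
    using iter_deriv_cmult[OF smooth_diff[OF s(1) s(1)] that, of "complex_of_real (1 / t n)" "t n" 0] iter_deriv_diff[OF s(1) s(1) that, of "t n" 0]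
    by (simp add: scaleR_conv_of_real divide_inverse)
  show "wconv W (\<lambda>n x. complex_of_real (1 / t n) * (f (t n) x - f 0 x)) (f' 0)"
  proof (rule wconv_of_lists[OF _ s(2) W])
    show "smooth (\<lambda>x. complex_of_real (1 / t n) * (f (t n) x - f 0 x))" for n
      by (intro smooth_cmult smooth_diff s)
    fix vs :: "'a list" assume vs: "set vs \<subseteq> Basis"
    obtain C where C: "\<And>t x. \<bar>t\<bar> \<le> 1 \<Longrightarrow> norm (iter_deriv vs (f' t) x) \<le> C * W x" using b[OF vs] by blast
    have "norm (iter_deriv vs (\<lambda>x. complex_of_real (1 / t n) * (f (t n) x - f 0 x)) x) \<le> C * W x" for n x
    proof -
      have "norm (iter_deriv vs (f (t n)) x - iter_deriv vs (f 0) x - t n *\<^sub>R 0) \<le> (C * W x) * \<bar>t n\<bar>"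
      proof (rule mean_value_affine[where \<phi>' = "\<lambda>t. iter_deriv vs (f' t) x"])
        fix u assume "u \<in> closed_segment 0 (t n)"
        then have "\<bar>u\<bar> \<le> 1" using t(3)[of n] by (auto simp: closed_segment_eq_real_ivl split: if_splits)
        then show "norm (iter_deriv vs (f' u) x - 0) \<le> C * W x" using C by simp
      qed (rule d[OF vs])
      then have "norm (iter_deriv vs (f (t n)) x - iter_deriv vs (f 0) x) / \<bar>t n\<bar> \<le> C * W x"
        using t(2)[of n] by (simp add: divide_le_eq)
      then show ?thesis unfolding e[OF vs] by (simp add: divide_inverse_commute)
    qed
    then show "\<exists>C. \<forall>n x. norm (iter_deriv vs (\<lambda>x. complex_of_real (1 / t n) * (f (t n) x - f 0 x)) x) \<le> C * W x" by blast
    fix x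
    have "has_dir_deriv (\<lambda>t. iter_deriv vs (f t) x) 1 (iter_deriv vs (f' 0) x) (0::real)"
      using d[OF vs, of x 0] by (simp add: has_dir_deriv_def)
    then have "((\<lambda>t. (iter_deriv vs (f t) x - iter_deriv vs (f 0) x) /\<^sub>R t) \<longlongrightarrow> iter_deriv vs (f' 0) x) (at 0)"
      by (simp add: has_dir_deriv_iff_tendsto)
    then show "(\<lambda>n. iter_deriv vs (\<lambda>x. complex_of_real (1 / t n) * (f (t n) x - f 0 x)) x) \<longlonglongrightarrow> iter_deriv vs (f' 0) x"
      unfolding e[OF vs] tendsto_at_iff_sequentially o_def using t by auto
  qed
qed

lemma wfam_wcl:
  assumes "wfam W f f'" "\<And>x. 0 \<le> W x"
  shows "wcl W (f 0)" "wcl W (f' 0)"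
  using assms by (auto simp: wfam_def intro!: wcl_of_lists) (metis abs_zero zero_le_one)+

lemma osc_family_deriv:
  fixes f f' g g' :: "real \<Rightarrow> real ^ 'n::finite \<Rightarrow> complex"
  assumes f: "wfam (\<lambda>x. japanese x powr K) f f'" and g: "wfam (\<lambda>_. 1) g g'"
  shows "((\<lambda>t. osc (\<lambda>z. f t (fst z) * g t (snd z))) has_vector_derivative
    osc (\<lambda>z. f' 0 (fst z) * g 0 (snd z)) + osc (\<lambda>z. f 0 (fst z) * g' 0 (snd z))) (at 0)"
proof -
  let ?G = "\<lambda>t. osc (\<lambda>z. f t (fst z) * g t (snd z))"
  let ?D = "osc (\<lambda>z. f' 0 (fst z) * g 0 (snd z)) + osc (\<lambda>z. f 0 (fst z) * g' 0 (snd z))"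
  \<comment> \<open>The bounds of \<open>wfam\<close> hold for \<bar>t\<bar> \<le> 1 only. The limit
    is taken inside the open interval, which gives the same filter at 0.\<close>
  have "((\<lambda>t. (?G t - ?G 0) /\<^sub>R t) \<longlongrightarrow> ?D) (at 0 within {-1<..<1})"
    unfolding tendsto_at_iff_sequentially o_def
  proof (intro allI impI)
    fix X :: "nat \<Rightarrow> real" assume X: "\<forall>i. X i \<in> {-1<..<1} - {0}" "X \<longlonglongrightarrow> 0"
    then have t: "\<And>n. X n \<noteq> 0" "\<And>n. \<bar>X n\<bar> \<le> 1" by (auto simp: abs_le_iff less_imp_le minus_le_iff)
    note cf = wfam_wconv[OF f _ X(2) t] and cg = wfam_wconv[OF g _ X(2) t]
    have nn: "0 \<le> japanese x powr K" "(0::real) \<le> 1" for x :: "real ^ 'n" by auto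
    note cf = cf[OF nn(1)] and cg = cg[OF nn(2)]
    define qf where "qf n x = complex_of_real (1 / X n) * (f (X n) x - f 0 x)" for n x
    define qg where "qg n x = complex_of_real (1 / X n) * (g (X n) x - g 0 x)" for n x
    have c: "wconv (\<lambda>x. japanese x powr K) qf (f' 0)" "wconv (\<lambda>_. 1) qg (g' 0)"
      using cf(2) cg(2) by (simp_all add: qf_def[abs_def] qg_def[abs_def])
    note w0 = wfam_wcl(1)[OF f nn(1)] wfam_wcl(1)[OF g nn(2)]
    have w: "wcl (\<lambda>x. japanese x powr K) (f (X n))" "wcl (\<lambda>_. 1) (g (X n))" "wcl (\<lambda>x. japanese x powr K) (qf n)" "wcl (\<lambda>_. 1) (qg n)" for n
      using wconv_elem_wcl[OF cf(1)] wconv_elem_wcl[OF cg(1)] wconv_elem_wcl[OF c(1)] wconv_elem_wcl[OF c(2)] by auto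
    have "(?G (X n) - ?G 0) /\<^sub>R X n = osc (\<lambda>z. qf n (fst z) * g (X n) (snd z)) + osc (\<lambda>z. f 0 (fst z) * qg n (snd z))" for n
    proof -
      have "(?G (X n) - ?G 0) /\<^sub>R X n = complex_of_real (1 / X n) * (?G (X n) - ?G 0)"
        by (simp add: scaleR_conv_of_real divide_inverse)
      also have "\<dots> = complex_of_real (1 / X n) * osc (\<lambda>z. f (X n) (fst z) * g (X n) (snd z) - f 0 (fst z) * g 0 (snd z))"
        by (simp add: osc_diff[OF wcl_tensor[OF w(1,2)] wcl_tensor[OF w0]])
      also have "\<dots> = osc (\<lambda>z. complex_of_real (1 / X n) * (f (X n) (fst z) * g (X n) (snd z) - f 0 (fst z) * g 0 (snd z)))"
        by (rule osc_cmult[symmetric, OF wcl_diff[OF wcl_tensor[OF w(1,2)] wcl_tensor[OF w0]]])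
      \<comment> \<open>The usual splitting behind the product rule: quotient of f times g at the
        moved parameter, plus f at 0 times the quotient of g.\<close>
      also have "\<dots> = osc (\<lambda>z. qf n (fst z) * g (X n) (snd z) + f 0 (fst z) * qg n (snd z))"
        by (simp add: qf_def qg_def algebra_simps)
      also have "\<dots> = osc (\<lambda>z. qf n (fst z) * g (X n) (snd z)) + osc (\<lambda>z. f 0 (fst z) * qg n (snd z))"
        by (rule osc_add[OF wcl_tensor[OF w(3,2)] wcl_tensor[OF w0(1) w(4)]])
      finally show ?thesis .
    qed
    moreover have "(\<lambda>n. osc (\<lambda>z. qf n (fst z) * g (X n) (snd z)) + osc (\<lambda>z. f 0 (fst z) * qg n (snd z))) \<longlonglongrightarrow> ?D"
      by (intro tendsto_add osc_tendsto[OF wconv_tensor[OF c(1) cg(1)]] osc_tendsto[OF wconv_tensor[OF wconv_const[OF w0(1)] c(2)]])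
    ultimately show "(\<lambda>n. (?G (X n) - ?G 0) /\<^sub>R X n) \<longlonglongrightarrow> ?D" by simp
  qed
  moreover have "at (0::real) within {-1<..<1} = at 0" by (rule at_within_open) auto
  ultimately have "has_dir_deriv ?G 1 ?D (0::real)" unfolding has_dir_deriv_iff_tendsto by simp
  then show ?thesis by (simp add: has_dir_deriv_def)
qed

text \<open>The factor 8 is 2 from Peetre's inequality for the shift by \<eta> times 4 from
  comparing \<theta> with \<xi>.\<close>

lemma japanese_powr_shift_le:
  assumes "norm (\<theta> - \<xi>) \<le> 1" "s \<le> K" "0 \<le> K"
  shows "japanese (\<theta> + \<eta>) powr s \<le> (8 powr K * japanese \<xi> powr K) * japanese \<eta> powr K"
proof -
  have "japanese (\<theta> + \<eta>) powr s \<le> japanese (\<theta> + \<eta>) powr K" by (rule japanese_powr_mono[OF assms(2)])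
  also have "\<dots> \<le> 2 powr K * japanese \<theta> powr K * japanese \<eta> powr K" using peetre[of \<theta> \<eta> K] assms(3) by simp
  also have "\<dots> \<le> 2 powr K * (4 powr K * japanese \<xi> powr K) * japanese \<eta> powr K"
    using japanese_powr_near[OF assms(1), of K] assms(3) by (intro mult_right_mono mult_left_mono) auto
  also have "\<dots> = (8 powr K * japanese \<xi> powr K) * japanese \<eta> powr K"
    by (simp add: powr_mult[symmetric] mult.assoc[symmetric])
  finally show ?thesis .
qed

text \<open>Only the constant depends on \<xi>; the growth K in \<eta> is the same for all base
  points and all derivatives, as \<open>wcl\<close> demands.\<close>

lemma CS_shift_bound:
  fixes p :: "real ^ 'n::finite \<Rightarrow> real ^ 'n \<Rightarrow> complex"
  assumes p: "p \<in> CS \<tau> m \<rho> \<delta>" and \<tau>: "0 \<le> \<tau>" and \<rho>: "0 \<le> \<rho>" and K: "m \<le> K" "0 \<le> K" and ws: "set ws \<subseteq> Basis"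
  shows "\<exists>C. \<forall>x \<theta> \<eta>. norm (\<theta> - \<xi>) \<le> 1 \<longrightarrow> norm (iter_deriv ws (p x) (\<theta> + \<eta>)) \<le> C * japanese \<eta> powr K"
proof -
  obtain C where C: "C \<ge> 0" "\<And>x \<xi>. norm (iter_deriv ws (p x) \<xi>) \<le> C * japanese \<xi> powr (m - \<rho> * real (length ws))"
    using CS_bound[OF p \<tau> ws, of "[]"] by (auto simp: mixed_deriv_Nil)
  have "m - \<rho> * real (length ws) \<le> K" using \<rho> K mult_nonneg_nonneg[OF \<rho>, of "real (length ws)"] by linarith
  then have "norm (iter_deriv ws (p x) (\<theta> + \<eta>)) \<le> C * ((8 powr K * japanese \<xi> powr K) * japanese \<eta> powr K)"
    if "norm (\<theta> - \<xi>) \<le> 1" for x \<theta> \<eta>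
    using C(1) japanese_powr_shift_le[OF that _ K(2)] by (intro order_trans[OF C(2)] mult_left_mono) auto
  then show ?thesis by (intro exI[of _ "C * (8 powr K * japanese \<xi> powr K)"]) (simp add: mult.assoc)
qed

lemma smooth_symbols_shift_bound:
  fixes q :: "real ^ 'n::finite \<Rightarrow> real ^ 'n \<Rightarrow> complex"
  assumes q: "q \<in> smooth_symbols m \<rho> \<delta>" and vs: "set vs \<subseteq> Basis"
  shows "\<exists>C. \<forall>x \<theta>. norm (\<theta> - \<xi>) \<le> 1 \<longrightarrow> norm (iter_deriv vs (\<lambda>x. q x \<theta>) x) \<le> C"
proof -
  define e where "e = m + \<delta> * real (length vs)"
  obtain C where C: "C \<ge> 0" "\<And>x \<xi>. norm (iter_deriv vs (\<lambda>x. q x \<xi>) x) \<le> C * japanese \<xi> powr e"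
    using smooth_symbols_bound[OF q vs] unfolding e_def by blast
  have "norm (iter_deriv vs (\<lambda>x. q x \<theta>) x) \<le> C * (4 powr \<bar>e\<bar> * japanese \<xi> powr e)" if "norm (\<theta> - \<xi>) \<le> 1" for x \<theta>
    using C(1) japanese_powr_near[OF that] by (intro order_trans[OF C(2)] mult_left_mono)
  then show ?thesis by blast
qed

lemma norm_line_le: "b \<in> Basis \<Longrightarrow> \<bar>t\<bar> \<le> 1 \<Longrightarrow> norm (\<xi> + t *\<^sub>R b - \<xi>) \<le> 1"
  by simp

lemma wfam_CS_xi:
  fixes p :: "real ^ 'n::finite \<Rightarrow> real ^ 'n \<Rightarrow> complex"
  assumes p: "p \<in> CS \<tau> m \<rho> \<delta>" and h: "0 \<le> \<tau>" "0 \<le> \<rho>" "0 \<le> \<delta>" and K: "m \<le> K" "0 \<le> K" and b: "b \<in> Basis"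
  shows "wfam (\<lambda>\<eta>. japanese \<eta> powr K) (\<lambda>t \<eta>. p x (\<xi> + t *\<^sub>R b + \<eta>)) (\<lambda>t \<eta>. dxi b p x (\<xi> + t *\<^sub>R b + \<eta>))"
  unfolding wfam_def
proof (intro conjI allI impI)
  note p' = CS_dxi[OF p h(1,3) b]
  note s = CS_smooth[OF p, of x] CS_smooth[OF p', of x]
  show "smooth (\<lambda>\<eta>. p x (\<xi> + t *\<^sub>R b + \<eta>))" "smooth (\<lambda>\<eta>. dxi b p x (\<xi> + t *\<^sub>R b + \<eta>))" for t
    by (rule affine_translate(1)[OF s(1)], rule affine_translate(1)[OF s(2)])
  fix vs :: "(real ^ 'n) list" assume vs: "set vs \<subseteq> Basis"
  note e = affine_translate(2)[OF s(1) vs] affine_translate(2)[OF s(2) vs]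
  show "((\<lambda>t. iter_deriv vs (\<lambda>\<eta>. p x (\<xi> + t *\<^sub>R b + \<eta>)) \<eta>) has_vector_derivative iter_deriv vs (\<lambda>\<eta>. dxi b p x (\<xi> + t *\<^sub>R b + \<eta>)) \<eta>) (at t)" for t \<eta>
    unfolding e using has_dir_deriv_line[OF CS_dxi_dir[OF p h(1,3) b vs], of x "\<xi> + \<eta>" t] by (simp add: add_ac)
  have K': "m - \<rho> \<le> K" using K h by linarith
  obtain C where C: "\<And>x \<theta> \<eta>. norm (\<theta> - \<xi>) \<le> 1 \<Longrightarrow> norm (iter_deriv vs (p x) (\<theta> + \<eta>)) \<le> C * japanese \<eta> powr K"
    using CS_shift_bound[OF p h(1,2) K vs] by blast
  obtain D where D: "\<And>x \<theta> \<eta>. norm (\<theta> - \<xi>) \<le> 1 \<Longrightarrow> norm (iter_deriv vs (dxi b p x) (\<theta> + \<eta>)) \<le> D * japanese \<eta> powr K"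
    using CS_shift_bound[OF p' h(1,2) K' K(2) vs] by blast
  have "C * w \<le> max C D * w" "D * w \<le> max C D * w" if "0 \<le> w" for w using that by (auto intro: mult_right_mono)
  then show "\<exists>C. \<forall>t \<eta>. \<bar>t\<bar> \<le> 1 \<longrightarrow> norm (iter_deriv vs (\<lambda>\<eta>. p x (\<xi> + t *\<^sub>R b + \<eta>)) \<eta>) \<le> C * japanese \<eta> powr K \<and>
      norm (iter_deriv vs (\<lambda>\<eta>. dxi b p x (\<xi> + t *\<^sub>R b + \<eta>)) \<eta>) \<le> C * japanese \<eta> powr K"
    unfolding e using C D norm_line_le[OF b, of _ \<xi>]
    by (intro exI[of _ "max C D"]) (meson order_trans powr_ge_zero)
qed

lemma wfam_CS_x:
  fixes p :: "real ^ 'n::finite \<Rightarrow> real ^ 'n \<Rightarrow> complex"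
  assumes p: "p \<in> CS \<tau> m \<rho> \<delta>" and h: "1 \<le> \<tau>" "0 \<le> \<rho>" "0 \<le> \<delta>" and K: "m + \<delta> \<le> K" "0 \<le> K" and b: "b \<in> Basis"
  shows "wfam (\<lambda>\<eta>. japanese \<eta> powr K) (\<lambda>t \<eta>. p (x + t *\<^sub>R b) (\<xi> + \<eta>)) (\<lambda>t \<eta>. dx b p (x + t *\<^sub>R b) (\<xi> + \<eta>))"
  unfolding wfam_def
proof (intro conjI allI impI)
  note p' = CS_dx[OF p h(1,3) b]
  have t: "0 \<le> \<tau>" "0 \<le> \<tau> - 1" using h by auto
  note s = CS_smooth[OF p] CS_smooth[OF p']
  show "smooth (\<lambda>\<eta>. p (x + t *\<^sub>R b) (\<xi> + \<eta>))" "smooth (\<lambda>\<eta>. dx b p (x + t *\<^sub>R b) (\<xi> + \<eta>))" for t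
    by (rule affine_translate(1)[OF s(1)], rule affine_translate(1)[OF s(2)])
  fix vs :: "(real ^ 'n) list" assume vs: "set vs \<subseteq> Basis"
  note e = affine_translate(2)[OF s(1) vs] affine_translate(2)[OF s(2) vs]
  show "((\<lambda>t. iter_deriv vs (\<lambda>\<eta>. p (x + t *\<^sub>R b) (\<xi> + \<eta>)) \<eta>) has_vector_derivative iter_deriv vs (\<lambda>\<eta>. dx b p (x + t *\<^sub>R b) (\<xi> + \<eta>)) \<eta>) (at t)" for t \<eta>
    unfolding e by (rule has_dir_deriv_line[OF CS_dx_dir[OF p h(1,3) b vs]])
  have K': "m \<le> K" using K h by linarith
  have z: "norm (\<xi> - \<xi>) \<le> 1" by simp
  obtain C where C: "\<And>x \<theta> \<eta>. norm (\<theta> - \<xi>) \<le> 1 \<Longrightarrow> norm (iter_deriv vs (p x) (\<theta> + \<eta>)) \<le> C * japanese \<eta> powr K"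
    using CS_shift_bound[OF p t(1) h(2) K' K(2) vs] by blast
  obtain D where D: "\<And>x \<theta> \<eta>. norm (\<theta> - \<xi>) \<le> 1 \<Longrightarrow> norm (iter_deriv vs (dx b p x) (\<theta> + \<eta>)) \<le> D * japanese \<eta> powr K"
    using CS_shift_bound[OF p' t(2) h(2) K vs] by blast
  have "C * w \<le> max C D * w" "D * w \<le> max C D * w" if "0 \<le> w" for w using that by (auto intro: mult_right_mono)
  then show "\<exists>C. \<forall>t \<eta>. \<bar>t\<bar> \<le> 1 \<longrightarrow> norm (iter_deriv vs (\<lambda>\<eta>. p (x + t *\<^sub>R b) (\<xi> + \<eta>)) \<eta>) \<le> C * japanese \<eta> powr K \<and>
      norm (iter_deriv vs (\<lambda>\<eta>. dx b p (x + t *\<^sub>R b) (\<xi> + \<eta>)) \<eta>) \<le> C * japanese \<eta> powr K"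
    unfolding e using C[OF z] D[OF z] by (intro exI[of _ "max C D"]) (meson order_trans powr_ge_zero)
qed

lemma wfam_symbols_xi:
  fixes q :: "real ^ 'n::finite \<Rightarrow> real ^ 'n \<Rightarrow> complex"
  assumes q: "q \<in> smooth_symbols m \<rho> \<delta>" and \<delta>: "0 \<le> \<delta>" and b: "b \<in> Basis"
  shows "wfam (\<lambda>_. 1) (\<lambda>t y. q (x + y) (\<xi> + t *\<^sub>R b)) (\<lambda>t y. dxi b q (x + y) (\<xi> + t *\<^sub>R b))"
  unfolding wfam_def
proof (intro conjI allI impI)
  note q' = smooth_symbols_dxi[OF q \<delta> b]
  note s = smooth_symbols_smooth_x[OF q] smooth_symbols_smooth_x[OF q']
  show "smooth (\<lambda>y. q (x + y) (\<xi> + t *\<^sub>R b))" "smooth (\<lambda>y. dxi b q (x + y) (\<xi> + t *\<^sub>R b))" for t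
    by (rule affine_translate(1)[OF s(1)], rule affine_translate(1)[OF s(2)])
  fix vs :: "(real ^ 'n) list" assume vs: "set vs \<subseteq> Basis"
  note e = affine_translate(2)[OF s(1) vs] affine_translate(2)[OF s(2) vs]
  show "((\<lambda>t. iter_deriv vs (\<lambda>y. q (x + y) (\<xi> + t *\<^sub>R b)) y) has_vector_derivative iter_deriv vs (\<lambda>y. dxi b q (x + y) (\<xi> + t *\<^sub>R b)) y) (at t)" for t y
    unfolding e by (rule has_dir_deriv_line[OF smooth_symbols_dxi_dir[OF q b vs]])
  obtain C where C: "\<And>x \<theta>. norm (\<theta> - \<xi>) \<le> 1 \<Longrightarrow> norm (iter_deriv vs (\<lambda>x. q x \<theta>) x) \<le> C"
    using smooth_symbols_shift_bound[OF q vs] by blast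
  obtain D where D: "\<And>x \<theta>. norm (\<theta> - \<xi>) \<le> 1 \<Longrightarrow> norm (iter_deriv vs (\<lambda>x. dxi b q x \<theta>) x) \<le> D"
    using smooth_symbols_shift_bound[OF q' vs] by blast
  show "\<exists>C. \<forall>t y. \<bar>t\<bar> \<le> 1 \<longrightarrow> norm (iter_deriv vs (\<lambda>y. q (x + y) (\<xi> + t *\<^sub>R b)) y) \<le> C * 1 \<and>
      norm (iter_deriv vs (\<lambda>y. dxi b q (x + y) (\<xi> + t *\<^sub>R b)) y) \<le> C * 1"
    unfolding e using C D norm_line_le[OF b, of _ \<xi>]
    by (intro exI[of _ "max C D"]) (simp add: le_max_iff_disj)
qed

lemma wfam_symbols_x:
  fixes q :: "real ^ 'n::finite \<Rightarrow> real ^ 'n \<Rightarrow> complex"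
  assumes q: "q \<in> smooth_symbols m \<rho> \<delta>" and \<delta>: "0 \<le> \<delta>" and b: "b \<in> Basis"
  shows "wfam (\<lambda>_. 1) (\<lambda>t y. q (x + t *\<^sub>R b + y) \<xi>) (\<lambda>t y. dx b q (x + t *\<^sub>R b + y) \<xi>)"
  unfolding wfam_def
proof (intro conjI allI impI)
  note q' = smooth_symbols_dx[OF q \<delta> b]
  note s = smooth_symbols_smooth_x[OF q] smooth_symbols_smooth_x[OF q']
  show "smooth (\<lambda>y. q (x + t *\<^sub>R b + y) \<xi>)" "smooth (\<lambda>y. dx b q (x + t *\<^sub>R b + y) \<xi>)" for t
    by (rule affine_translate(1)[OF s(1)], rule affine_translate(1)[OF s(2)])
  fix vs :: "(real ^ 'n) list" assume vs: "set vs \<subseteq> Basis"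
  note e = affine_translate(2)[OF s(1) vs] affine_translate(2)[OF s(2) vs]
  show "((\<lambda>t. iter_deriv vs (\<lambda>y. q (x + t *\<^sub>R b + y) \<xi>) y) has_vector_derivative iter_deriv vs (\<lambda>y. dx b q (x + t *\<^sub>R b + y) \<xi>) y) (at t)" for t y
    unfolding e using has_dir_deriv_line[OF smooth_symbols_dx_dir[OF q b vs], of \<xi> "x + y" t] by (simp add: add_ac)
  have z: "norm (\<xi> - \<xi>) \<le> 1" by simp
  obtain C where C: "\<And>x \<theta>. norm (\<theta> - \<xi>) \<le> 1 \<Longrightarrow> norm (iter_deriv vs (\<lambda>x. q x \<theta>) x) \<le> C"
    using smooth_symbols_shift_bound[OF q vs] by blast
  obtain D where D: "\<And>x \<theta>. norm (\<theta> - \<xi>) \<le> 1 \<Longrightarrow> norm (iter_deriv vs (\<lambda>x. dx b q x \<theta>) x) \<le> D"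
    using smooth_symbols_shift_bound[OF q' vs] by blast
  show "\<exists>C. \<forall>t y. \<bar>t\<bar> \<le> 1 \<longrightarrow> norm (iter_deriv vs (\<lambda>y. q (x + t *\<^sub>R b + y) \<xi>) y) \<le> C * 1 \<and>
      norm (iter_deriv vs (\<lambda>y. dx b q (x + t *\<^sub>R b + y) \<xi>) y) \<le> C * 1"
    unfolding e using C[OF z] D[OF z] by (intro exI[of _ "max C D"]) (simp add: le_max_iff_disj)
qed

lemma sharp_osc: "sharp p q x \<xi> = osc (\<lambda>z. p x (\<xi> + fst z) * q (x + snd z) \<xi>)"
  by (simp add: sharp_def osc_def sharp_amplitude_def)

lemma wcl_CS_shift:
  fixes p :: "real ^ 'n::finite \<Rightarrow> real ^ 'n \<Rightarrow> complex"
  assumes p: "p \<in> CS \<tau> m \<rho> \<delta>" and h: "0 \<le> \<tau>" "0 \<le> \<rho>" and K: "m \<le> K" "0 \<le> K"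
  shows "wcl (\<lambda>\<eta>. japanese \<eta> powr K) (\<lambda>\<eta>. p x (\<xi> + \<eta>))"
proof (rule wcl_of_lists)
  note s = CS_smooth[OF p, of x]
  show "smooth (\<lambda>\<eta>. p x (\<xi> + \<eta>))" by (rule affine_translate(1)[OF s])
  fix vs :: "(real ^ 'n) list" assume vs: "set vs \<subseteq> Basis"
  have z: "norm (\<xi> - \<xi>) \<le> 1" by simp
  show "\<exists>C. \<forall>\<eta>. norm (iter_deriv vs (\<lambda>\<eta>. p x (\<xi> + \<eta>)) \<eta>) \<le> C * japanese \<eta> powr K"
    unfolding affine_translate(2)[OF s vs] using CS_shift_bound[OF p h K vs, of \<xi>] z by blast
qed simp

lemma wcl_CS:
  fixes p :: "real ^ 'n::finite \<Rightarrow> real ^ 'n \<Rightarrow> complex"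
  assumes "p \<in> CS \<tau> m \<rho> \<delta>" "0 \<le> \<tau>" "0 \<le> \<rho>" "m \<le> K" "0 \<le> K"
  shows "wcl (\<lambda>\<eta>. japanese \<eta> powr K) (p x)"
  using wcl_CS_shift[OF assms, of x 0] by simp

lemma wcl_symbols_shift:
  fixes q :: "real ^ 'n::finite \<Rightarrow> real ^ 'n \<Rightarrow> complex"
  assumes q: "q \<in> smooth_symbols m \<rho> \<delta>"
  shows "wcl (\<lambda>_. 1) (\<lambda>y. q (x + y) \<xi>)"
proof (rule wcl_of_lists)
  note s = smooth_symbols_smooth_x[OF q, of \<xi>]
  show "smooth (\<lambda>y. q (x + y) \<xi>)" by (rule affine_translate(1)[OF s])
  fix vs :: "(real ^ 'n) list" assume vs: "set vs \<subseteq> Basis"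
  have z: "norm (\<xi> - \<xi>) \<le> 1" by simp
  show "\<exists>C. \<forall>y. norm (iter_deriv vs (\<lambda>y. q (x + y) \<xi>) y) \<le> C * 1"
    unfolding affine_translate(2)[OF s vs]
  proof -
    obtain C where C: "\<forall>x \<theta>. norm (\<theta> - \<xi>) \<le> 1 \<longrightarrow> norm (iter_deriv vs (\<lambda>x. q x \<theta>) x) \<le> C"
      using smooth_symbols_shift_bound[OF q vs, of \<xi>] by blast
    show "\<exists>C. \<forall>y. norm (iter_deriv vs (\<lambda>x. q x \<xi>) (x + y)) \<le> C * 1" by (intro exI[of _ C]) (use C z in auto)
  qed
qed simp

lemma wcl_sharp_amplitude:
  fixes p q :: "real ^ 'n::finite \<Rightarrow> real ^ 'n \<Rightarrow> complex"
  assumes "p \<in> CS \<tau> m \<rho> \<delta>" "0 \<le> \<tau>" "0 \<le> \<rho>" "q \<in> smooth_symbols m' \<rho> \<delta>"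
  shows "wcl (WW \<bar>m\<bar> 0) (\<lambda>z. p x (\<xi> + fst z) * q (x + snd z) \<xi>)"
  by (rule wcl_tensor[OF wcl_CS_shift[OF assms(1-3)] wcl_symbols_shift[OF assms(4)]]) auto

lemma sharp_dir_deriv_xi:
  fixes p q :: "real ^ 'n::finite \<Rightarrow> real ^ 'n \<Rightarrow> complex"
  assumes p: "p \<in> CS \<tau> m \<rho> \<delta>" and q: "q \<in> smooth_symbols m' \<rho> \<delta>" and h: "0 \<le> \<tau>" "0 \<le> \<rho>" "0 \<le> \<delta>" and b: "b \<in> Basis"
  shows "has_dir_deriv (sharp p q x) b (sharp (dxi b p) q x \<xi> + sharp p (dxi b q) x \<xi>) \<xi>"
  using osc_family_deriv[OF wfam_CS_xi[OF p h abs_ge_self abs_ge_zero b] wfam_symbols_xi[OF q h(3) b]]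
  by (simp add: has_dir_deriv_def sharp_osc)

lemma sharp_dir_deriv_x:
  fixes p q :: "real ^ 'n::finite \<Rightarrow> real ^ 'n \<Rightarrow> complex"
  assumes p: "p \<in> CS \<tau> m \<rho> \<delta>" and q: "q \<in> smooth_symbols m' \<rho> \<delta>" and h: "1 \<le> \<tau>" "0 \<le> \<rho>" "0 \<le> \<delta>" and b: "b \<in> Basis"
  shows "has_dir_deriv (\<lambda>x. sharp p q x \<xi>) b (sharp (dx b p) q x \<xi> + sharp p (dx b q) x \<xi>) x"
  using osc_family_deriv[OF wfam_CS_x[OF p h abs_ge_self abs_ge_zero b] wfam_symbols_x[OF q h(3) b]]
  by (simp add: has_dir_deriv_def sharp_osc)

text \<open>Needed on its own: for \<tau> below 1 there is no x-derivative from which continuity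
  could be deduced.\<close>

lemma sharp_isCont_x:
  fixes p q :: "real ^ 'n::finite \<Rightarrow> real ^ 'n \<Rightarrow> complex"
  assumes p: "p \<in> CS \<tau> m \<rho> \<delta>" and q: "q \<in> smooth_symbols m' \<rho> \<delta>" and h: "0 \<le> \<tau>" "0 \<le> \<rho>"
  shows "isCont (\<lambda>x. sharp p q x \<xi>) x"
  unfolding continuous_at_sequentially o_def
proof (intro allI impI)
  fix X assume X: "X \<longlonglongrightarrow> x"
  have z: "norm (\<xi> - \<xi>) \<le> 1" by simp
  have "wconv (\<lambda>\<eta>. japanese \<eta> powr \<bar>m\<bar>) (\<lambda>n \<eta>. p (X n) (\<xi> + \<eta>)) (\<lambda>\<eta>. p x (\<xi> + \<eta>))"
  proof (rule wconv_of_lists)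
    note s = CS_smooth[OF p]
    show "smooth (\<lambda>\<eta>. p (X n) (\<xi> + \<eta>))" "smooth (\<lambda>\<eta>. p x (\<xi> + \<eta>))" for n by (rule affine_translate(1)[OF s])+
    fix vs :: "(real ^ 'n) list" assume vs: "set vs \<subseteq> Basis"
    show "\<exists>C. \<forall>n \<eta>. norm (iter_deriv vs (\<lambda>\<eta>. p (X n) (\<xi> + \<eta>)) \<eta>) \<le> C * japanese \<eta> powr \<bar>m\<bar>"
      unfolding affine_translate(2)[OF s vs] using CS_shift_bound[OF p h abs_ge_self abs_ge_zero vs, of \<xi>] z by blast
    have "isCont (\<lambda>x. iter_deriv vs (p x) (\<xi> + \<eta>)) x" for \<eta>
      using Ck_isCont[OF CS_Ck[OF p vs], of "[]"] by simp
    from isCont_tendsto_compose[OF this X]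
    show "(\<lambda>n. iter_deriv vs (\<lambda>\<eta>. p (X n) (\<xi> + \<eta>)) \<eta>) \<longlonglongrightarrow> iter_deriv vs (\<lambda>\<eta>. p x (\<xi> + \<eta>)) \<eta>" for \<eta>
      unfolding affine_translate(2)[OF s vs] .
  qed simp
  moreover have "wconv (\<lambda>_. 1) (\<lambda>n y. q (X n + y) \<xi>) (\<lambda>y. q (x + y) \<xi>)"
  proof (rule wconv_of_lists)
    note s = smooth_symbols_smooth_x[OF q, of \<xi>]
    show "smooth (\<lambda>y. q (X n + y) \<xi>)" "smooth (\<lambda>y. q (x + y) \<xi>)" for n by (rule affine_translate(1)[OF s])+
    fix vs :: "(real ^ 'n) list" assume vs: "set vs \<subseteq> Basis"
    show "\<exists>C. \<forall>n y. norm (iter_deriv vs (\<lambda>y. q (X n + y) \<xi>) y) \<le> C * 1"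
      unfolding affine_translate(2)[OF s vs]
  proof -
    obtain C where C: "\<forall>x \<theta>. norm (\<theta> - \<xi>) \<le> 1 \<longrightarrow> norm (iter_deriv vs (\<lambda>x. q x \<theta>) x) \<le> C"
      using smooth_symbols_shift_bound[OF q vs, of \<xi>] by blast
    show "\<exists>C. \<forall>n y. norm (iter_deriv vs (\<lambda>x. q x \<xi>) (X n + y)) \<le> C * 1" by (intro exI[of _ C]) (use C z in auto)
  qed
    have "isCont (iter_deriv vs (\<lambda>x. q x \<xi>)) (x + y)" for y
      using smooth_continuous[OF smooth_iter_deriv[OF s vs]] by (simp add: continuous_on_eq_continuous_at)
    from isCont_tendsto_compose[OF this tendsto_add[OF X tendsto_const]]
    show "(\<lambda>n. iter_deriv vs (\<lambda>y. q (X n + y) \<xi>) y) \<longlonglongrightarrow> iter_deriv vs (\<lambda>y. q (x + y) \<xi>) y" for y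
      unfolding affine_translate(2)[OF s vs] .
  qed simp
  ultimately show "(\<lambda>n. sharp p q (X n) \<xi>) \<longlonglongrightarrow> sharp p q x \<xi>"
    unfolding sharp_osc by (rule osc_tendsto[OF wconv_tensor])
qed

section \<open>The remainder and its membership in the symbol class\<close>

definition sharp_rem :: "nat \<Rightarrow> (real ^ 'n::finite \<Rightarrow> real ^ 'n \<Rightarrow> complex) \<Rightarrow> (real ^ 'n \<Rightarrow> real ^ 'n \<Rightarrow> complex) \<Rightarrow>
    real ^ 'n \<Rightarrow> real ^ 'n \<Rightarrow> complex" where
  "sharp_rem M p q x \<xi> = sharp p q x \<xi> -
     (\<Sum>\<alpha> | mi_abs \<alpha> < M. 1 / of_nat (mi_fact \<alpha>) * mderiv \<alpha> (p x) \<xi> * Dderiv \<alpha> (\<lambda>z. q z \<xi>) x)"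

lemma Dderiv_translate: "smooth g \<Longrightarrow> Dderiv \<alpha> (\<lambda>y. g (x + y)) 0 = Dderiv \<alpha> g x"
  unfolding Dderiv_def mderiv_mi_list by (simp add: affine_translate(2)[OF _ mi_list_Basis])

lemma sharp_rem_osc_taylor_diff:
  assumes "q \<in> smooth_symbols m' \<rho> \<delta>"
  shows "sharp_rem M p q x \<xi> = osc_taylor_diff M \<xi> (p x) (\<lambda>y. q (x + y) \<xi>)"
  unfolding sharp_rem_def osc_taylor_diff_def sharp_osc Dderiv_translate[OF smooth_symbols_smooth_x[OF assms]] by simp

lemma sharp_rem_term_xi:
  fixes p q :: "real ^ 'n::finite \<Rightarrow> real ^ 'n \<Rightarrow> complex"
  assumes p: "p \<in> CS \<tau> m \<rho> \<delta>" and q: "q \<in> smooth_symbols m' \<rho> \<delta>" and h: "0 \<le> \<tau>" "0 \<le> \<delta>" and b: "b \<in> Basis"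
  shows "has_dir_deriv (\<lambda>\<xi>. c * mderiv \<alpha> (p x) \<xi> * Dderiv \<alpha> (\<lambda>z. q z \<xi>) x) b
    (c * mderiv \<alpha> (dxi b p x) \<xi> * Dderiv \<alpha> (\<lambda>z. q z \<xi>) x + c * mderiv \<alpha> (p x) \<xi> * Dderiv \<alpha> (\<lambda>z. dxi b q z \<xi>) x) \<xi>"
proof -
  have "has_dir_deriv (\<lambda>\<xi>. iter_deriv (mi_list \<alpha>) (p x) \<xi> * iter_deriv (mi_list \<alpha>) (\<lambda>z. q z \<xi>) x) b
      (iter_deriv (mi_list \<alpha>) (p x) \<xi> * iter_deriv (mi_list \<alpha>) (\<lambda>z. dxi b q z \<xi>) x +
       iter_deriv (mi_list \<alpha>) (dxi b p x) \<xi> * iter_deriv (mi_list \<alpha>) (\<lambda>z. q z \<xi>) x) \<xi>"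
    by (intro has_dir_deriv_mult CS_dxi_dir[OF p h b mi_list_Basis] smooth_symbols_dxi_dir[OF q b mi_list_Basis])
  then have "has_dir_deriv (\<lambda>\<xi>. (c * (1 / \<i>) ^ mi_abs \<alpha>) * (iter_deriv (mi_list \<alpha>) (p x) \<xi> * iter_deriv (mi_list \<alpha>) (\<lambda>z. q z \<xi>) x)) b
      ((c * (1 / \<i>) ^ mi_abs \<alpha>) * (iter_deriv (mi_list \<alpha>) (p x) \<xi> * iter_deriv (mi_list \<alpha>) (\<lambda>z. dxi b q z \<xi>) x +
       iter_deriv (mi_list \<alpha>) (dxi b p x) \<xi> * iter_deriv (mi_list \<alpha>) (\<lambda>z. q z \<xi>) x)) \<xi>"
    unfolding has_dir_deriv_def by (rule has_vector_derivative_mult_right)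
  then show ?thesis unfolding Dderiv_def mderiv_mi_list by (simp add: algebra_simps)
qed

lemma sharp_rem_term_x:
  fixes p q :: "real ^ 'n::finite \<Rightarrow> real ^ 'n \<Rightarrow> complex"
  assumes p: "p \<in> CS \<tau> m \<rho> \<delta>" and q: "q \<in> smooth_symbols m' \<rho> \<delta>" and h: "1 \<le> \<tau>" "0 \<le> \<delta>" and b: "b \<in> Basis"
  shows "has_dir_deriv (\<lambda>x. c * mderiv \<alpha> (p x) \<xi> * Dderiv \<alpha> (\<lambda>z. q z \<xi>) x) b
    (c * mderiv \<alpha> (dx b p x) \<xi> * Dderiv \<alpha> (\<lambda>z. q z \<xi>) x + c * mderiv \<alpha> (p x) \<xi> * Dderiv \<alpha> (\<lambda>z. dx b q z \<xi>) x) x"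
proof -
  have "has_dir_deriv (\<lambda>x. iter_deriv (mi_list \<alpha>) (p x) \<xi> * iter_deriv (mi_list \<alpha>) (\<lambda>z. q z \<xi>) x) b
      (iter_deriv (mi_list \<alpha>) (p x) \<xi> * iter_deriv (mi_list \<alpha>) (\<lambda>z. dx b q z \<xi>) x +
       iter_deriv (mi_list \<alpha>) (dx b p x) \<xi> * iter_deriv (mi_list \<alpha>) (\<lambda>z. q z \<xi>) x) x"
    by (intro has_dir_deriv_mult CS_dx_dir[OF p h b mi_list_Basis] smooth_symbols_dx_dir[OF q b mi_list_Basis])
  then have "has_dir_deriv (\<lambda>x. (c * (1 / \<i>) ^ mi_abs \<alpha>) * (iter_deriv (mi_list \<alpha>) (p x) \<xi> * iter_deriv (mi_list \<alpha>) (\<lambda>z. q z \<xi>) x)) b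
      ((c * (1 / \<i>) ^ mi_abs \<alpha>) * (iter_deriv (mi_list \<alpha>) (p x) \<xi> * iter_deriv (mi_list \<alpha>) (\<lambda>z. dx b q z \<xi>) x +
       iter_deriv (mi_list \<alpha>) (dx b p x) \<xi> * iter_deriv (mi_list \<alpha>) (\<lambda>z. q z \<xi>) x)) x"
    unfolding has_dir_deriv_def by (rule has_vector_derivative_mult_right)
  then show ?thesis unfolding Dderiv_def mderiv_mi_list by (simp add: algebra_simps)
qed

lemma has_dir_deriv_diff:
  "has_dir_deriv f b d x \<Longrightarrow> has_dir_deriv g b d' x \<Longrightarrow> has_dir_deriv (\<lambda>x. f x - g x) b (d - d') x"
  unfolding has_dir_deriv_def by (rule has_vector_derivative_diff)

lemma sharp_rem_dir_deriv_xi: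
  fixes p q :: "real ^ 'n::finite \<Rightarrow> real ^ 'n \<Rightarrow> complex"
  assumes p: "p \<in> CS \<tau> m \<rho> \<delta>" and q: "q \<in> smooth_symbols m' \<rho> \<delta>" and h: "0 \<le> \<tau>" "0 \<le> \<rho>" "0 \<le> \<delta>" and b: "b \<in> Basis"
  shows "has_dir_deriv (sharp_rem M p q x) b (sharp_rem M (dxi b p) q x \<xi> + sharp_rem M p (dxi b q) x \<xi>) \<xi>"
proof -
  have "has_dir_deriv (sharp_rem M p q x) b ((sharp (dxi b p) q x \<xi> + sharp p (dxi b q) x \<xi>) -
    (\<Sum>\<alpha> | mi_abs \<alpha> < M. 1 / of_nat (mi_fact \<alpha>) * mderiv \<alpha> (dxi b p x) \<xi> * Dderiv \<alpha> (\<lambda>z. q z \<xi>) x +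
      1 / of_nat (mi_fact \<alpha>) * mderiv \<alpha> (p x) \<xi> * Dderiv \<alpha> (\<lambda>z. dxi b q z \<xi>) x)) \<xi>"
    unfolding sharp_rem_def[abs_def]
    by (intro has_dir_deriv_diff sharp_dir_deriv_xi[OF p q h b] has_dir_deriv_sum sharp_rem_term_xi[OF p q h(1,3) b])
  then show ?thesis by (simp add: sharp_rem_def sum.distrib algebra_simps)
qed

lemma sharp_rem_dir_deriv_x:
  fixes p q :: "real ^ 'n::finite \<Rightarrow> real ^ 'n \<Rightarrow> complex"
  assumes p: "p \<in> CS \<tau> m \<rho> \<delta>" and q: "q \<in> smooth_symbols m' \<rho> \<delta>" and h: "1 \<le> \<tau>" "0 \<le> \<rho>" "0 \<le> \<delta>" and b: "b \<in> Basis"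
  shows "has_dir_deriv (\<lambda>x. sharp_rem M p q x \<xi>) b (sharp_rem M (dx b p) q x \<xi> + sharp_rem M p (dx b q) x \<xi>) x"
proof -
  have "has_dir_deriv (\<lambda>x. sharp_rem M p q x \<xi>) b ((sharp (dx b p) q x \<xi> + sharp p (dx b q) x \<xi>) -
    (\<Sum>\<alpha> | mi_abs \<alpha> < M. 1 / of_nat (mi_fact \<alpha>) * mderiv \<alpha> (dx b p x) \<xi> * Dderiv \<alpha> (\<lambda>z. q z \<xi>) x +
      1 / of_nat (mi_fact \<alpha>) * mderiv \<alpha> (p x) \<xi> * Dderiv \<alpha> (\<lambda>z. dx b q z \<xi>) x)) x"
    unfolding sharp_rem_def[abs_def]
    by (intro has_dir_deriv_diff sharp_dir_deriv_x[OF p q h b] has_dir_deriv_sum sharp_rem_term_x[OF p q h(1,3) b])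
  then show ?thesis by (simp add: sharp_rem_def sum.distrib algebra_simps)
qed

lemma sharp_rem_isCont_x:
  fixes p q :: "real ^ 'n::finite \<Rightarrow> real ^ 'n \<Rightarrow> complex"
  assumes p: "p \<in> CS \<tau> m \<rho> \<delta>" and q: "q \<in> smooth_symbols m' \<rho> \<delta>" and h: "0 \<le> \<tau>" "0 \<le> \<rho>"
  shows "isCont (\<lambda>x. sharp_rem M p q x \<xi>) x"
  unfolding sharp_rem_def Dderiv_def mderiv_mi_list
proof (intro continuous_intros sharp_isCont_x[OF p q h])
  fix \<alpha> :: "'n \<Rightarrow> nat"
  show "isCont (\<lambda>x. iter_deriv (mi_list \<alpha>) (p x) \<xi>) x"
    using Ck_isCont[OF CS_Ck[OF p mi_list_Basis], of "[]"] by simp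
  show "isCont (iter_deriv (mi_list \<alpha>) (\<lambda>z. q z \<xi>)) x"
    using smooth_continuous[OF smooth_iter_deriv[OF smooth_symbols_smooth_x[OF q] mi_list_Basis]]
    by (simp add: continuous_on_eq_continuous_at)
qed

text \<open>Bilinearity in the form f1 g1 - f2 g2 = (f1 - f2) g1 + f2 (g1 - g2); it reduces Holder
  bounds in x to the estimate of single remainders.\<close>

lemma osc_taylor_diff_minus:
  fixes f1 f2 g1 g2 :: "real ^ 'n::finite \<Rightarrow> complex"
  assumes f: "wcl (\<lambda>x. japanese x powr K) f1" "wcl (\<lambda>x. japanese x powr K) f2" and g: "wcl (\<lambda>_. 1) g1" "wcl (\<lambda>_. 1) g2" and K: "0 \<le> K"
  shows "osc_taylor_diff M \<xi> f1 g1 - osc_taylor_diff M \<xi> f2 g2 = osc_taylor_diff M \<xi> (\<lambda>x. f1 x - f2 x) g1 + osc_taylor_diff M \<xi> f2 (\<lambda>y. g1 y - g2 y)"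
proof -
  have sh: "wcl (\<lambda>x. japanese x powr K) (\<lambda>\<eta>. f (\<xi> + \<eta>))" if f: "wcl (\<lambda>x. japanese x powr K) f" for f
  proof (rule wcl_mono)
    show "wcl (\<lambda>\<eta>. japanese (\<xi> + \<eta>) powr K) (\<lambda>\<eta>. f (\<xi> + \<eta>))"
      by (rule wcl_affine[OF bounded_linear_ident f, where \<sigma> = "\<lambda>b. b" and c = "\<lambda>b. 1"]) auto
    show "japanese (\<xi> + \<eta>) powr K \<le> (2 powr \<bar>K\<bar> * japanese \<xi> powr K) * japanese \<eta> powr K" for \<eta>
      using peetre[of \<xi> \<eta> K] K by simp
  qed simp
  note w = wcl_tensor[OF sh[OF f(1)] g(1)] wcl_tensor[OF sh[OF f(2)] g(1)] wcl_tensor[OF sh[OF f(2)] g(2)]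
  have o: "osc (\<lambda>z. f1 (\<xi> + fst z) * g1 (snd z)) - osc (\<lambda>z. f2 (\<xi> + fst z) * g2 (snd z)) =
    osc (\<lambda>z. (f1 (\<xi> + fst z) - f2 (\<xi> + fst z)) * g1 (snd z)) + osc (\<lambda>z. f2 (\<xi> + fst z) * (g1 (snd z) - g2 (snd z)))"
    using osc_diff[OF w(1,2)] osc_diff[OF w(2,3)] by (simp add: left_diff_distrib right_diff_distrib)
  have s: "smooth f1" "smooth f2" "smooth g1" "smooth g2" using f g wcl_smooth by blast+
  have m: "mderiv \<alpha> (\<lambda>x. f1 x - f2 x) \<xi> = mderiv \<alpha> f1 \<xi> - mderiv \<alpha> f2 \<xi>" "Dderiv \<alpha> (\<lambda>y. g1 y - g2 y) 0 = Dderiv \<alpha> g1 0 - Dderiv \<alpha> g2 0" for \<alpha>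
    unfolding Dderiv_def mderiv_mi_list by (simp_all add: iter_deriv_diff s mi_list_Basis algebra_simps)
  show ?thesis unfolding osc_taylor_diff_def m using o by (simp add: sum_subtractf algebra_simps)
qed

lemma uniform_const:
  fixes P :: "'a::euclidean_space list \<Rightarrow> real \<Rightarrow> bool"
  assumes "\<And>vs. set vs \<subseteq> Basis \<Longrightarrow> \<exists>C\<ge>0. P vs C" and mono: "\<And>vs C D. P vs C \<Longrightarrow> C \<le> D \<Longrightarrow> P vs D"
  shows "\<exists>C\<ge>0. \<forall>vs. set vs \<subseteq> Basis \<and> length vs \<le> N \<longrightarrow> P vs C"
proof -
  define L where "L = {vs::'a list. set vs \<subseteq> Basis \<and> length vs \<le> N}"
  have fin: "finite L" unfolding L_def by (rule finite_lists_length_le) simp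
  obtain c where c: "\<And>vs. vs \<in> L \<Longrightarrow> c vs \<ge> 0 \<and> P vs (c vs)" using assms(1) unfolding L_def by (metis mem_Collect_eq)
  have "P vs (\<Sum>vs\<in>L. c vs)" if "vs \<in> L" for vs
    using c that by (intro mono[OF conjunct2[OF c[OF that]]] member_le_sum[OF that]) (auto simp: fin)
  moreover have "(\<Sum>vs\<in>L. c vs) \<ge> 0" using c by (intro sum_nonneg) auto
  ultimately show ?thesis by (intro exI[of _ "\<Sum>vs\<in>L. c vs"]) (auto simp: L_def)
qed

lemma sharp_rem_bound:
  fixes p q :: "real ^ 'n::finite \<Rightarrow> real ^ 'n \<Rightarrow> complex"
  assumes p: "p \<in> CS \<tau> m \<rho> \<delta>" and q: "q \<in> smooth_symbols m' \<rho> \<delta>" and h: "0 \<le> \<tau>" "0 \<le> \<delta>" "\<delta> < \<rho>" "\<rho> \<le> 1" "\<delta> < 1"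
  shows "\<exists>C. \<forall>x \<xi>. norm (sharp_rem M p q x \<xi>) \<le> C * japanese \<xi> powr (m + m' - (\<rho> - \<delta>) * real M)"
    and "\<exists>C. \<forall>t x z \<xi>. 0 < t \<and> t < 1 \<and> t \<le> \<tau> \<longrightarrow> norm (sharp_rem M p q x \<xi> - sharp_rem M p q z \<xi>) \<le>
      C * japanese \<xi> powr (m + m' - (\<rho> - \<delta>) * real M + \<delta> * t) * norm (x - z) powr t"
proof -
  have \<rho>: "0 \<le> \<rho>" using h by linarith
  \<comment> \<open>The room \<delta> is for differences of p, which count as order m + \<delta> t
    with t below 1.\<close>
  define mb where "mb = \<bar>m\<bar> + \<delta>"
  have mb: "0 \<le> mb" using h by (simp add: mb_def)
  obtain C N where C: "C \<ge> 0" "\<And>m (\<xi> :: real ^ 'n) f g A B. \<bar>m\<bar> \<le> mb \<Longrightarrow> wcl (\<lambda>x. japanese x powr mb) f \<Longrightarrow> wcl (\<lambda>_. 1) g \<Longrightarrow>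
    0 \<le> A \<Longrightarrow> 0 \<le> B \<Longrightarrow>
    (\<forall>vs \<eta>. set vs \<subseteq> Basis \<and> length vs \<le> N \<longrightarrow> norm (iter_deriv vs f \<eta>) \<le> A * japanese \<eta> powr (m - \<rho> * real (length vs))) \<Longrightarrow>
    (\<forall>vs y. set vs \<subseteq> Basis \<and> length vs \<le> N \<longrightarrow> norm (iter_deriv vs g y) \<le> B * japanese \<xi> powr (\<delta> * real (length vs))) \<Longrightarrow>
    norm (osc_taylor_diff M \<xi> f g) \<le> C * A * B * japanese \<xi> powr (m - (\<rho> - \<delta>) * real M)"
    using osc_taylor_diff_bound[OF h(2-5) mb, of M, where 'n = 'n] by metis
  have sp: "smooth (p x)" for x by (rule CS_smooth[OF p])
  have sq: "smooth (\<lambda>x. q x \<xi>)" for \<xi> by (rule smooth_symbols_smooth_x[OF q])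
  have wp: "wcl (\<lambda>\<eta>. japanese \<eta> powr mb) (p x)" for x
    by (rule wcl_CS[OF p h(1) \<rho> _ mb]) (use h in \<open>simp add: mb_def\<close>)
  have wq: "wcl (\<lambda>_. 1) (\<lambda>y. q (x + y) \<xi>)" for x \<xi> by (rule wcl_symbols_shift[OF q])
  have dq: "iter_deriv vs (\<lambda>y. q (x + y) \<xi>) y = iter_deriv vs (\<lambda>x. q x \<xi>) (x + y)" if "set vs \<subseteq> Basis" for vs x y \<xi>
    using affine_translate(2)[OF sq that] by simp
  have mono1: "\<forall>x \<xi>. f x \<xi> \<le> D * g \<xi>" if "\<forall>x \<xi>. f x \<xi> \<le> C * g \<xi>" "C \<le> D" "\<And>\<xi>. 0 \<le> g \<xi>"
    for f :: "real ^ 'n \<Rightarrow> real ^ 'n \<Rightarrow> real" and g :: "real ^ 'n \<Rightarrow> real" and C D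
    using that(1) mult_right_mono[OF that(2) that(3)] order_trans by blast
  have mono2: "\<forall>t x z \<xi>. Q t \<longrightarrow> f x z \<xi> \<le> D * g t \<xi> * norm (x - z) powr t"
    if "\<forall>t x z \<xi>. Q t \<longrightarrow> f x z \<xi> \<le> C * g t \<xi> * norm (x - z) powr t" "C \<le> D" "\<And>t \<xi>. 0 \<le> g t \<xi>"
    for f :: "real ^ 'n \<Rightarrow> real ^ 'n \<Rightarrow> real ^ 'n \<Rightarrow> real" and g :: "real \<Rightarrow> real ^ 'n \<Rightarrow> real" and C D Q
  proof (intro allI impI)
    fix t x z \<xi> assume "Q t"
    with that(1) have "f x z \<xi> \<le> C * g t \<xi> * norm (x - z) powr t" by blast
    also have "\<dots> \<le> D * g t \<xi> * norm (x - z) powr t" by (intro mult_right_mono that(2,3)) auto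
    finally show "f x z \<xi> \<le> D * g t \<xi> * norm (x - z) powr t" .
  qed
  have "\<exists>C\<ge>0. \<forall>vs. set vs \<subseteq> Basis \<and> length vs \<le> N \<longrightarrow>
    (\<forall>x \<xi>. norm (iter_deriv vs (p x) \<xi>) \<le> C * japanese \<xi> powr (m - \<rho> * real (length vs)))"
    by (rule uniform_const[OF _ mono1]) (use CS_bound[OF p h(1), of _ "[]"] in \<open>auto simp: mixed_deriv_Nil\<close>)
  then obtain A where A: "A \<ge> 0" "\<And>vs x \<xi>. set vs \<subseteq> Basis \<Longrightarrow> length vs \<le> N \<Longrightarrow> norm (iter_deriv vs (p x) \<xi>) \<le> A * japanese \<xi> powr (m - \<rho> * real (length vs))"
    by blast
  have "\<exists>C\<ge>0. \<forall>vs. set vs \<subseteq> Basis \<and> length vs \<le> N \<longrightarrow>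
    (\<forall>x \<xi>. norm (iter_deriv vs (\<lambda>x. q x \<xi>) x) \<le> C * japanese \<xi> powr (m' + \<delta> * real (length vs)))"
    by (rule uniform_const[OF _ mono1], rule smooth_symbols_bound[OF q]) auto
  then obtain B where B: "B \<ge> 0" "\<And>vs x \<xi>. set vs \<subseteq> Basis \<Longrightarrow> length vs \<le> N \<Longrightarrow> norm (iter_deriv vs (\<lambda>x. q x \<xi>) x) \<le> B * japanese \<xi> powr (m' + \<delta> * real (length vs))"
    by blast
  have "\<exists>C\<ge>0. \<forall>vs. set vs \<subseteq> Basis \<and> length vs \<le> N \<longrightarrow> (\<forall>t x z \<xi>. 0 < t \<and> t < 1 \<and> t \<le> \<tau> \<longrightarrow>
    norm (iter_deriv vs (p x) \<xi> - iter_deriv vs (p z) \<xi>) \<le> C * japanese \<xi> powr (m - \<rho> * real (length vs) + \<delta> * t) * norm (x - z) powr t)"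
    by (rule uniform_const[OF _ mono2]) (use CS_holder[OF p, of _ "[]"] in \<open>auto simp: mixed_deriv_Nil\<close>)
  then obtain A' where A': "A' \<ge> 0" "\<And>vs t x z \<xi>. set vs \<subseteq> Basis \<Longrightarrow> length vs \<le> N \<Longrightarrow> 0 < t \<Longrightarrow> t < 1 \<Longrightarrow> t \<le> \<tau> \<Longrightarrow>
      norm (iter_deriv vs (p x) \<xi> - iter_deriv vs (p z) \<xi>) \<le> A' * japanese \<xi> powr (m - \<rho> * real (length vs) + \<delta> * t) * norm (x - z) powr t"
    by blast
  have "\<exists>C\<ge>0. \<forall>vs. set vs \<subseteq> Basis \<and> length vs \<le> N \<longrightarrow> (\<forall>t x z \<xi>. 0 < t \<and> t < 1 \<longrightarrow>
    norm (iter_deriv vs (\<lambda>x. q x \<xi>) x - iter_deriv vs (\<lambda>x. q x \<xi>) z) \<le> C * japanese \<xi> powr (m' + \<delta> * real (length vs) + \<delta> * t) * norm (x - z) powr t)"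
    by (rule uniform_const[OF _ mono2], rule smooth_symbols_holder[OF q]) auto
  then obtain B' where B': "B' \<ge> 0" "\<And>vs t x z \<xi>. set vs \<subseteq> Basis \<Longrightarrow> length vs \<le> N \<Longrightarrow> 0 < t \<Longrightarrow> t < 1 \<Longrightarrow>
      norm (iter_deriv vs (\<lambda>x. q x \<xi>) x - iter_deriv vs (\<lambda>x. q x \<xi>) z) \<le> B' * japanese \<xi> powr (m' + \<delta> * real (length vs) + \<delta> * t) * norm (x - z) powr t"
    by blast
  \<comment> \<open>The order of q goes into the constant B for g, because \<xi> is fixed there;
    what is left is the factor caused by differentiation.\<close>
  have bq: "norm (iter_deriv vs (\<lambda>y. q (x + y) \<xi>) y) \<le> (B * japanese \<xi> powr m') * japanese \<xi> powr (\<delta> * real (length vs))"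
    if "set vs \<subseteq> Basis \<and> length vs \<le> N" for vs x y \<xi>
    using B(2)[of vs "\<xi>" "x + y"] that dq[of vs x \<xi> y] by (simp add: powr_add mult.assoc)
  have "norm (sharp_rem M p q x \<xi>) \<le> (C * A * B) * japanese \<xi> powr (m + m' - (\<rho> - \<delta>) * real M)" for x \<xi>
  proof -
    have "norm (osc_taylor_diff M \<xi> (p x) (\<lambda>y. q (x + y) \<xi>)) \<le> C * A * (B * japanese \<xi> powr m') * japanese \<xi> powr (m - (\<rho> - \<delta>) * real M)"
      by (rule C(2)[OF _ wp wq A(1)]) (use A B(1) bq h in \<open>auto simp: mb_def\<close>)
    also have "\<dots> = (C * A * B) * (japanese \<xi> powr m' * japanese \<xi> powr (m - (\<rho> - \<delta>) * real M))" by simp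
    also have "japanese \<xi> powr m' * japanese \<xi> powr (m - (\<rho> - \<delta>) * real M) = japanese \<xi> powr (m + m' - (\<rho> - \<delta>) * real M)"
      by (simp add: powr_add[symmetric] algebra_simps)
    finally show ?thesis by (simp add: sharp_rem_osc_taylor_diff[OF q])
  qed
  then show "\<exists>C. \<forall>x \<xi>. norm (sharp_rem M p q x \<xi>) \<le> C * japanese \<xi> powr (m + m' - (\<rho> - \<delta>) * real M)" by blast
  have "norm (sharp_rem M p q x \<xi> - sharp_rem M p q z \<xi>) \<le>
      (C * A' * B + C * A * B') * japanese \<xi> powr (m + m' - (\<rho> - \<delta>) * real M + \<delta> * t) * norm (x - z) powr t"
    if t: "0 < t" "t < 1" "t \<le> \<tau>" for t x z \<xi>
  proof -
    let ?d = "norm (x - z) powr t"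
    have d0: "0 \<le> ?d" by simp
    have dt: "0 \<le> \<delta> * t" "\<delta> * t \<le> \<delta>" using t h mult_left_mono[of t 1 \<delta>] by auto
    \<comment> \<open>The loss \<delta> t is attributed to the order of the first factor here, and
      to the constant of the second factor in the next estimate; the total is the same.\<close>
    have 1: "norm (osc_taylor_diff M \<xi> (\<lambda>\<xi>. p x \<xi> - p z \<xi>) (\<lambda>y. q (x + y) \<xi>)) \<le>
        C * (A' * ?d) * (B * japanese \<xi> powr m') * japanese \<xi> powr (m + \<delta> * t - (\<rho> - \<delta>) * real M)"
    proof (rule C(2)[OF _ wcl_diff[OF wp wp] wq])
      show "\<bar>m + \<delta> * t\<bar> \<le> mb" using dt by (auto simp: mb_def)
      show "0 \<le> A' * ?d" "0 \<le> B * japanese \<xi> powr m'" using A' B by auto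
      show "\<forall>vs y. set vs \<subseteq> Basis \<and> length vs \<le> N \<longrightarrow> norm (iter_deriv vs (\<lambda>y. q (x + y) \<xi>) y) \<le> B * japanese \<xi> powr m' * japanese \<xi> powr (\<delta> * real (length vs))"
        using bq by blast
      show "\<forall>vs \<eta>. set vs \<subseteq> Basis \<and> length vs \<le> N \<longrightarrow> norm (iter_deriv vs (\<lambda>\<xi>. p x \<xi> - p z \<xi>) \<eta>) \<le> A' * ?d * japanese \<eta> powr (m + \<delta> * t - \<rho> * real (length vs))"
      proof (intro allI impI)
        fix vs :: "(real ^ 'n) list" and \<eta> assume vs: "set vs \<subseteq> Basis \<and> length vs \<le> N"
        then show "norm (iter_deriv vs (\<lambda>\<xi>. p x \<xi> - p z \<xi>) \<eta>) \<le> A' * ?d * japanese \<eta> powr (m + \<delta> * t - \<rho> * real (length vs))"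
          using A'(2)[of vs t x \<eta> z] t by (simp add: iter_deriv_diff[OF sp sp] algebra_simps)
      qed
    qed
    have 2: "norm (osc_taylor_diff M \<xi> (p z) (\<lambda>y. q (x + y) \<xi> - q (z + y) \<xi>)) \<le>
        C * A * (B' * ?d * japanese \<xi> powr (m' + \<delta> * t)) * japanese \<xi> powr (m - (\<rho> - \<delta>) * real M)"
    proof (rule C(2)[OF _ wp wcl_diff[OF wq wq] A(1)])
      show "\<bar>m\<bar> \<le> mb" using h by (simp add: mb_def)
      show "0 \<le> B' * ?d * japanese \<xi> powr (m' + \<delta> * t)" using B' by simp
      show "\<forall>vs \<eta>. set vs \<subseteq> Basis \<and> length vs \<le> N \<longrightarrow> norm (iter_deriv vs (p z) \<eta>) \<le> A * japanese \<eta> powr (m - \<rho> * real (length vs))"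
        using A by blast
      show "\<forall>vs y. set vs \<subseteq> Basis \<and> length vs \<le> N \<longrightarrow> norm (iter_deriv vs (\<lambda>y. q (x + y) \<xi> - q (z + y) \<xi>) y) \<le>
          B' * ?d * japanese \<xi> powr (m' + \<delta> * t) * japanese \<xi> powr (\<delta> * real (length vs))"
      proof (intro allI impI)
        fix vs :: "(real ^ 'n) list" and y assume vs: "set vs \<subseteq> Basis \<and> length vs \<le> N"
        have "iter_deriv vs (\<lambda>y. q (x + y) \<xi> - q (z + y) \<xi>) y = iter_deriv vs (\<lambda>x. q x \<xi>) (x + y) - iter_deriv vs (\<lambda>x. q x \<xi>) (z + y)"
          using vs by (simp add: iter_deriv_diff wcl_smooth[OF wq] dq)
        moreover have "japanese \<xi> powr (m' + \<delta> * t) * japanese \<xi> powr (\<delta> * real (length vs)) = japanese \<xi> powr (m' + \<delta> * real (length vs) + \<delta> * t)"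
          by (simp add: powr_add[symmetric] algebra_simps)
        ultimately show "norm (iter_deriv vs (\<lambda>y. q (x + y) \<xi> - q (z + y) \<xi>) y) \<le>
          B' * ?d * japanese \<xi> powr (m' + \<delta> * t) * japanese \<xi> powr (\<delta> * real (length vs))"
          using B'(2)[of vs t \<xi> "x + y" "z + y"] t vs by (simp add: mult_ac)
      qed
    qed
    have "norm (sharp_rem M p q x \<xi> - sharp_rem M p q z \<xi>) \<le>
        C * (A' * ?d) * (B * japanese \<xi> powr m') * japanese \<xi> powr (m + \<delta> * t - (\<rho> - \<delta>) * real M) +
        C * A * (B' * ?d * japanese \<xi> powr (m' + \<delta> * t)) * japanese \<xi> powr (m - (\<rho> - \<delta>) * real M)"
      unfolding sharp_rem_osc_taylor_diff[OF q] osc_taylor_diff_minus[OF wp wp wq wq mb] by (intro norm_triangle_mono 1 2)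
    also have "\<dots> = (C * A' * B) * ?d * (japanese \<xi> powr m' * japanese \<xi> powr (m + \<delta> * t - (\<rho> - \<delta>) * real M)) +
        (C * A * B') * ?d * (japanese \<xi> powr (m' + \<delta> * t) * japanese \<xi> powr (m - (\<rho> - \<delta>) * real M))"
      by (simp only: mult_ac)
    also have "japanese \<xi> powr m' * japanese \<xi> powr (m + \<delta> * t - (\<rho> - \<delta>) * real M) = japanese \<xi> powr (m + m' - (\<rho> - \<delta>) * real M + \<delta> * t)"
      unfolding powr_add[symmetric] by (simp add: add_ac diff_conv_add_uminus del: add_uminus_conv_diff)
    also have "japanese \<xi> powr (m' + \<delta> * t) * japanese \<xi> powr (m - (\<rho> - \<delta>) * real M) = japanese \<xi> powr (m + m' - (\<rho> - \<delta>) * real M + \<delta> * t)"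
      unfolding powr_add[symmetric] by (simp add: add_ac diff_conv_add_uminus del: add_uminus_conv_diff)
    also have "a * d * P + b * d * P = (a + b) * P * d" for a b d P :: real by (simp add: algebra_simps)
    finally show ?thesis .
  qed
  then show "\<exists>C. \<forall>t x z \<xi>. 0 < t \<and> t < 1 \<and> t \<le> \<tau> \<longrightarrow> norm (sharp_rem M p q x \<xi> - sharp_rem M p q z \<xi>) \<le>
      C * japanese \<xi> powr (m + m' - (\<rho> - \<delta>) * real M + \<delta> * t) * norm (x - z) powr t" by blast
qed

text \<open>Only the total order is recorded, so the two pairs coming from one derivative lie in the
  same class. Their sum occurs in the Leibniz rule, hence the closure under addition.\<close>

inductive_set sharp_rem_sums :: "nat \<Rightarrow> real \<Rightarrow> real \<Rightarrow> real \<Rightarrow> real \<Rightarrow> (real ^ 'n::finite \<Rightarrow> real ^ 'n \<Rightarrow> complex) set"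
  for M \<rho> \<delta> \<tau> m where
  base: "p \<in> CS \<tau> m1 \<rho> \<delta> \<Longrightarrow> q \<in> smooth_symbols m2 \<rho> \<delta> \<Longrightarrow> m = m1 + m2 - (\<rho> - \<delta>) * real M \<Longrightarrow> sharp_rem M p q \<in> sharp_rem_sums M \<rho> \<delta> \<tau> m"
| add: "s \<in> sharp_rem_sums M \<rho> \<delta> \<tau> m \<Longrightarrow> s' \<in> sharp_rem_sums M \<rho> \<delta> \<tau> m \<Longrightarrow> (\<lambda>x \<xi>. s x \<xi> + s' x \<xi>) \<in> sharp_rem_sums M \<rho> \<delta> \<tau> m"

lemma sharp_rem_CS:
  fixes p q :: "real ^ 'n::finite \<Rightarrow> real ^ 'n \<Rightarrow> complex"
  assumes p: "p \<in> CS \<tau> m1 \<rho> \<delta>" and q: "q \<in> smooth_symbols m2 \<rho> \<delta>" and h: "0 \<le> \<tau>" "0 \<le> \<delta>" "\<delta> < \<rho>" "\<rho> \<le> 1" "\<delta> < 1"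
  shows "sharp_rem M p q \<in> CS \<tau> (m1 + m2 - (\<rho> - \<delta>) * real M) \<rho> \<delta>"
proof (rule CS_coinduct[where S = "sharp_rem_sums M \<rho> \<delta>"])
  show "sharp_rem M p q \<in> sharp_rem_sums M \<rho> \<delta> \<tau> (m1 + m2 - (\<rho> - \<delta>) * real M)" by (rule sharp_rem_sums.base[OF p q refl])
  show "0 \<le> \<tau>" "0 \<le> \<delta>" by (rule h)+
next
  have \<rho>: "0 \<le> \<rho>" using h by linarith
  fix \<tau> m :: real and s :: "real ^ 'n \<Rightarrow> real ^ 'n \<Rightarrow> complex" assume s: "s \<in> sharp_rem_sums M \<rho> \<delta> \<tau> m"
  show "\<exists>C. \<forall>x \<xi>. norm (s x \<xi>) \<le> C * japanese \<xi> powr m" if t: "0 \<le> \<tau>"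
    using s
  proof induction
    case (base p m1 q m2)
    then show ?case using sharp_rem_bound(1)[OF base(1,2) t h(2-5)] by simp
  next
    case (add s s')
    then obtain C C' where "\<And>x \<xi>. norm (s x \<xi>) \<le> C * japanese \<xi> powr m" "\<And>x \<xi>. norm (s' x \<xi>) \<le> C' * japanese \<xi> powr m" by blast
    then have "norm (s x \<xi> + s' x \<xi>) \<le> (C + C') * japanese \<xi> powr m" for x \<xi>
      unfolding distrib_right by (intro norm_triangle_mono)
    then show ?case by blast
  qed
  show "isCont (\<lambda>x. s x \<xi>) x" if t: "0 \<le> \<tau>" for x \<xi>
    using s
  proof induction
    case (base p m1 q m2)
    then show ?case using sharp_rem_isCont_x[OF base(1,2) t \<rho>] by simp
  qed (intro continuous_add)
  show "\<exists>C. \<forall>t x z \<xi>. 0 < t \<and> t < 1 \<and> t \<le> \<tau> \<longrightarrow>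
      norm (s x \<xi> - s z \<xi>) \<le> C * japanese \<xi> powr (m + \<delta> * t) * norm (x - z) powr t" if t: "0 \<le> \<tau>"
    using s
  proof induction
    case (base p m1 q m2)
    then show ?case using sharp_rem_bound(2)[OF base(1,2) t h(2-5)] by simp
  next
    case (add s s')
    then obtain C C' where C: "\<And>t x z \<xi>. 0 < t \<and> t < 1 \<and> t \<le> \<tau> \<Longrightarrow> norm (s x \<xi> - s z \<xi>) \<le> C * japanese \<xi> powr (m + \<delta> * t) * norm (x - z) powr t"
      "\<And>t x z \<xi>. 0 < t \<and> t < 1 \<and> t \<le> \<tau> \<Longrightarrow> norm (s' x \<xi> - s' z \<xi>) \<le> C' * japanese \<xi> powr (m + \<delta> * t) * norm (x - z) powr t" by blast
    have "norm (s x \<xi> + s' x \<xi> - (s z \<xi> + s' z \<xi>)) \<le> (C + C') * japanese \<xi> powr (m + \<delta> * t) * norm (x - z) powr t"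
      if "0 < t \<and> t < 1 \<and> t \<le> \<tau>" for t x z \<xi>
    proof -
      have "norm ((s x \<xi> - s z \<xi>) + (s' x \<xi> - s' z \<xi>)) \<le> (C + C') * japanese \<xi> powr (m + \<delta> * t) * norm (x - z) powr t"
        unfolding distrib_right by (intro norm_triangle_mono C that)
      then show ?thesis by (simp add: algebra_simps)
    qed
    then show ?case by blast
  qed
  show "\<exists>s'\<in>sharp_rem_sums M \<rho> \<delta> \<tau> (m - \<rho>). \<forall>x \<xi>. has_dir_deriv (s x) b (s' x \<xi>) \<xi>" if t: "0 \<le> \<tau>" and b: "b \<in> Basis" for b
    using s
  proof induction
    case (base p m1 q m2)
    have "sharp_rem M (dxi b p) q \<in> sharp_rem_sums M \<rho> \<delta> \<tau> (m - \<rho>)" "sharp_rem M p (dxi b q) \<in> sharp_rem_sums M \<rho> \<delta> \<tau> (m - \<rho>)"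
      by (rule sharp_rem_sums.base[OF CS_dxi[OF base(1) t h(2) b] base(2)], simp add: base(3),
          rule sharp_rem_sums.base[OF base(1) smooth_symbols_dxi[OF base(2) h(2) b]], simp add: base(3))
    from sharp_rem_sums.add[OF this] show ?case
      by (rule bexI[rotated]) (intro allI sharp_rem_dir_deriv_xi[OF base(1,2) t \<rho> h(2) b])
  next
    case (add s s')
    then obtain d d' where d: "d \<in> sharp_rem_sums M \<rho> \<delta> \<tau> (m - \<rho>)" "d' \<in> sharp_rem_sums M \<rho> \<delta> \<tau> (m - \<rho>)"
      "\<And>x \<xi>. has_dir_deriv (s x) b (d x \<xi>) \<xi>" "\<And>x \<xi>. has_dir_deriv (s' x) b (d' x \<xi>) \<xi>" by blast
    from sharp_rem_sums.add[OF d(1,2)] show ?case by (rule bexI[rotated]) (intro allI has_dir_deriv_add[OF d(3,4)])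
  qed
  show "\<exists>s'\<in>sharp_rem_sums M \<rho> \<delta> (\<tau> - 1) (m + \<delta>). \<forall>x \<xi>. has_dir_deriv (\<lambda>x. s x \<xi>) b (s' x \<xi>) x" if t: "1 \<le> \<tau>" and b: "b \<in> Basis" for b
    using s
  proof induction
    case (base p m1 q m2)
    \<comment> \<open>In the second Leibniz term p is not differentiated, but its regularity index
      has to drop along with that of the other term.\<close>
    have p': "p \<in> CS (\<tau> - 1) m1 \<rho> \<delta>" by (rule CS_mono[OF base(1) h(2)]) (use t in auto)
    have "sharp_rem M (dx b p) q \<in> sharp_rem_sums M \<rho> \<delta> (\<tau> - 1) (m + \<delta>)" "sharp_rem M p (dx b q) \<in> sharp_rem_sums M \<rho> \<delta> (\<tau> - 1) (m + \<delta>)"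
      by (rule sharp_rem_sums.base[OF CS_dx[OF base(1) t h(2) b] base(2)], simp add: base(3),
          rule sharp_rem_sums.base[OF p' smooth_symbols_dx[OF base(2) h(2) b]], simp add: base(3))
    from sharp_rem_sums.add[OF this] show ?case
      by (rule bexI[rotated]) (intro allI sharp_rem_dir_deriv_x[OF base(1,2) t \<rho> h(2) b])
  next
    case (add s s')
    then obtain d d' where d: "d \<in> sharp_rem_sums M \<rho> \<delta> (\<tau> - 1) (m + \<delta>)" "d' \<in> sharp_rem_sums M \<rho> \<delta> (\<tau> - 1) (m + \<delta>)"
      "\<And>x \<xi>. has_dir_deriv (\<lambda>x. s x \<xi>) b (d x \<xi>) x" "\<And>x \<xi>. has_dir_deriv (\<lambda>x. s' x \<xi>) b (d' x \<xi>) x" by blast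
    from sharp_rem_sums.add[OF d(1,2)] show ?case by (rule bexI[rotated]) (intro allI has_dir_deriv_add[OF d(3,4)])
  qed
qed

section \<open>Pseudodifferential operators on Schwartz functions\<close>

lemma isCont_of_locally_bounded_partials:
  fixes f :: "'a::euclidean_space \<Rightarrow> complex"
  assumes d: "\<And>z b. b \<in> Basis \<Longrightarrow> has_dir_deriv f b (D b z) z"
    and c: "\<And>b. b \<in> Basis \<Longrightarrow> \<exists>C. \<forall>z. norm (z - x) \<le> 1 \<longrightarrow> norm (D b z) \<le> C"
  shows "isCont f x"
proof -
  obtain C where C: "\<And>b z. b \<in> Basis \<Longrightarrow> norm (z - x) \<le> 1 \<Longrightarrow> norm (D b z) \<le> C b" using c by metis
  have "norm (D b z) \<le> (\<Sum>b\<in>Basis. \<bar>C b\<bar>)" if "b \<in> Basis" "norm (z - x) \<le> 1" for b z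
    using C[OF that] member_le_sum[OF that(1), of "\<lambda>b. \<bar>C b\<bar>"] by simp
  from isCont_of_bounded_partials[OF d this] show ?thesis .
qed

text \<open>Boundedness together with closure under derivatives and under multiplication by
  coordinates gives all Schwartz seminorms. Differentiability itself comes from boundedness of the
  derivatives, as the family contains derivatives of all orders.\<close>

lemma schwartz_coinduct:
  fixes \<Phi> :: "('a::euclidean_space \<Rightarrow> complex) set"
  assumes f: "f \<in> \<Phi>" and bd: "\<And>f. f \<in> \<Phi> \<Longrightarrow> \<exists>C. \<forall>x. norm (f x) \<le> C"
    and d: "\<And>f b. f \<in> \<Phi> \<Longrightarrow> b \<in> Basis \<Longrightarrow> \<exists>g\<in>\<Phi>. \<forall>x. has_dir_deriv f b (g x) x"
    and m: "\<And>f b. f \<in> \<Phi> \<Longrightarrow> b \<in> Basis \<Longrightarrow> (\<lambda>x. complex_of_real (x \<bullet> b) * f x) \<in> \<Phi>"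
  shows "f \<in> schwartz"
proof -
  have ct: "isCont f x" if f: "f \<in> \<Phi>" for f x
  proof -
    obtain D where D: "\<And>b. b \<in> Basis \<Longrightarrow> D b \<in> \<Phi>" "\<And>b x. b \<in> Basis \<Longrightarrow> has_dir_deriv f b (D b x) x"
      using d[OF f] by metis
    show ?thesis
    proof (rule isCont_of_locally_bounded_partials[OF D(2)])
      fix b :: 'a assume "b \<in> Basis"
      then obtain C where "\<And>z. norm (D b z) \<le> C" using bd[OF D(1)] by blast
      then show "\<exists>C. \<forall>z. norm (z - x) \<le> 1 \<longrightarrow> norm (D b z) \<le> C" by blast
    qed
  qed
  have pd: "f differentiable (at x)" "b \<in> Basis \<Longrightarrow> pd b f \<in> \<Phi>" if f: "f \<in> \<Phi>" for f x b
  proof -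
    obtain D where D: "\<And>b. b \<in> Basis \<Longrightarrow> D b \<in> \<Phi>" "\<And>b x. b \<in> Basis \<Longrightarrow> has_dir_deriv f b (D b x) x"
      using d[OF f] by metis
    note F = frechet_derivative_of_partials[OF D(2) ct[OF D(1)]]
    show "f differentiable (at x)" by (rule F(1))
    assume b: "b \<in> Basis"
    have "pd b f = D b" using F(2)[OF _ _ b] by (simp add: fun_eq_iff)
    then show "pd b f \<in> \<Phi>" using D(1)[OF b] by (simp only:)
  qed
  have sm: "smooth f" by (rule smooth_coinduct[OF f pd])
  have it: "iter_deriv vs f \<in> \<Phi>" if "set vs \<subseteq> Basis" for vs
    using that
  proof (induction vs)
    case (Cons v vs)
    then have "pd v (iter_deriv vs f) \<in> \<Phi>" by (intro pd(2)) auto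
    then show ?case by simp
  qed (simp add: f)
  have dec: "\<exists>C. \<forall>x. japanese x ^ k * norm (g x) \<le> C" if "g \<in> \<Phi>" for g k
    using that
  proof (induction k arbitrary: g)
    case 0
    then show ?case using bd by simp
  next
    case (Suc k)
    obtain C where C: "\<And>x. japanese x ^ k * norm (g x) \<le> C" using Suc by blast
    have "\<exists>C. \<forall>x. japanese x ^ k * norm (complex_of_real (x \<bullet> b) * g x) \<le> C" if "b \<in> Basis" for b
      by (rule Suc.IH[OF m[OF Suc.prems that]])
    then obtain B where B: "\<And>b x. b \<in> Basis \<Longrightarrow> japanese x ^ k * norm (complex_of_real (x \<bullet> b) * g x) \<le> B b" by metis
    have "japanese x ^ Suc k * norm (g x) \<le> C + (\<Sum>b\<in>Basis. B b)" for x
    proof -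
      \<comment> \<open>One power of the bracket is exchanged for 1 and the coordinates, by which
        the family may be multiplied.\<close>
      have "japanese x \<le> 1 + (\<Sum>b\<in>Basis. \<bar>x \<bullet> b\<bar>)" using japanese_le[of x] norm_le_l1[of x] by linarith
      then have "japanese x * (japanese x ^ k * norm (g x)) \<le> (1 + (\<Sum>b\<in>Basis. \<bar>x \<bullet> b\<bar>)) * (japanese x ^ k * norm (g x))"
        by (intro mult_right_mono) (auto intro!: mult_nonneg_nonneg zero_le_power less_imp_le[OF japanese_pos])
      also have "\<dots> = japanese x ^ k * norm (g x) + (\<Sum>b\<in>Basis. japanese x ^ k * norm (complex_of_real (x \<bullet> b) * g x))"
        unfolding distrib_right mult_1_left sum_distrib_right norm_mult norm_of_real by (simp only: mult.left_commute)
      also have "\<dots> \<le> C + (\<Sum>b\<in>Basis. B b)" by (intro add_mono C sum_mono B)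
      finally show ?thesis by (simp add: mult.assoc)
    qed
    then show ?case by blast
  qed
  show ?thesis unfolding schwartz_def using sm dec[OF it] by blast
qed

text \<open>The majorant D is independent of x, so through the mean value bound it dominates the
  difference quotients as well.\<close>

lemma has_dir_deriv_integral:
  fixes f :: "'a::real_normed_vector \<Rightarrow> 'b::euclidean_space \<Rightarrow> complex"
  assumes d: "\<And>x \<xi>. has_dir_deriv (\<lambda>x. f x \<xi>) b (f' x \<xi>) x"
    and i: "\<And>x. integrable lborel (f x)" "f' x \<in> borel_measurable lborel"
    and D: "\<And>x \<xi>. norm (f' x \<xi>) \<le> D \<xi>" "integrable lborel D"
  shows "has_dir_deriv (\<lambda>x. \<integral>\<xi>. f x \<xi> \<partial>lborel) b (\<integral>\<xi>. f' x \<xi> \<partial>lborel) x"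
  unfolding has_dir_deriv_iff_tendsto tendsto_at_iff_sequentially
proof (intro allI impI)
  fix X :: "nat \<Rightarrow> real" assume X: "\<forall>n. X n \<in> UNIV - {0}" "X \<longlonglongrightarrow> 0"
  then have X': "filterlim X (at 0) sequentially" by (auto simp: filterlim_at)
  have "(\<lambda>n. \<integral>\<xi>. (f (x + X n *\<^sub>R b) \<xi> - f x \<xi>) /\<^sub>R X n \<partial>lborel) \<longlonglongrightarrow> (\<integral>\<xi>. f' x \<xi> \<partial>lborel)"
  proof (rule integral_dominated_convergence[OF i(2) _ D(2)])
    show "(\<lambda>\<xi>. (f (x + X n *\<^sub>R b) \<xi> - f x \<xi>) /\<^sub>R X n) \<in> borel_measurable lborel" for n
      using borel_measurable_integrable[OF i(1)] by measurable
    show "AE \<xi> in lborel. (\<lambda>n. (f (x + X n *\<^sub>R b) \<xi> - f x \<xi>) /\<^sub>R X n) \<longlonglongrightarrow> f' x \<xi>"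
      using d[unfolded has_dir_deriv_iff_tendsto, THEN filterlim_compose, OF X'] by (intro AE_I2)
    have "norm ((f (x + X n *\<^sub>R b) \<xi> - f x \<xi>) /\<^sub>R X n) \<le> D \<xi>" for n \<xi>
    proof -
      have "norm (f (x + X n *\<^sub>R b) \<xi> - f x \<xi> - X n *\<^sub>R 0) \<le> D \<xi> * \<bar>X n\<bar>"
        by (rule has_dir_deriv_mean_value[where f = "\<lambda>x. f x \<xi>" and D = "\<lambda>x. f' x \<xi>"]) (use d D in auto)
      then show ?thesis using X(1) by (simp add: divide_simps)
    qed
    then show "AE \<xi> in lborel. norm ((f (x + X n *\<^sub>R b) \<xi> - f x \<xi>) /\<^sub>R X n) \<le> D \<xi>" for n by simp
  qed
  then show "((\<lambda>t. ((\<integral>\<xi>. f (x + t *\<^sub>R b) \<xi> \<partial>lborel) - (\<integral>\<xi>. f x \<xi> \<partial>lborel)) /\<^sub>R t) \<circ> X) \<longlonglongrightarrow> (\<integral>\<xi>. f' x \<xi> \<partial>lborel)"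
    using i(1) by (simp add: comp_def)
qed

lemma smooth_char: "smooth (\<lambda>\<xi>. exp (\<i> * complex_of_real (x \<bullet> \<xi>)))"
  unfolding inner_commute[of x] by (intro smooth_exp smooth_cmult smooth_inner)

lemma pd_char:
  fixes b x :: "'a::euclidean_space"
  shows "pd b (\<lambda>\<xi>. exp (\<i> * complex_of_real (x \<bullet> \<xi>))) = (\<lambda>\<xi>. \<i> * complex_of_real (x \<bullet> b) * exp (\<i> * complex_of_real (x \<bullet> \<xi>)))"
proof
  fix \<xi>
  have "has_dir_deriv (\<lambda>\<xi>. exp (\<i> * complex_of_real (x \<bullet> \<xi>))) b (\<i> * complex_of_real (x \<bullet> b) * exp (\<i> * complex_of_real (x \<bullet> \<xi>))) \<xi>"
    unfolding has_dir_deriv_def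
    by (rule has_vector_derivative_eq_rhs, rule field_vector_diff_chain_at[where f = "\<lambda>t. \<i> * complex_of_real (x \<bullet> (\<xi> + t *\<^sub>R b))" and g = exp, unfolded comp_def])
      (auto intro!: derivative_eq_intros simp: inner_add_right)
  from has_dir_deriv_unique[OF smooth_dir_deriv[OF smooth_char] this]
  show "pd b (\<lambda>\<xi>. exp (\<i> * complex_of_real (x \<bullet> \<xi>))) \<xi> = \<i> * complex_of_real (x \<bullet> b) * exp (\<i> * complex_of_real (x \<bullet> \<xi>))" .
qed

lemma wcl_char: "wcl (\<lambda>_. 1) (\<lambda>\<xi>. exp (\<i> * complex_of_real (x \<bullet> \<xi>)))"
proof (rule wcl_of_lists[OF smooth_char])
  fix vs :: "'a list" assume vs: "set vs \<subseteq> Basis"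
  have "\<exists>c. iter_deriv vs (\<lambda>\<xi>. exp (\<i> * complex_of_real (x \<bullet> \<xi>))) = (\<lambda>\<xi>. c * exp (\<i> * complex_of_real (x \<bullet> \<xi>)))"
    using vs
  proof (induction vs)
    case Nil
    show ?case by (intro exI[of _ 1]) simp
  next
    case (Cons v vs)
    then obtain c where c: "iter_deriv vs (\<lambda>\<xi>. exp (\<i> * complex_of_real (x \<bullet> \<xi>))) = (\<lambda>\<xi>. c * exp (\<i> * complex_of_real (x \<bullet> \<xi>)))" by auto
    have "iter_deriv (v # vs) (\<lambda>\<xi>. exp (\<i> * complex_of_real (x \<bullet> \<xi>))) = pd v (\<lambda>\<xi>. c * exp (\<i> * complex_of_real (x \<bullet> \<xi>)))"
      using c by simp
    also have "\<dots> = (\<lambda>\<xi>. c * pd v (\<lambda>\<xi>. exp (\<i> * complex_of_real (x \<bullet> \<xi>))) \<xi>)"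
      by (rule iter_deriv_cmult[OF smooth_char]) (use Cons in auto)
    finally show ?case unfolding pd_char by (intro exI[of _ "c * (\<i> * complex_of_real (x \<bullet> v))"]) (simp add: mult_ac)
  qed
  then obtain c where "iter_deriv vs (\<lambda>\<xi>. exp (\<i> * complex_of_real (x \<bullet> \<xi>))) = (\<lambda>\<xi>. c * exp (\<i> * complex_of_real (x \<bullet> \<xi>)))" by blast
  then show "\<exists>C. \<forall>\<xi>. norm (iter_deriv vs (\<lambda>\<xi>. exp (\<i> * complex_of_real (x \<bullet> \<xi>))) \<xi>) \<le> C * 1"
    by (intro exI[of _ "norm c"]) (simp add: norm_mult)
qed simp

lemma schwartz_char: "w \<in> schwartz \<Longrightarrow> (\<lambda>\<xi>. exp (\<i> * complex_of_real (x \<bullet> \<xi>)) * w \<xi>) \<in> schwartz"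
  by (rule schwartz_om[OF wcl_om[where K = 0]]) (use wcl_char in auto)

text \<open>The function w stands for a Fourier transform. Leaving it a free Schwartz function lets
  derivatives and coordinate factors be absorbed into q and w.\<close>

definition expint :: "('a \<Rightarrow> 'a \<Rightarrow> complex) \<Rightarrow> ('a \<Rightarrow> complex) \<Rightarrow> 'a::euclidean_space \<Rightarrow> complex" where
  "expint q w x = (\<integral>\<xi>. exp (\<i> * complex_of_real (x \<bullet> \<xi>)) * q x \<xi> * w \<xi> \<partial>lborel)"

lemma symbol_schwartz:
  fixes q :: "real ^ 'n::finite \<Rightarrow> real ^ 'n \<Rightarrow> complex"
  assumes q: "q \<in> smooth_symbols m \<rho> \<delta>" "0 \<le> \<rho>" and w: "w \<in> schwartz"
  shows "(\<lambda>\<xi>. q x \<xi> * w \<xi>) \<in> schwartz"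
  by (rule schwartz_om[OF wcl_om[OF wcl_CS[OF smooth_symbolsD[OF q(1), of 1] _ q(2) abs_ge_self abs_ge_zero]] w]) auto

lemma symbol_schwartz_bound:
  fixes q :: "real ^ 'n::finite \<Rightarrow> real ^ 'n \<Rightarrow> complex"
  assumes q: "q \<in> smooth_symbols m \<rho> \<delta>" and w: "w \<in> schwartz"
  shows "\<exists>C\<ge>0. \<forall>x \<xi>. norm (q x \<xi> * w \<xi>) \<le> C * japanese \<xi> powr s"
proof -
  obtain C where C: "C \<ge> 0" "\<And>x \<xi>. norm (q x \<xi>) \<le> C * japanese \<xi> powr m"
    using smooth_symbols_bound[OF q, of "[]"] by auto
  obtain D where D: "D \<ge> 0" "\<And>\<xi>. norm (w \<xi>) \<le> D * japanese \<xi> powr (s - m)"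
    using wcl_lists[OF schwartz_wcl[OF w], of "[]" "s - m"] by auto
  have "norm (q x \<xi> * w \<xi>) \<le> (C * D) * japanese \<xi> powr s" for x \<xi>
  proof -
    have "norm (q x \<xi>) * norm (w \<xi>) \<le> (C * japanese \<xi> powr m) * (D * japanese \<xi> powr (s - m))"
      by (intro mult_mono C D) (use C in auto)
    also have "\<dots> = (C * D) * (japanese \<xi> powr m * japanese \<xi> powr (s - m))" by simp
    also have "japanese \<xi> powr m * japanese \<xi> powr (s - m) = japanese \<xi> powr s" by (simp add: powr_add[symmetric])
    finally show ?thesis by (simp add: norm_mult)
  qed
  then show ?thesis using C D by (intro exI[of _ "C * D"]) auto
qed

lemma expint_schwartz_integrand:
  fixes q :: "real ^ 'n::finite \<Rightarrow> real ^ 'n \<Rightarrow> complex"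
  assumes q: "q \<in> smooth_symbols m \<rho> \<delta>" "0 \<le> \<rho>" and w: "w \<in> schwartz"
  shows "(\<lambda>\<xi>. exp (\<i> * complex_of_real (x \<bullet> \<xi>)) * q x \<xi> * w \<xi>) \<in> schwartz"
  using schwartz_char[OF symbol_schwartz[OF q w]] by (simp add: mult.assoc)

lemma expint_bounded:
  fixes q :: "real ^ 'n::finite \<Rightarrow> real ^ 'n \<Rightarrow> complex"
  assumes q: "q \<in> smooth_symbols m \<rho> \<delta>" and \<rho>: "0 \<le> \<rho>" and w: "w \<in> schwartz"
  shows "\<exists>C. \<forall>x. norm (expint q w x) \<le> C"
proof -
  obtain C where C: "C \<ge> 0" "\<And>x \<xi>. norm (q x \<xi> * w \<xi>) \<le> C * japanese \<xi> powr (- 2 * real DIM(real ^ 'n))"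
    using symbol_schwartz_bound[OF q w] by blast
  have "norm (expint q w x) \<le> (\<integral>\<xi>. C * japanese (\<xi> :: real ^ 'n) powr (- 2 * real DIM(real ^ 'n)) \<partial>lborel)" for x
    unfolding expint_def
    by (rule Bochner_Integration.integral_norm_bound_integral[OF schwartz_integrable[OF expint_schwartz_integrand[OF q(1) \<rho> w]] Bochner_Integration.integrable_mult_right[OF integrable_japanese]])
      (use C in \<open>auto simp: norm_mult\<close>)
  then show ?thesis by blast
qed

lemma expint_dir:
  fixes q :: "real ^ 'n::finite \<Rightarrow> real ^ 'n \<Rightarrow> complex"
  assumes q: "q \<in> smooth_symbols m \<rho> \<delta>" "0 \<le> \<rho>" "0 \<le> \<delta>" and w: "w \<in> schwartz" and b: "b \<in> Basis"
  shows "has_dir_deriv (expint q w) b (expint (dx b q) w x + expint q (\<lambda>\<xi>. \<i> * (complex_of_real (\<xi> \<bullet> b) * w \<xi>)) x) x"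
proof -
  define w' where "w' = (\<lambda>\<xi>::real ^ 'n. \<i> * (complex_of_real (\<xi> \<bullet> b) * w \<xi>))"
  have w': "w' \<in> schwartz" unfolding w'_def
    by (intro schwartz_cmult schwartz_om[OF om_inner[OF b]] w)
  note q' = smooth_symbols_dx[OF q(1,3) b]
  let ?E = "\<lambda>q w x \<xi>. exp (\<i> * complex_of_real (x \<bullet> \<xi>)) * q x \<xi> * w \<xi>"
  note s = expint_schwartz_integrand[OF q(1,2) w] expint_schwartz_integrand[OF q' q(2) w] expint_schwartz_integrand[OF q(1,2) w']
  obtain C where C: "C \<ge> 0" "\<And>x \<xi>. norm (dx b q x \<xi> * w \<xi>) \<le> C * japanese \<xi> powr (- 2 * real DIM(real ^ 'n))"
    using symbol_schwartz_bound[OF q' w] by blast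
  obtain D where D: "D \<ge> 0" "\<And>x \<xi>. norm (q x \<xi> * w' \<xi>) \<le> D * japanese \<xi> powr (- 2 * real DIM(real ^ 'n))"
    using symbol_schwartz_bound[OF q(1) w'] by blast
  have "has_dir_deriv (\<lambda>x. \<integral>\<xi>. ?E q w x \<xi> \<partial>lborel) b (\<integral>\<xi>. ?E (dx b q) w x \<xi> + ?E q w' x \<xi> \<partial>lborel) x"
  proof (rule has_dir_deriv_integral[where D = "\<lambda>\<xi>. (C + D) * japanese \<xi> powr (- 2 * real DIM(real ^ 'n))"])
    fix x \<xi> :: "real ^ 'n"
    have 1: "has_dir_deriv (\<lambda>x. exp (\<i> * complex_of_real (x \<bullet> \<xi>))) b (\<i> * complex_of_real (\<xi> \<bullet> b) * exp (\<i> * complex_of_real (x \<bullet> \<xi>))) x"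
      using smooth_dir_deriv[OF smooth_char, of \<xi> b x] unfolding pd_char by (simp only: inner_commute)
    have 2: "has_dir_deriv (\<lambda>x. q x \<xi>) b (dx b q x \<xi>) x"
      using smooth_symbols_dx_dir[OF q(1) b, of "[]"] by simp
    have 3: "has_dir_deriv (\<lambda>x. w \<xi>) b 0 x" by (simp add: has_dir_deriv_def)
    show "has_dir_deriv (\<lambda>x. ?E q w x \<xi>) b (?E (dx b q) w x \<xi> + ?E q w' x \<xi>) x"
      using has_dir_deriv_mult[OF has_dir_deriv_mult[OF 1 2] 3] by (simp add: w'_def algebra_simps)
    show "norm (?E (dx b q) w x \<xi> + ?E q w' x \<xi>) \<le> (C + D) * japanese \<xi> powr (- 2 * real DIM(real ^ 'n))"
      unfolding distrib_right by (rule norm_triangle_mono) (use C D in \<open>auto simp: norm_mult\<close>)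
  next
    show "integrable lborel (\<lambda>\<xi>. (C + D) * japanese (\<xi> :: real ^ 'n) powr (- 2 * real DIM(real ^ 'n)))"
      by (intro Bochner_Integration.integrable_mult_right integrable_japanese) simp
    show "integrable lborel (?E q w x)" for x by (rule schwartz_integrable[OF s(1)])
    show "(\<lambda>\<xi>. ?E (dx b q) w x \<xi> + ?E q w' x \<xi>) \<in> borel_measurable lborel"
      by (intro borel_measurable_integrable Bochner_Integration.integrable_add schwartz_integrable s)
  qed
  then show ?thesis unfolding expint_def[abs_def] w'_def[symmetric]
    by (simp add: Bochner_Integration.integral_add[OF schwartz_integrable[OF s(2)] schwartz_integrable[OF s(3)]])
qed

text \<open>Integration by parts in \<xi>: the coordinate of x is the \<xi>-derivative of the phase,
  and the derivative passes to q and to w.\<close>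

lemma expint_mult:
  fixes q :: "real ^ 'n::finite \<Rightarrow> real ^ 'n \<Rightarrow> complex"
  assumes q: "q \<in> smooth_symbols m \<rho> \<delta>" "0 \<le> \<rho>" "0 \<le> \<delta>" and w: "w \<in> schwartz" and b: "b \<in> Basis"
  shows "complex_of_real (x \<bullet> b) * expint q w x = \<i> * expint (dxi b q) w x + \<i> * expint q (pd b w) x"
proof -
  note q' = smooth_symbols_dxi[OF q(1,3) b]
  note s = expint_schwartz_integrand[OF q(1,2) w] expint_schwartz_integrand[OF q' q(2) w] expint_schwartz_integrand[OF q(1,2) schwartz_pd[OF w b]]
  have sm: "smooth (q x)" "smooth w" "smooth (\<lambda>\<xi>. q x \<xi> * w \<xi>)"
    using smooth_symbols_smooth_xi[OF q(1)] schwartz_smooth[OF w] by (auto intro: smooth_mult)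
  have dq: "dxi b q x = pd b (q x)" unfolding dxi_def mixed_deriv_def by (simp del: iter_deriv.simps add: iter_deriv.simps(1))
  let ?e = "\<lambda>\<xi>. exp (\<i> * complex_of_real (x \<bullet> \<xi>))"
  have "pd b (\<lambda>\<xi>. ?e \<xi> * (q x \<xi> * w \<xi>)) = (\<lambda>\<xi>. ?e \<xi> * pd b (\<lambda>\<xi>. q x \<xi> * w \<xi>) \<xi> + pd b ?e \<xi> * (q x \<xi> * w \<xi>))"
    by (rule pd_mult[OF smooth_differentiable[OF smooth_char] smooth_differentiable[OF sm(3)]])
  also have "pd b (\<lambda>\<xi>. q x \<xi> * w \<xi>) = (\<lambda>\<xi>. q x \<xi> * pd b w \<xi> + pd b (q x) \<xi> * w \<xi>)"
    by (rule pd_mult[OF smooth_differentiable[OF sm(1)] smooth_differentiable[OF sm(2)]])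
  finally have eq: "pd b (\<lambda>\<xi>. ?e \<xi> * q x \<xi> * w \<xi>) \<xi> = ?e \<xi> * q x \<xi> * pd b w \<xi> + ?e \<xi> * dxi b q x \<xi> * w \<xi> +
      \<i> * complex_of_real (x \<bullet> b) * (?e \<xi> * q x \<xi> * w \<xi>)" for \<xi>
    unfolding pd_char dq by (simp only: mult.assoc distrib_left mult.left_commute)
  have "0 = (\<integral>\<xi>. pd b (\<lambda>\<xi>. ?e \<xi> * q x \<xi> * w \<xi>) \<xi> \<partial>lborel)"
    by (rule schwartz_integral_pd[OF s(1) b, symmetric])
  also have "\<dots> = expint q (pd b w) x + expint (dxi b q) w x + \<i> * complex_of_real (x \<bullet> b) * expint q w x"
    unfolding eq expint_def using s[THEN schwartz_integrable]
    by (simp only: Bochner_Integration.integral_add Bochner_Integration.integrable_add Bochner_Integration.integral_mult_right_zero Bochner_Integration.integrable_mult_right)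
  finally have "\<i> * 0 = \<i> * (expint q (pd b w) x + expint (dxi b q) w x + \<i> * complex_of_real (x \<bullet> b) * expint q w x)" by (simp only:)
  then show ?thesis by (simp add: algebra_simps del: iter_deriv.simps)
qed

text \<open>The order of q is not an index: derivatives in x and \<xi> change it, and any order is
  integrable against a Schwartz function. The scalar c takes up the factors \<i>.\<close>

inductive_set expint_sums :: "real \<Rightarrow> real \<Rightarrow> (real ^ 'n::finite \<Rightarrow> complex) set" for \<rho> \<delta> :: real where
  base: "q \<in> smooth_symbols m \<rho> \<delta> \<Longrightarrow> w \<in> schwartz \<Longrightarrow> (\<lambda>x. c * expint q w x) \<in> expint_sums \<rho> \<delta>"
| add: "f \<in> expint_sums \<rho> \<delta> \<Longrightarrow> g \<in> expint_sums \<rho> \<delta> \<Longrightarrow> (\<lambda>x. f x + g x) \<in> expint_sums \<rho> \<delta>"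

lemma expint_schwartz:
  fixes q :: "real ^ 'n::finite \<Rightarrow> real ^ 'n \<Rightarrow> complex"
  assumes q: "q \<in> smooth_symbols m \<rho> \<delta>" "0 \<le> \<rho>" "0 \<le> \<delta>" and w: "w \<in> schwartz"
  shows "expint q w \<in> schwartz"
proof (rule schwartz_coinduct)
  show "expint q w \<in> expint_sums \<rho> \<delta>" using expint_sums.base[OF q(1) w, of 1] by simp
  fix f :: "real ^ 'n \<Rightarrow> complex" assume f: "f \<in> expint_sums \<rho> \<delta>"
  show "\<exists>C. \<forall>x. norm (f x) \<le> C"
    using f
  proof induction
    case (base q m w c)
    obtain C where "\<And>x. norm (expint q w x) \<le> C" using expint_bounded[OF base(1) q(2) base(2)] by blast
    then show ?case by (intro exI[of _ "norm c * C"]) (simp add: norm_mult mult_left_mono)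
  next
    case (add f g)
    then show ?case using norm_triangle_mono by blast
  qed
  fix b :: "real ^ 'n" assume b: "b \<in> Basis"
  show "\<exists>g\<in>expint_sums \<rho> \<delta>. \<forall>x. has_dir_deriv f b (g x) x"
    using f
  proof induction
    case (base q m w c)
    have w': "(\<lambda>\<xi>. \<i> * (complex_of_real (\<xi> \<bullet> b) * w \<xi>)) \<in> schwartz"
      by (intro schwartz_cmult schwartz_om[OF om_inner[OF b]] base)
    have d: "has_dir_deriv (\<lambda>x. c * expint q w x) b (c * expint (dx b q) w x + c * expint q (\<lambda>\<xi>. \<i> * (complex_of_real (\<xi> \<bullet> b) * w \<xi>)) x) x" for x
    proof -
      have "has_dir_deriv (\<lambda>x. c) b 0 x" by (simp add: has_dir_deriv_def)
      from has_dir_deriv_mult[OF this expint_dir[OF base(1) q(2,3) base(2) b, of x]] show ?thesis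
        by (simp only: distrib_left mult_zero_left add_0_right)
    qed
    from expint_sums.add[OF expint_sums.base[OF smooth_symbols_dx[OF base(1) q(3) b] base(2), of c] expint_sums.base[OF base(1) w', of c]]
    show ?case by (rule bexI[rotated]) (intro allI d)
  next
    case (add f g)
    then obtain d d' where d: "d \<in> expint_sums \<rho> \<delta>" "d' \<in> expint_sums \<rho> \<delta>"
      "\<And>x. has_dir_deriv f b (d x) x" "\<And>x. has_dir_deriv g b (d' x) x" by blast
    from expint_sums.add[OF d(1,2)] show ?case by (rule bexI[rotated]) (intro allI has_dir_deriv_add[OF d(3,4)])
  qed
  show "(\<lambda>x. complex_of_real (x \<bullet> b) * f x) \<in> expint_sums \<rho> \<delta>"
    using f
  proof induction
    case (base q m w c)
    have "complex_of_real (x \<bullet> b) * (c * expint q w x) = (c * \<i>) * expint (dxi b q) w x + (c * \<i>) * expint q (pd b w) x" for x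
      using arg_cong[OF expint_mult[OF base(1) q(2,3) base(2) b, of x], of "(*) c"] by (simp only: distrib_left mult.assoc mult.left_commute)
    then show ?case
      using expint_sums.add[OF expint_sums.base[OF smooth_symbols_dxi[OF base(1) q(3) b] base(2), of "c * \<i>"]
        expint_sums.base[OF base(1) schwartz_pd[OF base(2) b], of "c * \<i>"]] by (simp only:)
  next
    case (add f g)
    from expint_sums.add[OF add(3,4)] show ?case by (simp add: distrib_left)
  qed
qed

lemma smooth_symbols_one: "(\<lambda>(_ :: real ^ 'n::finite) _. 1) \<in> smooth_symbols 0 1 0"
  unfolding smooth_symbols_def
proof (intro INT_I)
  fix \<tau> :: real assume \<tau>: "\<tau> \<in> {0<..}"
  \<comment> \<open>A constant symbol is bounded by the power m only if m is nonnegative or the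
    constant is 0; after the first derivative only 0 remains, and it has every order.\<close>
  define S :: "real \<Rightarrow> real \<Rightarrow> (real ^ 'n \<Rightarrow> real ^ 'n \<Rightarrow> complex) set" where
    "S \<tau> m = {\<lambda>_ _. c | c. c = 0 \<or> 0 \<le> m}" for \<tau> m
  show "(\<lambda>(_ :: real ^ 'n) _. 1) \<in> CS \<tau> 0 1 0"
  proof (rule CS_coinduct[of _ S])
    show "(\<lambda>_ _. 1) \<in> S \<tau> 0" by (auto simp: S_def)
    fix t m and s :: "real ^ 'n \<Rightarrow> real ^ 'n \<Rightarrow> complex" assume s: "s \<in> S t m"
    then obtain c where c: "s = (\<lambda>_ _. c)" "c = 0 \<or> 0 \<le> m" by (auto simp: S_def)
    have z: "(\<lambda>_ _. 0) \<in> S t' m'" for t' m' by (auto simp: S_def)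
    have "norm c \<le> norm c * japanese \<xi> powr m" for \<xi> :: "real ^ 'n"
      using c(2) japanese_powr_mono[of 0 m \<xi>] japanese_pos[of \<xi>] by (auto simp: mult_le_cancel_left1)
    then show "\<exists>C. \<forall>x \<xi>. norm (s x \<xi>) \<le> C * japanese \<xi> powr m" using c(1) by auto
    show "isCont (\<lambda>x. s x \<xi>) x" for x \<xi> by (simp add: c)
    show "\<exists>s'\<in>S t (m - 1). \<forall>x \<xi>. has_dir_deriv (s x) b (s' x \<xi>) \<xi>" for b
      by (rule bexI[OF _ z]) (simp add: c has_dir_deriv_def)
    show "\<exists>s'\<in>S (t - 1) (m + 0). \<forall>x \<xi>. has_dir_deriv (\<lambda>x. s x \<xi>) b (s' x \<xi>) x" for b
      by (rule bexI[OF _ z]) (simp add: c has_dir_deriv_def)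
    show "\<exists>C. \<forall>u x z \<xi>. 0 < u \<and> u < 1 \<and> u \<le> t \<longrightarrow>
      norm (s x \<xi> - s z \<xi>) \<le> C * japanese \<xi> powr (m + 0 * u) * norm (x - z) powr u"
      by (rule exI[of _ 0]) (simp add: c)
  qed (use \<tau> in auto)
qed

lemma fourier_schwartz: "u \<in> schwartz \<Longrightarrow> fourier (u :: real ^ 'n::finite \<Rightarrow> complex) \<in> schwartz"
proof -
  assume u: "u \<in> schwartz"
  \<comment> \<open>The Fourier transform is the operator with symbol 1 up to a reflection; so it
    maps Schwartz functions to Schwartz functions as a special case of
    \<open>expint_schwartz\<close>.\<close>
  have "expint (\<lambda>_ _. 1) u \<in> schwartz" by (rule expint_schwartz[OF smooth_symbols_one _ _ u]) auto
  from schwartz_scale[OF this, of "-1"] show ?thesis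
    by (simp add: expint_def fourier_def[abs_def] inner_commute)
qed

lemma pseudo_op_expint:
  "u \<in> schwartz \<Longrightarrow> pseudo_op q (u :: real ^ 'n::finite \<Rightarrow> complex) = (\<lambda>x. osc_fac TYPE(real ^ 'n) * expint q (fourier u) x)"
  by (simp add: pseudo_op_def expint_def osc_fac_vec fun_eq_iff)

section \<open>Composition: exchanging the oscillatory integral with the integral over
  frequencies\<close>

lemma schwartz_translate: "f \<in> schwartz \<Longrightarrow> (\<lambda>x. f (a + x)) \<in> schwartz"
  for f :: "'a::euclidean_space \<Rightarrow> complex"
  unfolding schwartz_iff
proof
  fix s assume f: "\<forall>s. wcl (\<lambda>x. japanese x powr s) f"
  show "wcl (\<lambda>x. japanese x powr s) (\<lambda>x. f (a + x))"
    by (rule wcl_mono[where D = "2 powr \<bar>s\<bar> * japanese a powr \<bar>s\<bar>", OF wcl_affine[OF bounded_linear_ident f[rule_format, of s], of "\<lambda>b. b" "\<lambda>_. 1" a]])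
      (use peetre[of _ a s] in \<open>auto simp: mult_ac add.commute\<close>)
qed

lemma fourier_translate:
  fixes v :: "real ^ 'n::finite \<Rightarrow> complex"
  assumes "v \<in> borel_measurable borel"
  shows "fourier (\<lambda>y. v (x + y)) \<eta> = exp (\<i> * complex_of_real (x \<bullet> \<eta>)) * fourier v \<eta>"
proof -
  have [measurable]: "v \<in> borel_measurable borel" by fact
  have "fourier (\<lambda>y. v (x + y)) \<eta> = (\<integral>y. exp (- \<i> * complex_of_real (((y + x) - x) \<bullet> \<eta>)) * v (y + x) \<partial>lborel)"
    by (simp add: fourier_def add.commute)
  also have "\<dots> = (\<integral>y. exp (- \<i> * complex_of_real ((y - x) \<bullet> \<eta>)) * v y \<partial>lborel)"
    by (rule integral_translate[of "\<lambda>y. exp (- \<i> * complex_of_real ((y - x) \<bullet> \<eta>)) * v y"]) measurable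
  also have "\<dots> = (\<integral>y. exp (\<i> * complex_of_real (x \<bullet> \<eta>)) * (exp (- \<i> * complex_of_real (y \<bullet> \<eta>)) * v y) \<partial>lborel)"
    by (simp add: inner_diff_left algebra_simps exp_add[symmetric] flip: mult.assoc exp_add)
  finally show ?thesis by (simp add: fourier_def)
qed

lemma osc_tensor_fourier:
  fixes f g :: "real ^ 'n::finite \<Rightarrow> complex"
  assumes "f \<in> schwartz" "g \<in> schwartz"
  shows "osc (\<lambda>z. f (fst z) * g (snd z)) = osc_fac TYPE(real ^ 'n) * (\<integral>\<eta>. f \<eta> * fourier g \<eta> \<partial>lborel)"
  unfolding osc_schwartz[OF schwartz_tensor[OF assms]] osc_exp_integral_iterated[OF assms] fourier_def ..

text \<open>Modulation in y translates the Fourier transform of g, and translation invariance moves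
  the shift to f. This turns the argument \<eta> of the first symbol into \<zeta> + \<eta>.\<close>

lemma osc_modulate:
  fixes f g :: "real ^ 'n::finite \<Rightarrow> complex"
  assumes f: "f \<in> schwartz" and g: "g \<in> schwartz"
  shows "osc (\<lambda>z. f (fst z) * (exp (\<i> * complex_of_real (\<zeta> \<bullet> snd z)) * g (snd z))) = osc (\<lambda>z. f (\<zeta> + fst z) * g (snd z))"
proof -
  have F: "fourier (\<lambda>y. exp (\<i> * complex_of_real (\<zeta> \<bullet> y)) * g y) \<eta> = fourier g (- \<zeta> + \<eta>)" for \<eta>
    unfolding fourier_def
    by (rule Bochner_Integration.integral_cong[OF refl]) (simp add: inner_add_right inner_commute algebra_simps exp_add exp_diff exp_minus divide_inverse)
  have m: "(\<lambda>\<eta>. f \<eta> * fourier g (- \<zeta> + \<eta>)) \<in> borel_measurable borel"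
    by (intro smooth_borel smooth_mult schwartz_smooth f affine_translate(1) fourier_schwartz g)
  show ?thesis
    unfolding osc_tensor_fourier[OF f schwartz_char[OF g]] osc_tensor_fourier[OF schwartz_translate[OF f] g] F
    using integral_translate[OF m, of \<zeta>] by (simp add: add.commute)
qed

text \<open>A cutoff is needed in \<eta> only, since v decays in y. The cutoff is at most 1 in
  modulus, so the limiting integrand itself dominates.\<close>

lemma osc_pseudo_op:
  fixes f v :: "real ^ 'n::finite \<Rightarrow> complex"
  assumes f: "wcl (\<lambda>\<eta>. japanese \<eta> powr K) f" and v: "v \<in> schwartz"
  shows "osc (\<lambda>z. f (fst z) * v (x + snd z)) =
    osc_fac TYPE(real ^ 'n) * (\<integral>\<xi>. exp (\<i> * complex_of_real (x \<bullet> \<xi>)) * f \<xi> * fourier v \<xi> \<partial>lborel)"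
proof -
  note c = gauss_cut[OF f wcl_om[OF f] powr_ge_zero]
  note vx = schwartz_translate[OF v, of x]
  have "wconv (WW K 0) (\<lambda>n z. gauss_cut n f (fst z) * v (x + snd z)) (\<lambda>z. f (fst z) * v (x + snd z))"
    by (rule wconv_tensor[OF c(2) wconv_const[OF schwartz_wcl_1[OF vx]]])
  note lim1 = osc_tendsto[OF this]
  have eq: "osc (\<lambda>z. gauss_cut n f (fst z) * v (x + snd z)) =
      osc_fac TYPE(real ^ 'n) * (\<integral>\<xi>. exp (\<i> * complex_of_real (x \<bullet> \<xi>)) * gauss_cut n f \<xi> * fourier v \<xi> \<partial>lborel)" for n
    unfolding osc_tensor_fourier[OF c(1) vx] fourier_translate[OF smooth_borel[OF schwartz_smooth[OF v]]]
    by (simp only: mult_ac)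
  have s: "(\<lambda>\<xi>. exp (\<i> * complex_of_real (x \<bullet> \<xi>)) * (f \<xi> * fourier v \<xi>)) \<in> schwartz"
    by (intro schwartz_char schwartz_om[OF wcl_om[OF f]] fourier_schwartz v)
  have "(\<lambda>n. \<integral>\<xi>. exp (\<i> * complex_of_real (x \<bullet> \<xi>)) * gauss_cut n f \<xi> * fourier v \<xi> \<partial>lborel) \<longlonglongrightarrow>
      (\<integral>\<xi>. exp (\<i> * complex_of_real (x \<bullet> \<xi>)) * f \<xi> * fourier v \<xi> \<partial>lborel)"
  proof (rule integral_dominated_convergence[where w = "\<lambda>\<xi>. norm (exp (\<i> * complex_of_real (x \<bullet> \<xi>)) * (f \<xi> * fourier v \<xi>))"])
    show "integrable lborel (\<lambda>\<xi>. norm (exp (\<i> * complex_of_real (x \<bullet> \<xi>)) * (f \<xi> * fourier v \<xi>)))"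
      by (intro integrable_norm schwartz_integrable s)
    show "(\<lambda>\<xi>. exp (\<i> * complex_of_real (x \<bullet> \<xi>)) * f \<xi> * fourier v \<xi>) \<in> borel_measurable lborel"
      using borel_measurable_integrable[OF schwartz_integrable[OF s]] by (simp add: mult.assoc)
    have s': "(\<lambda>\<xi>. exp (\<i> * complex_of_real (x \<bullet> \<xi>)) * (gauss_cut n f \<xi> * fourier v \<xi>)) \<in> schwartz" for n
      by (intro schwartz_char schwartz_om[OF wcl_om[OF schwartz_wcl[OF c(1), of 0]]] fourier_schwartz v)
    show "(\<lambda>\<xi>. exp (\<i> * complex_of_real (x \<bullet> \<xi>)) * gauss_cut n f \<xi> * fourier v \<xi>) \<in> borel_measurable lborel" for n
      using borel_measurable_integrable[OF schwartz_integrable[OF s'[of n]]] by (simp add: mult.assoc)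
    show "AE \<xi> in lborel. (\<lambda>n. exp (\<i> * complex_of_real (x \<bullet> \<xi>)) * gauss_cut n f \<xi> * fourier v \<xi>) \<longlonglongrightarrow> exp (\<i> * complex_of_real (x \<bullet> \<xi>)) * f \<xi> * fourier v \<xi>"
      by (intro AE_I2 tendsto_intros wconv_lim0[OF c(2)])
    show "AE \<xi> in lborel. norm (exp (\<i> * complex_of_real (x \<bullet> \<xi>)) * gauss_cut n f \<xi> * fourier v \<xi>) \<le> norm (exp (\<i> * complex_of_real (x \<bullet> \<xi>)) * (f \<xi> * fourier v \<xi>))" for n
      by (intro AE_I2) (simp add: gauss_cut_def norm_mult norm_gauss mult_left_le_one_le mult.assoc)
  qed
  from tendsto_mult[OF tendsto_const this, of "osc_fac TYPE(real ^ 'n)"] show ?thesis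
    using LIMSEQ_unique[OF lim1] unfolding eq by blast
qed

text \<open>This gives the joint measurability required by Fubini's theorem. It follows from locally
  bounded partial derivatives in both variables.\<close>

lemma smooth_symbols_jointly_continuous:
  fixes q :: "real ^ 'n::finite \<Rightarrow> real ^ 'n \<Rightarrow> complex"
  assumes q: "q \<in> smooth_symbols m \<rho> \<delta>" and \<delta>: "0 \<le> \<delta>"
  shows "continuous_on UNIV (\<lambda>z. q (fst z) (snd z))"
  unfolding continuous_on_eq_continuous_at[OF open_UNIV]
proof
  fix z0 :: "(real ^ 'n) \<times> (real ^ 'n)"
  define D where "D b z = (if snd b = 0 then dx (fst b) q (fst z) (snd z) else dxi (snd b) q (fst z) (snd z))"
    for b z :: "(real ^ 'n) \<times> (real ^ 'n)"
  show "isCont (\<lambda>z. q (fst z) (snd z)) z0"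
  proof (rule isCont_of_locally_bounded_partials[where D = D])
    fix z b :: "(real ^ 'n) \<times> (real ^ 'n)" assume "b \<in> Basis"
    then consider c where "b = (c, 0)" "c \<in> Basis" | c where "b = (0, c)" "c \<in> Basis" by (auto simp: Basis_prod_def)
    then show "has_dir_deriv (\<lambda>z. q (fst z) (snd z)) b (D b z) z"
    proof cases
      case 1
      then show ?thesis using smooth_symbols_dx_dir[OF q 1(2), of "[]" "snd z" "fst z"]
        by (simp add: D_def has_dir_deriv_def)
    next
      case 2
      then have "c \<noteq> 0" by auto
      then show ?thesis using smooth_symbols_dxi_dir[OF q 2(2), of "[]" "fst z" "snd z"] 2
        by (simp add: D_def has_dir_deriv_def)
    qed
  next
    fix b :: "(real ^ 'n) \<times> (real ^ 'n)" assume "b \<in> Basis"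
    have loc: "\<exists>C. \<forall>z. norm (z - z0) \<le> 1 \<longrightarrow> norm (p (fst z) (snd z)) \<le> C" if p: "p \<in> smooth_symbols m' \<rho> \<delta>" for p m'
    proof -
      obtain C where C: "C \<ge> 0" "\<And>x \<xi>. norm (p x \<xi>) \<le> C * japanese \<xi> powr m'"
        using smooth_symbols_bound[OF p, of "[]"] by auto
      have "norm (p (fst z) (snd z)) \<le> C * (4 powr \<bar>m'\<bar> * japanese (snd z0) powr m')" if "norm (z - z0) \<le> 1" for z
      proof -
        have "norm (snd z - snd z0) \<le> 1" using that norm_snd_le[of "snd (z - z0)" "fst (z - z0)"] by (simp add: minus_prod_def)
        from mult_left_mono[OF japanese_powr_near[OF this] C(1), of m'] C(2) show ?thesis by (rule order_trans[rotated])
      qed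
      then show ?thesis by blast
    qed
    from \<open>b \<in> Basis\<close> consider c where "b = (c, 0)" "c \<in> Basis" | c where "b = (0, c)" "c \<in> Basis" by (auto simp: Basis_prod_def)
    then show "\<exists>C. \<forall>z. norm (z - z0) \<le> 1 \<longrightarrow> norm (D b z) \<le> C"
    proof cases
      case 1
      then show ?thesis using loc[OF smooth_symbols_dx[OF q \<delta> 1(2)]] by (simp add: D_def)
    next
      case 2
      then have "c \<noteq> 0" by auto
      then show ?thesis using loc[OF smooth_symbols_dxi[OF q \<delta> 2(2)]] 2 by (simp add: D_def)
    qed
  qed
qed

lemma expint_shift_schwartz:
  fixes g :: "real ^ 'n::finite \<Rightarrow> complex"
  assumes q: "q \<in> smooth_symbols m \<rho> \<delta>" and g: "g \<in> schwartz"
  shows "(\<lambda>y. g y * q (x + y) \<zeta>) \<in> schwartz"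
  using schwartz_om[OF wcl_om[where K = 0] g, of "\<lambda>y. q (x + y) \<zeta>"] wcl_symbols_shift[OF q, of x \<zeta>] by (simp add: mult.commute)

text \<open>With f and g Schwartz the integrand is absolutely integrable in (\<eta>, y, \<zeta>), so
  Fubini's theorem applies; the character of x + y splits into one of x and a modulation in y,
  handled by \<open>osc_modulate\<close>. The integrability claim later supplies measurability in
  \<zeta>.\<close>

lemma osc_expint_schwartz:
  fixes f g w :: "real ^ 'n::finite \<Rightarrow> complex" and x :: "real ^ 'n"
  assumes f: "f \<in> schwartz" and g: "g \<in> schwartz" and q: "q \<in> smooth_symbols m \<rho> \<delta>" "0 \<le> \<rho>" "0 \<le> \<delta>" and w: "w \<in> schwartz"
  defines "B \<equiv> \<lambda>\<zeta>. exp (\<i> * complex_of_real (x \<bullet> \<zeta>)) * osc (\<lambda>z. f (\<zeta> + fst z) * (g (snd z) * q (x + snd z) \<zeta>)) * w \<zeta>"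
  shows "osc (\<lambda>z. f (fst z) * (g (snd z) * expint q w (x + snd z))) = (\<integral>\<zeta>. B \<zeta> \<partial>lborel)"
    and "integrable lborel B"
proof -
  let ?c = "osc_fac TYPE(real ^ 'n)"
  define H where "H z \<zeta> = osc_exp z * (f (fst z) * g (snd z)) * (exp (\<i> * complex_of_real ((x + snd z) \<bullet> \<zeta>)) * q (x + snd z) \<zeta> * w \<zeta>)"
    for z :: "(real ^ 'n) \<times> (real ^ 'n)" and \<zeta>
  define d1 where "d1 = - 2 * real DIM((real ^ 'n) \<times> (real ^ 'n))"
  define d2 where "d2 = - 2 * real DIM(real ^ 'n)"
  obtain C1 where C1: "C1 \<ge> 0" "\<And>z. norm (f (fst z) * g (snd z)) \<le> C1 * japanese z powr d1"
    using wcl_lists[OF schwartz_wcl[OF schwartz_tensor[OF f g]], of "[]" d1] by auto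
  obtain C2 where C2: "C2 \<ge> 0" "\<And>y \<zeta>. norm (q y \<zeta> * w \<zeta>) \<le> C2 * japanese \<zeta> powr d2"
    using symbol_schwartz_bound[OF q(1) w] by blast
  have cont: "continuous_on UNIV (\<lambda>u. H (fst u) (snd u))"
  proof -
    have 1: "continuous_on UNIV (\<lambda>u::((real ^ 'n) \<times> (real ^ 'n)) \<times> (real ^ 'n). h (k u))"
      if "smooth h" "continuous_on UNIV k" for h :: "real ^ 'n \<Rightarrow> complex" and k
      by (rule continuous_on_compose2[OF smooth_continuous[OF that(1)] that(2)]) simp
    have 2: "continuous_on UNIV (\<lambda>u::((real ^ 'n) \<times> (real ^ 'n)) \<times> (real ^ 'n). q (x + snd (fst u)) (snd u))"
      using continuous_on_compose2[OF smooth_symbols_jointly_continuous[OF q(1,3)], of UNIV "\<lambda>u. (x + snd (fst u), snd u)"]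
      by (simp add: continuous_on_Pair continuous_intros)
    show ?thesis unfolding H_def osc_exp_def
      by (intro continuous_intros 2 1[OF schwartz_smooth[OF f]] 1[OF schwartz_smooth[OF g]] 1[OF schwartz_smooth[OF w]])
  qed
  have i: "integrable (lborel \<Otimes>\<^sub>M lborel) (\<lambda>(z, \<zeta>). H z \<zeta>)"
  proof (rule Bochner_Integration.integrable_bound)
    show "integrable (lborel \<Otimes>\<^sub>M lborel) (\<lambda>u::((real ^ 'n) \<times> (real ^ 'n)) \<times> (real ^ 'n). (C1 * C2) * (japanese (fst u) powr d1 * japanese (snd u) powr d2))"
      unfolding lborel_prod d1_def d2_def by (intro Bochner_Integration.integrable_mult_right integrable_japanese_prod) auto
    show "(\<lambda>(z, \<zeta>). H z \<zeta>) \<in> borel_measurable (lborel \<Otimes>\<^sub>M lborel)"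
      unfolding lborel_prod case_prod_beta' using borel_measurable_continuous_onI[OF cont] by simp
    have "norm (H z \<zeta>) \<le> (C1 * C2) * (japanese z powr d1 * japanese \<zeta> powr d2)" for z \<zeta>
    proof -
      have "norm (H z \<zeta>) = norm (f (fst z) * g (snd z)) * norm (q (x + snd z) \<zeta> * w \<zeta>)"
        by (simp add: H_def norm_mult norm_osc_exp)
      also have "\<dots> \<le> (C1 * japanese z powr d1) * (C2 * japanese \<zeta> powr d2)"
        by (intro mult_mono C1 C2) (use C1 in auto)
      finally show ?thesis by (simp add: mult_ac)
    qed
    then show "AE u in lborel \<Otimes>\<^sub>M lborel. norm (case u of (z, \<zeta>) \<Rightarrow> H z \<zeta>) \<le>
        norm ((C1 * C2) * (japanese (fst u) powr d1 * japanese (snd u) powr d2))"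
      using C1(1) C2(1) by (intro AE_I2) (simp add: case_prod_beta' abs_mult)
  qed
  have inner: "?c * (\<integral>z. H z \<zeta> \<partial>lborel) = B \<zeta>" for \<zeta>
  proof -
    note gq = expint_shift_schwartz[OF q(1) g, of x \<zeta>]
    have "H z \<zeta> = (exp (\<i> * complex_of_real (x \<bullet> \<zeta>)) * w \<zeta>) *
        (osc_exp z * (f (fst z) * (exp (\<i> * complex_of_real (\<zeta> \<bullet> snd z)) * (g (snd z) * q (x + snd z) \<zeta>))))" for z
      by (simp add: H_def inner_add_left inner_add_right distrib_left exp_add inner_commute)
    then have "?c * (\<integral>z. H z \<zeta> \<partial>lborel) = (exp (\<i> * complex_of_real (x \<bullet> \<zeta>)) * w \<zeta>) *
        osc (\<lambda>z. f (fst z) * (exp (\<i> * complex_of_real (\<zeta> \<bullet> snd z)) * (g (snd z) * q (x + snd z) \<zeta>)))"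
      unfolding osc_schwartz[OF schwartz_tensor[OF f schwartz_char[OF gq]]] by simp
    then show ?thesis unfolding osc_modulate[OF f gq] B_def by simp
  qed
  note ex = schwartz_translate[OF expint_schwartz[OF q w], of x]
  have eg: "(\<lambda>y. g y * expint q w (x + y)) \<in> schwartz"
    by (rule schwartz_om[OF wcl_om[OF schwartz_wcl[OF g, of 0]] ex])
  have "osc (\<lambda>z. f (fst z) * (g (snd z) * expint q w (x + snd z))) = ?c * (\<integral>z. \<integral>\<zeta>. H z \<zeta> \<partial>lborel \<partial>lborel)"
    unfolding osc_schwartz[OF schwartz_tensor[OF f eg]] unfolding expint_def H_def by (simp add: mult.assoc)
  also have "\<dots> = ?c * (\<integral>\<zeta>. \<integral>z. H z \<zeta> \<partial>lborel \<partial>lborel)"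
    by (simp only: lborel_pair.Fubini_integral[OF i])
  also have "\<dots> = (\<integral>\<zeta>. B \<zeta> \<partial>lborel)" by (simp add: inner[symmetric])
  finally show "osc (\<lambda>z. f (fst z) * (g (snd z) * expint q w (x + snd z))) = (\<integral>\<zeta>. B \<zeta> \<partial>lborel)" .
  show "integrable lborel B"
    using Bochner_Integration.integrable_mult_right[OF lborel_pair.integrable_snd[OF i], of ?c] unfolding inner by simp
qed

text \<open>The limit of the preceding identity as the Gaussian cutoffs are removed. The crucial
  point is a bound on the inner oscillatory integrals that is uniform in n and of polynomial growth
  in \<zeta>; it comes from the uniform constant of \<open>osc_tensor_bound\<close>, and the decay
  of w beats it.\<close>

lemma osc_expint:
  fixes f w :: "real ^ 'n::finite \<Rightarrow> complex"
  assumes f: "wcl (\<lambda>\<eta>. japanese \<eta> powr K) f" and K: "0 \<le> K"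
    and q: "q \<in> smooth_symbols m \<rho> \<delta>" "0 \<le> \<rho>" "0 \<le> \<delta>" and w: "w \<in> schwartz"
  shows "osc (\<lambda>z. f (fst z) * expint q w (x + snd z)) =
    expint (\<lambda>x \<zeta>. osc (\<lambda>z. f (\<zeta> + fst z) * q (x + snd z) \<zeta>)) w x"
proof -
  let ?e = "\<lambda>\<zeta>. exp (\<i> * complex_of_real (x \<bullet> \<zeta>))"
  let ?g = "\<lambda>n y. gauss ((1 / real (Suc n)) *\<^sub>R y) :: complex"
  note c = gauss_cut[OF f wcl_om[OF f] powr_ge_zero]
  have gs: "?g n \<in> schwartz" for n by (rule schwartz_scale[OF gauss_schwartz]) simp
  have gl: "wconv (\<lambda>_. 1) (\<lambda>n y :: real ^ 'n. ?g n y) (\<lambda>_. 1)"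
    using wconv_cutoff[OF schwartz_wcl_1[OF gauss_schwartz] cutoff_seq] by (simp only: gauss_0)
  note ex = schwartz_translate[OF expint_schwartz[OF q w], of x]
  have wg: "wconv (\<lambda>_. 1) (\<lambda>n y. ?g n y * h y) h" if "wcl (\<lambda>_. 1) h" for h :: "real ^ 'n \<Rightarrow> complex"
    using wconv_mult[OF gl wconv_const[OF that]] by simp
  have shift: "wconv (\<lambda>\<eta>. japanese \<eta> powr K) (\<lambda>n \<eta>. F n (\<zeta> + \<eta>)) (\<lambda>\<eta>. h (\<zeta> + \<eta>))"
    if "wconv (\<lambda>\<eta>. japanese \<eta> powr K) F h" for F h and \<zeta> :: "real ^ 'n"
    by (rule wconv_mono[where D = "2 powr \<bar>K\<bar> * japanese \<zeta> powr \<bar>K\<bar>", OF wconv_affine[OF bounded_linear_ident that, of "\<lambda>b. b" "\<lambda>_. 1" \<zeta>]])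
      (use peetre[of _ \<zeta> K] in \<open>auto simp: mult_ac add.commute\<close>)
  define B where "B n \<zeta> = osc (\<lambda>z. gauss_cut n f (\<zeta> + fst z) * (?g n (snd z) * q (x + snd z) \<zeta>))" for n \<zeta>
  define b where "b \<zeta> = osc (\<lambda>z. f (\<zeta> + fst z) * q (x + snd z) \<zeta>)" for \<zeta>
  have lim1: "(\<lambda>n. \<integral>\<zeta>. ?e \<zeta> * B n \<zeta> * w \<zeta> \<partial>lborel) \<longlonglongrightarrow> osc (\<lambda>z. f (fst z) * expint q w (x + snd z))"
    using osc_tendsto[OF wconv_tensor[OF c(2) wg[OF schwartz_wcl_1[OF ex]]]]
    unfolding osc_expint_schwartz(1)[OF c(1) gs q w] B_def .
  have lim2: "(\<lambda>n. B n \<zeta>) \<longlonglongrightarrow> b \<zeta>" for \<zeta>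
    unfolding B_def b_def by (rule osc_tendsto[OF wconv_tensor[OF shift[OF c(2)] wg[OF wcl_symbols_shift[OF q(1)]]]])
  obtain k where k: "K - 2 * real k \<le> - 2 * real DIM(real ^ 'n)" using exists_osc_order by blast
  define N where "N = 2 * DIM(real ^ 'n)"
  from osc_tensor_bound[OF k] obtain C0 where "C0 \<ge> 0 \<and> (\<forall>(f :: real ^ 'n \<Rightarrow> complex) g A B.
    wcl (\<lambda>x. japanese x powr K) f \<and> wcl (\<lambda>_. 1) g \<and> 0 \<le> A \<and> 0 \<le> B \<and>
    bdd N A (\<lambda>x. japanese x powr K) f \<and> bdd (2 * k) B (\<lambda>_. 1) g \<longrightarrow>
    norm (osc (\<lambda>z. f (fst z) * g (snd z))) \<le> C0 * A * B)"
    unfolding N_def by (elim exE)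
  note C0 = conjunct1[OF this] conjunct2[OF this, rule_format, OF conjI[OF _ conjI[OF _ conjI[OF _ conjI[OF _ conjI]]]]]
  obtain A0 where A0: "A0 \<ge> 0" "\<And>n. bdd N A0 (\<lambda>\<eta>. japanese \<eta> powr K) (gauss_cut n f)"
    using c(2) unfolding wconv_def by meson
  obtain G where G: "G \<ge> 0" "\<And>n. bdd (2 * k) G (\<lambda>_. 1) (\<lambda>y::real ^ 'n. ?g n y)"
    using gl unfolding wconv_def by meson
  \<comment> \<open>At most 2 k derivatives in y of q are used, so M bounds the growth in \<zeta> of
    all of them; the shift of f by \<zeta> adds the growth K.\<close>
  define M where "M = \<bar>m\<bar> + \<delta> * real (2 * k)"
  have "\<exists>C\<ge>0. \<forall>vs. set vs \<subseteq> Basis \<and> length vs \<le> 2 * k \<longrightarrow>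
    (\<forall>x \<xi>. norm (iter_deriv vs (\<lambda>x. q x \<xi>) x) \<le> C * japanese \<xi> powr (m + \<delta> * real (length vs)))"
  proof (rule uniform_const)
    show "\<forall>x \<xi>. norm (iter_deriv vs (\<lambda>x. q x \<xi>) x) \<le> D * japanese \<xi> powr (m + \<delta> * real (length vs))"
      if "\<forall>x \<xi>. norm (iter_deriv vs (\<lambda>x. q x \<xi>) x) \<le> C * japanese \<xi> powr (m + \<delta> * real (length vs))" "C \<le> D" for vs C D
      using that(1) mult_right_mono[OF that(2) powr_ge_zero] order_trans by blast
  qed (rule smooth_symbols_bound[OF q(1)])
  then obtain B0 where B0: "B0 \<ge> 0" "\<And>vs x \<xi>. set vs \<subseteq> Basis \<Longrightarrow> length vs \<le> 2 * k \<Longrightarrow>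
    norm (iter_deriv vs (\<lambda>x. q x \<xi>) x) \<le> B0 * japanese \<xi> powr (m + \<delta> * real (length vs))" by blast
  define E where "E = C0 * (A0 * 2 powr K) * (2 ^ (2 * k) * G * B0)"
  have E: "norm (B n \<zeta>) \<le> E * japanese \<zeta> powr (K + M)" for n \<zeta>
  proof -
    have 1: "bdd N (A0 * 2 powr K * japanese \<zeta> powr K) (\<lambda>\<eta>. japanese \<eta> powr K) (\<lambda>\<eta>. gauss_cut n f (\<zeta> + \<eta>))"
      unfolding bdd_def
    proof (intro allI impI)
      fix vs :: "(real ^ 'n) list" and \<eta> assume vs: "set vs \<subseteq> Basis \<and> length vs \<le> N"
      have "norm (iter_deriv vs (\<lambda>\<eta>. gauss_cut n f (\<zeta> + \<eta>)) \<eta>) \<le> A0 * japanese (\<zeta> + \<eta>) powr K"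
        unfolding affine_translate(2)[OF schwartz_smooth[OF c(1)] conjunct1[OF vs]] using bddD[OF A0(2)] vs by blast
      also have "\<dots> \<le> A0 * (2 powr \<bar>K\<bar> * japanese \<zeta> powr K * japanese \<eta> powr \<bar>K\<bar>)"
        by (intro mult_left_mono peetre A0)
      finally show "norm (iter_deriv vs (\<lambda>\<eta>. gauss_cut n f (\<zeta> + \<eta>)) \<eta>) \<le> A0 * 2 powr K * japanese \<zeta> powr K * japanese \<eta> powr K"
        using K by (simp add: mult.assoc)
    qed
    have 2: "bdd (2 * k) (B0 * japanese \<zeta> powr M) (\<lambda>_. 1) (\<lambda>y. q (x + y) \<zeta>)"
      unfolding bdd_def
    proof (intro allI impI)
      fix vs :: "(real ^ 'n) list" and y assume vs: "set vs \<subseteq> Basis \<and> length vs \<le> 2 * k"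
      have "norm (iter_deriv vs (\<lambda>y. q (x + y) \<zeta>) y) \<le> B0 * japanese \<zeta> powr (m + \<delta> * real (length vs))"
        unfolding affine_translate(2)[OF smooth_symbols_smooth_x[OF q(1)] conjunct1[OF vs]] using B0(2) vs by blast
      also have "\<dots> \<le> B0 * japanese \<zeta> powr M"
        unfolding M_def by (intro mult_left_mono japanese_powr_mono add_mono B0 q) (use vs in auto)
      finally show "norm (iter_deriv vs (\<lambda>y. q (x + y) \<zeta>) y) \<le> B0 * japanese \<zeta> powr M * 1" by simp
    qed
    have 3: "bdd (2 * k) (2 ^ (2 * k) * G * (B0 * japanese \<zeta> powr M)) (\<lambda>_. 1) (\<lambda>y. ?g n y * q (x + y) \<zeta>)"
      using bdd_mult[OF schwartz_smooth[OF gs] wcl_smooth[OF wcl_symbols_shift[OF q(1)]] G(2) 2 G(1), of n] B0(1) by simp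
    have "norm (B n \<zeta>) \<le> C0 * (A0 * 2 powr K * japanese \<zeta> powr K) * (2 ^ (2 * k) * G * (B0 * japanese \<zeta> powr M))"
      unfolding B_def
    proof (rule C0(2)[OF _ _ _ _ 1 3])
      show "wcl (\<lambda>x. japanese x powr K) (\<lambda>\<eta>. gauss_cut n f (\<zeta> + \<eta>))" by (rule schwartz_wcl[OF schwartz_translate[OF c(1)]])
      show "wcl (\<lambda>_. 1) (\<lambda>y. ?g n y * q (x + y) \<zeta>)" by (rule schwartz_wcl_1[OF expint_shift_schwartz[OF q(1) gs]])
    qed (use A0 G B0 in auto)
    also have "\<dots> = E * (japanese \<zeta> powr K * japanese \<zeta> powr M)" by (simp add: E_def)
    finally show ?thesis by (simp only: powr_add)
  qed
  define L where "L = - 2 * real DIM(real ^ 'n)"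
  \<comment> \<open>The decay of w is chosen to cancel the growth K + M and to leave an integrable
    power.\<close>
  obtain W where W: "W \<ge> 0" "\<And>\<zeta>. norm (w \<zeta>) \<le> W * japanese \<zeta> powr (L - (K + M))"
    using wcl_lists[OF schwartz_wcl[OF w], of "[]" "L - (K + M)"] by auto
  have E0: "0 \<le> E" using C0 A0 G B0 by (simp add: E_def)
  have "(\<lambda>n. \<integral>\<zeta>. ?e \<zeta> * B n \<zeta> * w \<zeta> \<partial>lborel) \<longlonglongrightarrow> (\<integral>\<zeta>. ?e \<zeta> * b \<zeta> * w \<zeta> \<partial>lborel)"
  proof (rule integral_dominated_convergence[where w = "\<lambda>\<zeta>. (E * W) * japanese \<zeta> powr L"])
    have l: "(\<lambda>n. ?e \<zeta> * B n \<zeta> * w \<zeta>) \<longlonglongrightarrow> ?e \<zeta> * b \<zeta> * w \<zeta>" for \<zeta> by (intro tendsto_intros lim2)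
    then show "AE \<zeta> in lborel. (\<lambda>n. ?e \<zeta> * B n \<zeta> * w \<zeta>) \<longlonglongrightarrow> ?e \<zeta> * b \<zeta> * w \<zeta>" by simp
    show m: "(\<lambda>\<zeta>. ?e \<zeta> * B n \<zeta> * w \<zeta>) \<in> borel_measurable lborel" for n
      unfolding B_def by (rule borel_measurable_integrable[OF osc_expint_schwartz(2)[OF c(1) gs q w]])
    \<comment> \<open>Measurability in \<zeta> of the limiting oscillatory integral is inherited
      from the cut-off integrals as a pointwise limit.\<close>
    show "(\<lambda>\<zeta>. ?e \<zeta> * b \<zeta> * w \<zeta>) \<in> borel_measurable lborel" by (rule borel_measurable_LIMSEQ_metric[OF m l])
    show "integrable lborel (\<lambda>\<zeta> :: real ^ 'n. (E * W) * japanese \<zeta> powr L)"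
      unfolding L_def by (intro Bochner_Integration.integrable_mult_right integrable_japanese) simp
    have "norm (?e \<zeta> * B n \<zeta> * w \<zeta>) \<le> (E * W) * japanese \<zeta> powr L" for n \<zeta>
    proof -
      have "norm (?e \<zeta> * B n \<zeta> * w \<zeta>) = norm (B n \<zeta>) * norm (w \<zeta>)" by (simp add: norm_mult)
      also have "\<dots> \<le> (E * japanese \<zeta> powr (K + M)) * (W * japanese \<zeta> powr (L - (K + M)))"
        by (intro mult_mono E W) (use E0 in auto)
      also have "\<dots> = (E * W) * (japanese \<zeta> powr (K + M) * japanese \<zeta> powr (L - (K + M)))" by simp
      also have "japanese \<zeta> powr (K + M) * japanese \<zeta> powr (L - (K + M)) = japanese \<zeta> powr L" by (simp add: powr_add[symmetric])
      finally show ?thesis .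
    qed
    then show "AE \<zeta> in lborel. norm (?e \<zeta> * B n \<zeta> * w \<zeta>) \<le> (E * W) * japanese \<zeta> powr L" for n by simp
  qed
  from LIMSEQ_unique[OF lim1 this] show ?thesis unfolding expint_def b_def .
qed

lemma pseudo_op_sharp:
  fixes p q :: "real ^ 'n::finite \<Rightarrow> real ^ 'n \<Rightarrow> complex"
  assumes p: "p \<in> CS \<tau> m \<rho> \<delta>" "0 \<le> \<tau>" and q: "q \<in> smooth_symbols m' \<rho> \<delta>" and h: "0 \<le> \<rho>" "0 \<le> \<delta>"
  shows "pseudo_op (sharp p q) = compose schwartz (pseudo_op p) (pseudo_op q)"
proof
  fix u :: "real ^ 'n \<Rightarrow> complex"
  show "pseudo_op (sharp p q) u = compose schwartz (pseudo_op p) (pseudo_op q) u"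
  proof (cases "u \<in> schwartz")
    \<comment> \<open>Outside the Schwartz space both sides are \<open>undefined\<close>.\<close>
    case False
    then show ?thesis by (simp add: pseudo_op_def compose_def)
  next
    case u: True
    let ?c = "osc_fac TYPE(real ^ 'n)"
    note fu = fourier_schwartz[OF u]
    define v where "v = pseudo_op q u"
    \<comment> \<open>The outer operator in the composition is only specified on Schwartz
      functions.\<close>
    have v: "v \<in> schwartz" unfolding v_def pseudo_op_expint[OF u]
      by (intro schwartz_cmult expint_schwartz[OF q h fu])
    have "pseudo_op p v x = pseudo_op (sharp p q) u x" for x
    proof -
      note wp = wcl_CS[OF p h(1) abs_ge_self abs_ge_zero, of x]
      have w: "wcl (WW \<bar>m\<bar> 0) (\<lambda>z. p x (fst z) * expint q (fourier u) (x + snd z))"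
        by (rule wcl_tensor[OF wp schwartz_wcl_1[OF schwartz_translate[OF expint_schwartz[OF q h fu]]]])
      have "pseudo_op p v x = osc (\<lambda>z. p x (fst z) * v (x + snd z))"
        unfolding osc_pseudo_op[OF wp v] pseudo_op_expint[OF v] expint_def ..
      also have "\<dots> = osc (\<lambda>z. ?c * (p x (fst z) * expint q (fourier u) (x + snd z)))"
        unfolding v_def pseudo_op_expint[OF u] by (simp only: mult.left_commute)
      also have "\<dots> = ?c * osc (\<lambda>z. p x (fst z) * expint q (fourier u) (x + snd z))" by (rule osc_cmult[OF w])
      also have "osc (\<lambda>z. p x (fst z) * expint q (fourier u) (x + snd z)) = expint (sharp p q) (fourier u) x"
        unfolding osc_expint[OF wp abs_ge_zero q h fu] unfolding expint_def sharp_osc ..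
      finally show ?thesis unfolding pseudo_op_expint[OF u] .
    qed
    then show ?thesis using u by (simp add: compose_eq v_def[symmetric] fun_eq_iff)
  qed
qed

theorem lemma3p35:
  fixes m1 m2 \<tau> \<rho> \<delta> :: real
    and p1 p2 :: "real ^ 'n::finite \<Rightarrow> real ^ 'n \<Rightarrow> complex"
  assumes "\<tau> > 0"
    and "0 \<le> \<delta>" and "\<delta> < \<rho>" and "\<rho> \<le> 1" and "\<delta> < 1"
    and "p1 \<in> CS \<tau> m1 \<rho> \<delta>"
    and "p2 \<in> smooth_symbols m2 \<rho> \<delta>"
  shows "compose schwartz (pseudo_op p1) (pseudo_op p2) \<in> OP (CS \<tau> (m1 + m2) \<rho> \<delta>)
    \<and> (\<forall>x \<xi>. \<exists>I. has_osc_integral (sharp_amplitude p1 p2 x \<xi>) I)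
    \<and> sharp p1 p2 \<in> CS \<tau> (m1 + m2) \<rho> \<delta>
    \<and> pseudo_op (sharp p1 p2) = compose schwartz (pseudo_op p1) (pseudo_op p2)
    \<and> (\<forall>N::nat.
        (\<lambda>x \<xi>. sharp p1 p2 x \<xi> -
           (\<Sum>\<alpha> | mi_abs \<alpha> \<le> N.
              1 / of_nat (mi_fact \<alpha>) * mderiv \<alpha> (p1 x) \<xi> * Dderiv \<alpha> (\<lambda>z. p2 z \<xi>) x))
        \<in> CS \<tau> (m1 + m2 - (\<rho> - \<delta>) * (real N + 1)) \<rho> \<delta>)"
proof (intro conjI allI)
  have h: "0 \<le> \<tau>" "0 \<le> \<rho>" using assms by linarith+
  note sharp_rem = sharp_rem_CS[OF assms(6,7) h(1) assms(2-5)]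
  \<comment> \<open>For M = 0 the sum is empty and nothing is subtracted from the order.\<close>
  have "sharp_rem 0 p1 p2 = sharp p1 p2" by (simp add: fun_eq_iff sharp_rem_def)
  with sharp_rem[of 0] show 1: "sharp p1 p2 \<in> CS \<tau> (m1 + m2) \<rho> \<delta>" by simp
  show 2: "pseudo_op (sharp p1 p2) = compose schwartz (pseudo_op p1) (pseudo_op p2)"
    by (rule pseudo_op_sharp[OF assms(6) h(1) assms(7) h(2) assms(2)])
  from 1 show "compose schwartz (pseudo_op p1) (pseudo_op p2) \<in> OP (CS \<tau> (m1 + m2) \<rho> \<delta>)"
    unfolding OP_def 2[symmetric] by (rule imageI)
  show "\<exists>I. has_osc_integral (sharp_amplitude p1 p2 x \<xi>) I" for x \<xi>
  proof -
    \<comment> \<open>For fixed x and \<xi> the amplitude has order \<open>\<bar>m1\<bar>\<close> in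
      \<eta> and order 0 in y.\<close>
    obtain k where "\<bar>m1\<bar> - 2 * real k \<le> - 2 * real DIM(real ^ 'n)" using exists_osc_order by blast
    from has_osc_integral_oscJ[OF wcl_sharp_amplitude[OF assms(6) h assms(7), of x \<xi>] this] show ?thesis
      unfolding sharp_amplitude_def fst_conv snd_conv by (rule exI)
  qed
  fix N :: nat
  show "(\<lambda>x \<xi>. sharp p1 p2 x \<xi> -
      (\<Sum>\<alpha> | mi_abs \<alpha> \<le> N. 1 / of_nat (mi_fact \<alpha>) * mderiv \<alpha> (p1 x) \<xi> * Dderiv \<alpha> (\<lambda>z. p2 z \<xi>) x))
    \<in> CS \<tau> (m1 + m2 - (\<rho> - \<delta>) * (real N + 1)) \<rho> \<delta>"
    \<comment> \<open>M = N + 1 turns the strict inequality of the remainder into the sum over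
      \<open>mi_abs \<alpha> \<le> N\<close>.\<close>
    using sharp_rem[of "Suc N"] unfolding sharp_rem_def[abs_def] less_Suc_eq_le by (simp only: of_nat_Suc add.commute)
qed

end
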